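(* Let $p\ge2$, and let $m_1<m_2<\cdots<m_p$ and $n_1<n_2<\cdots<n_p$ be positive integers and $a_1,\dots,a_p$ integers. Let $\mathbf{G}$ be the geometric last-passage growth function and let $A(\boldsymbol\theta)$, $B(\boldsymbol\theta)$ be the $n_p\times n_p$ matrices defined in the context. Then, for every $r>1$, $$\Pr[\mathbf{G}(m_1,n_1)<a_1,\dots,\mathbf{G}(m_p,n_p)<a_p]=\oint_{\gamma_r^{p-1}}d\theta_1\cdots d\theta_{p-1}\,\frac{\det(I+A(\boldsymbol\theta)+B(\boldsymbol\theta))}{\prod_{k=1}^{p-1}(\theta_k-1)},$$ where $\gamma_r^{p-1}=\gamma_r\times\cdots\times\gamma_r$ ($p-1$ times) and $\gamma_r$ is the counter-clockwise circle of radius $r$ around the origin.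
   Context: **Growth model.** Fix $0<q<1$. $\omega(m,n)$, $m,n\ge1$, are i.i.d. with $\Pr[\omega(m,n)=k]=(1-q)q^k$, $k\ge0$. $\mathbf{G}(m,n)=\max\{\mathbf{G}(m-1,n),\mathbf{G}(m,n-1)\}+\omega(m,n)$ for $m,n\ge1$, with $\mathbf{G}(m,0)=\mathbf{G}(0,n)=0$. **Notation.** $\oint_\gamma dz=\frac1{2\pi \mathrm{i}}\int_\gamma dz$; $\gamma_\rho$, $\gamma_\rho(1)$ are counter-clockwise circles of radius $\rho$ around $0$, $1$. $N=n_p$, $n_0=m_0=a_0=0$, $w_c=1-\sqrt q$. For $y=n,m,a$: $\Delta_{k,l}y=y_l-y_k$, $\Delta_ky=y_k-y_{k-1}$; $\Delta_{k,l}(m,a)=(\Delta_{k,l}m,\Delta_{k,l}a)$, $\Delta_k(n,m,a)=(\Delta_kn,\Delta_km,\Delta_ka)$, etc. $r^*=\min\{r,p-1\}$; for $i\in(n_{r-1},n_r]$ put $n(i)=n_{r^*}$, $m(i)=m_{r^*}$, $a(i)=a_{r^*}$. For an $N\times N$ matrix $M$ its $(r,s)$-block ($1\le r,s\le p$) is $M(r,i;s,j)=\mathbf{1}_{\{i\in(n_{r-1},n_r],\,j\in(n_{s-1},n_s]\}}M(i,j)$. $$G^*(w|n,m,a)=\frac{w^n(1-w)^{a+m}}{(1-\frac w{1-q})^m},\qquad G(w|n,m,a)=\frac{G^*(w|n,m,a)}{G^*(w_c|n,m,a)}.$$ $c(i,j)=\exp\{\mu\frac{(n(i)-i)-(n(j)-j)}{\nu_T}\}$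 with constants $\mu,\nu_T>0$ (a conjugation factor; it does not affect the determinant), and $c(r,i;s,j)$ is its block form. For $\boldsymbol\theta\in(\mathbb{C}\setminus0)^{p-1}$, $\vec\varepsilon\in\{1,2\}^{p-1}$, $1\le r\le p$: $\theta(r|\vec\varepsilon)=\prod_{k=1}^{r-1}\theta_k^{2-\varepsilon_k}\prod_{k=r}^{p-1}\theta_k^{1-\varepsilon_k}$; $\varepsilon^k=(2,\dots,2,1,\dots,1)$ with $k-1$ twos, $1\le k\le p$; $$\Theta(r|k)=\theta(r|\varepsilon^k)-\big(1-\mathbf{1}_{\{r=p,\,k=p-2\}}\big)\,\theta(r|\varepsilon^{k+1})\quad\text{for }1\le k<\min\{r,p-1\},$$ and $\Theta(r|k)=0$ otherwise; $(-1)^{\varepsilon_{[k_1,k_2]}}=(-1)^{\sum_{k=\max\{1,k_1\}}^{\min\{k_2,p-1\}}\varepsilon_k}$. **Auxiliary matrices** ($1\le i,j\le N$). Radii: $0<\tau_2<\tau_1<1-\sqrt q$. Given $0\le k_1<k_2\le p$ and $\vec\varepsilon$, radii $q<R_k<\sqrt q$, $k_1<k\le k_2$, satisfy for $k_1<k<k_2$: $R_k<R_{k+1}$ if $\varepsilon_k=2$, $R_k>R_{k+1}$ if $\varepsilon_k=1$; $\vec\gamma_{R^{\vec\varepsilon}}=\gamma_{R_{k_1+1}}(1)\times\cdots\times\gamma_{R_{k_2}}(1)$; $d\vec z=dz_{k_1+1}\cdots dz_{k_2}$. Put $L_0=0$ and, for $1\le k\le p$, $$L_k(i,j)=\frac1{w_c}\oint_{\gamma_{\tau_1}}d\zeta_1\oint_{\gamma_{\tau_2}}d\zeta_2\frac{G(\zeta_1|n_k-i,m_k-m(i),a_k-a(i))}{G(\zeta_2|n_k-j+1,m_k-m(j),a_k-a(j))(\zeta_1-\zeta_2)}.$$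 Further, $$L^{\vec\varepsilon}_{(k_1,k_2]}(i,j)=\frac{\mathbf{1}_{\{i>n_{k_1},\,j\le n_{k_2}\}}}{w_c}\oint_{\gamma_{\tau_1}}d\zeta_1\oint_{\gamma_{\tau_2}}d\zeta_2\oint_{\vec\gamma_{R^{\vec\varepsilon}}}d\vec z\,\frac{\prod_{k_1<k\le k_2}G(z_k|\Delta_k(n,m,a))\prod_{k_1<k<k_2}(z_k-z_{k+1})^{-1}\big(\frac{1-\zeta_1}{1-z_1}\big)^{\mathbf{1}_{\{k_1=0\}}}(z_{k_1+1}-\zeta_1)^{-1}(z_{k_2}-\zeta_2)^{-1}}{G(\zeta_1|i-n_{k_1},m(i)-m_{k_1},a(i)-a_{k_1})\,G(\zeta_2|n_{k_2}-j+1,m_{k_2}-m(j),a_{k_2}-a(j))},$$ $$J^{\vec\varepsilon}_{(k_1,k_2]}(i,j)=\frac1{w_c}\oint_{\gamma_{\tau_1}}d\zeta_1\oint_{\vec\gamma_{R^{\vec\varepsilon}}}d\vec z\,\frac{\prod_{k_1<k<k_2}G(z_k|\Delta_k(n,m,a))\,G(z_{k_2}|j-1-n_{k_2-1},\Delta_{k_2}(m,a))\big(\frac{1-\zeta_1}{1-z_1}\big)^{\mathbf{1}_{\{k_1=0\}}}}{G(\zeta_1|i-n_{k_1},m(i)-m_{k_1},a(i)-a_{k_1})\prod_{k_1<k<k_2}(z_k-z_{k+1})\,(z_{k_1+1}-\zeta_1)},$$ $$\Lambda_p(i,j)=\frac{\mathbf{1}_{\{i>n_{p-1}\}}}{w_c}\oint_{\gamma_{\tau_2}}d\zeta_2\oint_{\gamma_{R_p}(1)}dz_p\frac{G(z_p|n_p-i,\Delta_pm,\Delta_pa)}{G(\zeta_2|n_p-j+1,m_p-m(j),a_p-a(j))(z_p-\zeta_2)},\quad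 q<R_p<\sqrt q.$$ **Basic blocks.** $L[k,k|\emptyset](r,i;s,j)=c(r,i;s,j)\mathbf{1}_{\{s<k<r^*\}}L_k(r,i;s,j)$; $L^{\vec\varepsilon}[k_1,k_2|(k_1,k_2]](r,i;s,j)=c(r,i;s,j)\mathbf{1}_{\{k_1<r^*,\,s^*<k_2,\,k_1<k_2\}}L^{\vec\varepsilon}_{(k_1,k_2]}(r,i;s,j)$; $L^{\vec\varepsilon}[k_1|(k_1,k_2]](r,i;s,j)=c(r,i;s,j)\mathbf{1}_{\{k_1<r^*,\,s=k_2<p,\,k_1<k_2\}}J^{\vec\varepsilon}_{(k_1,k_2]}(r,i;s,j)$; $L[p|p](r,i;s,j)=c(r,i;s,j)\mathbf{1}_{\{r=p\}}\Lambda_p(r,i;s,j)$. **The matrices $A$ and $B$.** $$B(r,i;s,j|\boldsymbol\theta)=(1+\Theta(r|s))\,c(r,i;s,j)\,\mathbf{1}_{\{s<r^*\}}\frac1{w_c}\oint_{\gamma_\tau}\frac{dw}{G(w|i-j+1,\Delta_{s,r^*}(m,a))},\qquad 0<\tau<1-\sqrt q.$$ $A(\boldsymbol\theta)=A_1(\boldsymbol\theta)+A_2(\boldsymbol\theta)$ with $A_1(r,i;s,j|\boldsymbol\theta)=\sum_{k=0}^p\Theta(r|k)L[k,k|\emptyset](r,i;s,j)$ and $$A_2(r,i;s,j|\boldsymbol\theta)=\sum(-1)^{\varepsilon_{[k_1,k_2]}+k_1+k_2^*}\,\theta(r|\vec\varepsilon)\Big[L^{\vec\varepsilon}[k_1,k_2|(k_1,k_2]]+L^{\vec\varepsilon}[k_1|(k_1,k_2]]+\mathbf{1}_{\{k_1=p-1,k_2=p\}}L[p|p]\Big](r,i;s,j),$$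 the sum over $0\le k_1<k_2\le p$ and $\vec\varepsilon\in\{1,2\}^{p-1}$ with $\varepsilon_k=2$ for $k<\max\{k_1,1\}$ and $\varepsilon_k=1$ for $k>\min\{k_2,p-1\}$.
   Formalization: In Θ(r|k) the factor 1−1_{r=p,k=p−2} is dropped, so Θ(r|k)=θ(r|ε^k)−θ(r|ε^{k+1}) for all 1≤k<min{r,p−1}; with that factor the identity fails, e.g. for p=3, q=1/25, n=m=(1,2,3), a=(1,3,1). *)

theory Defs
  imports
    "HOL-Probability.Probability"
    "HOL-Complex_Analysis.Complex_Analysis"
    "Jordan_Normal_Form.Determinant"
begin

fun lpp :: "(nat \<times> nat \<Rightarrow> nat) \<Rightarrow> nat \<Rightarrow> nat \<Rightarrow> nat" where
  "lpp w 0 n = 0"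
| "lpp w (Suc m) 0 = 0"
| "lpp w (Suc m) (Suc n) = max (lpp w m (Suc n)) (lpp w (Suc m) n) + w (Suc m, Suc n)"

definition oint :: "complex \<Rightarrow> real \<Rightarrow> (complex \<Rightarrow> complex) \<Rightarrow> complex" where
  "oint c \<rho> f = contour_integral (circlepath c \<rho>) f / (2 * of_real pi * \<i>)"

text \<open>Iterated integral over a product of concentric circles: the variable with index
  \<open>k\<close> runs over the circle of radius \<open>\<rho> k\<close> around \<open>c\<close>. The integrand may depend only on
  the coordinates listed in \<open>ks\<close>; the remaining ones are set to \<open>0\<close>.\<close>

fun oints :: "complex \<Rightarrow> (nat \<Rightarrow> real) \<Rightarrow> nat list \<Rightarrow> ((nat \<Rightarrow> complex) \<Rightarrow> complex) \<Rightarrow> complex" where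
  "oints c \<rho> [] f = f (\<lambda>_. 0)"
| "oints c \<rho> (k # ks) f = oint c (\<rho> k) (\<lambda>w. oints c \<rho> ks (\<lambda>z. f (z(k := w))))"

definition w_c :: "real \<Rightarrow> complex" where
  "w_c q = of_real (1 - sqrt q)"

definition G_star :: "real \<Rightarrow> complex \<Rightarrow> int \<Rightarrow> int \<Rightarrow> int \<Rightarrow> complex" where
  "G_star q w n m a =
     w powi n * (1 - w) powi (a + m) / (1 - w / of_real (1 - q)) powi m"

definition G_fun :: "real \<Rightarrow> complex \<Rightarrow> int \<Rightarrow> int \<Rightarrow> int \<Rightarrow> complex" where
  "G_fun q w n m a = G_star q w n m a / G_star q (w_c q) n m a"

text \<open>Everywhere below \<open>p\<close> is the number of points, \<open>n\<close>, \<open>m\<close>, \<open>a\<close> carry the data at the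
  indices \<open>1, \<dots>, p\<close> together with the value \<open>0\<close> at the index \<open>0\<close>, and matrix indices
  \<open>i\<close>, \<open>j\<close> range over \<open>1, \<dots>, n p\<close>.\<close>

definition star :: "nat \<Rightarrow> nat \<Rightarrow> nat" where
  "star p r = min r (p - 1)"

definition block_of :: "nat \<Rightarrow> (nat \<Rightarrow> nat) \<Rightarrow> nat \<Rightarrow> nat" where
  "block_of p n i = (THE r. 1 \<le> r \<and> r \<le> p \<and> n (r - 1) < i \<and> i \<le> n r)"

definition block_form ::
  "(nat \<Rightarrow> nat) \<Rightarrow> (nat \<Rightarrow> nat \<Rightarrow> complex) \<Rightarrow> nat \<Rightarrow> nat \<Rightarrow> nat \<Rightarrow> nat \<Rightarrow> complex" where
  "block_form n M r i s j =
     of_bool (n (r - 1) < i \<and> i \<le> n r \<and> n (s - 1) < j \<and> j \<le> n s) * M i j"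

text \<open>The matrix with \<open>(r,s)\<close>-blocks \<open>F r i s j\<close>; the library matrices are indexed from \<open>0\<close>.\<close>

definition assemble ::
  "nat \<Rightarrow> (nat \<Rightarrow> nat) \<Rightarrow> (nat \<Rightarrow> nat \<Rightarrow> nat \<Rightarrow> nat \<Rightarrow> complex) \<Rightarrow> complex mat" where
  "assemble p n F = Matrix.mat (n p) (n p)
     (\<lambda>(i, j). F (block_of p n (Suc i)) (Suc i) (block_of p n (Suc j)) (Suc j))"

definition theta :: "nat \<Rightarrow> (nat \<Rightarrow> complex) \<Rightarrow> nat \<Rightarrow> (nat \<Rightarrow> nat) \<Rightarrow> complex" where
  "theta p \<theta> r \<epsilon> =
     (\<Prod>k\<in>{1..<r}. \<theta> k powi (2 - int (\<epsilon> k))) * (\<Prod>k\<in>{r..<p}. \<theta> k powi (1 - int (\<epsilon> k)))"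

definition eps_step :: "nat \<Rightarrow> nat \<Rightarrow> nat" where
  "eps_step k l = (if l < k then 2 else 1)"

text \<open>A printed version of this formula multiplies the subtracted term by
  \<open>1 - 1{r = p, k = p - 2}\<close>. For \<open>p = 2\<close> that factor is void, but for \<open>p = 3\<close> it makes
  the determinantal identity fail: \<open>q = 1/25\<close>, \<open>n = m = (1,2,3)\<close>, \<open>a = (1,3,0)\<close> would give
  about \<open>2.25\<close> (by numerical quadrature) as the probability of the empty event.\<close>

definition Theta :: "nat \<Rightarrow> (nat \<Rightarrow> complex) \<Rightarrow> nat \<Rightarrow> nat \<Rightarrow> complex" where
  "Theta p \<theta> r k =
     (if 1 \<le> k \<and> k < star p r
      then theta p \<theta> r (eps_step k) - theta p \<theta> r (eps_step (Suc k))
      else 0)"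

definition eps_all :: "nat \<Rightarrow> (nat \<Rightarrow> nat) set" where
  "eps_all p = ({1..p - 1} \<rightarrow>\<^sub>E {1, 2})"

definition eps_range :: "nat \<Rightarrow> nat \<Rightarrow> nat \<Rightarrow> (nat \<Rightarrow> nat) set" where
  "eps_range p k1 k2 = {\<epsilon> \<in> eps_all p.
     \<forall>k\<in>{1..p - 1}. (k < max k1 1 \<longrightarrow> \<epsilon> k = 2) \<and> (min k2 (p - 1) < k \<longrightarrow> \<epsilon> k = 1)}"

text \<open>\<open>R k1 k2 \<epsilon> k\<close> is the radius of the circle around \<open>1\<close> carrying the variable \<open>z\<^sub>k\<close> in the
  integrals belonging to \<open>k1 < k2\<close> and \<open>\<epsilon>\<close>.\<close>

definition admissible_radii ::
  "real \<Rightarrow> nat \<Rightarrow> (nat \<Rightarrow> nat \<Rightarrow> (nat \<Rightarrow> nat) \<Rightarrow> nat \<Rightarrow> real) \<Rightarrow> bool" where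
  "admissible_radii q p R \<longleftrightarrow>
     (\<forall>k1 k2. \<forall>\<epsilon>\<in>eps_all p. k1 < k2 \<and> k2 \<le> p \<longrightarrow>
        (\<forall>k. k1 < k \<and> k \<le> k2 \<longrightarrow> q < R k1 k2 \<epsilon> k \<and> R k1 k2 \<epsilon> k < sqrt q) \<and>
        (\<forall>k. k1 < k \<and> k < k2 \<longrightarrow>
           (\<epsilon> k = 2 \<longrightarrow> R k1 k2 \<epsilon> k < R k1 k2 \<epsilon> (Suc k)) \<and>
           (\<epsilon> k = 1 \<longrightarrow> R k1 k2 \<epsilon> k > R k1 k2 \<epsilon> (Suc k))))"

context
  fixes q :: real and p :: nat
    and n m :: "nat \<Rightarrow> nat" and a :: "nat \<Rightarrow> int"
    and \<mu> \<nu> :: real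
    and \<tau> \<tau>1 \<tau>2 :: real
    and R :: "nat \<Rightarrow> nat \<Rightarrow> (nat \<Rightarrow> nat) \<Rightarrow> nat \<Rightarrow> real" and R\<Lambda> :: real
begin

text \<open>These are \<open>n(i)\<close>, \<open>m(i)\<close>, \<open>a(i)\<close>.\<close>

definition n_row :: "nat \<Rightarrow> int" where "n_row i = int (n (star p (block_of p n i)))"
definition m_row :: "nat \<Rightarrow> int" where "m_row i = int (m (star p (block_of p n i)))"
definition a_row :: "nat \<Rightarrow> int" where "a_row i = a (star p (block_of p n i))"

definition c_conj :: "nat \<Rightarrow> nat \<Rightarrow> complex" where
  "c_conj i j = of_real (exp (\<mu> * (of_int ((n_row i - int i) - (n_row j - int j)) / \<nu>)))"

definition L_mat :: "nat \<Rightarrow> nat \<Rightarrow> nat \<Rightarrow> complex" where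
  "L_mat k i j = (if k = 0 then 0 else
     1 / w_c q * oint 0 \<tau>1 (\<lambda>\<zeta>1. oint 0 \<tau>2 (\<lambda>\<zeta>2.
       G_fun q \<zeta>1 (int (n k) - int i) (int (m k) - m_row i) (a k - a_row i) /
       (G_fun q \<zeta>2 (int (n k) - int j + 1) (int (m k) - m_row j) (a k - a_row j) * (\<zeta>1 - \<zeta>2)))))"

definition L_eps :: "nat \<Rightarrow> nat \<Rightarrow> (nat \<Rightarrow> nat) \<Rightarrow> nat \<Rightarrow> nat \<Rightarrow> complex" where
  "L_eps k1 k2 \<epsilon> i j =
     of_bool (i > n k1 \<and> j \<le> n k2) / w_c q *
     oint 0 \<tau>1 (\<lambda>\<zeta>1. oint 0 \<tau>2 (\<lambda>\<zeta>2. oints 1 (R k1 k2 \<epsilon>) [Suc k1..<Suc k2] (\<lambda>z.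
       (\<Prod>k\<in>{k1<..k2}. G_fun q (z k) (int (n k) - int (n (k - 1)))
          (int (m k) - int (m (k - 1))) (a k - a (k - 1)))
       * (\<Prod>k\<in>{k1<..<k2}. inverse (z k - z (Suc k)))
       * ((1 - \<zeta>1) / (1 - z 1)) ^ of_bool (k1 = 0)
       * inverse (z (Suc k1) - \<zeta>1) * inverse (z k2 - \<zeta>2)
       / (G_fun q \<zeta>1 (int i - int (n k1)) (m_row i - int (m k1)) (a_row i - a k1)
          * G_fun q \<zeta>2 (int (n k2) - int j + 1) (int (m k2) - m_row j) (a k2 - a_row j)))))"

definition J_eps :: "nat \<Rightarrow> nat \<Rightarrow> (nat \<Rightarrow> nat) \<Rightarrow> nat \<Rightarrow> nat \<Rightarrow> complex" where
  "J_eps k1 k2 \<epsilon> i j =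
     1 / w_c q *
     oint 0 \<tau>1 (\<lambda>\<zeta>1. oints 1 (R k1 k2 \<epsilon>) [Suc k1..<Suc k2] (\<lambda>z.
       (\<Prod>k\<in>{k1<..<k2}. G_fun q (z k) (int (n k) - int (n (k - 1)))
          (int (m k) - int (m (k - 1))) (a k - a (k - 1)))
       * G_fun q (z k2) (int j - 1 - int (n (k2 - 1)))
           (int (m k2) - int (m (k2 - 1))) (a k2 - a (k2 - 1))
       * ((1 - \<zeta>1) / (1 - z 1)) ^ of_bool (k1 = 0)
       / (G_fun q \<zeta>1 (int i - int (n k1)) (m_row i - int (m k1)) (a_row i - a k1)
          * (\<Prod>k\<in>{k1<..<k2}. z k - z (Suc k)) * (z (Suc k1) - \<zeta>1))))"

definition Lambda_mat :: "nat \<Rightarrow> nat \<Rightarrow> complex" where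
  "Lambda_mat i j =
     of_bool (i > n (p - 1)) / w_c q *
     oint 0 \<tau>2 (\<lambda>\<zeta>2. oint 1 R\<Lambda> (\<lambda>z.
       G_fun q z (int (n p) - int i) (int (m p) - int (m (p - 1))) (a p - a (p - 1)) /
       (G_fun q \<zeta>2 (int (n p) - int j + 1) (int (m p) - m_row j) (a p - a_row j) * (z - \<zeta>2))))"

definition L_diag_block :: "nat \<Rightarrow> nat \<Rightarrow> nat \<Rightarrow> nat \<Rightarrow> nat \<Rightarrow> complex" where
  "L_diag_block k r i s j =
     block_form n c_conj r i s j * of_bool (s < k \<and> k < star p r)
     * block_form n (L_mat k) r i s j"

definition L_eps_block ::
  "nat \<Rightarrow> nat \<Rightarrow> (nat \<Rightarrow> nat) \<Rightarrow> nat \<Rightarrow> nat \<Rightarrow> nat \<Rightarrow> nat \<Rightarrow> complex" where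
  "L_eps_block k1 k2 \<epsilon> r i s j =
     block_form n c_conj r i s j * of_bool (k1 < star p r \<and> star p s < k2 \<and> k1 < k2)
     * block_form n (L_eps k1 k2 \<epsilon>) r i s j"

definition J_eps_block ::
  "nat \<Rightarrow> nat \<Rightarrow> (nat \<Rightarrow> nat) \<Rightarrow> nat \<Rightarrow> nat \<Rightarrow> nat \<Rightarrow> nat \<Rightarrow> complex" where
  "J_eps_block k1 k2 \<epsilon> r i s j =
     block_form n c_conj r i s j * of_bool (k1 < star p r \<and> s = k2 \<and> k2 < p \<and> k1 < k2)
     * block_form n (J_eps k1 k2 \<epsilon>) r i s j"

definition Lambda_block :: "nat \<Rightarrow> nat \<Rightarrow> nat \<Rightarrow> nat \<Rightarrow> complex" where
  "Lambda_block r i s j =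
     block_form n c_conj r i s j * of_bool (r = p) * block_form n Lambda_mat r i s j"

definition B_block :: "(nat \<Rightarrow> complex) \<Rightarrow> nat \<Rightarrow> nat \<Rightarrow> nat \<Rightarrow> nat \<Rightarrow> complex" where
  "B_block \<theta> r i s j =
     (1 + Theta p \<theta> r s) * block_form n c_conj r i s j * of_bool (s < star p r)
     * (1 / w_c q)
     * oint 0 \<tau> (\<lambda>w. 1 / G_fun q w (int i - int j + 1)
         (int (m (star p r)) - int (m s)) (a (star p r) - a s))"

definition A1_block :: "(nat \<Rightarrow> complex) \<Rightarrow> nat \<Rightarrow> nat \<Rightarrow> nat \<Rightarrow> nat \<Rightarrow> complex" where
  "A1_block \<theta> r i s j = (\<Sum>k\<in>{0..p}. Theta p \<theta> r k * L_diag_block k r i s j)"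

definition A2_block :: "(nat \<Rightarrow> complex) \<Rightarrow> nat \<Rightarrow> nat \<Rightarrow> nat \<Rightarrow> nat \<Rightarrow> complex" where
  "A2_block \<theta> r i s j =
     (\<Sum>k2\<in>{0..p}. \<Sum>k1\<in>{0..<k2}. \<Sum>\<epsilon>\<in>eps_range p k1 k2.
        (- 1) ^ ((\<Sum>k\<in>{max 1 k1..min k2 (p - 1)}. \<epsilon> k) + k1 + star p k2)
        * theta p \<theta> r \<epsilon>
        * (L_eps_block k1 k2 \<epsilon> r i s j + J_eps_block k1 k2 \<epsilon> r i s j
           + of_bool (k1 = p - 1 \<and> k2 = p) * Lambda_block r i s j))"

definition A_matrix :: "(nat \<Rightarrow> complex) \<Rightarrow> complex mat" where
  "A_matrix \<theta> = assemble p n (\<lambda>r i s j. A1_block \<theta> r i s j + A2_block \<theta> r i s j)"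

definition B_matrix :: "(nat \<Rightarrow> complex) \<Rightarrow> complex mat" where
  "B_matrix \<theta> = assemble p n (B_block \<theta>)"

end

end

theory Submission
  imports Defs
begin

text \<open>The rows \<open>j \<mapsto> G(t, j)\<close> form a Markov chain with product transition weights. Such
  weights map determinants built from sequences and their successive differences to
  determinants of the same kind (\<open>one_step\<close>). A constraint \<open>G(m\<^sub>k, n\<^sub>k) < a\<^sub>k\<close> is inserted by
  multiplying each sequence by \<open>\<theta>\<^sub>k\<close> below \<open>a\<^sub>k\<close> and by \<open>1\<close> above, and integrating over \<open>\<theta>\<^sub>k\<close>
  (\<open>theta_integral\<close>). Representing sequences by contour integrals, the probability becomes an
  integral over \<open>\<theta>\<close> of one determinant with entries \<open>Tmat\<close>. Truncation of a sequence becomes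
  taking the principal parts at \<open>0\<close> and near \<open>1\<close>; separating the two expands each entry into
  the terms of \<open>A\<^sub>1\<close>, \<open>B\<close> and \<open>I\<close> and a sum over \<open>k\<^sub>1 < k\<^sub>2\<close>. In the integrals defining \<open>A\<^sub>2\<close>
  the order of two neighbouring radii decides whether a residue is picked up, so that the sum
  over \<open>\<epsilon>\<close> reassembles the same sum over \<open>k\<^sub>1 < k\<^sub>2\<close>.\<close>

section \<open>Contour integrals and principal parts\<close>

text \<open>The determinants survive a step because row \<open>j\<close> carries the difference of
  order \<open>j + 1\<close>: a sum over one coordinate then leaves only a multiple of the preceding
  row. Such sums start at minus infinity, so all sequences must vanish far below. They are read off
  the circle of radius 2 around 1, hence are O(2^x), and this bound alone singles out the right
  solution of each recursion. That circle encloses the pole at 0 together with those near 1, which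
  is why a truncation has two principal parts. Those at 0 never nest: modulo functions regular at 0
  a truncation is multiplication by a constant, so only one cut \<open>k1\<close> from the left and
  one cut \<open>k2\<close> from the right survive. A truncation carries a free pair of parameters
  \<open>t1\<close>, \<open>t2\<close>, since three pairs are needed: \<theta> and 1 for the
  probability, a multiple of this pair in each block of rows, and values 0, 1, -1 that encode the
  order of two radii. Homogeneity in each pair cancels the powers of \<theta> that the constraints
  produce.\<close>

lemma oint_cong:
  assumes "\<And>z. cmod (z - c) = \<rho> \<Longrightarrow> f z = g z" "0 \<le> \<rho>"
  shows "oint c \<rho> f = oint c \<rho> g"
proof -
  have "contour_integral (circlepath c \<rho>) f = contour_integral (circlepath c \<rho>) g"
    by (rule contour_integral_eq) (use assms in \<open>auto simp: dist_norm norm_minus_commute\<close>)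
  then show ?thesis by (simp add: oint_def)
qed

lemma integrable_sphere:
  assumes "continuous_on (sphere c \<rho>) f" "0 \<le> \<rho>"
  shows "f contour_integrable_on (circlepath c \<rho>)"
  using assms by (intro contour_integrable_continuous_circlepath) auto

lemma oint_add:
  assumes "continuous_on (sphere c \<rho>) f" "continuous_on (sphere c \<rho>) g" "0 \<le> \<rho>"
  shows "oint c \<rho> (\<lambda>z. f z + g z) = oint c \<rho> f + oint c \<rho> g"
  using assms by (simp add: oint_def contour_integral_add integrable_sphere add_divide_distrib)

lemma oint_diff:
  assumes "continuous_on (sphere c \<rho>) f" "continuous_on (sphere c \<rho>) g" "0 \<le> \<rho>"
  shows "oint c \<rho> (\<lambda>z. f z - g z) = oint c \<rho> f - oint c \<rho> g"
  using assms by (simp add: oint_def contour_integral_diff integrable_sphere diff_divide_distrib)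

text \<open>No integrability is assumed: for nonzero \<open>k\<close> both integrands are integrable
  or neither is, and the integral of a non-integrable function is 0 by convention. Hence constants
  can later be pulled through iterated integrals without any continuity argument.\<close>

lemma oint_cmul: "oint c \<rho> (\<lambda>z. k * f z) = k * oint c \<rho> f"
proof (cases "k = 0")
  case False
  show ?thesis
  proof (cases "f contour_integrable_on (circlepath c \<rho>)")
    case True
    then show ?thesis by (simp add: oint_def contour_integral_lmul)
  next
    case nf: False
    have "\<not> (\<lambda>z. k * f z) contour_integrable_on (circlepath c \<rho>)"
    proof
      assume "(\<lambda>z. k * f z) contour_integrable_on (circlepath c \<rho>)"
      from contour_integrable_lmul[OF this, of "inverse k"] False nf
      show False by (simp add: field_simps)
    qed
    with nf show ?thesis by (simp add: oint_def not_integrable_contour_integral)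
  qed
qed (simp add: oint_def)

lemma oint_mulc: "oint c \<rho> (\<lambda>z. f z * k) = oint c \<rho> f * k"
  using oint_cmul[of c \<rho> k f] by (simp add: mult.commute)

lemma oint_divc: "oint c \<rho> (\<lambda>z. f z / k) = oint c \<rho> f / k"
  using oint_mulc[of c \<rho> f "inverse k"] by (simp add: divide_inverse)

lemma oint_neg: "oint c \<rho> (\<lambda>z. - f z) = - oint c \<rho> f"
  using oint_cmul[of c \<rho> "-1" f] by simp

lemma oint_zero [simp]: "oint c \<rho> (\<lambda>z. 0) = 0"
  by (simp add: oint_def)

lemma oint_sum:
  assumes "\<And>x. x \<in> A \<Longrightarrow> continuous_on (sphere c \<rho>) (f x)" "0 \<le> \<rho>"
  shows "oint c \<rho> (\<lambda>z. \<Sum>x\<in>A. f x z) = (\<Sum>x\<in>A. oint c \<rho> (f x))"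
proof (cases "finite A")
  case True
  then show ?thesis using assms(1)
  proof (induction A)
    case (insert x F)
    have "continuous_on (sphere c \<rho>) (\<lambda>z. \<Sum>x\<in>F. f x z)"
      using insert.prems by (intro continuous_on_sum) auto
    with insert assms(2) show ?case by (simp add: oint_add)
  qed simp
qed simp

lemma oint_swap:
  assumes "continuous_on (sphere c \<rho> \<times> sphere c' \<rho>') (\<lambda>(x, y). f x y)" "0 \<le> \<rho>" "0 \<le> \<rho>'"
  shows "oint c \<rho> (\<lambda>x. oint c' \<rho>' (\<lambda>y. f x y)) = oint c' \<rho>' (\<lambda>y. oint c \<rho> (\<lambda>x. f x y))"
proof -
  have vd: "continuous_on {0..1} (\<lambda>t. vector_derivative (circlepath a b) (at t))" for a b
    by (simp add: vector_derivative_circlepath) (intro continuous_intros)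
  have "contour_integral (circlepath c \<rho>) (\<lambda>w. contour_integral (circlepath c' \<rho>') (f w)) =
        contour_integral (circlepath c' \<rho>') (\<lambda>z. contour_integral (circlepath c \<rho>) (\<lambda>w. f w z))"
    by (rule contour_integral_swap) (use assms vd in auto)
  moreover have "oint c1 \<rho>1 (\<lambda>x. oint c2 \<rho>2 (\<lambda>y. g x y)) =
      contour_integral (circlepath c1 \<rho>1) (\<lambda>x. contour_integral (circlepath c2 \<rho>2) (\<lambda>y. g x y))
        / (2 * of_real pi * \<i>) / (2 * of_real pi * \<i>)" for c1 c2 \<rho>1 \<rho>2 g
  proof -
    have "oint c1 \<rho>1 (\<lambda>x. oint c2 \<rho>2 (\<lambda>y. g x y)) =
        oint c1 \<rho>1 (\<lambda>x. contour_integral (circlepath c2 \<rho>2) (\<lambda>y. g x y) / (2 * of_real pi * \<i>))"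
      by (subst (2) oint_def) (rule refl)
    also have "\<dots> = oint c1 \<rho>1 (\<lambda>x. contour_integral (circlepath c2 \<rho>2) (\<lambda>y. g x y)) / (2 * of_real pi * \<i>)"
      by (rule oint_divc)
    finally show ?thesis by (subst (asm) (2) oint_def)
  qed
  ultimately show ?thesis by metis
qed

section \<open>Deformation of circles, Cauchy formula on an annulus, decay at infinity\<close>

definition annulus :: "complex \<Rightarrow> real \<Rightarrow> real \<Rightarrow> complex set" where
  "annulus c r0 r1 = {z. r0 < cmod (z - c) \<and> cmod (z - c) < r1}"

lemma open_annulus [simp, intro]: "open (annulus c r0 r1)"
proof -
  have "open {z. r0 < cmod (z - c)}" "open {z. cmod (z - c) < r1}"
    by (intro open_Collect_less continuous_intros)+
  then show ?thesis by (auto simp: annulus_def Collect_conj_eq)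
qed

lemma sphere_annulus: "r0 < \<rho> \<Longrightarrow> \<rho> < r1 \<Longrightarrow> sphere c \<rho> \<subseteq> annulus c r0 r1"
  by (auto simp: annulus_def dist_norm norm_minus_commute)

lemma hol_cont_sphere:
  assumes "f holomorphic_on annulus c r0 r1" "r0 < \<rho>" "\<rho> < r1"
  shows "continuous_on (sphere c \<rho>) f"
  using assms holomorphic_on_imp_continuous_on continuous_on_subset sphere_annulus by metis

text \<open>The straight homotopy between points of equal angle stays in the annulus, since its
  moduli are convex combinations of the two radii.\<close>

lemma oint_radius:
  assumes hol: "f holomorphic_on annulus c r0 r1"
    and "r0 < \<rho>1" "\<rho>1 < r1" "r0 < \<rho>2" "\<rho>2 < r1" "0 < \<rho>1" "0 < \<rho>2"
  shows "oint c \<rho>1 f = oint c \<rho>2 f"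
proof -
  have "homotopic_loops (annulus c r0 r1) (circlepath c \<rho>1) (circlepath c \<rho>2)"
  proof (rule homotopic_loops_linear)
    fix t :: real assume t: "t \<in> {0..1}"
    show "closed_segment (circlepath c \<rho>1 t) (circlepath c \<rho>2 t) \<subseteq> annulus c r0 r1"
    proof
      fix x assume "x \<in> closed_segment (circlepath c \<rho>1 t) (circlepath c \<rho>2 t)"
      then obtain u where u: "0 \<le> u" "u \<le> 1"
        and x: "x = (1 - u) *\<^sub>R circlepath c \<rho>1 t + u *\<^sub>R circlepath c \<rho>2 t"
        by (auto simp: closed_segment_def)
      define e where "e = exp (2 * of_real pi * \<i> * of_real t)"
      have e: "cmod e = 1" by (simp add: e_def norm_exp_eq_Re)
      have "x - c = of_real ((1 - u) * \<rho>1 + u * \<rho>2) * e"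
        by (simp add: x circlepath scaleR_conv_of_real e_def algebra_simps)
      then have n: "cmod (x - c) = \<bar>(1 - u) * \<rho>1 + u * \<rho>2\<bar>"
        by (simp only: norm_mult e norm_of_real mult_1_right)
      have lt: "(1 - u) * \<rho>1 + u * \<rho>2 < r1"
        using convex_bound_lt[of \<rho>1 r1 \<rho>2 "1 - u" u] u assms by auto
      \<comment> \<open>\<open>convex_bound_lt\<close> bounds from above, hence the negated radii.
        The maximum with 0 covers a negative \<open>r0\<close> and makes the combination positive,
        so that the absolute value in \<open>n\<close> disappears.\<close>
      have gt: "(1 - u) * (- \<rho>1) + u * (- \<rho>2) < - max r0 0"
        by (rule convex_bound_lt) (use u assms in auto)
      have "max r0 0 < (1 - u) * \<rho>1 + u * \<rho>2" using gt by (simp only: mult_minus_right)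
      with n lt show "x \<in> annulus c r0 r1" by (auto simp: annulus_def)
    qed
  qed (use assms in auto)
  then have "contour_integral (circlepath c \<rho>1) f = contour_integral (circlepath c \<rho>2) f"
    by (intro Cauchy_theorem_homotopic_loops[of "annulus c r0 r1"] hol) auto
  then show ?thesis by (simp add: oint_def)
qed

lemma oint_eq_0:
  assumes "f holomorphic_on ball c r1" "0 < \<rho>" "\<rho> < r1"
  shows "oint c \<rho> f = 0"
proof -
  have "(f has_contour_integral 0) (circlepath c \<rho>)"
    by (rule Cauchy_theorem_convex_simple[of _ "ball c r1"])
       (use assms in \<open>auto simp: dist_norm norm_minus_commute\<close>)
  then show ?thesis by (simp add: oint_def contour_integral_unique)
qed

lemma oint_Cauchy:
  assumes "f holomorphic_on ball c r1" "cmod (z - c) < \<rho>" "\<rho> < r1"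
  shows "oint c \<rho> (\<lambda>w. f w / (w - z)) = f z"
proof -
  have "((\<lambda>u. f u/(u-z)) has_contour_integral (2 * of_real pi * \<i> * f z)) (circlepath c \<rho>)"
    by (rule Cauchy_integral_circlepath_simple)
       (use assms in \<open>auto intro: holomorphic_on_subset\<close>)
  then show ?thesis by (simp add: oint_def contour_integral_unique)
qed

text \<open>The difference quotient \<open>k\<close> has a removable singularity at
  \<open>z\<close>, so its integral is the same over both circles; the kernel 1/(w - z) integrates
  to 1 over the outer circle and to 0 over the inner one.\<close>

lemma oint_annulus:
  assumes hol: "f holomorphic_on annulus c r0 r1"
    and z: "r0 < \<rho>1" "\<rho>1 < cmod (z - c)" "cmod (z - c) < \<rho>2" "\<rho>2 < r1" and "0 < \<rho>1"
  shows "oint c \<rho>2 (\<lambda>w. f w / (w - z)) = f z + oint c \<rho>1 (\<lambda>w. f w / (w - z))"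
proof -
  define k where "k w = (if w = z then deriv f z else (f w - f z) / (w - z))" for w
  have k: "k holomorphic_on annulus c r0 r1"
    unfolding k_def by (rule pole_lemma_open) (use hol in auto)
  have eq: "oint c \<rho>1 k = oint c \<rho>2 k"
    by (rule oint_radius[OF k]) (use assms in auto)
  have e: "oint c \<rho> k = oint c \<rho> (\<lambda>w. f w / (w - z)) - f z * oint c \<rho> (\<lambda>w. 1 / (w - z))"
    if "cmod (z - c) \<noteq> \<rho>" "r0 < \<rho>" "\<rho> < r1" "0 < \<rho>" for \<rho>
  proof -
    have ne: "w \<noteq> z" if "cmod (w - c) = \<rho>" for w using that \<open>cmod (z - c) \<noteq> \<rho>\<close> by auto
    have "oint c \<rho> k = oint c \<rho> (\<lambda>w. f w / (w - z) - f z * (1 / (w - z)))"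
      by (rule oint_cong) (use ne that in \<open>auto simp: k_def diff_divide_distrib\<close>)
    also have "\<dots> = oint c \<rho> (\<lambda>w. f w / (w - z)) - oint c \<rho> (\<lambda>w. f z * (1 / (w - z)))"
      using that ne
      by (intro oint_diff continuous_intros hol_cont_sphere[OF hol])
         (auto simp: dist_norm norm_minus_commute)
    finally show ?thesis by (simp only: oint_cmul)
  qed
  have "oint c \<rho>2 (\<lambda>w. 1 / (w - z)) = 1"
    using oint_Cauchy[of "\<lambda>_. 1" c "\<rho>2 + 1" z \<rho>2] assms by simp
  moreover have "oint c \<rho>1 (\<lambda>w. 1 / (w - z)) = 0"
  proof (rule oint_eq_0[of _ c "cmod (z - c)"])
    show "(\<lambda>w. 1 / (w - z)) holomorphic_on ball c (cmod (z - c))"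
      by (intro holomorphic_intros) (auto simp: dist_norm norm_minus_commute)
  qed (use assms in auto)
  ultimately show ?thesis using eq e[of \<rho>1] e[of \<rho>2] z assms by simp
qed

lemma oint_norm_le:
  assumes "continuous_on (sphere c \<rho>) f" "0 < \<rho>" "\<And>z. cmod (z - c) = \<rho> \<Longrightarrow> cmod (f z) \<le> B" "0 \<le> B"
  shows "cmod (oint c \<rho> f) \<le> B * \<rho>"
proof -
  have "f contour_integrable_on (circlepath c \<rho>)" using assms by (intro integrable_sphere) auto
  then have "(f has_contour_integral contour_integral (circlepath c \<rho>) f) (circlepath c \<rho>)"
    by (rule has_contour_integral_integral)
  from has_contour_integral_bound_circlepath[OF this \<open>0 \<le> B\<close> \<open>0 < \<rho>\<close> assms(3)]
  have "cmod (contour_integral (circlepath c \<rho>) f) \<le> B * (2 * pi * \<rho>)" by simp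
  then have "cmod (contour_integral (circlepath c \<rho>) f) / (2 * pi) \<le> B * \<rho>"
    using pi_gt_zero by (subst pos_divide_le_eq) (simp_all only: mult_ac)
  then show ?thesis by (simp add: oint_def norm_divide norm_mult)
qed

text \<open>The circle may be enlarged at will, and over radius R the integral is O(1/R).\<close>

lemma oint_decay:
  assumes hol: "f holomorphic_on {z. r0 < cmod (z - c)}" and r: "r0 < \<rho>" "0 < \<rho>"
    and B: "\<And>z. R0 \<le> cmod (z - c) \<Longrightarrow> cmod (f z) \<le> K / (cmod (z - c))\<^sup>2"
  shows "oint c \<rho> f = 0"
proof -
  have K: "cmod (oint c \<rho> f) \<le> \<bar>K\<bar> / R" if R: "max (max R0 \<rho>) 1 \<le> R" for R
  proof -
    have holR: "f holomorphic_on annulus c r0 (R + 1)" 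
      by (rule holomorphic_on_subset[OF hol]) (auto simp: annulus_def)
    have "oint c \<rho> f = oint c R f"
      by (rule oint_radius[OF holR]) (use r R in auto)
    moreover have "cmod (oint c R f) \<le> (\<bar>K\<bar> / R\<^sup>2) * R"
    proof (rule oint_norm_le)
      show "continuous_on (sphere c R) f" by (rule hol_cont_sphere[OF holR]) (use r R in auto)
      show "cmod (f z) \<le> \<bar>K\<bar> / R\<^sup>2" if "cmod (z - c) = R" for z
        using B[of z] that R by (smt (verit) divide_right_mono zero_le_power2)
    qed (use r R in auto)
    ultimately show ?thesis using R by (simp add: power2_eq_square)
  qed
  have lim: "((\<lambda>R. \<bar>K\<bar> / R) \<longlongrightarrow> 0) at_top"
    by (intro tendsto_divide_0[OF tendsto_const] filterlim_ident filterlim_at_top_imp_at_infinity)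
  have "cmod (oint c \<rho> f) \<le> 0"
    by (rule tendsto_lowerbound[OF lim]) (auto intro!: eventually_mono[OF eventually_ge_at_top[of "max (max R0 \<rho>) 1"]] K)
  then show ?thesis by simp
qed

text \<open>The part of the Laurent expansion of \<open>f\<close> around \<open>c\<close> with negative powers, for \<open>f\<close>
  holomorphic on the annulus \<open>r0 < \<bar>z - c\<bar> < r1\<close>.\<close>

definition prin :: "complex \<Rightarrow> real \<Rightarrow> real \<Rightarrow> (complex \<Rightarrow> complex) \<Rightarrow> complex \<Rightarrow> complex" where
  "prin c r0 r1 f z = oint c ((r0 + min (cmod (z - c)) r1) / 2) (\<lambda>w. f w / (z - w))"

lemma hol_quot:
  assumes "f holomorphic_on annulus c r0 r1" "r1 \<le> cmod (z - c)"
  shows "(\<lambda>w. f w / (z - w)) holomorphic_on annulus c r0 r1"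
  by (intro holomorphic_intros assms) (use assms in \<open>auto simp: annulus_def\<close>)

lemma prin_radius:
  assumes hol: "f holomorphic_on annulus c r0 r1" and "0 \<le> r0" "r0 < \<rho>" "\<rho> < r1" "\<rho> < cmod (z - c)"
  shows "prin c r0 r1 f z = oint c \<rho> (\<lambda>w. f w / (z - w))"
  unfolding prin_def
  by (rule oint_radius[of _ c r0 "min r1 (cmod (z - c))"])
     (rule hol_quot[OF holomorphic_on_subset[OF hol]], use assms in \<open>auto simp: annulus_def min_def\<close>)

text \<open>Continuity on the circle is enough, as nothing is claimed about boundary values. Points
  inside the circle will give regular parts, points outside give principal parts.\<close>

lemma Cauchy_type_holomorphic:
  assumes f: "continuous_on (sphere c \<rho>) f" and "0 < \<rho>"
  shows "(\<lambda>z. oint c \<rho> (\<lambda>w. f w / (z - w))) holomorphic_on {z. cmod (z - c) \<noteq> \<rho>}"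
proof -
  have op: "open {z. cmod (z - c) \<noteq> \<rho>}" by (intro open_Collect_neq continuous_intros)
  have "\<exists>g'. ((\<lambda>z. contour_integral (circlepath c \<rho>) (\<lambda>w. f w / (w - z))) has_field_derivative g') (at z)"
    if "cmod (z - c) \<noteq> \<rho>" for z
  proof -
    have "((\<lambda>z. contour_integral (circlepath c \<rho>) (\<lambda>w. f w / (w - z))) has_field_derivative
        (of_nat 1 * contour_integral (circlepath c \<rho>) (\<lambda>u. f u/(u-z)^(Suc 1)))) (at z)"
    proof (rule Cauchy_next_derivative(2)[where B = "2 * pi * \<rho>" and S = "{z. cmod (z - c) \<noteq> \<rho>}"])
      show "((\<lambda>u. f u / (u - w) ^ 1) has_contour_integral contour_integral (circlepath c \<rho>) (\<lambda>u. f u / (u - w)))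
            (circlepath c \<rho>)" if "w \<in> {z. cmod (z - c) \<noteq> \<rho>} - path_image (circlepath c \<rho>)" for w
      proof -
        have "(\<lambda>u. f u / (u - w)) contour_integrable_on (circlepath c \<rho>)"
          by (intro integrable_sphere continuous_intros f)
             (use that \<open>0 < \<rho>\<close> in \<open>auto simp: dist_norm norm_minus_commute\<close>)
        then show ?thesis by (simp add: has_contour_integral_integral)
      qed
    qed (use assms op that in \<open>auto simp: vector_derivative_circlepath norm_mult dist_norm norm_minus_commute\<close>)
    then show ?thesis by blast
  qed
  then have h: "(\<lambda>z. contour_integral (circlepath c \<rho>) (\<lambda>w. f w / (w - z))) holomorphic_on {z. cmod (z - c) \<noteq> \<rho>}"
    unfolding holomorphic_on_def field_differentiable_def
    by (auto intro: has_field_derivative_at_within)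
  have "(\<lambda>z. - (contour_integral (circlepath c \<rho>) (\<lambda>w. f w / (w - z)) / (2 * of_real pi * \<i>))) holomorphic_on {z. cmod (z - c) \<noteq> \<rho>}"
    by (intro holomorphic_intros h) auto
  moreover have "(\<lambda>w. f w / (z - w)) = (\<lambda>w. - (f w / (w - z)))" for z
    by (metis minus_diff_eq minus_divide_right)
  ultimately show ?thesis
    by (simp only: oint_neg) (simp add: oint_def)
qed

text \<open>The radius in \<open>prin\<close> moves with \<open>z\<close>. Near a given point one
  fixed radius serves, because the value does not depend on it.\<close>

lemma prin_holomorphic:
  assumes hol: "f holomorphic_on annulus c r0 r1" and r: "0 \<le> r0" "r0 < r1"
  shows "prin c r0 r1 f holomorphic_on {z. r0 < cmod (z - c)}"
proof -
  have "prin c r0 r1 f field_differentiable (at z)" if z: "r0 < cmod (z - c)" for z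
  proof -
    define \<rho> where "\<rho> = (r0 + min (cmod (z - c)) r1) / 2"
    have \<rho>: "r0 < \<rho>" "\<rho> < r1" "\<rho> < cmod (z - c)" using z r by (auto simp: \<rho>_def min_def)
    let ?U = "{z. \<rho> < cmod (z - c)}"
    have op: "open ?U" by (intro open_Collect_less continuous_intros)
    have "(\<lambda>z. oint c \<rho> (\<lambda>w. f w / (z - w))) holomorphic_on ?U"
      by (rule holomorphic_on_subset[OF Cauchy_type_holomorphic])
         (use \<rho> r hol_cont_sphere[OF hol] in auto)
    then have "prin c r0 r1 f holomorphic_on ?U"
      by (rule holomorphic_transform) (use \<rho> r prin_radius[OF hol] in auto)
    then show ?thesis using op \<rho> by (auto simp: holomorphic_on_open field_differentiable_def)
  qed
  then show ?thesis by (auto simp: holomorphic_on_def field_differentiable_at_within)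
qed

lemma prin_regular:
  assumes hol: "f holomorphic_on annulus c r0 r1"
    and "0 \<le> r0" "r0 < cmod (z - c)" "cmod (z - c) < \<rho>" "\<rho> < r1"
  shows "f z - prin c r0 r1 f z = oint c \<rho> (\<lambda>w. f w / (w - z))"
proof -
  obtain \<rho>1 where \<rho>1: "r0 < \<rho>1" "\<rho>1 < cmod (z - c)" using dense[OF assms(3)] by auto
  have "prin c r0 r1 f z = oint c \<rho>1 (\<lambda>w. - (f w / (w - z)))"
    using prin_radius[OF hol, of \<rho>1 z] \<rho>1 assms by (simp add: minus_divide_right)
  then show ?thesis
    using oint_annulus[OF hol, of \<rho>1 z \<rho>] \<rho>1 assms by (simp add: oint_neg)
qed

text \<open>The regular part is the Cauchy integral over a circle that encloses \<open>z\<close>; as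
  such it also makes sense at the points inside \<open>r0\<close>, where \<open>f\<close> need not
  be defined.\<close>

lemma prin_extend:
  assumes hol: "f holomorphic_on annulus c r0 r1" and r: "0 \<le> r0" "r0 < r1"
  obtains h where "h holomorphic_on ball c r1" "\<And>z. z \<in> annulus c r0 r1 \<Longrightarrow> f z = h z + prin c r0 r1 f z"
proof
  define h where "h z = oint c ((max r0 (cmod (z - c)) + r1) / 2) (\<lambda>w. f w / (w - z))" for z
  have heq: "h z = oint c \<rho> (\<lambda>w. f w / (w - z))" if "r0 < \<rho>" "cmod (z - c) < \<rho>" "\<rho> < r1" for \<rho> z
    unfolding h_def
  proof (rule oint_radius[of _ c "max r0 (cmod (z - c))" r1])
    show "(\<lambda>w. f w / (w - z)) holomorphic_on annulus c (max r0 (cmod (z - c))) r1"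
      by (intro holomorphic_intros holomorphic_on_subset[OF hol]) (auto simp: annulus_def)
  qed (use that r in \<open>auto simp: max_def\<close>)
  have "h field_differentiable (at z)" if z: "cmod (z - c) < r1" for z
  proof -
    define \<rho> where "\<rho> = (max r0 (cmod (z - c)) + r1) / 2"
    have \<rho>: "r0 < \<rho>" "\<rho> < r1" "cmod (z - c) < \<rho>" using z r by (auto simp: \<rho>_def max_def)
    let ?U = "{z. cmod (z - c) < \<rho>}"
    have op: "open ?U" by (intro open_Collect_less continuous_intros)
    have "(\<lambda>z. - oint c \<rho> (\<lambda>w. f w / (z - w))) holomorphic_on ?U"
      by (intro holomorphic_intros holomorphic_on_subset[OF Cauchy_type_holomorphic])
         (use \<rho> r hol_cont_sphere[OF hol] in auto)
    moreover have "- oint c \<rho> (\<lambda>w. f w / (x - w)) = h x" if "x \<in> ?U" for x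
    proof -
      have "oint c \<rho> (\<lambda>w. - (f w / (x - w))) = h x" 
        using heq[of \<rho> x] \<rho> that by (simp add: minus_divide_right)
      then show ?thesis by (simp add: oint_neg)
    qed
    ultimately have "h holomorphic_on ?U"
      by (metis (no_types, lifting) holomorphic_transform)
    then show ?thesis using op \<rho> by (auto simp: holomorphic_on_open field_differentiable_def)
  qed
  then show "h holomorphic_on ball c r1"
    by (auto simp: holomorphic_on_def field_differentiable_at_within dist_norm norm_minus_commute)
  show "f z = h z + prin c r0 r1 f z" if z: "z \<in> annulus c r0 r1" for z
  proof -
    obtain \<rho> where "cmod (z - c) < \<rho>" "\<rho> < r1" using dense[of "cmod (z - c)" r1] z by (auto simp: annulus_def)
    then show ?thesis using prin_regular[OF hol, of z \<rho>] heq[of \<rho> z] z r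
      by (auto simp: annulus_def algebra_simps)
  qed
qed

text \<open>One radius serves all functions at the same \<open>z\<close>, so that linearity of
  \<open>prin\<close> is inherited from the integral.\<close>

lemma prin_in_annulus:
  assumes "0 \<le> r0" "r0 < r1" "r0 < cmod (z - c)"
  obtains \<rho> where "r0 < \<rho>" "\<rho> < r1" "\<rho> < cmod (z - c)" "\<And>f. prin c r0 r1 f z = oint c \<rho> (\<lambda>w. f w / (z - w))"
  using that[of "(r0 + min (cmod (z - c)) r1) / 2"] assms by (auto simp: prin_def min_def)

lemma prin_cong:
  assumes "0 \<le> r0" "r0 < r1" "r0 < cmod (z - c)" "\<And>w. w \<in> annulus c r0 r1 \<Longrightarrow> f w = g w"
  shows "prin c r0 r1 f z = prin c r0 r1 g z"
proof -
  obtain \<rho> where \<rho>: "r0 < \<rho>" "\<rho> < r1" "\<And>f. prin c r0 r1 f z = oint c \<rho> (\<lambda>w. f w / (z - w))"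
    using prin_in_annulus[OF assms(1-3)] by metis
  show ?thesis unfolding \<rho>(3)
    by (rule oint_cong) (use assms \<rho> in \<open>auto simp: annulus_def\<close>)
qed

lemma prin_add:
  assumes "f holomorphic_on annulus c r0 r1" "g holomorphic_on annulus c r0 r1"
    and "0 \<le> r0" "r0 < r1" "r0 < cmod (z - c)"
  shows "prin c r0 r1 (\<lambda>w. f w + g w) z = prin c r0 r1 f z + prin c r0 r1 g z"
proof -
  obtain \<rho> where \<rho>: "r0 < \<rho>" "\<rho> < r1" "\<rho> < cmod (z - c)" "\<And>f. prin c r0 r1 f z = oint c \<rho> (\<lambda>w. f w / (z - w))"
    using prin_in_annulus[OF assms(3-5)] by metis
  have "oint c \<rho> (\<lambda>w. f w / (z - w) + g w / (z - w)) = oint c \<rho> (\<lambda>w. f w / (z - w)) + oint c \<rho> (\<lambda>w. g w / (z - w))"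
    using \<rho> assms
    by (intro oint_add continuous_intros hol_cont_sphere[OF assms(1)] hol_cont_sphere[OF assms(2)])
       (auto simp: dist_norm norm_minus_commute)
  then show ?thesis by (simp add: \<rho>(4) add_divide_distrib)
qed

lemma prin_cmul: "prin c r0 r1 (\<lambda>w. k * f w) z = k * prin c r0 r1 f z"
  unfolding prin_def using oint_cmul[of c _ k "\<lambda>w. f w / (z - w)"] by (simp add: times_divide_eq_right)

lemma prin_diff:
  assumes "f holomorphic_on annulus c r0 r1" "g holomorphic_on annulus c r0 r1"
    and "0 \<le> r0" "r0 < r1" "r0 < cmod (z - c)"
  shows "prin c r0 r1 (\<lambda>w. f w - g w) z = prin c r0 r1 f z - prin c r0 r1 g z"
proof -
  have "(\<lambda>w. -1 * g w) holomorphic_on annulus c r0 r1" by (intro holomorphic_intros assms)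
  from prin_add[OF assms(1) this assms(3-5)] show ?thesis by (simp only: prin_cmul) simp
qed

lemma prin_eq_0:
  assumes "f holomorphic_on ball c r1" "0 \<le> r0" "r0 < r1" "r0 < cmod (z - c)"
  shows "prin c r0 r1 f z = 0"
proof -
  obtain \<rho> where \<rho>: "r0 < \<rho>" "\<rho> < r1" "\<rho> < cmod (z - c)" "\<And>f. prin c r0 r1 f z = oint c \<rho> (\<lambda>w. f w / (z - w))"
    using prin_in_annulus[OF assms(2-4)] by metis
  show ?thesis unfolding \<rho>(4)
  proof (rule oint_eq_0[of _ c "min r1 (cmod (z - c))"])
    show "(\<lambda>w. f w / (z - w)) holomorphic_on ball c (min r1 (cmod (z - c)))"
      by (intro holomorphic_intros holomorphic_on_subset[OF assms(1)]) (auto simp: dist_norm norm_minus_commute)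
  qed (use \<rho> assms in auto)
qed

lemma prin_hol_annulus:
  assumes "f holomorphic_on annulus c r0 r1" "0 \<le> r0" "r0 < r1"
  shows "prin c r0 r1 f holomorphic_on annulus c r0 r1"
  by (rule holomorphic_on_subset[OF prin_holomorphic[OF assms]]) (auto simp: annulus_def)

lemma annulus_subset_ball: "annulus c r0 r1 \<subseteq> ball c r1"
  by (auto simp: annulus_def dist_norm norm_minus_commute)

text \<open>\<open>f\<close> and its principal part differ by a function that extends to the ball,
  and multiplication by \<open>u\<close> keeps it there. This is what makes nested principal parts
  at 0 collapse into one.\<close>

lemma prin_mult_prin:
  assumes u: "u holomorphic_on ball c r1" and f: "f holomorphic_on annulus c r0 r1"
    and r: "0 \<le> r0" "r0 < r1" "r0 < cmod (z - c)"
  shows "prin c r0 r1 (\<lambda>w. u w * prin c r0 r1 f w) z = prin c r0 r1 (\<lambda>w. u w * f w) z"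
proof -
  obtain h where h: "h holomorphic_on ball c r1" "\<And>z. z \<in> annulus c r0 r1 \<Longrightarrow> f z = h z + prin c r0 r1 f z"
    using prin_extend[OF f r(1,2)] by metis
  note sub = holomorphic_on_subset[OF _ annulus_subset_ball]
  have "prin c r0 r1 (\<lambda>w. u w * f w) z = prin c r0 r1 (\<lambda>w. u w * h w + u w * prin c r0 r1 f w) z"
    by (rule prin_cong[OF r]) (use h(2) in \<open>auto simp: algebra_simps\<close>)
  also have "\<dots> = prin c r0 r1 (\<lambda>w. u w * h w) z + prin c r0 r1 (\<lambda>w. u w * prin c r0 r1 f w) z"
    by (intro prin_add holomorphic_intros r sub[OF u] sub[OF h(1)] prin_hol_annulus f)
  also have "prin c r0 r1 (\<lambda>w. u w * h w) z = 0"
    by (intro prin_eq_0 holomorphic_intros u h r)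
  finally show ?thesis by simp
qed

lemma oint_mult_prin:
  assumes u: "u holomorphic_on ball c r1" and f: "f holomorphic_on annulus c r0 r1"
    and r: "0 \<le> r0" "r0 < \<rho>" "\<rho> < r1"
  shows "oint c \<rho> (\<lambda>w. u w * prin c r0 r1 f w) = oint c \<rho> (\<lambda>w. u w * f w)"
proof -
  have r01: "r0 < r1" using r by simp
  obtain h where h: "h holomorphic_on ball c r1" "\<And>z. z \<in> annulus c r0 r1 \<Longrightarrow> f z = h z + prin c r0 r1 f z"
    using prin_extend[OF f r(1) r01] by metis
  note sub = holomorphic_on_subset[OF _ annulus_subset_ball]
  have "oint c \<rho> (\<lambda>w. u w * f w) = oint c \<rho> (\<lambda>w. u w * h w + u w * prin c r0 r1 f w)"
    by (rule oint_cong) (use h(2) r in \<open>auto simp: algebra_simps annulus_def\<close>)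
  also have "\<dots> = oint c \<rho> (\<lambda>w. u w * h w) + oint c \<rho> (\<lambda>w. u w * prin c r0 r1 f w)"
    using r by (intro oint_add continuous_intros hol_cont_sphere[OF sub[OF u] r(2,3)]
       hol_cont_sphere[OF sub[OF h(1)] r(2,3)] hol_cont_sphere[OF prin_hol_annulus[OF f r(1) r01] r(2,3)]) simp
  also have "oint c \<rho> (\<lambda>w. u w * h w) = 0"
    by (rule oint_eq_0[where ?r1.0 = r1]) (use r in \<open>auto intro!: holomorphic_intros u h\<close>)
  finally show ?thesis by simp
qed

lemma prin_decay:
  assumes f: "f holomorphic_on annulus c r0 r1" and r: "0 \<le> r0" "r0 < r1"
  obtains K R0 where "r0 < R0" "0 \<le> K" "\<And>z. R0 \<le> cmod (z - c) \<Longrightarrow> cmod (prin c r0 r1 f z) \<le> K / cmod (z - c)"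
proof -
  define \<rho> where "\<rho> = (r0 + r1) / 2"
  have \<rho>: "r0 < \<rho>" "\<rho> < r1" "0 < \<rho>" using r by (auto simp: \<rho>_def)
  have cont: "continuous_on (sphere c \<rho>) f" by (rule hol_cont_sphere[OF f]) (use \<rho> in auto)
  have "compact (f ` sphere c \<rho>)" using cont by (rule compact_continuous_image) simp
  then obtain B where B: "\<And>w. w \<in> sphere c \<rho> \<Longrightarrow> cmod (f w) \<le> B" "0 < B"
    by (metis compact_imp_bounded bounded_pos imageI)
  show ?thesis
  proof (rule that[of "2 * \<rho>" "2 * B * \<rho>"])
    fix z assume z: "2 * \<rho> \<le> cmod (z - c)"
    have "cmod (f w / (z - w)) \<le> B / (cmod (z - c) / 2)" if w: "cmod (w - c) = \<rho>" for w
    proof -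
      have "cmod (z - c) \<le> cmod (z - w) + cmod (w - c)" using norm_triangle_ineq[of "z - w" "w - c"] by simp
      then have "cmod (z - c) / 2 \<le> cmod (z - w)" using z w by simp
      moreover have "cmod (f w) \<le> B" using B w by (simp add: dist_norm norm_minus_commute)
      ultimately show ?thesis unfolding norm_divide using z \<rho> B(2)
        by (intro frac_le) auto
    qed
    then have "cmod (oint c \<rho> (\<lambda>w. f w / (z - w))) \<le> B / (cmod (z - c) / 2) * \<rho>"
      using \<rho> z B(2) by (intro oint_norm_le continuous_intros cont) (auto simp: dist_norm norm_minus_commute)
    also have "\<dots> = 2 * B * \<rho> / cmod (z - c)" by simp
    finally show "cmod (prin c r0 r1 f z) \<le> 2 * B * \<rho> / cmod (z - c)"
      using prin_radius[OF f r(1), of \<rho> z] \<rho> z by simp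
  qed (use \<rho> B in auto)
qed

text \<open>Each factor is O(1/z) at infinity, so the product decays quadratically and the contour
  can be pushed to infinity.\<close>

lemma oint_prin_prin:
  assumes f: "f holomorphic_on annulus c r0 r1" and g: "g holomorphic_on annulus c r0 r1"
    and r: "0 \<le> r0" "r0 < r1" "r0 < \<rho>"
  shows "oint c \<rho> (\<lambda>w. prin c r0 r1 f w * prin c r0 r1 g w) = 0"
proof -
  obtain K R0 where K: "r0 < R0" "0 \<le> K" "\<And>z. R0 \<le> cmod (z - c) \<Longrightarrow> cmod (prin c r0 r1 f z) \<le> K / cmod (z - c)"
    using prin_decay[OF f r(1,2)] by metis
  obtain K' R0' where K': "r0 < R0'" "0 \<le> K'" "\<And>z. R0' \<le> cmod (z - c) \<Longrightarrow> cmod (prin c r0 r1 g z) \<le> K' / cmod (z - c)"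
    using prin_decay[OF g r(1,2)] by metis
  show ?thesis
  proof (rule oint_decay[of _ r0 c \<rho> "max R0 R0'" "K * K'"])
    fix z assume z: "max R0 R0' \<le> cmod (z - c)"
    have "cmod (prin c r0 r1 f z) * cmod (prin c r0 r1 g z) \<le> (K / cmod (z - c)) * (K' / cmod (z - c))"
      using K K' z by (intro mult_mono) auto
    then show "cmod (prin c r0 r1 f z * prin c r0 r1 g z) \<le> K * K' / (cmod (z - c))\<^sup>2"
      by (simp add: norm_mult power2_eq_square)
  qed (use r in \<open>auto intro!: holomorphic_intros prin_holomorphic f g\<close>)
qed

section \<open>Sequences encoded by contour functions\<close>

locale rate =
  fixes q :: real
  assumes q0: "0 < q" and q1: "q < 1"
begin

section \<open>The domain of the integrands and its large circles\<close>

definition Ex :: "complex set" where "Ex = {z. q < cmod (z - 1)}"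
text \<open>The integrands have their poles at 1, at 1 - q and at 0. The first two lie in the disc
  of radius \<open>q\<close> around 1, which both domains exclude; membership in \<open>Ex\<close>
  instead of \<open>Om\<close> records regularity at 0.\<close>

definition Om :: "complex set" where "Om = {z. q < cmod (z - 1) \<and> z \<noteq> 0}"

text \<open>Principal parts at the pole \<open>0\<close> and at the singularities in \<open>\<bar>z - 1\<bar> \<le> q\<close>.\<close>

abbreviation P0 :: "(complex \<Rightarrow> complex) \<Rightarrow> complex \<Rightarrow> complex" where "P0 \<equiv> prin 0 0 (1 - q)"
abbreviation P1 :: "(complex \<Rightarrow> complex) \<Rightarrow> complex \<Rightarrow> complex" where "P1 \<equiv> prin 1 q 1"

lemma open_Ex [simp, intro]: "open Ex"
  unfolding Ex_def by (intro open_Collect_less continuous_intros)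

lemma Om_eq: "Om = Ex - {0}" by (auto simp: Om_def Ex_def)

lemma open_Om [simp, intro]: "open Om" by (simp add: Om_eq open_delete)

lemma Om_Ex: "Om \<subseteq> Ex" by (auto simp: Om_eq)

lemma annulus0_Om: "annulus 0 0 (1 - q) \<subseteq> Om"
proof
  fix z assume "z \<in> annulus 0 0 (1 - q)"
  then show "z \<in> Om" using norm_triangle_ineq4[of z "z - 1"] by (auto simp: annulus_def Om_def)
qed

lemma annulus1_Om: "annulus 1 q 1 \<subseteq> Om" by (auto simp: annulus_def Om_def)

lemma ball0_Ex: "ball 0 (1 - q) \<subseteq> Ex"
proof
  fix z :: complex assume "z \<in> ball 0 (1 - q)"
  then show "z \<in> Ex" using norm_triangle_ineq4[of z "z - 1"] by (auto simp: Ex_def)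
qed

lemma hol_annulus0: "f holomorphic_on Om \<Longrightarrow> f holomorphic_on annulus 0 0 (1 - q)"
  by (rule holomorphic_on_subset[OF _ annulus0_Om])
lemma hol_annulus1: "f holomorphic_on Om \<Longrightarrow> f holomorphic_on annulus 1 q 1"
  by (rule holomorphic_on_subset[OF _ annulus1_Om])
lemma hol_big: "f holomorphic_on Om \<Longrightarrow> f holomorphic_on annulus 1 1 r"
  using q1 by (elim holomorphic_on_subset) (auto simp: annulus_def Om_def)
lemma Ex_Om: "f holomorphic_on Ex \<Longrightarrow> f holomorphic_on Om"
  by (rule holomorphic_on_subset[OF _ Om_Ex])
lemma Ex_ball0: "f holomorphic_on Ex \<Longrightarrow> f holomorphic_on ball 0 (1 - q)"
  by (rule holomorphic_on_subset[OF _ ball0_Ex])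

lemma P0_hol0: "f holomorphic_on Om \<Longrightarrow> P0 f holomorphic_on - {0}"
  using prin_holomorphic[OF hol_annulus0, of f] q1 by (simp add: Compl_eq)

lemma P0_hol: "f holomorphic_on Om \<Longrightarrow> P0 f holomorphic_on Om"
  by (rule holomorphic_on_subset[OF P0_hol0]) (auto simp: Om_def)

lemma P1_Ex: "f holomorphic_on Om \<Longrightarrow> P1 f holomorphic_on Ex"
  using prin_holomorphic[OF hol_annulus1, of f] q0 q1 by (simp add: Ex_def)

lemma P1_hol: "f holomorphic_on Om \<Longrightarrow> P1 f holomorphic_on Om"
  by (rule Ex_Om[OF P1_Ex])

lemma P0_ball1: "f holomorphic_on Om \<Longrightarrow> P0 f holomorphic_on ball 1 1"
  by (rule holomorphic_on_subset[OF P0_hol0]) auto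

text \<open>\<open>h - P0 h\<close> away from 0 and the regular part near 0 agree on the punctured
  disc; glued together they remove the singularity at 0.\<close>

lemma Om_split:
  assumes h: "h holomorphic_on Om"
  obtains h0 where "h0 holomorphic_on Ex" "\<And>z. z \<in> Om \<Longrightarrow> h z = h0 z + P0 h z"
proof -
  obtain e where e: "e holomorphic_on ball 0 (1 - q)" "\<And>z. z \<in> annulus 0 0 (1 - q) \<Longrightarrow> h z = e z + P0 h z"
    using prin_extend[OF hol_annulus0[OF h]] q1 by auto
  define h0 where "h0 z = (if z = 0 then e 0 else h z - P0 h z)" for z
  have 1: "h0 holomorphic_on Om"
    by (rule holomorphic_transform[of "\<lambda>z. h z - P0 h z"])
       (intro holomorphic_intros h P0_hol, auto simp: h0_def Om_def)
  have 2: "h0 holomorphic_on ball 0 (1 - q)"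
    by (rule holomorphic_transform[OF e(1)]) (use e(2) in \<open>auto simp: h0_def annulus_def\<close>)
  have "h0 holomorphic_on (Om \<union> ball 0 (1 - q))"
    using 1 2 by (simp add: holomorphic_on_Un)
  moreover have "Ex \<subseteq> Om \<union> ball 0 (1 - q)" using q1 by (auto simp: Om_eq)
  ultimately have "h0 holomorphic_on Ex" using holomorphic_on_subset by blast
  then show ?thesis by (rule that) (auto simp: h0_def Om_def)
qed

lemma in_Om: "cmod (z - 1) = \<rho> \<Longrightarrow> q < \<rho> \<Longrightarrow> \<rho> \<noteq> 1 \<Longrightarrow> z \<in> Om"
  by (auto simp: Om_def)

lemma sphere_Om:
  assumes "f holomorphic_on Om" "q < \<rho>" "\<rho> \<noteq> 1"
  shows "continuous_on (sphere 1 \<rho>) f"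
proof (rule continuous_on_subset[OF holomorphic_on_imp_continuous_on[OF assms(1)]])
  show "sphere 1 \<rho> \<subseteq> Om" using assms(2,3) by (auto simp: Om_def dist_norm norm_minus_commute)
qed

text \<open>A circle around 1 of radius above 1 cannot be shrunk past the pole at 0. After
  \<open>Om_split\<close> the summand \<open>h0\<close> has no pole there and its circle shrinks
  freely, while \<open>P0 h\<close> is regular in the unit disc around 1 and its large integral
  reduces to the residue of \<open>h\<close> at 0.\<close>

lemma big_split:
  assumes h: "h holomorphic_on Om" and "1 < Rb" "q < R" "R < 1" "0 < \<tau>" "\<tau> < 1 - q"
  shows "oint 1 Rb h = oint 1 R h + oint 0 \<tau> h"
proof -
  obtain h0 where h0: "h0 holomorphic_on Ex" "\<And>z. z \<in> Om \<Longrightarrow> h z = h0 z + P0 h z"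
    using Om_split[OF h] by metis
  have split: "oint 1 \<rho> h = oint 1 \<rho> h0 + oint 1 \<rho> (P0 h)" if "q < \<rho>" "\<rho> \<noteq> 1" for \<rho>
  proof -
    have "oint 1 \<rho> h = oint 1 \<rho> (\<lambda>z. h0 z + P0 h z)"
      by (rule oint_cong) (use that q0 h0(2) in_Om in auto)
    also have "\<dots> = oint 1 \<rho> h0 + oint 1 \<rho> (P0 h)"
      using that q0 by (intro oint_add sphere_Om Ex_Om[OF h0(1)] P0_hol h) auto
    finally show ?thesis .
  qed
  have "oint 1 R (P0 h) = 0"
    by (rule oint_eq_0[OF P0_ball1[OF h]]) (use assms q0 in auto)
  moreover have "oint 1 R h0 = oint 1 Rb h0"
    by (rule oint_radius[of _ 1 q "Rb + 1"]) (use assms q0 in \<open>auto intro!: holomorphic_on_subset[OF h0(1)] simp: annulus_def Ex_def\<close>)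
  moreover have "oint 1 Rb (P0 h) = oint 0 \<tau> h"
  proof -
    \<comment> \<open>Shrinking the circle around 0 puts all of it inside the circle of radius
      \<open>Rb\<close> around 1: the kernel is then nonsingular on the product of the circles, and
      the Cauchy formula applies to every point \<open>w\<close> of the small one.\<close>
    define \<tau>' where "\<tau>' = min \<tau> ((Rb - 1) / 2)"
    have \<tau>': "0 < \<tau>'" "\<tau>' < 1 - q" "\<tau>' < Rb - 1" using assms by (auto simp: \<tau>'_def min_def)
    have far: "Rb - 1 \<le> cmod z" if "cmod (z - 1) = Rb" for z
      using norm_triangle_ineq4[of z 1] that by simp
    have "oint 1 Rb (P0 h) = oint 1 Rb (\<lambda>z. oint 0 \<tau>' (\<lambda>w. h w / (z - w)))"
    proof (rule oint_cong)
      fix z assume "cmod (z - 1) = Rb"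
      then have "\<tau>' < cmod (z - 0)" using far[of z] \<tau>' by auto
      then show "P0 h z = oint 0 \<tau>' (\<lambda>w. h w / (z - w))"
        by (intro prin_radius[OF hol_annulus0[OF h]]) (use \<tau>' in auto)
    qed (use assms in auto)
    also have "\<dots> = oint 0 \<tau>' (\<lambda>w. oint 1 Rb (\<lambda>z. h w / (z - w)))"
    proof (rule oint_swap)
      have "continuous_on (sphere 0 \<tau>') h"
        by (rule hol_cont_sphere[OF hol_annulus0[OF h]]) (use \<tau>' in auto)
      then have "continuous_on (sphere 1 Rb \<times> sphere 0 \<tau>') (\<lambda>x. h (snd x))"
        by (rule continuous_on_compose2) (auto intro!: continuous_intros)
      moreover have apart: "z \<noteq> w" if "z \<in> sphere 1 Rb" "w \<in> sphere 0 \<tau>'" for z w :: complex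
        using that far[of z] \<tau>' by (auto simp: dist_norm norm_minus_commute)
      ultimately show "continuous_on (sphere 1 Rb \<times> sphere 0 \<tau>') (\<lambda>(z, w). h w / (z - w))"
        unfolding case_prod_beta
      proof (intro continuous_intros)
        show "\<forall>x\<in>sphere (1::complex) Rb \<times> sphere 0 \<tau>'. fst x - snd x \<noteq> 0"
        proof
          fix x :: "complex \<times> complex" assume "x \<in> sphere 1 Rb \<times> sphere 0 \<tau>'"
          then show "fst x - snd x \<noteq> 0" using apart[of "fst x" "snd x"] by (simp only: mem_Times_iff right_minus_eq) simp
        qed
      qed
    qed (use \<tau>' assms in auto)
    also have "\<dots> = oint 0 \<tau>' h"
    proof (rule oint_cong)
      fix w assume w: "cmod (w - 0) = \<tau>'"
      have "oint 1 Rb (\<lambda>z. h w / (z - w)) = h w"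
        by (rule oint_Cauchy[of "\<lambda>_. h w" 1 "Rb + 1"]) (use w \<tau>' norm_triangle_ineq4[of w 1] in auto)
      then show "oint 1 Rb (\<lambda>z. h w / (z - w)) = h w" .
    qed (use \<tau>' in auto)
    also have "\<dots> = oint 0 \<tau> h"
      by (rule oint_radius[OF hol_annulus0[OF h]]) (use \<tau>' assms in auto)
    finally show ?thesis .
  qed
  ultimately show ?thesis using split[of R] split[of Rb] assms q0 q1 by simp
qed

text \<open>The principal part taken on the large circle is the sum of those belonging to the two
  groups of poles inside it. Truncation of a sequence refers to the large circle; this translates it
  into \<open>P1\<close> and \<open>P0\<close>.\<close>

lemma big_prin:
  assumes h: "h holomorphic_on Om" and "1 < Rb" "Rb < cmod (z - 1)"
  shows "oint 1 Rb (\<lambda>w. h w / (z - w)) = P1 h z + P0 h z"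
proof -
  define R where "R = (q + 1) / 2"
  have R: "q < R" "R < 1" using q1 by (auto simp: R_def)
  have z0: "z \<noteq> 0" using assms by auto
  define \<tau> where "\<tau> = min (1 - q) (cmod z) / 2"
  have \<tau>: "0 < \<tau>" "\<tau> < 1 - q" "\<tau> < cmod z" using q1 z0 by (auto simp: \<tau>_def min_def)
  let ?A = "{z'. cmod (z' - 1) < cmod (z - 1)}"
  have opA: "open ?A" by (intro open_Collect_less continuous_intros)
  obtain h0 where h0: "h0 holomorphic_on Ex" "\<And>z. z \<in> Om \<Longrightarrow> h z = h0 z + P0 h z"
    using Om_split[OF h] by metis
  have split: "oint 1 \<rho> (\<lambda>w. h w / (z - w)) = oint 1 \<rho> (\<lambda>w. h0 w / (z - w)) + oint 1 \<rho> (\<lambda>w. P0 h w / (z - w))"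
    if "q < \<rho>" "\<rho> \<noteq> 1" "\<rho> < cmod (z - 1)" for \<rho>
  proof -
    have "oint 1 \<rho> (\<lambda>w. h w / (z - w)) = oint 1 \<rho> (\<lambda>w. h0 w / (z - w) + P0 h w / (z - w))"
      by (rule oint_cong) (use that q0 h0(2) in_Om in \<open>auto simp: add_divide_distrib\<close>)
    also have "\<dots> = oint 1 \<rho> (\<lambda>w. h0 w / (z - w)) + oint 1 \<rho> (\<lambda>w. P0 h w / (z - w))"
      using that q0 by (intro oint_add continuous_intros sphere_Om Ex_Om[OF h0(1)] P0_hol h) (auto simp: dist_norm norm_minus_commute)
    finally show ?thesis .
  qed
  have "oint 1 R (\<lambda>w. P0 h w / (z - w)) = 0"
    by (rule oint_eq_0[where ?r1.0 = 1])
       (use assms q0 R in \<open>auto intro!: holomorphic_intros P0_ball1 h simp: dist_norm norm_minus_commute\<close>)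
  moreover have "oint 1 R (\<lambda>w. h0 w / (z - w)) = oint 1 Rb (\<lambda>w. h0 w / (z - w))"
  proof (rule oint_radius[of _ 1 q "cmod (z - 1)"])
    show "(\<lambda>w. h0 w / (z - w)) holomorphic_on annulus 1 q (cmod (z - 1))"
      by (intro hol_quot holomorphic_on_subset[OF h0(1)]) (auto simp: annulus_def Ex_def)
  qed (use assms q0 R in auto)
  moreover have "oint 1 Rb (\<lambda>w. P0 h w / (z - w)) = P0 h z"
  proof -
    have hol: "(\<lambda>w. P0 h w / (z - w)) holomorphic_on annulus 1 1 (cmod (z - 1))"
      by (intro hol_quot hol_big P0_hol h) auto
    define \<tau>' where "\<tau>' = min \<tau> ((Rb - 1) / 2)"
    have \<tau>': "0 < \<tau>'" "\<tau>' < 1 - q" "\<tau>' < Rb - 1" "\<tau>' < cmod z" using assms \<tau> by (auto simp: \<tau>'_def min_def)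
    have far: "Rb - 1 \<le> cmod z" if "cmod (z - 1) = Rb" for z
      using norm_triangle_ineq4[of z 1] that by simp
    have "oint 1 Rb (\<lambda>w. P0 h w / (z - w)) = oint 1 Rb (\<lambda>y. oint 0 \<tau>' (\<lambda>w. h w / (y - w) / (z - y)))"
    proof (rule oint_cong)
      fix y assume "cmod (y - 1) = Rb"
      then have "\<tau>' < cmod (y - 0)" using far[of y] \<tau>' by auto
      then have "P0 h y = oint 0 \<tau>' (\<lambda>w. h w / (y - w))"
        by (intro prin_radius[OF hol_annulus0[OF h]]) (use \<tau>' in auto)
      then show "P0 h y / (z - y) = oint 0 \<tau>' (\<lambda>w. h w / (y - w) / (z - y))" by (simp only: oint_divc)
    qed (use assms in auto)
    also have "\<dots> = oint 0 \<tau>' (\<lambda>w. oint 1 Rb (\<lambda>y. h w / (y - w) / (z - y)))"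
    proof (rule oint_swap)
      have "continuous_on (sphere 0 \<tau>') h"
        by (rule hol_cont_sphere[OF hol_annulus0[OF h]]) (use \<tau>' in auto)
      then have "continuous_on (sphere 1 Rb \<times> sphere 0 \<tau>') (\<lambda>x. h (snd x))"
        by (rule continuous_on_compose2) (auto intro!: continuous_intros)
      moreover have apart: "z \<noteq> w" if "z \<in> sphere 1 Rb" "w \<in> sphere 0 \<tau>'" for z w :: complex
        using that far[of z] \<tau>' by (auto simp: dist_norm norm_minus_commute)
      ultimately show "continuous_on (sphere 1 Rb \<times> sphere 0 \<tau>') (\<lambda>(y, w). h w / (y - w) / (z - y))"
        unfolding case_prod_beta
      proof (intro continuous_intros)
        show "\<forall>x\<in>sphere (1::complex) Rb \<times> sphere 0 \<tau>'. fst x - snd x \<noteq> 0"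
        proof
          fix x :: "complex \<times> complex" assume "x \<in> sphere 1 Rb \<times> sphere 0 \<tau>'"
          then show "fst x - snd x \<noteq> 0" using apart[of "fst x" "snd x"] by (simp only: mem_Times_iff right_minus_eq) simp
        qed
        show "\<forall>x\<in>sphere 1 Rb \<times> sphere 0 \<tau>'. z - fst x \<noteq> 0"
          using assms by (auto simp: dist_norm norm_minus_commute)
      qed
    qed (use \<tau>' assms in auto)
    also have "\<dots> = oint 0 \<tau>' (\<lambda>w. h w / (z - w))"
    proof (rule oint_cong)
      fix w assume w: "cmod (w - 0) = \<tau>'"
      have "oint 1 Rb (\<lambda>y. (h w / (z - y)) / (y - w)) = h w / (z - w)"
        by (rule oint_Cauchy[of "\<lambda>y. h w / (z - y)" 1 "cmod (z - 1)"])
           (use w \<tau>' assms norm_triangle_ineq4[of w 1] in \<open>auto intro!: holomorphic_intros simp: dist_norm norm_minus_commute\<close>)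
      then show "oint 1 Rb (\<lambda>y. h w / (y - w) / (z - y)) = h w / (z - w)" by (simp add: mult.commute)
    qed (use \<tau>' in auto)
    also have "\<dots> = P0 h z"
      by (rule prin_radius[OF hol_annulus0[OF h], symmetric]) (use \<tau>' in auto)
    finally show ?thesis .
  qed
  moreover have "oint 1 R (\<lambda>w. h w / (z - w)) = P1 h z"
    by (rule prin_radius[OF hol_annulus1[OF h], symmetric]) (use R assms q0 in auto)
  ultimately show ?thesis using split[of R] split[of Rb] assms R q0 q1 by simp
qed

text \<open>On sequences, multiplication of \<open>\<Psi>\<close> by \<open>1 - z\<close> is a shift, multiplication by \<open>- z\<close> is the
  forward difference, and multiplication by \<open>step_factor\<close> is convolution with the geometric weights.\<close>

definition seq :: "(complex \<Rightarrow> complex) \<Rightarrow> int \<Rightarrow> complex" where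
  "seq \<Psi> x = oint 1 2 (\<lambda>z. \<Psi> z * (1 - z) powi x)"

definition tseq :: "(complex \<Rightarrow> complex) \<Rightarrow> int \<Rightarrow> int \<Rightarrow> complex" where
  "tseq \<Psi> k x = seq (\<lambda>z. (- z) powi k * \<Psi> z) x"

lemma powi_hol_Om: "(\<lambda>z. z powi k) holomorphic_on Om" "(\<lambda>z. (- z) powi k) holomorphic_on Om"
  "(\<lambda>z. (1 - z) powi k) holomorphic_on Om"
proof -
  have "1 - z \<noteq> 0" if "z \<in> Om" for z using that q0 by (auto simp: Om_def)
  then show "(\<lambda>z. (1 - z) powi k) holomorphic_on Om" by (intro holomorphic_on_power_int holomorphic_intros) simp
  have "z \<noteq> 0" if "z \<in> Om" for z using that by (simp add: Om_def)
  then show "(\<lambda>z. z powi k) holomorphic_on Om" "(\<lambda>z. (- z) powi k) holomorphic_on Om"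
    by (intro holomorphic_on_power_int holomorphic_intros; simp)+
qed

lemma cont_seq:
  assumes "f holomorphic_on Om"
  shows "continuous_on (sphere 1 2) (\<lambda>z. f z * (1 - z) powi x)"
proof (rule sphere_Om)
  show "(\<lambda>z. f z * (1 - z) powi x) holomorphic_on Om"
    by (rule holomorphic_on_mult[OF assms powi_hol_Om(3)])
qed (use q1 in auto)

lemma seq_add:
  assumes "f holomorphic_on Om" "g holomorphic_on Om"
  shows "seq (\<lambda>z. f z + g z) x = seq f x + seq g x"
  unfolding seq_def distrib_right by (rule oint_add[OF cont_seq[OF assms(1)] cont_seq[OF assms(2)]]) simp

lemma seq_diff:
  assumes "f holomorphic_on Om" "g holomorphic_on Om"
  shows "seq (\<lambda>z. f z - g z) x = seq f x - seq g x"
  unfolding seq_def left_diff_distrib by (rule oint_diff[OF cont_seq[OF assms(1)] cont_seq[OF assms(2)]]) simp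

lemma seq_cmul: "seq (\<lambda>z. c * f z) x = c * seq f x"
  unfolding seq_def using oint_cmul[of 1 2 c] by (simp add: mult.assoc)

lemma seq_cong: "(\<And>z. z \<in> Om \<Longrightarrow> f z = g z) \<Longrightarrow> seq f x = seq g x"
  unfolding seq_def by (intro oint_cong) (use q1 in_Om in auto)

section \<open>Growth of the sequences and vanishing far below\<close>

lemma seq_bound:
  assumes "\<Psi> holomorphic_on Om"
  obtains K where "0 \<le> K" "\<And>x. cmod (seq \<Psi> x) \<le> K * 2 powi x"
proof -
  have cont: "continuous_on (sphere 1 2) \<Psi>" using q1 by (intro sphere_Om assms) auto
  then have "compact (\<Psi> ` sphere 1 2)" by (rule compact_continuous_image) simp
  then obtain B where B: "\<And>w. w \<in> sphere 1 2 \<Longrightarrow> cmod (\<Psi> w) \<le> B" "0 < B"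
    by (metis compact_imp_bounded bounded_pos imageI)
  show ?thesis
  proof (rule that[of "B * 2"])
    fix x :: int
    have "cmod (oint 1 2 (\<lambda>z. \<Psi> z * (1 - z) powi x)) \<le> (B * 2 powi x) * 2"
    proof (rule oint_norm_le)
      show "continuous_on (sphere 1 2) (\<lambda>z. \<Psi> z * (1 - z) powi x)"
        using q1 by (intro sphere_Om holomorphic_intros assms powi_hol_Om) auto
      show "cmod (\<Psi> z * (1 - z) powi x) \<le> B * 2 powi x" if "cmod (z - 1) = 2" for z
        using B(1)[of z] that by (simp add: norm_mult norm_power_int norm_minus_commute dist_norm)
    qed (use B in auto)
    then show "cmod (seq \<Psi> x) \<le> B * 2 * 2 powi x" by (simp add: seq_def mult_ac)
  qed (use B in auto)
qed

text \<open>Going down by n places multiplies the modulus by at least 1, whereas the bound shrinks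
  by the factor 2^(-n); only 0 satisfies both.\<close>

lemma backward_vanish:
  fixes f :: "int \<Rightarrow> complex"
  assumes K: "\<And>x. cmod (f x) \<le> K * 2 powi x" and rec: "\<And>x. x \<le> L \<Longrightarrow> f (x - 1) = c * f x"
    and c: "1 \<le> cmod c" and x: "x \<le> L"
  shows "f x = 0"
proof -
  have n: "f (x - int n) = c ^ n * f x" for n
  proof (induction n)
    case (Suc n)
    have "f (x - int (Suc n)) = f ((x - int n) - 1)" by (simp add: algebra_simps)
    also have "\<dots> = c * f (x - int n)" using x by (intro rec) auto
    finally show ?case using Suc by simp
  qed simp
  have "cmod (f x) \<le> K * 2 powi x * (1 / 2) ^ n" for n
  proof -
    have "cmod (f x) * 1 \<le> cmod (f x) * cmod c ^ n"
      by (intro mult_left_mono one_le_power c) auto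
    also have "\<dots> = cmod (f (x - int n))" by (simp add: n norm_mult norm_power)
    also have "\<dots> \<le> K * 2 powi (x - int n)" by (rule K)
    also have "\<dots> = K * 2 powi x * (1 / 2) ^ n" by (simp add: power_int_diff power_divide)
    finally show ?thesis by simp
  qed
  moreover have "(\<lambda>n. K * 2 powi x * (1 / 2) ^ n) \<longlonglongrightarrow> K * 2 powi x * 0"
    by (intro tendsto_intros LIMSEQ_power_zero) auto
  ultimately have "cmod (f x) \<le> K * 2 powi x * 0"
    by (intro tendsto_lowerbound[of "\<lambda>n. K * 2 powi x * (1 / 2) ^ n" _ sequentially]) auto
  then show ?thesis by simp
qed

text \<open>The class in which sums from minus infinity make sense. It is closed under division by
  \<open>- z\<close>, which is summation from below, under convolution with the weights, and under
  truncation.\<close>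

definition low_vanish :: "(complex \<Rightarrow> complex) \<Rightarrow> bool" where
  "low_vanish \<Psi> \<longleftrightarrow> \<Psi> holomorphic_on Om \<and> (\<exists>L. \<forall>x<L. seq \<Psi> x = 0)"

lemma seq_shift: "seq (\<lambda>z. \<Psi> z * (1 - z) powi k) x = seq \<Psi> (x + k)"
  unfolding seq_def
proof (rule oint_cong)
  fix z assume "cmod (z - 1) = 2"
  then have "1 - z \<noteq> 0" by auto
  then show "\<Psi> z * (1 - z) powi k * (1 - z) powi x = \<Psi> z * (1 - z) powi (x + k)"
    by (simp add: power_int_add mult_ac)
qed simp

lemma seq_step: 
  assumes "\<Psi> holomorphic_on Om"
  shows "seq (\<lambda>z. - z * \<Psi> z) x = seq \<Psi> (x + 1) - seq \<Psi> x"
proof -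
  have "seq (\<lambda>z. - z * \<Psi> z) x = seq (\<lambda>z. \<Psi> z * (1 - z) powi 1 - \<Psi> z) x"
    by (rule seq_cong) (simp add: algebra_simps)
  also have "\<dots> = seq (\<lambda>z. \<Psi> z * (1 - z) powi 1) x - seq \<Psi> x"
    by (intro seq_diff holomorphic_intros assms powi_hol_Om)
  finally show ?thesis by (simp only: seq_shift)
qed

lemma low_vanish_add: assumes "low_vanish f" "low_vanish g" shows "low_vanish (\<lambda>z. f z + g z)"
proof -
  obtain L where L: "f holomorphic_on Om" "\<forall>x<L. seq f x = 0" using assms(1) unfolding low_vanish_def by blast
  obtain L' where L': "g holomorphic_on Om" "\<forall>x<L'. seq g x = 0" using assms(2) unfolding low_vanish_def by blast
  have "(\<lambda>z. f z + g z) holomorphic_on Om" by (intro holomorphic_intros L L')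
  moreover have "\<forall>x<min L L'. seq (\<lambda>z. f z + g z) x = 0" by (simp add: seq_add[OF L(1) L'(1)] L L')
  ultimately show ?thesis unfolding low_vanish_def by blast
qed

lemma low_vanish_cmul: assumes "low_vanish f" shows "low_vanish (\<lambda>z. c * f z)"
proof -
  obtain L where L: "f holomorphic_on Om" "\<forall>x<L. seq f x = 0" using assms unfolding low_vanish_def by blast
  have "(\<lambda>z. c * f z) holomorphic_on Om" by (intro holomorphic_intros L)
  moreover have "\<forall>x<L. seq (\<lambda>z. c * f z) x = 0" by (simp add: seq_cmul L(2))
  ultimately show ?thesis unfolding low_vanish_def by blast
qed

lemma low_vanish_diff: "low_vanish f \<Longrightarrow> low_vanish g \<Longrightarrow> low_vanish (\<lambda>z. f z - g z)"
  using low_vanish_add[of f "\<lambda>z. -1 * g z"] low_vanish_cmul[of g "-1"] by simp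

lemma low_vanish_cong:
  assumes "\<And>z. z \<in> Om \<Longrightarrow> f z = g z" "low_vanish f" shows "low_vanish g"
proof -
  have "seq g x = seq f x" for x by (rule seq_cong) (simp add: assms(1))
  moreover have "g holomorphic_on Om"
    by (rule holomorphic_transform[of f]) (use assms in \<open>simp_all add: low_vanish_def\<close>)
  ultimately show ?thesis using assms(2) by (simp add: low_vanish_def)
qed

lemma low_vanish_z: assumes "low_vanish \<Psi>" shows "low_vanish (\<lambda>z. - z * \<Psi> z)"
proof -
  obtain L where L: "\<Psi> holomorphic_on Om" "\<forall>x<L. seq \<Psi> x = 0" using assms unfolding low_vanish_def by blast
  have "(\<lambda>z. - z * \<Psi> z) holomorphic_on Om" by (intro holomorphic_intros L)
  moreover have "\<forall>x<L - 1. seq (\<lambda>z. - z * \<Psi> z) x = 0" using L(2) by (simp only: seq_step[OF L(1)]) simp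
  ultimately show ?thesis unfolding low_vanish_def by blast
qed

text \<open>Below \<open>L\<close> the new sequence has zero differences, so it is constant there,
  and \<open>backward_vanish\<close> with factor 1 makes the constant 0.\<close>

lemma low_vanish_zinv:
  assumes "low_vanish \<Psi>" shows "low_vanish (\<lambda>z. inverse (- z) * \<Psi> z)"
proof -
  obtain L where L: "\<Psi> holomorphic_on Om" "\<forall>x<L. seq \<Psi> x = 0" using assms unfolding low_vanish_def by blast
  let ?g = "\<lambda>z. inverse (- z) * \<Psi> z"
  have hol: "?g holomorphic_on Om" by (intro holomorphic_intros L) (auto simp: Om_def)
  have step: "seq \<Psi> x = seq ?g (x + 1) - seq ?g x" for x
    unfolding seq_step[OF hol, symmetric] by (rule seq_cong) (auto simp: Om_def)
  obtain K where K: "\<And>x. cmod (seq ?g x) \<le> K * 2 powi x" using seq_bound[OF hol] by metis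
  have "seq ?g x = 0" if "x < L" for x
  proof (rule backward_vanish[OF K, of L 1])
    show "seq ?g (x - 1) = 1 * seq ?g x" if "x \<le> L" for x
      using step[of "x - 1"] L(2) that by simp
  qed (use that in auto)
  with hol show ?thesis unfolding low_vanish_def by blast
qed

lemma low_vanish_zpow: assumes "low_vanish \<Psi>" shows "low_vanish (\<lambda>z. (- z) powi k * \<Psi> z)"
proof -
  have p: "low_vanish (\<lambda>z. (- z) powi (int n) * \<Psi> z)" for n
  proof (induction n)
    case (Suc n)
    have "(- z) powi int (Suc n) = - z * (- z) powi int n" for z :: complex
      unfolding power_int_of_nat by simp
    then show ?case by (intro low_vanish_cong[OF _ low_vanish_z[OF Suc]]) (simp add: Om_def)
  qed (use assms in simp)
  have m: "low_vanish (\<lambda>z. (- z) powi (- int n) * \<Psi> z)" for n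
  proof (induction n)
    case (Suc n)
    have "(- z) powi (- int (Suc n)) = inverse (- z) * (- z) powi (- int n)" for z :: complex
      unfolding power_int_minus power_int_of_nat by simp
    then show ?case by (intro low_vanish_cong[OF _ low_vanish_zinv[OF Suc]]) (simp add: Om_def)
  qed (use assms in simp)
  show ?thesis by (cases k) (use p m in blast)+
qed

text \<open>The generating function of the geometric law: the series of (1 - q) q^k (1 - z)^(-k)
  over k >= 0, which converges for |z - 1| > q.\<close>

definition step_factor :: "complex \<Rightarrow> complex" where
  "step_factor z = (1 - z) / (1 - z / of_real (1 - q))"

lemma step_factor_denom: "z \<in> Ex \<Longrightarrow> 1 - z / of_real (1 - q) \<noteq> 0"
proof
  assume "z \<in> Ex" "1 - z / of_real (1 - q) = 0"
  then have "z = of_real (1 - q)" using q1 by (simp add: field_simps flip: of_real_diff)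
  then have "z - 1 = of_real (- q)" by simp
  then have "cmod (z - 1) = q" using q0 by (simp only: norm_of_real)
  with \<open>z \<in> Ex\<close> show False by (simp add: Ex_def)
qed

lemma step_factor_hol: "step_factor holomorphic_on Om"
  unfolding step_factor_def[abs_def] using Om_Ex step_factor_denom by (intro holomorphic_intros) (use q1 in auto)

text \<open>The convolution is used only through this first-order recursion, so that no infinite sum
  occurs.\<close>

lemma seq_step_factor:
  assumes "\<Psi> holomorphic_on Om"
  shows "seq (\<lambda>z. step_factor z * \<Psi> z) x - of_real q * seq (\<lambda>z. step_factor z * \<Psi> z) (x - 1) = of_real (1 - q) * seq \<Psi> x"
proof -
  let ?g = "\<lambda>z. step_factor z * \<Psi> z"
  have hol: "?g holomorphic_on Om" by (intro holomorphic_intros assms step_factor_hol)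
  have sh: "seq ?g (x - 1) = seq (\<lambda>z. ?g z * (1 - z) powi (-1)) x" by (simp only: seq_shift) simp
  have "seq ?g x - of_real q * seq ?g (x - 1) = seq (\<lambda>z. ?g z - of_real q * (?g z * (1 - z) powi (-1))) x"
    unfolding sh seq_cmul[symmetric]
    by (intro seq_diff[symmetric] holomorphic_intros hol powi_hol_Om)
  also have "\<dots> = seq (\<lambda>z. of_real (1 - q) * \<Psi> z) x"
  proof (rule seq_cong)
    fix z assume z: "z \<in> Om"
    then have nz: "1 - z \<noteq> 0" "1 - z / of_real (1 - q) \<noteq> 0" using q0 step_factor_denom Om_Ex by (auto simp: Om_def)
    have q: "of_real (1 - q) \<noteq> (0::complex)" using q1 by simp
    have e: "(1 - z) - of_real q = of_real (1 - q) * (1 - z / of_real (1 - q))"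
      using q by (simp add: right_diff_distrib)
    have "step_factor z * (1 - of_real q * (1 - z) powi (-1)) =
        ((1 - z) * (1 - of_real q * inverse (1 - z))) / (1 - z / of_real (1 - q))"
      by (simp add: step_factor_def power_int_minus)
    also have "(1 - z) * (1 - of_real q * inverse (1 - z)) = of_real (1 - q) * (1 - z / of_real (1 - q))"
      unfolding e[symmetric] right_diff_distrib mult.left_commute[of "1 - z"] using nz(1) q by simp
    also have "\<dots> / (1 - z / of_real (1 - q)) = of_real (1 - q)"
      using nz(2) by (rule nonzero_mult_div_cancel_right)
    finally have "step_factor z * (1 - of_real q * (1 - z) powi (-1)) = of_real (1 - q)" .
    then show "?g z - of_real q * (?g z * (1 - z) powi (-1)) = of_real (1 - q) * \<Psi> z"
      by (metis (no_types, lifting) mult.assoc mult.commute mult.right_neutral right_diff_distrib)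
  qed
  finally show ?thesis by (simp only: seq_cmul)
qed

text \<open>Far below, the recursion of \<open>seq_step_factor\<close> is homogeneous and multiplies
  by 1/q > 1 on the way down, against the bound 2^x.\<close>

lemma low_vanish_step_factor:
  assumes "low_vanish \<Psi>" shows "low_vanish (\<lambda>z. step_factor z * \<Psi> z)"
proof -
  obtain L where L: "\<Psi> holomorphic_on Om" "\<forall>x<L. seq \<Psi> x = 0" using assms unfolding low_vanish_def by blast
  let ?g = "\<lambda>z. step_factor z * \<Psi> z"
  have hol: "?g holomorphic_on Om" by (intro holomorphic_intros L step_factor_hol)
  obtain K where K: "\<And>x. cmod (seq ?g x) \<le> K * 2 powi x" using seq_bound[OF hol] by metis
  have "seq ?g x = 0" if "x < L" for x
  proof (rule backward_vanish[OF K, of "L - 1" "inverse (of_real q)"])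
    show "seq ?g (x - 1) = inverse (of_real q) * seq ?g x" if "x \<le> L - 1" for x
      using seq_step_factor[OF L(1), of x] L(2) that q0 by (simp add: field_simps)
    show "1 \<le> cmod (inverse (of_real q))" using q0 q1 by (simp add: norm_inverse one_le_inverse)
  qed (use that in auto)
  with hol show ?thesis unfolding low_vanish_def by blast
qed

text \<open>The Cauchy kernel acts as the indicator of nonnegative exponents: for a negative one the
  integrand has no singularity outside the contour and is O(1/z^2) at infinity.\<close>

lemma oint_powi_kernel:
  assumes "1 < cmod (w - 1)" "cmod (w - 1) < \<rho>"
  shows "oint 1 \<rho> (\<lambda>z. (1 - z) powi k / (z - w)) = (if 0 \<le> k then (1 - w) powi k else 0)"
proof (cases "0 \<le> k")
  case True
  have "(\<lambda>z. (1 - z) powi k) holomorphic_on ball 1 (\<rho> + 1)"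
    by (intro holomorphic_on_power_int holomorphic_intros disjI1 True)
  then have "oint 1 \<rho> (\<lambda>z. (1 - z) powi k / (z - w)) = (1 - w) powi k"
    by (rule oint_Cauchy) (use assms in auto)
  with True show ?thesis by simp
next
  case False
  have "oint 1 \<rho> (\<lambda>z. (1 - z) powi k / (z - w)) = 0"
  proof (rule oint_decay[of _ "cmod (w - 1)" _ _ "2 * cmod (w - 1)" 2])
    show "(\<lambda>z. (1 - z) powi k / (z - w)) holomorphic_on {z. cmod (w - 1) < cmod (z - 1)}"
    proof (intro holomorphic_on_divide holomorphic_on_power_int holomorphic_intros disjI2 ballI)
      fix z assume z: "z \<in> {z. cmod (w - 1) < cmod (z - 1)}"
      show "1 - z \<noteq> 0" using z assms by auto
      show "z - w \<noteq> 0" using z by auto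
    qed
    fix z assume z: "2 * cmod (w - 1) \<le> cmod (z - 1)"
    have "cmod (z - 1) \<le> cmod (z - w) + cmod (w - 1)" using norm_triangle_ineq[of "z - w" "w - 1"] by simp
    then have *: "cmod (z - 1) / 2 \<le> cmod (z - w)" using z by simp
    have c: "cmod (1 - z) = cmod (z - 1)" by (rule norm_minus_commute)
    have v: "1 \<le> cmod (z - 1)" using z assms by linarith
    have "cmod ((1 - z) powi k) \<le> cmod (z - 1) powi (-1)"
      unfolding norm_power_int c by (rule power_int_increasing) (use v False in simp_all)
    then have "cmod ((1 - z) powi k) \<le> 1 / cmod (z - 1)" by (simp add: power_int_minus divide_inverse)
    then have "cmod ((1 - z) powi k / (z - w)) \<le> (1 / cmod (z - 1)) / (cmod (z - 1) / 2)"
      unfolding norm_divide using * v by (intro frac_le) auto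
    then show "cmod ((1 - z) powi k / (z - w)) \<le> 2 / (cmod (z - 1))\<^sup>2"
      by (simp add: power2_eq_square)
  qed (use assms in auto)
  with False show ?thesis by simp
qed

text \<open>The power \<open>b\<close> of 1 - w moves the cut to 0. On the circle of radius 2 the
  two principal parts together are a Cauchy integral over the circle of radius 3/2; after the
  integrals are exchanged, \<open>oint_powi_kernel\<close> keeps exactly the exponents with
  \<open>x - b\<close> nonnegative.\<close>

lemma seq_trunc:
  fixes b :: int and \<Psi> :: "complex \<Rightarrow> complex"
  assumes \<Psi>: "\<Psi> holomorphic_on Om"
  defines "u \<equiv> \<lambda>w. (1 - w) powi b * \<Psi> w"
  shows "seq (\<lambda>z. (1 - z) powi (- b) * (P1 u z + P0 u z)) x = (if b \<le> x then seq \<Psi> x else 0)"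
proof -
  have u: "u holomorphic_on Om" unfolding u_def by (intro holomorphic_intros \<Psi> powi_hol_Om)
  have "seq (\<lambda>z. (1 - z) powi (- b) * (P1 u z + P0 u z)) x =
     oint 1 2 (\<lambda>z. oint 1 (3/2) (\<lambda>w. (1 - z) powi (x - b) * (u w / (z - w))))"
    unfolding seq_def oint_cmul
  proof (rule oint_cong)
    fix z assume z: "cmod (z - 1) = 2"
    then have "1 - z \<noteq> 0" by auto
    then show "(1 - z) powi (- b) * (P1 u z + P0 u z) * (1 - z) powi x =
        (1 - z) powi (x - b) * oint 1 (3/2) (\<lambda>w. u w / (z - w))"
      by (subst big_prin[OF u]) (use z in \<open>auto simp: power_int_diff power_int_minus field_simps\<close>)
  qed simp
  also have "\<dots> = oint 1 (3/2) (\<lambda>w. oint 1 2 (\<lambda>z. (1 - z) powi (x - b) * (u w / (z - w))))"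
  proof (rule oint_swap)
    have "continuous_on (sphere 1 (3/2)) u" using q1 by (intro sphere_Om u) auto
    then have "continuous_on (sphere 1 2 \<times> sphere 1 (3/2)) (\<lambda>x. u (snd x))"
      by (rule continuous_on_compose2) (auto intro!: continuous_intros)
    then show "continuous_on (sphere 1 2 \<times> sphere 1 (3/2)) (\<lambda>(z, w). (1 - z) powi (x - b) * (u w / (z - w)))"
      unfolding case_prod_beta by (intro continuous_intros) auto
  qed auto
  also have "\<dots> = oint 1 (3/2) (\<lambda>w. if b \<le> x then \<Psi> w * (1 - w) powi x else 0)"
  proof (rule oint_cong)
    fix w assume w: "cmod (w - 1) = 3 / 2"
    then have nz: "1 - w \<noteq> 0" by auto
    have "oint 1 2 (\<lambda>z. u w * ((1 - z) powi (x - b) / (z - w))) = u w * (if 0 \<le> x - b then (1 - w) powi (x - b) else 0)"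
      by (subst oint_cmul, subst oint_powi_kernel) (use w in auto)
    then show "oint 1 2 (\<lambda>z. (1 - z) powi (x - b) * (u w / (z - w))) = (if b \<le> x then \<Psi> w * (1 - w) powi x else 0)"
      using nz by (simp add: u_def power_int_diff mult_ac)
  qed simp
  also have "\<dots> = (if b \<le> x then seq \<Psi> x else 0)"
  proof (cases "b \<le> x")
    case True
    have "oint 1 (3/2) (\<lambda>w. \<Psi> w * (1 - w) powi x) = oint 1 2 (\<lambda>w. \<Psi> w * (1 - w) powi x)"
      by (rule oint_radius[of _ 1 1 3]) (auto intro!: hol_big holomorphic_intros \<Psi> powi_hol_Om)
    with True show ?thesis by (simp add: seq_def)
  qed simp
  finally show ?thesis .
qed

lemma low_vanish_trunc:
  assumes "low_vanish \<Psi>"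
  shows "low_vanish (\<lambda>z. (1 - z) powi (- b) * (P1 (\<lambda>w. (1 - w) powi b * \<Psi> w) z + P0 (\<lambda>w. (1 - w) powi b * \<Psi> w) z))"
proof -
  obtain L where L: "\<Psi> holomorphic_on Om" "\<forall>x<L. seq \<Psi> x = 0" using assms unfolding low_vanish_def by blast
  have u: "(\<lambda>w. (1 - w) powi b * \<Psi> w) holomorphic_on Om" by (intro holomorphic_intros L powi_hol_Om)
  show ?thesis unfolding low_vanish_def seq_trunc[OF L(1)]
    by (intro conjI holomorphic_intros powi_hol_Om P1_hol P0_hol u exI[of _ L]) (use L(2) in auto)
qed

lemma tseq_step:
  assumes "low_vanish \<Psi>" shows "tseq \<Psi> (k + 1) x = tseq \<Psi> k (x + 1) - tseq \<Psi> k x"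
proof -
  have hol: "(\<lambda>z. (- z) powi k * \<Psi> z) holomorphic_on Om"
    using assms by (intro holomorphic_intros powi_hol_Om) (simp add: low_vanish_def)
  show ?thesis unfolding tseq_def seq_step[OF hol, symmetric]
    by (rule seq_cong) (auto simp: Om_def power_int_add)
qed

lemma tseq_bounded_below: "low_vanish \<Psi> \<Longrightarrow> \<exists>L. \<forall>x<L. tseq \<Psi> k x = 0"
  using low_vanish_zpow[of \<Psi> k] unfolding low_vanish_def tseq_def by blast

lemma tseq_step_factor:
  assumes "low_vanish \<Psi>"
  shows "tseq (\<lambda>z. step_factor z * \<Psi> z) k x - of_real q * tseq (\<lambda>z. step_factor z * \<Psi> z) k (x - 1) = of_real (1 - q) * tseq \<Psi> k x"
proof -
  have hol: "(\<lambda>z. (- z) powi k * \<Psi> z) holomorphic_on Om"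
    using assms by (intro holomorphic_intros powi_hol_Om) (simp add: low_vanish_def)
  show ?thesis using seq_step_factor[OF hol, of x] unfolding tseq_def by (simp only: mult.left_commute)
qed

end

section \<open>Determinants along one step of the growth process\<close>

definition rdet :: "nat \<Rightarrow> (nat \<Rightarrow> nat \<Rightarrow> complex) \<Rightarrow> complex" where
  "rdet N r = Determinant.det (Matrix.mat N N (\<lambda>(i, j). r i j))"

lemma rdet_cong: "(\<And>i j. i < N \<Longrightarrow> j < N \<Longrightarrow> r i j = r' i j) \<Longrightarrow> rdet N r = rdet N r'"
  unfolding rdet_def by (rule arg_cong[of _ _ Determinant.det]) auto

lemma rdet_expand:
  "rdet N r = (\<Sum>p | p permutes {0..<N}. signof p * (\<Prod>i = 0..<N. r i (p i)))"
  unfolding rdet_def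
proof (subst det_def'[of _ N])
  show "(\<Sum>p | p permutes {0..<N}. signof p * (\<Prod>i = 0..<N. Matrix.mat N N (\<lambda>(i, j). r i j) $$ (i, p i))) =
    (\<Sum>p | p permutes {0..<N}. signof p * (\<Prod>i = 0..<N. r i (p i)))"
  proof (intro sum.cong refl arg_cong2[of _ _ _ _ "(*)"] prod.cong)
    fix p i assume "p \<in> {p. p permutes {0..<N}}" "i \<in> {0..<N}"
    then have "p i < N" "i < N" using permutes_in_image[of p "{0..<N}" i] by auto
    then show "Matrix.mat N N (\<lambda>(i, j). r i j) $$ (i, p i) = r i (p i)" by simp
  qed
qed simp

lemma rdet_expand_row:
  assumes "k < N"
  shows "rdet N (r(k := v)) = (\<Sum>p | p permutes {0..<N}. v (p k) * (signof p * (\<Prod>i\<in>{0..<N} - {k}. r i (p i))))"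
  unfolding rdet_expand
proof (rule sum.cong)
  fix p assume "p \<in> {p. p permutes {0..<N}}"
  have "(\<Prod>i = 0..<N. (r(k := v)) i (p i)) = v (p k) * (\<Prod>i\<in>{0..<N} - {k}. (r(k := v)) i (p i))"
    using assms by (subst prod.remove[of _ k]) auto
  also have "(\<Prod>i\<in>{0..<N} - {k}. (r(k := v)) i (p i)) = (\<Prod>i\<in>{0..<N} - {k}. r i (p i))"
    by (rule prod.cong) auto
  finally show "signof p * (\<Prod>i = 0..<N. (r(k := v)) i (p i)) = v (p k) * (signof p * (\<Prod>i\<in>{0..<N} - {k}. r i (p i)))"
    by simp
qed simp

lemma rdet_row_sum:
  assumes "k < N"
  shows "(\<Sum>x\<in>A. c x * rdet N (r(k := v x))) = rdet N (r(k := (\<lambda>i. \<Sum>x\<in>A. c x * v x i)))"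
  unfolding rdet_expand_row[OF assms] sum_distrib_left sum_distrib_right
  by (subst sum.swap) (simp add: mult_ac)

lemma rdet_row_add:
  assumes "k < N"
  shows "rdet N (r(k := (\<lambda>i. u i + v i))) = rdet N (r(k := u)) + rdet N (r(k := v))"
  unfolding rdet_expand_row[OF assms] by (simp add: distrib_right sum.distrib)

lemma rdet_row_scale:
  assumes "k < N"
  shows "rdet N (r(k := (\<lambda>i. a * v i))) = a * rdet N (r(k := v))"
  unfolding rdet_expand_row[OF assms] by (simp add: sum_distrib_left mult_ac)

lemma rdet_eq_rows:
  assumes "k < N" "l < N" "k \<noteq> l" "\<And>i. i < N \<Longrightarrow> r k i = r l i"
  shows "rdet N r = 0"
  unfolding rdet_def
  by (rule det_identical_rows[of _ N k l]) (use assms in \<open>auto intro!: eq_vecI simp: row_def\<close>)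

lemma rdet_row_add_multiple:
  assumes "k < N" "l < N" "k \<noteq> l" "\<And>i. i < N \<Longrightarrow> r k i = u i + a * r l i"
  shows "rdet N r = rdet N (r(k := u))"
proof -
  have "rdet N r = rdet N (r(k := (\<lambda>i. u i + a * r l i)))"
    by (rule rdet_cong) (use assms in auto)
  also have "\<dots> = rdet N (r(k := u)) + a * rdet N (r(k := r l))"
    by (simp only: rdet_row_add[OF assms(1)] rdet_row_scale[OF assms(1)])
  also have "rdet N (r(k := r l)) = 0"
    by (rule rdet_eq_rows[of k _ l]) (use assms in auto)
  finally show ?thesis by (simp only: mult_zero_right add_0_right)
qed

lemma rdet_upper:
  assumes "\<And>i j. i < N \<Longrightarrow> j < i \<Longrightarrow> r i j = 0"
  shows "rdet N r = (\<Prod>i<N. r i i)"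
proof -
  have "upper_triangular (Matrix.mat N N (\<lambda>(i, j). r i j))"
    by (rule upper_triangularI) (use assms in auto)
  then show ?thesis unfolding rdet_def
    by (subst det_upper_triangular[of _ N])
       (auto simp: diag_mat_def lessThan_atLeast0 prod.distinct_set_conv_list[symmetric] intro!: prod.cong)
qed

lemma rdet_mult:
  "rdet N (\<lambda>i j. \<Sum>k<N. r i k * s k j) = rdet N r * rdet N s"
proof -
  have "Matrix.mat N N (\<lambda>(i, j). \<Sum>k<N. r i k * s k j) =
      Matrix.mat N N (\<lambda>(i, j). r i j) * Matrix.mat N N (\<lambda>(i, j). s i j)"
    by (rule eq_matI) (auto simp: scalar_prod_def lessThan_atLeast0 intro!: sum.cong)
  then show ?thesis unfolding rdet_def by (simp add: det_mult[of _ N])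
qed

lemma rdet_transpose: "rdet N (\<lambda>i j. r j i) = rdet N r"
proof -
  have "Matrix.mat N N (\<lambda>(i, j). r j i) = transpose_mat (Matrix.mat N N (\<lambda>(i, j). r i j))"
    by (rule eq_matI) auto
  then show ?thesis unfolding rdet_def by (simp add: det_transpose[of _ N])
qed

lemma rdet_holomorphic:
  assumes "\<And>i j. i < N \<Longrightarrow> j < N \<Longrightarrow> (\<lambda>z. r z i j) holomorphic_on S"
  shows "(\<lambda>z. rdet N (r z)) holomorphic_on S"
proof -
  have "(\<lambda>z. \<Sum>p | p permutes {0..<N}. signof p * (\<Prod>i = 0..<N. r z i (p i))) holomorphic_on S"
  proof (intro holomorphic_intros)
    fix p i assume "p \<in> {p. p permutes {0..<N}}" "i \<in> {0..<N}"
    then have "p i < N" "i < N" using permutes_in_image[of p "{0..<N}" i] by auto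
    then show "(\<lambda>z. r z i (p i)) holomorphic_on S" by (intro assms)
  qed
  then show ?thesis by (simp only: rdet_expand)
qed

section \<open>Convolution with the geometric weights\<close>

definition weight :: "real \<Rightarrow> int \<Rightarrow> complex" where
  "weight q k = (if 0 \<le> k then of_real ((1 - q) * q ^ nat k) else 0)"

lemma weight_Suc: "0 \<le> k \<Longrightarrow> weight q (k + 1) = of_real q * weight q k"
  by (simp add: weight_def nat_add_distrib)

lemma sum_int_Suc: "l \<le> u + 1 \<Longrightarrow> (\<Sum>t\<in>{l..u + 1}. f t) = (\<Sum>t\<in>{l..u}. f t) + f (u + 1 :: int)"
  for f :: "int \<Rightarrow> 'b :: comm_monoid_add"
proof -
  assume "l \<le> u + 1"
  then have "{l..u + 1} = insert (u + 1) {l..u}" by auto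
  then show ?thesis by (simp add: add.commute)
qed

lemma sum_telescope:
  fixes f :: "int \<Rightarrow> complex"
  assumes "\<And>t. f' t = f (t + 1) - f t" "l \<le> u + 1"
  shows "(\<Sum>t\<in>{l..u}. f' t) = f (u + 1) - f l"
proof -
  have n: "(\<Sum>t\<in>{l..l - 1 + int n}. f' t) = f (l + int n) - f l" for n
  proof (induction n)
    case (Suc n)
    have "l - 1 + int (Suc n) = (l - 1 + int n) + 1" by simp
    then have "(\<Sum>t\<in>{l..l - 1 + int (Suc n)}. f' t) = (\<Sum>t\<in>{l..l - 1 + int n}. f' t) + f' (l - 1 + int n + 1)"
      by (simp only:) (rule sum_int_Suc, simp)
    also have "l - 1 + int n + 1 = l + int n" by simp
    also have "f' (l + int n) = f (l + int (Suc n)) - f (l + int n)"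
      unfolding assms(1) by (simp add: ac_simps)
    finally show ?case using Suc by simp
  qed simp
  have "u = l - 1 + int (nat (u + 1 - l))" "u + 1 = l + int (nat (u + 1 - l))" using assms(2) by simp_all
  with n[of "nat (u + 1 - l)"] show ?thesis by metis
qed

text \<open>Read \<open>g\<close> as the convolution of \<open>f\<close> from minus infinity. Since
  the weights are geometric, the part of it up to \<open>b\<close> is its value at \<open>b\<close>
  times a power of \<open>q\<close>.\<close>

lemma weight_sum:
  assumes "\<And>x. g x - of_real q * g (x - 1) = of_real (1 - q) * f x" "b \<le> y"
  shows "(\<Sum>t\<in>{b + 1..y}. weight q (y - t) * f t) = g y - of_real q ^ nat (y - b) * g b"
  using assms(2)
proof (induction y rule: int_ge_induct)
  case (step i)
  have "(\<Sum>t\<in>{b + 1..i + 1}. weight q (i + 1 - t) * f t) =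
      (\<Sum>t\<in>{b + 1..i}. weight q (i + 1 - t) * f t) + weight q 0 * f (i + 1)"
    using step by (subst sum_int_Suc) auto
  also have "(\<Sum>t\<in>{b + 1..i}. weight q (i + 1 - t) * f t) = (\<Sum>t\<in>{b + 1..i}. of_real q * (weight q (i - t) * f t))"
    by (rule sum.cong) (auto simp: weight_Suc[symmetric] algebra_simps)
  also have "\<dots> = of_real q * (g i - of_real q ^ nat (i - b) * g b)"
    by (simp only: sum_distrib_left[symmetric] step)
  also have "weight q 0 * f (i + 1) = g (i + 1) - of_real q * g i"
    using assms(1)[of "i + 1"] by (simp add: weight_def)
  also have "nat (i + 1 - b) = Suc (nat (i - b))" using step by simp
  ultimately show ?case by (simp add: algebra_simps)
qed simp

text \<open>For \<open>t\<close> up to \<open>b\<close> the weight is constant and the sum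
  telescopes; above \<open>b\<close> it is a convolution. The two correction terms involve
  \<open>g\<close> and \<open>f\<close> of one order less, which will be the entries of the
  preceding row after and before the step.\<close>

lemma weight_sum_max:
  assumes g: "\<And>x. g x - of_real q * g (x - 1) = of_real (1 - q) * f x"
    and f': "\<And>x. f' x = f (x + 1) - f x" and g': "\<And>x. g' x = g (x + 1) - g x"
    and ab: "l \<le> b" "b \<le> y"
  shows "(\<Sum>t\<in>{l..y}. weight q (y - max t b) * f' t) = g' y + weight q (y - b) * g b - weight q (y - b) * f l"
proof -
  have gf': "g' x - of_real q * g' (x - 1) = of_real (1 - q) * f' x" for x
  proof -
    have "g' x - of_real q * g' (x - 1) = (g (x + 1) - of_real q * g (x + 1 - 1)) - (g x - of_real q * g (x - 1))"
      by (simp add: g' algebra_simps)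
    also have "\<dots> = of_real (1 - q) * f (x + 1) - of_real (1 - q) * f x" by (simp only: g)
    finally show ?thesis by (simp only: f' right_diff_distrib)
  qed
  have "{l..y} = {l..b} \<union> {b + 1..y}" using ab by auto
  then have "(\<Sum>t\<in>{l..y}. weight q (y - max t b) * f' t) =
     (\<Sum>t\<in>{l..b}. weight q (y - max t b) * f' t) + (\<Sum>t\<in>{b + 1..y}. weight q (y - max t b) * f' t)"
    by (simp only:) (rule sum.union_disjoint, auto)
  also have "(\<Sum>t\<in>{l..b}. weight q (y - max t b) * f' t) = (\<Sum>t\<in>{l..b}. weight q (y - b) * f' t)"
    by (rule sum.cong) auto
  also have "\<dots> = weight q (y - b) * (f (b + 1) - f l)"
    using ab by (simp only: sum_distrib_left[symmetric], subst sum_telescope[of f' f l b]) (auto simp: f')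
  also have "(\<Sum>t\<in>{b + 1..y}. weight q (y - max t b) * f' t) = (\<Sum>t\<in>{b + 1..y}. weight q (y - t) * f' t)"
    by (rule sum.cong) auto
  also have "\<dots> = g' y - of_real q ^ nat (y - b) * g' b" using gf' ab(2) by (rule weight_sum[of g' q f' b y])
  finally have e: "(\<Sum>t\<in>{l..y}. weight q (y - max t b) * f' t) =
    weight q (y - b) * (f (b + 1) - f l) + (g' y - of_real q ^ nat (y - b) * g' b)" .
  have "weight q (y - b) = of_real (1 - q) * of_real q ^ nat (y - b)" using ab by (simp add: weight_def)
  then have e1: "weight q (y - b) * f (b + 1) = of_real q ^ nat (y - b) * (g (b + 1) - of_real q * g b)"
    and e2: "weight q (y - b) * g b = of_real q ^ nat (y - b) * (of_real (1 - q) * g b)"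
    using g[of "b + 1"] by (simp_all add: mult_ac)
  have "weight q (y - b) * f (b + 1) - of_real q ^ nat (y - b) * g' b =
      of_real q ^ nat (y - b) * (of_real (1 - q) * g b)"
    unfolding e1 g' by (simp add: algebra_simps)
  then have "weight q (y - b) * f (b + 1) - of_real q ^ nat (y - b) * g' b = weight q (y - b) * g b"
    by (simp only: e2)
  moreover have "weight q (y - b) * (f (b + 1) - f l) + (g' y - of_real q ^ nat (y - b) * g' b) =
      g' y + (weight q (y - b) * f (b + 1) - of_real q ^ nat (y - b) * g' b) - weight q (y - b) * f l"
    by (simp add: algebra_simps)
  ultimately show ?thesis using e by simp
qed

definition incr :: "nat \<Rightarrow> int \<Rightarrow> (nat \<Rightarrow> int) \<Rightarrow> (nat \<Rightarrow> int) set" where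
  "incr n l u = {x \<in> {..<n} \<rightarrow>\<^sub>E UNIV. (\<forall>j<n. l \<le> x j \<and> x j \<le> u j) \<and> (\<forall>j. Suc j < n \<longrightarrow> x j \<le> x (Suc j))}"

lemma finite_incr [simp, intro]: "finite (incr n l u)"
proof (rule finite_subset)
  show "incr n l u \<subseteq> {..<n} \<rightarrow>\<^sub>E (\<Union>j<n. {l..u j})" by (auto simp: incr_def PiE_def Pi_def)
qed (auto intro!: finite_PiE)

lemma incr_0: "incr 0 l u = {\<lambda>_. undefined}"
  by (auto simp: incr_def)

lemma sum_incr_Suc:
  fixes F :: "(nat \<Rightarrow> int) \<Rightarrow> 'b :: comm_monoid_add"
  shows "(\<Sum>x\<in>incr (Suc n) l u. F x) =
    (\<Sum>x\<in>incr n l u. \<Sum>t\<in>{(if n = 0 then l else x (n - 1))..u n}. F (x(n := t)))"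
proof -
  have "(\<Sum>x\<in>incr n l u. \<Sum>t\<in>{(if n = 0 then l else x (n - 1))..u n}. F (x(n := t))) =
    (\<Sum>(x, t)\<in>(SIGMA x:incr n l u. {(if n = 0 then l else x (n - 1))..u n}). F (x(n := t)))"
    by (subst sum.Sigma) auto
  also have "\<dots> = (\<Sum>x\<in>incr (Suc n) l u. F x)"
  proof (rule sum.reindex_bij_witness[where i = "\<lambda>x. (x(n := undefined), x n)" and j = "\<lambda>(x, t). x(n := t)"])
    fix a assume "a \<in> (SIGMA x:incr n l u. {(if n = 0 then l else x (n - 1))..u n})"
    then obtain x t where a: "a = (x, t)" "x \<in> incr n l u" "(if n = 0 then l else x (n - 1)) \<le> t" "t \<le> u n" by auto
    show "(\<lambda>x. (x(n := undefined), x n)) ((\<lambda>(x, t). x(n := t)) a) = a"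
      using a by (auto simp: incr_def fun_eq_iff PiE_def extensional_def)
    have "l \<le> t" using a by (cases n) (auto simp: incr_def split: if_splits intro: order_trans)
    moreover have "x j \<le> (x(n := t)) (Suc j)" if "Suc j < Suc n" for j
      using a that by (cases "Suc j = n") (auto simp: incr_def split: if_splits)
    ultimately show "(\<lambda>(x, t). x(n := t)) a \<in> incr (Suc n) l u"
      using a by (auto simp: incr_def PiE_def extensional_def less_Suc_eq)
  next
    fix x assume x: "x \<in> incr (Suc n) l u"
    then have "(if n = 0 then l else x (n - 1)) \<le> x n" by (cases n) (auto simp: incr_def)
    with x show "(x(n := undefined), x n) \<in> (SIGMA x:incr n l u. {(if n = 0 then l else x (n - 1))..u n})"
      by (auto simp: incr_def PiE_def extensional_def)
  qed auto
  finally show ?thesis by simp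
qed

text \<open>The k-th differences of one sequence, where negative orders are sums from below; the
  vanishing clause fixes the constants of summation.\<close>

definition tower :: "(int \<Rightarrow> int \<Rightarrow> complex) \<Rightarrow> bool" where
  "tower \<phi> \<longleftrightarrow> (\<forall>k x. \<phi> (k + 1) x = \<phi> k (x + 1) - \<phi> k x) \<and> (\<forall>k. \<exists>L. \<forall>x<L. \<phi> k x = 0)"

lemma tower_step: "tower \<phi> \<Longrightarrow> \<phi> (k + 1) x = \<phi> k (x + 1) - \<phi> k x"
  by (simp add: tower_def)

text \<open>With the order one above the row index, summing row \<open>n\<close> from below produces
  the order carried by row \<open>n - 1\<close>.\<close>

definition tower_det :: "nat \<Rightarrow> (nat \<Rightarrow> int \<Rightarrow> int \<Rightarrow> complex) \<Rightarrow> (nat \<Rightarrow> int) \<Rightarrow> complex" where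
  "tower_det N \<phi> x = rdet N (\<lambda>j i. \<phi> i (int j + 1) (x j))"

definition transition :: "real \<Rightarrow> nat \<Rightarrow> (nat \<Rightarrow> int) \<Rightarrow> (nat \<Rightarrow> int) \<Rightarrow> complex" where
  "transition q n x y = (\<Prod>j<n. weight q (y j - (if j = 0 then x 0 else max (x j) (y (j - 1)))))"

lemma weight_sum_0:
  assumes "\<And>x. g x - of_real q * g (x - 1) = of_real (1 - q) * f x"
    and "\<And>x. x < l \<Longrightarrow> f x = 0" "\<And>x. x < l \<Longrightarrow> g x = 0" "l \<le> y"
  shows "(\<Sum>t\<in>{l..y}. weight q (y - t) * f t) = g y"
  using weight_sum[of g q f "l - 1" y] assms by simp

text \<open>The sum over the last coordinate telescopes up to a multiple of the previous row.\<close>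

lemma one_step_partial:
  fixes \<phi> \<gamma> :: "nat \<Rightarrow> int \<Rightarrow> int \<Rightarrow> complex"
  assumes \<phi>: "\<And>i. i < N \<Longrightarrow> tower (\<phi> i)" and \<gamma>: "\<And>i. i < N \<Longrightarrow> tower (\<gamma> i)"
    and W: "\<And>i k x. i < N \<Longrightarrow> \<gamma> i k x - of_real q * \<gamma> i k (x - 1) = of_real (1 - q) * \<phi> i k x"
    and l: "\<And>i x. i < N \<Longrightarrow> x < l \<Longrightarrow> \<phi> i 1 x = 0 \<and> \<gamma> i 1 x = 0"
    and y: "\<And>j. Suc j < N \<Longrightarrow> y j \<le> y (Suc j)" "l \<le> y 0" and "n \<le> N"
  shows "(\<Sum>x\<in>incr n l y. transition q n x y * rdet N (\<lambda>j i. if j < n then \<phi> i (int j + 1) (x j) else c j i)) =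
    rdet N (\<lambda>j i. if j < n then \<gamma> i (int j + 1) (y j) else c j i)"
  using \<open>n \<le> N\<close>
proof (induction n arbitrary: c)
  case 0
  then show ?case by (simp add: incr_0 transition_def)
next
  case (Suc n)
  \<comment> \<open>The sum over the last coordinate without its multiple of row
    \<open>n - 1\<close> of the old determinant. It still contains a multiple of row
    \<open>n - 1\<close> of the new one, which goes away only after the induction hypothesis has
    replaced the other rows. The rows \<open>c\<close> are arbitrary so that \<open>C\<close> can be
    parked there meanwhile.\<close>
  define C where "C i = (if n = 0 then \<gamma> i 1 (y 0) else
     \<gamma> i (int n + 1) (y n) + weight q (y n - y (n - 1)) * \<gamma> i (int n) (y (n - 1)))" for i
  let ?R = "\<lambda>x j i. if j < n then \<phi> i (int j + 1) (x j) else c j i"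
  have inner: "(\<Sum>t\<in>{(if n = 0 then l else x (n - 1))..y n}. transition q (Suc n) (x(n := t)) y *
      rdet N (\<lambda>j i. if j < Suc n then \<phi> i (int j + 1) ((x(n := t)) j) else c j i)) =
    transition q n x y * rdet N (\<lambda>j i. if j < n then \<phi> i (int j + 1) (x j) else (c(n := C)) j i)"
    if x: "x \<in> incr n l y" for x
  proof -
    let ?w = "\<lambda>t. weight q (y n - (if n = 0 then t else max t (y (n - 1))))"
    have K: "transition q (Suc n) (x(n := t)) y = transition q n x y * ?w t" for t
    proof -
      have "(\<Prod>j<n. weight q (y j - (if j = 0 then (x(n := t)) 0 else max ((x(n := t)) j) (y (j - 1))))) =
        (\<Prod>j<n. weight q (y j - (if j = 0 then x 0 else max (x j) (y (j - 1)))))"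
        by (rule prod.cong) auto
      then show ?thesis by (simp add: transition_def)
    qed
    have D: "rdet N (\<lambda>j i. if j < Suc n then \<phi> i (int j + 1) ((x(n := t)) j) else c j i) =
        rdet N ((?R x)(n := (\<lambda>i. \<phi> i (int n + 1) t)))" for t
      by (rule rdet_cong) auto
    have "(\<Sum>t\<in>{(if n = 0 then l else x (n - 1))..y n}. transition q (Suc n) (x(n := t)) y *
        rdet N (\<lambda>j i. if j < Suc n then \<phi> i (int j + 1) ((x(n := t)) j) else c j i)) =
      transition q n x y * (\<Sum>t\<in>{(if n = 0 then l else x (n - 1))..y n}. ?w t * rdet N ((?R x)(n := (\<lambda>i. \<phi> i (int n + 1) t))))"
      unfolding K D sum_distrib_left by (simp only: mult.assoc)
    also have "\<dots> = transition q n x y * rdet N ((?R x)(n := (\<lambda>i. \<Sum>t\<in>{(if n = 0 then l else x (n - 1))..y n}. ?w t * \<phi> i (int n + 1) t)))"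
      using Suc.prems by (subst rdet_row_sum) auto
    also have "rdet N ((?R x)(n := (\<lambda>i. \<Sum>t\<in>{(if n = 0 then l else x (n - 1))..y n}. ?w t * \<phi> i (int n + 1) t))) =
        rdet N ((?R x)(n := C))"
    proof (cases "n = 0")
      case True
      have "(\<Sum>t\<in>{l..y 0}. weight q (y 0 - t) * \<phi> i 1 t) = \<gamma> i 1 (y 0)" if "i < N" for i
        by (rule weight_sum_0[of "\<gamma> i 1" q "\<phi> i 1"]) (use that l y W in auto)
      then show ?thesis using True by (intro rdet_cong) (auto simp: C_def)
    next
      case False
      have xy: "x (n - 1) \<le> y (n - 1)" using x False by (auto simp: incr_def)
      have yy: "y (n - 1) \<le> y n" using y(1)[of "n - 1"] False Suc.prems by auto
      have row: "(\<Sum>t\<in>{x (n - 1)..y n}. ?w t * \<phi> i (int n + 1) t) = C i + (- weight q (y n - y (n - 1))) * \<phi> i (int n) (x (n - 1))"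
        if i: "i < N" for i
        using weight_sum_max[of "\<gamma> i (int n)" q "\<phi> i (int n)" "\<phi> i (int n + 1)" "\<gamma> i (int n + 1)" "x (n - 1)" "y (n - 1)" "y n"]
          W[OF i] tower_step[OF \<phi>[OF i]] tower_step[OF \<gamma>[OF i]] xy yy False
        by (simp add: C_def)
      have "rdet N ((?R x)(n := (\<lambda>i. \<Sum>t\<in>{x (n - 1)..y n}. ?w t * \<phi> i (int n + 1) t))) =
        rdet N (((?R x)(n := (\<lambda>i. \<Sum>t\<in>{x (n - 1)..y n}. ?w t * \<phi> i (int n + 1) t)))(n := C))"
        by (rule rdet_row_add_multiple[of n N "n - 1" _ C "- weight q (y n - y (n - 1))"])
           (use False Suc.prems row in \<open>auto simp: of_nat_diff\<close>)
      then show ?thesis using False by simp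
    qed
    also have "rdet N ((?R x)(n := C)) = rdet N (\<lambda>j i. if j < n then \<phi> i (int j + 1) (x j) else (c(n := C)) j i)"
      by (rule rdet_cong) auto
    finally show ?thesis .
  qed
  have "(\<Sum>x\<in>incr (Suc n) l y. transition q (Suc n) x y * rdet N (\<lambda>j i. if j < Suc n then \<phi> i (int j + 1) (x j) else c j i)) =
    (\<Sum>x\<in>incr n l y. transition q n x y * rdet N (\<lambda>j i. if j < n then \<phi> i (int j + 1) (x j) else (c(n := C)) j i))"
    unfolding sum_incr_Suc by (rule sum.cong[OF refl inner])
  also have "\<dots> = rdet N (\<lambda>j i. if j < n then \<gamma> i (int j + 1) (y j) else (c(n := C)) j i)"
    using Suc by simp
  also have "\<dots> = rdet N (\<lambda>j i. if j < Suc n then \<gamma> i (int j + 1) (y j) else c j i)"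
  proof (cases "n = 0")
    case True
    then show ?thesis by (intro rdet_cong) (auto simp: C_def)
  next
    case False
    have "rdet N (\<lambda>j i. if j < n then \<gamma> i (int j + 1) (y j) else (c(n := C)) j i) =
      rdet N ((\<lambda>j i. if j < n then \<gamma> i (int j + 1) (y j) else (c(n := C)) j i)(n := (\<lambda>i. \<gamma> i (int n + 1) (y n))))"
      by (rule rdet_row_add_multiple[of n N "n - 1" _ _ "weight q (y n - y (n - 1))"])
         (use False Suc.prems in \<open>auto simp: C_def of_nat_diff\<close>)
    also have "\<dots> = rdet N (\<lambda>j i. if j < Suc n then \<gamma> i (int j + 1) (y j) else c j i)"
      by (rule rdet_cong) auto
    finally show ?thesis .
  qed
  finally show ?case .
qed

lemma one_step:
  fixes \<phi> \<gamma> :: "nat \<Rightarrow> int \<Rightarrow> int \<Rightarrow> complex"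
  assumes "\<And>i. i < N \<Longrightarrow> tower (\<phi> i)" "\<And>i. i < N \<Longrightarrow> tower (\<gamma> i)"
    and "\<And>i k x. i < N \<Longrightarrow> \<gamma> i k x - of_real q * \<gamma> i k (x - 1) = of_real (1 - q) * \<phi> i k x"
    and "\<And>i x. i < N \<Longrightarrow> x < l \<Longrightarrow> \<phi> i 1 x = 0 \<and> \<gamma> i 1 x = 0"
    and "\<And>j. Suc j < N \<Longrightarrow> y j \<le> y (Suc j)" "l \<le> y 0"
  shows "(\<Sum>x\<in>incr N l y. transition q N x y * tower_det N \<phi> x) = tower_det N \<gamma> y"
proof -
  have "rdet N (\<lambda>j i. if j < N then f j i else 0) = rdet N f" for f
    by (rule rdet_cong) auto
  then show ?thesis
    using one_step_partial[of N \<phi> \<gamma> q l y N "\<lambda>_ _. 0", OF assms] by (simp add: tower_det_def)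
qed

text \<open>Each sum telescopes between the preceding coordinate and \<open>A\<close>; the value at
  the preceding coordinate is the entry one row up and is removed by a row operation.\<close>

lemma last_sum_partial:
  fixes \<phi> :: "nat \<Rightarrow> int \<Rightarrow> int \<Rightarrow> complex"
  assumes \<phi>: "\<And>i. i < N \<Longrightarrow> tower (\<phi> i)"
    and l: "\<And>i x. i < N \<Longrightarrow> x \<le> l \<Longrightarrow> \<phi> i 0 x = 0" and A: "l \<le> A" and "n \<le> N"
  shows "(\<Sum>x\<in>incr n l (\<lambda>_. A - 1). rdet N (\<lambda>j i. if j < n then \<phi> i (int j + 1) (x j) else c j i)) =
    rdet N (\<lambda>j i. if j < n then \<phi> i (int j) A else c j i)"
  using \<open>n \<le> N\<close>
proof (induction n arbitrary: c)
  case 0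
  then show ?case by (simp add: incr_0)
next
  case (Suc n)
  define C where "C i = \<phi> i (int n) A" for i
  let ?R = "\<lambda>x j i. if j < n then \<phi> i (int j + 1) (x j) else c j i"
  have inner: "(\<Sum>t\<in>{(if n = 0 then l else x (n - 1))..A - 1}.
      rdet N (\<lambda>j i. if j < Suc n then \<phi> i (int j + 1) ((x(n := t)) j) else c j i)) =
    rdet N (\<lambda>j i. if j < n then \<phi> i (int j + 1) (x j) else (c(n := C)) j i)"
    if x: "x \<in> incr n l (\<lambda>_. A - 1)" for x
  proof -
    let ?l = "if n = 0 then l else x (n - 1)"
    have D: "rdet N (\<lambda>j i. if j < Suc n then \<phi> i (int j + 1) ((x(n := t)) j) else c j i) =
        1 * rdet N ((?R x)(n := (\<lambda>i. \<phi> i (int n + 1) t)))" for t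
      by (simp only: mult_1, rule rdet_cong) auto
    have "x (n - 1) \<le> A - 1" if "n \<noteq> 0" using x that by (auto simp: incr_def)
    then have lA: "?l \<le> A - 1 + 1" using A by auto
    have "(\<Sum>t\<in>{?l..A - 1}. rdet N (\<lambda>j i. if j < Suc n then \<phi> i (int j + 1) ((x(n := t)) j) else c j i)) =
      rdet N ((?R x)(n := (\<lambda>i. \<Sum>t\<in>{?l..A - 1}. 1 * \<phi> i (int n + 1) t)))"
      unfolding D using Suc.prems by (subst rdet_row_sum) auto
    also have "\<dots> = rdet N ((?R x)(n := (\<lambda>i. \<phi> i (int n) A - \<phi> i (int n) ?l)))"
    proof (rule rdet_cong)
      fix j i assume "i < N"
      have "(\<Sum>t\<in>{?l..A - 1}. \<phi> i (int n + 1) t) = \<phi> i (int n) (A - 1 + 1) - \<phi> i (int n) ?l"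
        by (rule sum_telescope[OF _ lA]) (rule tower_step[OF \<phi>[OF \<open>i < N\<close>]])
      then show "((?R x)(n := (\<lambda>i. \<Sum>t\<in>{?l..A - 1}. 1 * \<phi> i (int n + 1) t))) j i =
          ((?R x)(n := (\<lambda>i. \<phi> i (int n) A - \<phi> i (int n) ?l))) j i" by simp
    qed
    also have "\<dots> = rdet N ((?R x)(n := C))"
    proof (cases "n = 0")
      case True
      then show ?thesis using l by (intro rdet_cong) (auto simp: C_def)
    next
      case False
      have "rdet N ((?R x)(n := (\<lambda>i. \<phi> i (int n) A - \<phi> i (int n) ?l))) =
        rdet N (((?R x)(n := (\<lambda>i. \<phi> i (int n) A - \<phi> i (int n) ?l)))(n := C))"
        by (rule rdet_row_add_multiple[of n N "n - 1" _ C "-1"])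
           (use False Suc.prems in \<open>auto simp: of_nat_diff C_def\<close>)
      then show ?thesis by simp
    qed
    also have "rdet N ((?R x)(n := C)) = rdet N (\<lambda>j i. if j < n then \<phi> i (int j + 1) (x j) else (c(n := C)) j i)"
      by (rule rdet_cong) auto
    finally show ?thesis .
  qed
  have "(\<Sum>x\<in>incr (Suc n) l (\<lambda>_. A - 1). rdet N (\<lambda>j i. if j < Suc n then \<phi> i (int j + 1) (x j) else c j i)) =
    (\<Sum>x\<in>incr n l (\<lambda>_. A - 1). rdet N (\<lambda>j i. if j < n then \<phi> i (int j + 1) (x j) else (c(n := C)) j i))"
    unfolding sum_incr_Suc by (rule sum.cong[OF refl inner])
  also have "\<dots> = rdet N (\<lambda>j i. if j < n then \<phi> i (int j) A else (c(n := C)) j i)"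
    using Suc by simp
  also have "\<dots> = rdet N (\<lambda>j i. if j < Suc n then \<phi> i (int j) A else c j i)"
    by (rule rdet_cong) (auto simp: C_def less_Suc_eq)
  finally show ?case .
qed

lemma last_sum:
  fixes \<phi> :: "nat \<Rightarrow> int \<Rightarrow> int \<Rightarrow> complex"
  assumes "\<And>i. i < N \<Longrightarrow> tower (\<phi> i)" "\<And>i x. i < N \<Longrightarrow> x \<le> l \<Longrightarrow> \<phi> i 0 x = 0" "l \<le> A"
  shows "(\<Sum>x\<in>incr N l (\<lambda>_. A - 1). tower_det N \<phi> x) = rdet N (\<lambda>j i. \<phi> i (int j) A)"
proof -
  have "rdet N (\<lambda>j i. if j < N then f j i else 0) = rdet N f" for f
    by (rule rdet_cong) auto
  then show ?thesis
    using last_sum_partial[of N \<phi> l A N "\<lambda>_ _. 0", OF assms] by (simp add: tower_det_def)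
qed

section \<open>Supports of differences and the insertion of a constraint\<close>

lemma const_below:
  fixes f :: "int \<Rightarrow> complex"
  assumes "\<And>x. x < a \<Longrightarrow> f (x + 1) = f x" "\<And>x. x < L \<Longrightarrow> f x = 0" "x \<le> a"
  shows "f x = 0"
proof (cases "x < L")
  case False
  then have "L - 1 \<le> x" by simp
  then show ?thesis using assms(3)
  proof (induction x rule: int_ge_induct)
    case base then show ?case using assms(2) by simp
  next
    case (step i) then show ?case using assms(1)[of i] by simp
  qed
qed (use assms in auto)

text \<open>Where a difference vanishes the sequence of one order less is constant, up to and
  including \<open>a\<close>, and it is 0 far below. The end point \<open>a\<close> itself is thus
  gained.\<close>

lemma tower_low:
  assumes "tower \<phi>" "\<And>x. x < a \<Longrightarrow> \<phi> n x = 0" "k < n" "x \<le> a"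
  shows "\<phi> k x = 0"
proof -
  have "k \<le> n - 1" using assms(3) by simp
  then have "\<forall>x\<le>a. \<phi> k x = 0"
  proof (induction k rule: int_le_induct)
    case base
    obtain L where L: "\<And>x. x < L \<Longrightarrow> \<phi> (n - 1) x = 0" using assms(1) unfolding tower_def by blast
    have "\<phi> (n - 1) (x + 1) = \<phi> (n - 1) x" if "x < a" for x
      using tower_step[OF assms(1), of "n - 1" x] assms(2)[OF that] by simp
    then show ?case using const_below[of a "\<phi> (n - 1)" L] L by blast
  next
    case (step i)
    obtain L where L: "\<And>x. x < L \<Longrightarrow> \<phi> (i - 1) x = 0" using assms(1) unfolding tower_def by blast
    have "\<phi> (i - 1) (x + 1) = \<phi> (i - 1) x" if "x < a" for x
      using tower_step[OF assms(1), of "i - 1" x] step that by simp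
    then show ?case using const_below[of a "\<phi> (i - 1)" L] L by blast
  qed
  with assms(4) show ?thesis by simp
qed

lemma tower_high:
  assumes "tower \<phi>" "\<And>x. a \<le> x \<Longrightarrow> \<phi> n x = 0" "n \<le> k" "a \<le> x"
  shows "\<phi> k x = 0"
proof -
  have "\<forall>x\<ge>a. \<phi> k x = 0" using assms(3)
  proof (induction k rule: int_ge_induct)
    case (step i)
    then show ?case using tower_step[OF assms(1), of i] by simp
  qed (use assms in simp)
  with assms(4) show ?thesis by simp
qed

lemma rdet_scale_rows: "rdet N (\<lambda>j i. s j * r j i) = (\<Prod>j<N. s j) * rdet N r"
  unfolding rdet_expand sum_distrib_left
  by (rule sum.cong) (auto simp: prod.distrib lessThan_atLeast0)

lemma rdet_zero_row: "k < N \<Longrightarrow> (\<And>i. i < N \<Longrightarrow> r k i = 0) \<Longrightarrow> rdet N r = 0"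
proof -
  assume k: "k < N" and z: "\<And>i. i < N \<Longrightarrow> r k i = 0"
  have "rdet N r = rdet N (r(k := (\<lambda>i. 0 * r k i)))" by (rule rdet_cong) (use z in auto)
  also have "\<dots> = 0" by (subst rdet_row_scale[OF k]) simp
  finally show ?thesis .
qed

lemma mono_le:
  fixes x :: "nat \<Rightarrow> int"
  assumes "\<And>j. Suc j < N \<Longrightarrow> x j \<le> x (Suc j)" "i \<le> j" "j < N"
  shows "x i \<le> x j"
  using assms(2,3)
proof (induction j rule: dec_induct)
  case (step j)
  then show ?case using assms(1)[of j] by simp
qed simp

text \<open>Row \<open>j\<close> carries order \<open>j + 1\<close>. If
  \<open>x (n - 1) < a\<close>, the first \<open>n\<close> rows see only \<alpha>, and the
  determinant is \<theta>^n times a polynomial, which the Cauchy formula evaluates at 1. Otherwise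
  the rows from \<open>n - 1\<close> on see only \<beta>, at most n - 1 powers of \<theta> arise,
  and the integrand is O(1/\<theta>^2) at infinity.\<close>

lemma theta_integral:
  fixes \<phi> \<alpha> \<beta> :: "nat \<Rightarrow> int \<Rightarrow> int \<Rightarrow> complex"
  assumes \<alpha>: "\<And>i. i < N \<Longrightarrow> tower (\<alpha> i)" and \<beta>: "\<And>i. i < N \<Longrightarrow> tower (\<beta> i)"
    and sum: "\<And>i k x. i < N \<Longrightarrow> \<phi> i k x = \<alpha> i k x + \<beta> i k x"
    and \<beta>0: "\<And>i x. i < N \<Longrightarrow> x < a \<Longrightarrow> \<beta> i (int n) x = 0"
    and \<alpha>0: "\<And>i x. i < N \<Longrightarrow> a \<le> x \<Longrightarrow> \<alpha> i (int n) x = 0"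
    and n: "1 \<le> n" "n \<le> N" and x: "\<And>j. Suc j < N \<Longrightarrow> x j \<le> x (Suc j)" and r: "1 < r"
  shows "oint 0 r (\<lambda>\<theta>. tower_det N (\<lambda>i k x. \<theta> * \<alpha> i k x + \<beta> i k x) x / (\<theta> ^ n * (\<theta> - 1))) =
    (if x (n - 1) < a then tower_det N \<phi> x else 0)"
proof (cases "x (n - 1) < a")
  case True
  define p where "p \<theta> = rdet N (\<lambda>j i. if j < n then \<phi> i (int j + 1) (x j) else \<theta> * \<alpha> i (int j + 1) (x j) + \<beta> i (int j + 1) (x j))" for \<theta>
  have D: "tower_det N (\<lambda>i k x. \<theta> * \<alpha> i k x + \<beta> i k x) x = \<theta> ^ n * p \<theta>" for \<theta>
  proof -
    have "\<beta> i (int j + 1) (x j) = 0" if "j < n" "i < N" for i j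
    proof -
      have "x j \<le> x (n - 1)" by (rule mono_le[of N x, OF x]) (use that n in auto)
      then have "x j < a" using True by simp
      then show ?thesis
      proof (cases "int j + 1 = int n")
        case True
        with \<beta>0[OF that(2) \<open>x j < a\<close>] show ?thesis by simp
      next
        case False
        with that(1) have "int j + 1 < int n" by simp
        show ?thesis
        proof (rule tower_low[OF \<beta>[OF that(2)]])
          show "\<beta> i (int n) y = 0" if "y < a" for y using \<beta>0[OF \<open>i < N\<close> that] .
          show "int j + 1 < int n" by fact
          show "x j \<le> a" using \<open>x j < a\<close> by simp
        qed
      qed
    qed
    then have "tower_det N (\<lambda>i k x. \<theta> * \<alpha> i k x + \<beta> i k x) x = rdet N (\<lambda>j i. (if j < n then \<theta> else 1) *
       (if j < n then \<phi> i (int j + 1) (x j) else \<theta> * \<alpha> i (int j + 1) (x j) + \<beta> i (int j + 1) (x j)))"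
      unfolding tower_det_def by (intro rdet_cong) (auto simp: sum)
    also have "\<dots> = (\<Prod>j<N. if j < n then \<theta> else 1) * p \<theta>" by (simp only: rdet_scale_rows p_def)
    also have "(\<Prod>j<N. if j < n then \<theta> else 1) = \<theta> ^ n"
    proof -
      have "{..<N} \<inter> {j. j < n} = {..<n}" using n by auto
      then show ?thesis by (simp add: prod.If_cases)
    qed
    finally show ?thesis .
  qed
  have "oint 0 r (\<lambda>\<theta>. tower_det N (\<lambda>i k x. \<theta> * \<alpha> i k x + \<beta> i k x) x / (\<theta> ^ n * (\<theta> - 1))) = oint 0 r (\<lambda>\<theta>. p \<theta> / (\<theta> - 1))"
    by (rule oint_cong) (use r in \<open>auto simp: D\<close>)
  also have "\<dots> = p 1"
  proof (rule oint_Cauchy[of _ _ "r + 1"])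
    show "p holomorphic_on ball 0 (r + 1)" unfolding p_def
    proof (rule rdet_holomorphic)
      fix j i
      show "(\<lambda>z. if j < n then \<phi> i (int j + 1) (x j) else z * \<alpha> i (int j + 1) (x j) + \<beta> i (int j + 1) (x j))
          holomorphic_on ball 0 (r + 1)"
        by (cases "j < n"; simp only: if_True if_False not_True_eq_False not_False_eq_True simp_thms; intro holomorphic_intros)
    qed
  qed (use r in auto)
  also have "p 1 = tower_det N \<phi> x" unfolding p_def tower_det_def by (rule rdet_cong) (simp add: sum)
  finally show ?thesis using True by simp
next
  case False
  \<comment> \<open>In this case \<theta> is taken out of the first \<open>n - 1\<close> rows only,
    and what remains is a polynomial in 1/\<theta>, bounded outside the unit disc.\<close>
  define p where "p s = rdet N (\<lambda>j i. if j < n - 1 then \<alpha> i (int j + 1) (x j) + s * \<beta> i (int j + 1) (x j) else \<phi> i (int j + 1) (x j))" for s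
  have D: "tower_det N (\<lambda>i k x. \<theta> * \<alpha> i k x + \<beta> i k x) x = \<theta> ^ (n - 1) * p (1 / \<theta>)" if "\<theta> \<noteq> 0" for \<theta>
  proof -
    have "\<alpha> i (int j + 1) (x j) = 0" if "\<not> j < n - 1" "i < N" "j < N" for i j
    proof -
      have "x (n - 1) \<le> x j" by (rule mono_le[of N x, OF x]) (use that n in auto)
      then have "a \<le> x j" using False by simp
      show ?thesis
      proof (rule tower_high[OF \<alpha>[OF that(2)]])
        show "\<alpha> i (int n) y = 0" if "a \<le> y" for y using \<alpha>0[OF \<open>i < N\<close> that] .
        show "int n \<le> int j + 1" using that(1) by simp
      qed fact
    qed
    then have "tower_det N (\<lambda>i k x. \<theta> * \<alpha> i k x + \<beta> i k x) x = rdet N (\<lambda>j i. (if j < n - 1 then \<theta> else 1) *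
       (if j < n - 1 then \<alpha> i (int j + 1) (x j) + (1 / \<theta>) * \<beta> i (int j + 1) (x j) else \<phi> i (int j + 1) (x j)))"
      unfolding tower_det_def using that by (intro rdet_cong) (auto simp: sum distrib_left)
    also have "\<dots> = (\<Prod>j<N. if j < n - 1 then \<theta> else 1) * p (1 / \<theta>)" by (simp only: rdet_scale_rows p_def)
    also have "(\<Prod>j<N. if j < n - 1 then \<theta> else 1) = \<theta> ^ (n - 1)"
    proof -
      have "{..<N} \<inter> {j. j < n - 1} = {..<n - 1}" using n by auto
      then show ?thesis by (simp add: prod.If_cases)
    qed
    finally show ?thesis .
  qed
  have holp: "p holomorphic_on UNIV" unfolding p_def
  proof (rule rdet_holomorphic)
    fix j i
    show "(\<lambda>z. if j < n - 1 then \<alpha> i (int j + 1) (x j) + z * \<beta> i (int j + 1) (x j) else \<phi> i (int j + 1) (x j))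
        holomorphic_on UNIV"
      by (cases "j < n - 1"; simp only: if_True if_False not_True_eq_False not_False_eq_True simp_thms; intro holomorphic_intros)
  qed
  have "p holomorphic_on cball 0 1" by (rule holomorphic_on_subset[OF holp]) simp
  then have "compact (p ` cball 0 1)"
    by (intro compact_continuous_image holomorphic_on_imp_continuous_on compact_cball)
  then obtain B where B: "\<And>s. s \<in> cball 0 1 \<Longrightarrow> cmod (p s) \<le> B" "0 < B"
    by (metis compact_imp_bounded bounded_pos imageI)
  have "oint 0 r (\<lambda>\<theta>. tower_det N (\<lambda>i k x. \<theta> * \<alpha> i k x + \<beta> i k x) x / (\<theta> ^ n * (\<theta> - 1))) =
      oint 0 r (\<lambda>\<theta>. p (1 / \<theta>) / (\<theta> * (\<theta> - 1)))"
  proof (rule oint_cong)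
    fix \<theta> assume "cmod (\<theta> - 0) = r"
    then have nz: "\<theta> \<noteq> 0" using r by auto
    obtain n' where "n = Suc n'" using n by (cases n) auto
    then have pw: "\<theta> ^ n = \<theta> ^ (n - 1) * \<theta>" by simp
    show "tower_det N (\<lambda>i k x. \<theta> * \<alpha> i k x + \<beta> i k x) x / (\<theta> ^ n * (\<theta> - 1)) = p (1 / \<theta>) / (\<theta> * (\<theta> - 1))"
      unfolding D[OF nz] pw mult.assoc
      by (rule nonzero_mult_divide_mult_cancel_left) (use nz in simp)
  qed (use r in auto)
  also have "\<dots> = 0"
  proof (rule oint_decay[of _ 1 0 r 2 "2 * B"])
    have "(\<lambda>\<theta>. 1 / \<theta>) holomorphic_on {z. 1 < cmod (z - 0)}" by (intro holomorphic_intros) auto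
    then have "(p \<circ> (\<lambda>\<theta>. 1 / \<theta>)) holomorphic_on {z. 1 < cmod (z - 0)}"
      by (rule holomorphic_on_compose_gen[OF _ holp]) simp
    then have "(\<lambda>\<theta>. p (1 / \<theta>)) holomorphic_on {z. 1 < cmod (z - 0)}" by (simp only: o_def)
    then show "(\<lambda>\<theta>. p (1 / \<theta>) / (\<theta> * (\<theta> - 1))) holomorphic_on {z. 1 < cmod (z - 0)}"
    proof (rule holomorphic_on_divide)
      show "z * (z - 1) \<noteq> 0" if "z \<in> {z. 1 < cmod (z - 0)}" for z using that by auto
    qed (intro holomorphic_intros)
    fix \<theta> assume \<theta>: "2 \<le> cmod (\<theta> - 0)"
    have "cmod \<theta> / 2 \<le> cmod (\<theta> - 1)" using norm_triangle_ineq2[of \<theta> 1] \<theta> by simp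
    then have "cmod \<theta> * (cmod \<theta> / 2) \<le> cmod (\<theta> * (\<theta> - 1))" unfolding norm_mult by (intro mult_left_mono) auto
    moreover have "cmod (p (1 / \<theta>)) \<le> B" using \<theta> by (intro B) (auto simp: norm_divide divide_le_eq)
    moreover have "0 < cmod \<theta> * (cmod \<theta> / 2)" using \<theta> by (intro mult_pos_pos) auto
    ultimately have "cmod (p (1 / \<theta>) / (\<theta> * (\<theta> - 1))) \<le> B / (cmod \<theta> * (cmod \<theta> / 2))"
      unfolding norm_divide using B(2) by (intro frac_le) auto
    then show "cmod (p (1 / \<theta>) / (\<theta> * (\<theta> - 1))) \<le> 2 * B / (cmod (\<theta> - 0))\<^sup>2"
      by (simp add: power2_eq_square mult_ac)
  qed (use r in auto)
  finally show ?thesis using False by simp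
qed

text \<open>A positive coordinate makes the last one positive, and the last row consists of
  differences of nonnegative order, which vanish from 1 on. If no coordinate is positive, the
  entries of negative order are sums from below that have not yet met the mass at 0, and the matrix
  is triangular.\<close>

lemma initial_det:
  fixes E :: "int \<Rightarrow> int \<Rightarrow> complex"
  assumes E: "tower E" and E0: "\<And>x. E 0 x = (if x = 0 then e else 0)"
    and x: "\<And>j. Suc j < N \<Longrightarrow> x j \<le> x (Suc j)"
  shows "rdet N (\<lambda>j i. E (int j - int i) (x j)) = (if \<forall>j<N. x j = 0 then e ^ N else 0)"
proof (cases "\<exists>j<N. 0 < x j")
  case True
  then obtain j where j: "j < N" "0 < x j" by auto
  have "x j \<le> x (N - 1)" by (rule mono_le[of N x, OF x]) (use j in auto)
  then have xN: "1 \<le> x (N - 1)" using j by simp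
  have E01: "E 0 y = 0" if "1 \<le> y" for y using E0[of y] that by simp
  have "E (int (N - 1) - int i) (x (N - 1)) = 0" if "i < N" for i
    using that by (intro tower_high[OF E E01 _ xN]) auto
  then have "rdet N (\<lambda>j i. E (int j - int i) (x j)) = 0"
    using j by (intro rdet_zero_row[of "N - 1"]) auto
  with j show ?thesis by auto
next
  case False
  then have le: "x j \<le> 0" if "j < N" for j using that by force
  have E1: "E (- 1) x = 0" if "x < 1" for x
  proof (rule tower_low[OF E])
    show "E 0 y = 0" if "y < 0" for y using E0[of y] that by simp
  qed (use that in simp_all)
  have z: "E (int j - int i) (x j) = 0" if "j < i" "j < N" for i j
  proof (cases "int j - int i = -1")
    case True
    then show ?thesis using E1[of "x j"] le[OF that(2)] by simp
  next
    case False
    then have "int j - int i < -1" using that(1) by simp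
    moreover have "x j \<le> 1" using le[OF that(2)] by simp
    ultimately show ?thesis using tower_low[OF E E1] by blast
  qed
  have "rdet N (\<lambda>j i. E (int j - int i) (x j)) = rdet N (\<lambda>i j. E (int j - int i) (x j))"
    by (rule rdet_transpose)
  also have "\<dots> = (\<Prod>j<N. E (int j - int j) (x j))"
    by (rule rdet_upper, rule z) auto
  also have "\<dots> = (\<Prod>j<N. if x j = 0 then e else 0)" by (simp add: E0)
  also have "\<dots> = (if \<forall>j<N. x j = 0 then e ^ N else 0)"
    by (auto intro!: prod_zero)
  finally show ?thesis .
qed

section \<open>The chain of rows as a contour integral\<close>

locale pts = rate q for q :: real +
  fixes p :: nat and n m :: "nat \<Rightarrow> nat" and a :: "nat \<Rightarrow> int"
  assumes p2: "2 \<le> p"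
    and zero: "n 0 = 0" "m 0 = 0" "a 0 = 0"
    and n_less: "\<And>k. k < p \<Longrightarrow> n k < n (Suc k)"
    and m_less: "\<And>k. k < p \<Longrightarrow> m k < m (Suc k)"
begin

definition g :: "nat \<Rightarrow> complex \<Rightarrow> complex" where
  "g k z = G_star q z (int (n k) - int (n (k - 1))) (int (m k) - int (m (k - 1))) (a k - a (k - 1))"

text \<open>It moves the cut from \<open>a k\<close> to 0 and the difference order from
  \<open>n k\<close> to 0, so that on the remaining factor \<open>h\<close> the constraint at
  \<open>k\<close> acts simply through \<open>P1\<close> and \<open>P0\<close>.\<close>

definition norm_factor :: "nat \<Rightarrow> complex \<Rightarrow> complex" where
  "norm_factor k z = (1 - z) powi (- a k) * z powi (- int (n k))"

text \<open>On sequences this multiplies the values at negative indices by \<open>t1\<close> and the others by \<open>t2\<close>.\<close>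

definition mix :: "complex \<Rightarrow> complex \<Rightarrow> (complex \<Rightarrow> complex) \<Rightarrow> complex \<Rightarrow> complex" where
  "mix t1 t2 h z = t1 * h z - (t1 - t2) * (P1 h z + P0 h z)"

lemma n_mono: "k \<le> l \<Longrightarrow> l \<le> p \<Longrightarrow> n k \<le> n l"
proof (induction l rule: dec_induct)
  case (step l)
  then show ?case using n_less[of l] by simp
qed simp

lemma m_mono: "k \<le> l \<Longrightarrow> l \<le> p \<Longrightarrow> m k \<le> m l"
proof (induction l rule: dec_induct)
  case (step l)
  then show ?case using m_less[of l] by simp
qed simp

lemma n_strict: "k < l \<Longrightarrow> l \<le> p \<Longrightarrow> n k < n l"
  using n_less[of k] n_mono[of "Suc k" l] by simp
lemma m_strict: "k < l \<Longrightarrow> l \<le> p \<Longrightarrow> m k < m l"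
  using m_less[of k] m_mono[of "Suc k" l] by simp
lemma n_pos: "1 \<le> k \<Longrightarrow> k \<le> p \<Longrightarrow> 1 \<le> n k"
  using n_strict[of 0 k] by simp

lemma OmD: "z \<in> Om \<Longrightarrow> z \<noteq> 0" "z \<in> Om \<Longrightarrow> 1 - z \<noteq> 0" "z \<in> Om \<Longrightarrow> 1 - z / of_real (1 - q) \<noteq> 0"
  using step_factor_denom[of z] Om_Ex q0 by (auto simp: Om_def)

lemma G_star_hol: "(\<lambda>z. G_star q z i j k) holomorphic_on Om"
  unfolding G_star_def
  by (intro holomorphic_on_divide holomorphic_on_mult powi_hol_Om holomorphic_on_power_int holomorphic_intros disjI2 ballI)
     (use OmD q1 in auto)

lemma g_hol: "g k holomorphic_on Om"
  unfolding g_def[abs_def] by (rule G_star_hol)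

lemma mix_hol: "h holomorphic_on Om \<Longrightarrow> mix t1 t2 h holomorphic_on Om"
  unfolding mix_def[abs_def] by (intro holomorphic_intros P1_hol P0_hol)

lemma norm_factor_step:
  assumes "z \<in> Om" "k < p"
  shows "norm_factor (Suc k) z * g (Suc k) z = step_factor z ^ (m (Suc k) - m k) * norm_factor k z"
proof -
  define d where "d = m (Suc k) - m k"
  have d: "int (m (Suc k)) - int (m k) = int d" using m_less[OF assms(2)] by (simp add: d_def)
  have e1: "(1 - z) powi (- a (Suc k)) * (1 - z) powi (a (Suc k) - a k + int d) = (1 - z) powi (- a k) * (1 - z) ^ d"
    using OmD[OF assms(1)] by (simp flip: power_int_add add: power_int_of_nat[symmetric] del: power_int_of_nat)
  have e2: "z powi (- int (n (Suc k))) * z powi (int (n (Suc k)) - int (n k)) = z powi (- int (n k))"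
    using OmD[OF assms(1)] by (simp flip: power_int_add)
  have "norm_factor (Suc k) z * g (Suc k) z =
     ((1 - z) powi (- a (Suc k)) * (1 - z) powi (a (Suc k) - a k + int d)) *
     (z powi (- int (n (Suc k))) * z powi (int (n (Suc k)) - int (n k))) / (1 - z / of_real (1 - q)) ^ d"
    by (simp add: norm_factor_def g_def G_star_def d)
  also have "\<dots> = step_factor z ^ d * norm_factor k z"
    unfolding e1 e2 by (simp add: step_factor_def norm_factor_def power_divide)
  finally show ?thesis by (simp add: d_def)
qed

lemma tower_tseq: "low_vanish \<Psi> \<Longrightarrow> tower (tseq \<Psi>)"
  unfolding tower_def using tseq_step tseq_bounded_below by blast

definition N :: nat where "N = n p"

lemma N_pos: "0 < N" using n_pos[of p] p2 by (simp add: N_def)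

lemma low_vanish_hol: "low_vanish \<Psi> \<Longrightarrow> \<Psi> holomorphic_on Om" by (simp add: low_vanish_def)

lemma low_vanish_step_factor_pow: "low_vanish \<Psi> \<Longrightarrow> low_vanish (\<lambda>z. step_factor z ^ d * \<Psi> z)"
proof (induction d)
  case (Suc d)
  then show ?case using low_vanish_step_factor[of "\<lambda>z. step_factor z ^ d * \<Psi> z"] by (simp add: mult.assoc)
qed simp

lemma neg_powi:
  fixes z :: complex
  shows "(-1) ^ j * (- z) powi int j = z powi int j" "(-1) ^ j * (- z) powi (- int j) = z powi (- int j)"
  by (cases "even j"; simp add: power_int_minus)+

text \<open>Truncation is understood for the factor in 1 - z alone. The power of z is removed and
  restored by powers of \<open>- z\<close>, which preserve the class; the signs they leave are
  constants.\<close>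

lemma low_vanish_norm_factor_trunc:
  assumes "low_vanish (\<lambda>z. norm_factor k z * h z)" "h holomorphic_on Om"
  shows "low_vanish (\<lambda>z. norm_factor k z * (P1 h z + P0 h z))"
proof -
  have "low_vanish (\<lambda>z. (- z) powi int (n k) * (norm_factor k z * h z))" by (rule low_vanish_zpow[OF assms(1)])
  then have "low_vanish (\<lambda>z. (-1) ^ n k * ((- z) powi int (n k) * (norm_factor k z * h z)))" by (rule low_vanish_cmul)
  then have b: "low_vanish (\<lambda>z. (1 - z) powi (- a k) * h z)" (is "low_vanish ?\<Psi>")
  proof (rule low_vanish_cong[rotated])
    fix z assume "z \<in> Om"
    then show "(-1) ^ n k * ((- z) powi int (n k) * (norm_factor k z * h z)) = (1 - z) powi (- a k) * h z"
      using OmD(1)[of z] unfolding norm_factor_def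
      by (simp only: mult.assoc[symmetric] neg_powi) (simp add: power_int_minus)
  qed
  have e: "(1 - w) powi a k * ?\<Psi> w = h w" if "w \<in> Om" for w
    using OmD(2)[OF that] by (simp add: power_int_minus)
  have "low_vanish (\<lambda>z. (1 - z) powi (- a k) * (P1 (\<lambda>w. (1 - w) powi a k * ?\<Psi> w) z + P0 (\<lambda>w. (1 - w) powi a k * ?\<Psi> w) z))"
    by (rule low_vanish_trunc[OF b])
  then have "low_vanish (\<lambda>z. (1 - z) powi (- a k) * (P1 h z + P0 h z))"
  proof (rule low_vanish_cong[rotated])
    fix z assume z: "z \<in> Om"
    have "P1 (\<lambda>w. (1 - w) powi a k * ?\<Psi> w) z = P1 h z"
      by (rule prin_cong) (use z q0 q1 e annulus1_Om in \<open>auto simp: Om_def\<close>)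
    moreover have "P0 (\<lambda>w. (1 - w) powi a k * ?\<Psi> w) z = P0 h z"
      by (rule prin_cong) (use z q0 q1 e annulus0_Om in \<open>auto simp: Om_def\<close>)
    ultimately show "(1 - z) powi (- a k) * (P1 (\<lambda>w. (1 - w) powi a k * ?\<Psi> w) z + P0 (\<lambda>w. (1 - w) powi a k * ?\<Psi> w) z) =
      (1 - z) powi (- a k) * (P1 h z + P0 h z)" by simp
  qed
  then have "low_vanish (\<lambda>z. (- z) powi (- int (n k)) * ((1 - z) powi (- a k) * (P1 h z + P0 h z)))" by (rule low_vanish_zpow)
  then have "low_vanish (\<lambda>z. (-1) ^ n k * ((- z) powi (- int (n k)) * ((1 - z) powi (- a k) * (P1 h z + P0 h z))))" by (rule low_vanish_cmul)
  then show ?thesis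
  proof (rule low_vanish_cong[rotated])
    fix z assume "z \<in> Om"
    show "(-1) ^ n k * ((- z) powi (- int (n k)) * ((1 - z) powi (- a k) * (P1 h z + P0 h z))) = norm_factor k z * (P1 h z + P0 h z)"
      unfolding norm_factor_def by (simp only: mult.assoc[symmetric] neg_powi) (simp only: mult.commute)
  qed
qed

lemma tseq_norm_factor_trunc:
  assumes "h holomorphic_on Om"
  shows "tseq (\<lambda>z. norm_factor k z * (P1 h z + P0 h z)) (int (n k)) x =
    (if a k \<le> x then tseq (\<lambda>z. norm_factor k z * h z) (int (n k)) x else 0)"
proof -
  have c: "(- z) powi int (n k) * (norm_factor k z * w) = (-1) ^ n k * ((1 - z) powi (- a k) * w)" if "z \<in> Om" for z w
  proof -
    have "(- z) powi int (n k) = (-1) ^ n k * z ^ n k" by (cases "even (n k)") simp_all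
    then show ?thesis using OmD(1)[OF that] by (simp add: norm_factor_def power_int_minus)
  qed
  let ?\<Psi> = "\<lambda>z. (1 - z) powi (- a k) * h z"
  have hol: "?\<Psi> holomorphic_on Om" by (intro holomorphic_on_mult powi_hol_Om assms)
  have e: "(1 - w) powi a k * ?\<Psi> w = h w" if "w \<in> Om" for w
    using OmD(2)[OF that] by (simp add: power_int_minus)
  have "tseq (\<lambda>z. norm_factor k z * (P1 h z + P0 h z)) (int (n k)) x =
     seq (\<lambda>z. (-1) ^ n k * ((1 - z) powi (- a k) *
       (P1 (\<lambda>w. (1 - w) powi a k * ?\<Psi> w) z + P0 (\<lambda>w. (1 - w) powi a k * ?\<Psi> w) z))) x"
    unfolding tseq_def
  proof (rule seq_cong)
    fix z assume z: "z \<in> Om"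
    have "P1 (\<lambda>w. (1 - w) powi a k * ?\<Psi> w) z = P1 h z"
      by (rule prin_cong) (use z q0 q1 e annulus1_Om in \<open>auto simp: Om_def\<close>)
    moreover have "P0 (\<lambda>w. (1 - w) powi a k * ?\<Psi> w) z = P0 h z"
      by (rule prin_cong) (use z q0 q1 e annulus0_Om in \<open>auto simp: Om_def\<close>)
    ultimately show "(- z) powi int (n k) * (norm_factor k z * (P1 h z + P0 h z)) = (-1) ^ n k * ((1 - z) powi (- a k) *
       (P1 (\<lambda>w. (1 - w) powi a k * ?\<Psi> w) z + P0 (\<lambda>w. (1 - w) powi a k * ?\<Psi> w) z))"
      by (simp only: c[OF z])
  qed
  also have "\<dots> = (if a k \<le> x then (-1) ^ n k * seq ?\<Psi> x else 0)"
    unfolding seq_cmul seq_trunc[OF hol] by simp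
  also have "(-1) ^ n k * seq ?\<Psi> x = tseq (\<lambda>z. norm_factor k z * h z) (int (n k)) x"
    unfolding tseq_def seq_cmul[symmetric] by (rule seq_cong) (simp only: c)
  finally show ?thesis .
qed

text \<open>The bound \<open>a p\<close> is imposed on every row: passage times grow with time and
  along a row, so the constraint at the last point says the same. This is why
  \<open>meets_at\<close> stops at \<open>p - 1\<close>.\<close>

definition states :: "(nat \<Rightarrow> int) set" where
  "states = {x \<in> {..<N} \<rightarrow>\<^sub>E UNIV. (\<forall>j<N. x j < a p) \<and> (\<forall>j. Suc j < N \<longrightarrow> x j \<le> x (Suc j))}"

definition succ :: "(nat \<Rightarrow> int) \<Rightarrow> (nat \<Rightarrow> int) set" where
  "succ x = {y \<in> states. \<forall>j<N. x j \<le> y j}"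

definition meets_at :: "nat \<Rightarrow> (nat \<Rightarrow> int) \<Rightarrow> complex" where
  "meets_at t y = (if \<forall>k\<in>{1..<p}. m k = t \<longrightarrow> y (n k - 1) < a k then 1 else 0)"

text \<open>The conditional probability, given the row \<open>x\<close>, of meeting the constraints during the last
  \<open>s\<close> time steps.\<close>

fun V :: "nat \<Rightarrow> (nat \<Rightarrow> int) \<Rightarrow> complex" where
  "V 0 x = 1"
| "V (Suc s) x = (\<Sum>y\<in>succ x. transition q N x y * meets_at (m p - s) y * V s y)"

text \<open>States are not bounded below, but the determinants vanish on all but finitely many of
  them. Summing over the support avoids choosing a lower bound here; \<open>fin_supp\<close>
  supplies one where sums are rearranged.\<close>

definition supp_sum :: "((nat \<Rightarrow> int) \<Rightarrow> complex) \<Rightarrow> complex" where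
  "supp_sum F = sum F {x \<in> states. F x \<noteq> 0}"

definition fin_supp :: "((nat \<Rightarrow> int) \<Rightarrow> complex) \<Rightarrow> int \<Rightarrow> bool" where
  "fin_supp F l \<longleftrightarrow> (\<forall>x\<in>states. x 0 < l \<longrightarrow> F x = 0)"

abbreviation box :: "int \<Rightarrow> (nat \<Rightarrow> int) set" where "box l \<equiv> incr N l (\<lambda>_. a p - 1)"

lemma box_eq: "box l = {x \<in> states. l \<le> x 0}"
proof -
  have "l \<le> x j" if "x \<in> states" "l \<le> x 0" "j < N" for x j
    using mono_le[of N x 0 j] that by (auto simp: states_def)
  then show ?thesis using N_pos by (auto simp: incr_def states_def)
qed

lemma supp_sum_eq:
  assumes "fin_supp F l" shows "supp_sum F = sum F (box l)"
  unfolding supp_sum_def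
proof (rule sum.mono_neutral_left)
  show "{x \<in> states. F x \<noteq> 0} \<subseteq> box l" using assms by (auto simp: box_eq fin_supp_def)
  show "\<forall>i\<in>box l - {x \<in> states. F x \<noteq> 0}. F i = 0" by (auto simp: box_eq)
qed simp

lemma fin_supp_mult: "fin_supp F l \<Longrightarrow> fin_supp (\<lambda>x. F x * h x) l"
  by (simp add: fin_supp_def)

lemma fin_supp_mono: "fin_supp F l \<Longrightarrow> l' \<le> l \<Longrightarrow> fin_supp F l'"
  by (auto simp: fin_supp_def)

abbreviation tseq_det :: "(nat \<Rightarrow> complex \<Rightarrow> complex) \<Rightarrow> (nat \<Rightarrow> int) \<Rightarrow> complex" where
  "tseq_det \<Psi> \<equiv> tower_det N (\<lambda>i. tseq (\<Psi> i))"

lemma common_bound: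
  assumes "\<And>i. i < N \<Longrightarrow> low_vanish (\<Psi> i)"
  shows "\<exists>L. \<forall>i x. i < N \<longrightarrow> x < L \<longrightarrow> tseq (\<Psi> i) k x = 0"
proof -
  have "\<forall>i\<in>{..<N}. \<exists>L. \<forall>x<L. tseq (\<Psi> i) k x = 0" using assms tseq_bounded_below by blast
  then obtain f where f: "\<forall>i\<in>{..<N}. \<forall>x<f i. tseq (\<Psi> i) k x = 0" by metis
  show ?thesis
  proof (intro exI[of _ "Min (f ` {..<N})"] allI impI)
    fix i x assume "i < N" "x < Min (f ` {..<N})"
    then have "x < f i" by (meson Min_le finite_imageI finite_lessThan imageI lessThan_iff order_less_le_trans)
    then show "tseq (\<Psi> i) k x = 0" using f \<open>i < N\<close> by auto
  qed
qed

lemma tseq_det_supp: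
  assumes "\<And>i x. i < N \<Longrightarrow> x < L \<Longrightarrow> tseq (\<Psi> i) 1 x = 0"
  shows "fin_supp (tseq_det \<Psi>) L"
  unfolding fin_supp_def tower_det_def
proof (intro ballI impI)
  fix x :: "nat \<Rightarrow> int" assume "x 0 < L"
  then show "rdet N (\<lambda>j i. tseq (\<Psi> i) (int j + 1) (x j)) = 0"
    using assms N_pos by (intro rdet_zero_row[of 0]) auto
qed

text \<open>Exchanging the sums over the current row \<open>x\<close> and the next row
  \<open>y\<close> moves one time step from \<open>V\<close> onto the determinant; the inner sum
  over \<open>x\<close> is \<open>one_step\<close>.\<close>

lemma supp_sum_step:
  assumes B: "\<And>i. i < N \<Longrightarrow> low_vanish (\<Psi> i)"
  shows "supp_sum (\<lambda>x. tseq_det \<Psi> x * V (Suc s) x) = supp_sum (\<lambda>x. tseq_det (\<lambda>i z. step_factor z * \<Psi> i z) x * (meets_at (m p - s) x * V s x))"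
proof -
  let ?\<Phi> = "\<lambda>i z. step_factor z * \<Psi> i z"
  have B': "\<And>i. i < N \<Longrightarrow> low_vanish (?\<Phi> i)" by (intro low_vanish_step_factor B)
  obtain L1 where L1: "\<And>i x. i < N \<Longrightarrow> x < L1 \<Longrightarrow> tseq (\<Psi> i) 1 x = 0" using common_bound[of \<Psi> 1] B by blast
  obtain L2 where L2: "\<And>i x. i < N \<Longrightarrow> x < L2 \<Longrightarrow> tseq (?\<Phi> i) 1 x = 0" using common_bound[of ?\<Phi> 1] B' by blast
  define l where "l = min L1 L2"
  have sel1: "fin_supp (\<lambda>x. tseq_det \<Psi> x * V (Suc s) x) l"
    by (rule fin_supp_mult[OF fin_supp_mono[OF tseq_det_supp[OF L1]]]) (auto simp: l_def)
  have sel2: "fin_supp (\<lambda>x. tseq_det ?\<Phi> x * (meets_at (m p - s) x * V s x)) l"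
    by (rule fin_supp_mult[OF fin_supp_mono[OF tseq_det_supp[OF L2]]]) (auto simp: l_def)
  have fs: "finite (succ x)" for x
  proof (rule finite_subset)
    show "succ x \<subseteq> {..<N} \<rightarrow>\<^sub>E (\<Union>j<N. {x j..a p})" by (force simp: succ_def states_def PiE_def Pi_def)
  qed (auto intro!: finite_PiE)
  have "supp_sum (\<lambda>x. tseq_det \<Psi> x * V (Suc s) x) =
    (\<Sum>x\<in>box l. \<Sum>y\<in>succ x. tseq_det \<Psi> x * (transition q N x y * meets_at (m p - s) y * V s y))"
    unfolding supp_sum_eq[OF sel1] by (simp add: sum_distrib_left)
  also have "\<dots> = (\<Sum>(x, y)\<in>Sigma (box l) succ. tseq_det \<Psi> x * (transition q N x y * meets_at (m p - s) y * V s y))"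
    by (rule sum.Sigma) (use fs in auto)
  also have "\<dots> = (\<Sum>(y, x)\<in>Sigma (box l) (incr N l). tseq_det \<Psi> x * (transition q N x y * meets_at (m p - s) y * V s y))"
  proof (rule sum.reindex_bij_witness[where i = prod.swap and j = prod.swap])
    have sw: "(x \<in> box l \<and> y \<in> succ x) \<longleftrightarrow> (y \<in> box l \<and> x \<in> incr N l y)" for x y
      unfolding box_eq succ_def incr_def[of N l y] states_def
      using mono_le[of N x 0] N_pos by (auto intro: order_trans le_less_trans)
    show "prod.swap z \<in> Sigma (box l) (incr N l)" if "z \<in> Sigma (box l) succ" for z
      using that sw by (cases z) simp
    show "prod.swap z \<in> Sigma (box l) succ" if "z \<in> Sigma (box l) (incr N l)" for z
      using that sw by (cases z) simp
  qed auto
  also have "\<dots> = (\<Sum>y\<in>box l. \<Sum>x\<in>incr N l y. tseq_det \<Psi> x * (transition q N x y * meets_at (m p - s) y * V s y))"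
    by (rule sum.Sigma[symmetric]) auto
  also have "\<dots> = (\<Sum>y\<in>box l. tseq_det ?\<Phi> y * (meets_at (m p - s) y * V s y))"
  proof (rule sum.cong)
    fix y assume y: "y \<in> box l"
    have "(\<Sum>x\<in>incr N l y. transition q N x y * tseq_det \<Psi> x) = tseq_det ?\<Phi> y"
    proof (rule one_step)
      show "tower (tseq (\<Psi> i))" "tower (tseq (?\<Phi> i))" if "i < N" for i
        using B B' that tower_tseq by blast+
      show "tseq (?\<Phi> i) k x - of_real q * tseq (?\<Phi> i) k (x - 1) = of_real (1 - q) * tseq (\<Psi> i) k x" if "i < N" for i k x
        by (rule tseq_step_factor[OF B[OF that]])
      show "tseq (\<Psi> i) 1 x = 0 \<and> tseq (?\<Phi> i) 1 x = 0" if "i < N" "x < l" for i x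
        using L1 L2 that by (simp add: l_def)
      show "y j \<le> y (Suc j)" if "Suc j < N" for j using y that by (auto simp: incr_def)
      show "l \<le> y 0" using y by (simp add: box_eq)
    qed
    moreover have "(\<Sum>x\<in>incr N l y. tseq_det \<Psi> x * (transition q N x y * meets_at (m p - s) y * V s y)) =
      (\<Sum>x\<in>incr N l y. transition q N x y * tseq_det \<Psi> x) * (meets_at (m p - s) y * V s y)"
      unfolding sum_distrib_right by (rule sum.cong) simp_all
    ultimately show "(\<Sum>x\<in>incr N l y. tseq_det \<Psi> x * (transition q N x y * meets_at (m p - s) y * V s y)) = tseq_det ?\<Phi> y * (meets_at (m p - s) y * V s y)"
      by simp
  qed simp
  also have "\<dots> = supp_sum (\<lambda>x. tseq_det ?\<Phi> x * (meets_at (m p - s) x * V s x))" by (rule supp_sum_eq[OF sel2, symmetric])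
  finally show ?thesis .
qed

lemma tower_det_cong: "(\<And>i k x. i < N \<Longrightarrow> \<phi> i k x = \<phi>' i k x) \<Longrightarrow> tower_det N \<phi> = tower_det N \<phi>'"
  unfolding tower_det_def by (intro ext rdet_cong) simp

lemma tseq_det_cong:
  assumes "\<And>i z. i < N \<Longrightarrow> z \<in> Om \<Longrightarrow> f i z = h i z" shows "tseq_det f = tseq_det h"
  by (rule tower_det_cong) (auto simp: tseq_def intro!: seq_cong assms)

lemma supp_sum_steps:
  assumes "\<And>i. i < N \<Longrightarrow> low_vanish (\<Psi> i)" and "\<And>t y. m p - (s + Suc d) < t \<Longrightarrow> t < m p - s \<Longrightarrow> meets_at t y = 1"
    and "s + Suc d \<le> m p"
  shows "supp_sum (\<lambda>x. tseq_det \<Psi> x * V (s + Suc d) x) = supp_sum (\<lambda>x. tseq_det (\<lambda>i z. step_factor z ^ Suc d * \<Psi> i z) x * (meets_at (m p - s) x * V s x))"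
  using assms
proof (induction d arbitrary: \<Psi>)
  case 0
  then show ?case using supp_sum_step[of \<Psi> s] by simp
next
  case (Suc d)
  have "supp_sum (\<lambda>x. tseq_det \<Psi> x * V (s + Suc (Suc d)) x) =
      supp_sum (\<lambda>x. tseq_det (\<lambda>i z. step_factor z * \<Psi> i z) x * (meets_at (m p - (s + Suc d)) x * V (s + Suc d) x))"
    using supp_sum_step[of \<Psi> "s + Suc d", OF Suc.prems(1)] by (simp only: add_Suc_right)
  also have "\<dots> = supp_sum (\<lambda>x. tseq_det (\<lambda>i z. step_factor z * \<Psi> i z) x * V (s + Suc d) x)"
  proof -
    have "meets_at (m p - (s + Suc d)) x = 1" for x by (rule Suc.prems(2)) (use Suc.prems(3) in auto)
    then show ?thesis by simp
  qed
  also have "\<dots> = supp_sum (\<lambda>x. tseq_det (\<lambda>i z. step_factor z ^ Suc d * (step_factor z * \<Psi> i z)) x * (meets_at (m p - s) x * V s x))"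
    by (rule Suc.IH) (use Suc.prems low_vanish_step_factor in auto)
  also have "(\<lambda>i z. step_factor z ^ Suc d * (step_factor z * \<Psi> i z)) = (\<lambda>i z. step_factor z ^ Suc (Suc d) * \<Psi> i z)"
    by (intro ext) simp
  finally show ?case .
qed

lemma meets_at_between: "k < p \<Longrightarrow> m k < t \<Longrightarrow> t < m (Suc k) \<Longrightarrow> meets_at t y = 1"
proof -
  assume k: "k < p" "m k < t" "t < m (Suc k)"
  have "m l \<noteq> t" if "l \<in> {1..<p}" for l
  proof (cases "l \<le> k")
    case True then show ?thesis using m_mono[of l k] k by auto
  next
    case False then show ?thesis using m_mono[of "Suc k" l] k that by auto
  qed
  then show ?thesis by (simp add: meets_at_def)
qed

lemma meets_at_last: "meets_at (m p) y = 1"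
proof -
  have "m l \<noteq> m p" if "l \<in> {1..<p}" for l using m_strict[of l p] that by auto
  then show ?thesis by (simp add: meets_at_def)
qed

lemma meets_at_at: "k \<in> {1..<p} \<Longrightarrow> meets_at (m k) y = (if y (n k - 1) < a k then 1 else 0)"
proof -
  assume k: "k \<in> {1..<p}"
  have "m l = m k \<longleftrightarrow> l = k" if "l \<in> {1..<p}" for l
    using m_strict[of l k] m_strict[of k l] k that by (cases l k rule: linorder_cases) auto
  then show ?thesis using k unfolding meets_at_def by auto
qed

text \<open>No constraint lies strictly between \<open>m k\<close> and \<open>m (Suc k)\<close>, so
  the convolution factors accumulate, and \<open>norm_factor_step\<close> turns them into the single
  factor \<open>g (Suc k)\<close>.\<close>

lemma supp_sum_move:
  assumes "\<And>i. i < N \<Longrightarrow> low_vanish (\<lambda>z. norm_factor k z * h i z)" "k < p"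
  shows "supp_sum (\<lambda>x. tseq_det (\<lambda>i z. norm_factor k z * h i z) x * V (m p - m k) x) =
    supp_sum (\<lambda>x. tseq_det (\<lambda>i z. norm_factor (Suc k) z * (g (Suc k) z * h i z)) x * (meets_at (m (Suc k)) x * V (m p - m (Suc k)) x))"
proof -
  obtain d where d: "m (Suc k) - m k = Suc d" using m_less[OF assms(2)] by (metis Suc_diff_Suc)
  have le: "m k < m (Suc k)" "m (Suc k) \<le> m p" using m_less m_mono[of "Suc k" p] assms(2) by auto
  have e: "m p - m k = (m p - m (Suc k)) + Suc d" using d le by simp
  have e2: "m p - (m p - m (Suc k)) = m (Suc k)" "m p - (m p - m (Suc k) + Suc d) = m k" using d le by simp_all
  have "supp_sum (\<lambda>x. tseq_det (\<lambda>i z. norm_factor k z * h i z) x * V (m p - m k) x) =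
    supp_sum (\<lambda>x. tseq_det (\<lambda>i z. step_factor z ^ Suc d * (norm_factor k z * h i z)) x * (meets_at (m p - (m p - m (Suc k))) x * V (m p - m (Suc k)) x))"
    unfolding e by (rule supp_sum_steps) (use assms meets_at_between le d in \<open>auto simp: e2\<close>)
  also have "tseq_det (\<lambda>i z. step_factor z ^ Suc d * (norm_factor k z * h i z)) = tseq_det (\<lambda>i z. norm_factor (Suc k) z * (g (Suc k) z * h i z))"
    by (rule tseq_det_cong) (use norm_factor_step assms(2) in \<open>simp add: mult.assoc[symmetric] flip: d\<close>)
  finally show ?thesis unfolding e2 .
qed

text \<open>Here the constraints are consumed from \<open>k\<close> upwards, as the induction on
  \<open>p - k\<close> requires; \<open>full_chain\<close> builds the same function from the
  starting end.\<close>

fun steps :: "(nat \<Rightarrow> complex) \<Rightarrow> nat \<Rightarrow> nat \<Rightarrow> (complex \<Rightarrow> complex) \<Rightarrow> complex \<Rightarrow> complex" where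
  "steps \<theta> 0 k h = h"
| "steps \<theta> (Suc d) k h = steps \<theta> d (Suc k) (\<lambda>z. g (Suc k) z * mix (\<theta> k) 1 h z)"

lemma steps_cong: "(\<And>l. k \<le> l \<Longrightarrow> \<theta> l = \<theta>' l) \<Longrightarrow> steps \<theta> d k h = steps \<theta>' d k h"
  by (induction d arbitrary: k h) (auto intro!: arg_cong[of _ _ "\<lambda>x. x"])

lemma low_vanish_mix:
  assumes "low_vanish (\<lambda>z. norm_factor k z * h z)" "h holomorphic_on Om"
  shows "low_vanish (\<lambda>z. norm_factor k z * mix t1 t2 h z)"
proof (rule low_vanish_cong)
  show "low_vanish (\<lambda>z. t1 * (norm_factor k z * h z) - (t1 - t2) * (norm_factor k z * (P1 h z + P0 h z)))"
    by (intro low_vanish_diff low_vanish_cmul assms low_vanish_norm_factor_trunc)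
qed (simp add: mix_def algebra_simps)

lemma low_vanish_norm_factor_step:
  assumes "low_vanish (\<lambda>z. norm_factor k z * h z)" "k < p"
  shows "low_vanish (\<lambda>z. norm_factor (Suc k) z * (g (Suc k) z * h z))"
proof (rule low_vanish_cong[OF _ low_vanish_step_factor_pow[OF assms(1), of "m (Suc k) - m k"]])
  fix z assume "z \<in> Om"
  from norm_factor_step[OF this assms(2)]
  show "step_factor z ^ (m (Suc k) - m k) * (norm_factor k z * h z) = norm_factor (Suc k) z * (g (Suc k) z * h z)"
    by (simp add: mult.assoc[symmetric])
qed

lemma tseq_lin:
  assumes "low_vanish f" "low_vanish h" shows "tseq (\<lambda>z. c * f z + h z) k x = c * tseq f k x + tseq h k x"
proof -
  have "tseq (\<lambda>z. c * f z + h z) k x = seq (\<lambda>z. c * ((- z) powi k * f z) + (- z) powi k * h z) x"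
    unfolding tseq_def by (rule seq_cong) (simp add: algebra_simps)
  also have "\<dots> = c * tseq f k x + tseq h k x"
    unfolding tseq_def seq_cmul[symmetric]
    using assms by (intro seq_add holomorphic_on_mult holomorphic_on_const powi_hol_Om low_vanish_hol)
  finally show ?thesis .
qed

text \<open>Each indicator is traded for an integral over its own parameter, the finite sum over
  rows goes under that integral, and the time steps up to the next constraint move onto the
  determinant. At \<open>k = p\<close> only a sum over a box remains, which telescopes to the value
  at \<open>a p\<close>.\<close>

lemma supp_sum_chain:
  assumes "1 \<le> k" "k \<le> p" "1 < r" and "\<And>i. i < N \<Longrightarrow> low_vanish (\<lambda>z. norm_factor k z * h i z)" "\<And>i. i < N \<Longrightarrow> h i holomorphic_on Om"
  shows "supp_sum (\<lambda>x. tseq_det (\<lambda>i z. norm_factor k z * h i z) x * (meets_at (m k) x * V (m p - m k) x)) =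
    oints 0 (\<lambda>_. r) [k..<p] (\<lambda>\<theta>. rdet N (\<lambda>j i. tseq (\<lambda>z. norm_factor p z * steps \<theta> (p - k) k (h i) z) (int j) (a p)) /
      (\<Prod>l\<in>{k..<p}. \<theta> l ^ n l * (\<theta> l - 1)))"
  using assms
proof (induction "p - k" arbitrary: k h)
  case 0
  then have k: "k = p" by simp
  let ?\<Psi> = "\<lambda>i z. norm_factor p z * h i z"
  have B: "low_vanish (?\<Psi> i)" if "i < N" for i using 0 that k by simp
  obtain L1 where L1: "\<And>i x. i < N \<Longrightarrow> x < L1 \<Longrightarrow> tseq (?\<Psi> i) 1 x = 0" using common_bound[of ?\<Psi> 1] B by blast
  obtain L2 where L2: "\<And>i x. i < N \<Longrightarrow> x < L2 \<Longrightarrow> tseq (?\<Psi> i) 0 x = 0" using common_bound[of ?\<Psi> 0] B by blast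
  define l where "l = min (min L1 (L2 - 1)) (a p)"
  have "fin_supp (tseq_det ?\<Psi>) l"
    by (rule fin_supp_mono[OF tseq_det_supp[OF L1]]) (auto simp: l_def)
  then have "supp_sum (tseq_det ?\<Psi>) = sum (tseq_det ?\<Psi>) (box l)" by (rule supp_sum_eq)
  also have "\<dots> = rdet N (\<lambda>j i. tseq (?\<Psi> i) (int j) (a p))"
    by (rule last_sum) (use B tower_tseq L2 in \<open>auto simp: l_def\<close>)
  finally show ?case using k by (simp add: meets_at_last)
next
  case (Suc d)
  then have k: "1 \<le> k" "k < p" by auto
  let ?\<beta> = "\<lambda>i z. norm_factor k z * (P1 (h i) z + P0 (h i) z)"
  let ?\<alpha> = "\<lambda>i z. norm_factor k z * h i z - ?\<beta> i z"
  let ?Y = "\<lambda>w i z. norm_factor k z * mix w 1 (h i) z"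
  let ?V = "V (m p - m k)"
  have B\<phi>: "low_vanish (\<lambda>z. norm_factor k z * h i z)" "h i holomorphic_on Om" if "i < N" for i using Suc.prems that by auto
  have B\<beta>: "low_vanish (?\<beta> i)" if "i < N" for i using low_vanish_norm_factor_trunc B\<phi>[OF that] by blast
  have B\<alpha>: "low_vanish (?\<alpha> i)" if "i < N" for i using low_vanish_diff[OF B\<phi>(1)[OF that] B\<beta>[OF that]] .
  have Y: "tseq (?Y w i) = (\<lambda>k x. w * tseq (?\<alpha> i) k x + tseq (?\<beta> i) k x)" if "i < N" for w i
  proof (intro ext)
    fix k' x
    have "tseq (?Y w i) k' x = tseq (\<lambda>z. w * ?\<alpha> i z + ?\<beta> i z) k' x"
      unfolding tseq_def by (rule seq_cong) (simp add: mix_def algebra_simps)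
    then show "tseq (?Y w i) k' x = w * tseq (?\<alpha> i) k' x + tseq (?\<beta> i) k' x"
      by (simp only: tseq_lin[OF B\<alpha>[OF that] B\<beta>[OF that]])
  qed
  have \<phi>: "tseq (\<lambda>z. norm_factor k z * h i z) k' x = tseq (?\<alpha> i) k' x + tseq (?\<beta> i) k' x" if "i < N" for i k' x
    using tseq_lin[OF B\<alpha>[OF that] B\<beta>[OF that], of 1 k' x] by simp
  have D: "tseq_det (?Y w) = tower_det N (\<lambda>i k x. w * tseq (?\<alpha> i) k x + tseq (?\<beta> i) k x)" for w
    by (rule tower_det_cong) (simp add: Y)
  have th: "tseq_det (\<lambda>i z. norm_factor k z * h i z) x * meets_at (m k) x = oint 0 r (\<lambda>w. tseq_det (?Y w) x / (w ^ n k * (w - 1)))"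
    if x: "x \<in> states" for x
  proof -
    have "oint 0 r (\<lambda>w. tseq_det (?Y w) x / (w ^ n k * (w - 1))) = (if x (n k - 1) < a k then tseq_det (\<lambda>i z. norm_factor k z * h i z) x else 0)"
      unfolding D
    proof (rule theta_integral)
      show "tower (tseq (?\<alpha> i))" "tower (tseq (?\<beta> i))" if "i < N" for i
        using B\<alpha> B\<beta> that tower_tseq by blast+
      show "tseq (\<lambda>z. norm_factor k z * h i z) k' x = tseq (?\<alpha> i) k' x + tseq (?\<beta> i) k' x" if "i < N" for i k' x
        by (rule \<phi>[OF that])
      show "tseq (?\<beta> i) (int (n k)) x = 0" if "i < N" "x < a k" for i x
        using tseq_norm_factor_trunc[OF B\<phi>(2)[OF that(1)], of k x] that by simp
      show "tseq (?\<alpha> i) (int (n k)) x = 0" if "i < N" "a k \<le> x" for i x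
        using tseq_norm_factor_trunc[OF B\<phi>(2)[OF that(1)], of k x] \<phi>[OF that(1), of "int (n k)" x] that by simp
      show "1 \<le> n k" "n k \<le> N" using n_pos n_mono k by (auto simp: N_def)
      show "x j \<le> x (Suc j)" if "Suc j < N" for j using x that by (simp add: states_def)
    qed (rule \<open>1 < r\<close>)
    moreover have "meets_at (m k) x = (if x (n k - 1) < a k then 1 else 0)" using k by (intro meets_at_at) auto
    ultimately show ?thesis by simp
  qed
  \<comment> \<open>The bound comes from the two parts separately and so does not depend on
    \<open>w\<close>: one finite box serves the whole circle, and sum and integral may be
    exchanged.\<close>
  obtain L1 where L1: "\<And>i x. i < N \<Longrightarrow> x < L1 \<Longrightarrow> tseq (?\<alpha> i) 1 x = 0" using common_bound[of ?\<alpha> 1] B\<alpha> by blast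
  obtain L2 where L2: "\<And>i x. i < N \<Longrightarrow> x < L2 \<Longrightarrow> tseq (?\<beta> i) 1 x = 0" using common_bound[of ?\<beta> 1] B\<beta> by blast
  define l where "l = min L1 L2"
  have l: "tseq (?\<alpha> i) 1 x = 0" "tseq (?\<beta> i) 1 x = 0" if "i < N" "x < l" for i x
    using L1 L2 that by (auto simp: l_def)
  have sY: "fin_supp (tseq_det (?Y w)) l" for w by (rule tseq_det_supp) (simp add: Y l)
  have s\<phi>: "fin_supp (tseq_det (\<lambda>i z. norm_factor k z * h i z)) l" by (rule tseq_det_supp) (simp add: \<phi> l)
  have cont: "continuous_on (sphere 0 r) (\<lambda>w. tseq_det (?Y w) x / (w ^ n k * (w - 1)) * ?V x)" for x
  proof -
    have "(\<lambda>w. tseq_det (?Y w) x) holomorphic_on UNIV"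
      unfolding D tower_det_def by (rule rdet_holomorphic) (intro holomorphic_intros)
    then have "continuous_on (sphere 0 r) (\<lambda>w. tseq_det (?Y w) x)"
      using holomorphic_on_imp_continuous_on continuous_on_subset subset_UNIV by blast
    then show ?thesis using \<open>1 < r\<close> by (intro continuous_intros) (auto simp: dist_norm)
  qed
  have "supp_sum (\<lambda>x. tseq_det (\<lambda>i z. norm_factor k z * h i z) x * (meets_at (m k) x * ?V x)) =
    (\<Sum>x\<in>box l. tseq_det (\<lambda>i z. norm_factor k z * h i z) x * (meets_at (m k) x * ?V x))"
    by (rule supp_sum_eq[OF fin_supp_mult[OF s\<phi>]])
  also have "\<dots> = (\<Sum>x\<in>box l. oint 0 r (\<lambda>w. tseq_det (?Y w) x / (w ^ n k * (w - 1)) * ?V x))"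
  proof (rule sum.cong)
    fix x assume "x \<in> box l"
    then have "x \<in> states" by (simp add: box_eq)
    then show "tseq_det (\<lambda>i z. norm_factor k z * h i z) x * (meets_at (m k) x * ?V x) = oint 0 r (\<lambda>w. tseq_det (?Y w) x / (w ^ n k * (w - 1)) * ?V x)"
      unfolding oint_mulc by (simp only: th[symmetric] mult.assoc)
  qed simp
  also have "\<dots> = oint 0 r (\<lambda>w. \<Sum>x\<in>box l. tseq_det (?Y w) x / (w ^ n k * (w - 1)) * ?V x)"
    by (rule oint_sum[symmetric, OF cont]) (use \<open>1 < r\<close> in simp)
  also have "\<dots> = oint 0 r (\<lambda>w. supp_sum (\<lambda>x. tseq_det (?Y w) x * ?V x) / (w ^ n k * (w - 1)))"
  proof -
    have "(\<Sum>x\<in>box l. tseq_det (?Y w) x / (w ^ n k * (w - 1)) * ?V x) = supp_sum (\<lambda>x. tseq_det (?Y w) x * ?V x) / (w ^ n k * (w - 1))" for w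
      unfolding supp_sum_eq[OF fin_supp_mult[OF sY]] sum_divide_distrib by (rule sum.cong) simp_all
    then show ?thesis by simp
  qed
  also have "\<dots> = oint 0 r (\<lambda>w. oints 0 (\<lambda>_. r) [Suc k..<p] (\<lambda>\<theta>.
      rdet N (\<lambda>j i. tseq (\<lambda>z. norm_factor p z * steps \<theta> (p - Suc k) (Suc k) (\<lambda>z. g (Suc k) z * mix w 1 (h i) z) z) (int j) (a p)) /
      (\<Prod>l\<in>{Suc k..<p}. \<theta> l ^ n l * (\<theta> l - 1))) / (w ^ n k * (w - 1)))"
  proof (rule oint_cong)
    fix w
    have BY: "low_vanish (?Y w i)" if "i < N" for i by (rule low_vanish_mix) (use B\<phi> that in auto)
    have "supp_sum (\<lambda>x. tseq_det (?Y w) x * ?V x) =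
      supp_sum (\<lambda>x. tseq_det (\<lambda>i z. norm_factor (Suc k) z * (g (Suc k) z * mix w 1 (h i) z)) x * (meets_at (m (Suc k)) x * V (m p - m (Suc k)) x))"
      by (rule supp_sum_move[OF BY k(2)])
    also have "\<dots> = oints 0 (\<lambda>_. r) [Suc k..<p] (\<lambda>\<theta>.
      rdet N (\<lambda>j i. tseq (\<lambda>z. norm_factor p z * steps \<theta> (p - Suc k) (Suc k) (\<lambda>z. g (Suc k) z * mix w 1 (h i) z) z) (int j) (a p)) /
      (\<Prod>l\<in>{Suc k..<p}. \<theta> l ^ n l * (\<theta> l - 1)))"
    proof (rule Suc.hyps)
      show "d = p - Suc k" using Suc.hyps(2) by simp
      show "1 \<le> Suc k" "Suc k \<le> p" "1 < r" using k \<open>1 < r\<close> by auto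
      show "low_vanish (\<lambda>z. norm_factor (Suc k) z * (g (Suc k) z * mix w 1 (h i) z))" if "i < N" for i
        by (rule low_vanish_norm_factor_step[OF BY[OF that] k(2)])
      show "(\<lambda>z. g (Suc k) z * mix w 1 (h i) z) holomorphic_on Om" if "i < N" for i
        by (intro holomorphic_on_mult g_hol mix_hol B\<phi> that)
    qed
    finally show "supp_sum (\<lambda>x. tseq_det (?Y w) x * ?V x) / (w ^ n k * (w - 1)) = oints 0 (\<lambda>_. r) [Suc k..<p] (\<lambda>\<theta>.
      rdet N (\<lambda>j i. tseq (\<lambda>z. norm_factor p z * steps \<theta> (p - Suc k) (Suc k) (\<lambda>z. g (Suc k) z * mix w 1 (h i) z) z) (int j) (a p)) /
      (\<Prod>l\<in>{Suc k..<p}. \<theta> l ^ n l * (\<theta> l - 1))) / (w ^ n k * (w - 1))" by simp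
  qed (use \<open>1 < r\<close> in simp)
  also have "\<dots> = oints 0 (\<lambda>_. r) [k..<p] (\<lambda>\<theta>. rdet N (\<lambda>j i. tseq (\<lambda>z. norm_factor p z * steps \<theta> (p - k) k (h i) z) (int j) (a p)) /
      (\<Prod>l\<in>{k..<p}. \<theta> l ^ n l * (\<theta> l - 1)))"
  proof -
    have div: "oints c \<rho> ks F / K = oints c \<rho> ks (\<lambda>\<theta>. F \<theta> / K)" for c \<rho> ks F and K :: complex
      by (induction ks arbitrary: F) (simp_all flip: oint_divc)
    have pk: "p - k = Suc (p - Suc k)" using k by simp
    have e1: "steps (\<theta>(k := w)) (p - k) k (h i) = steps \<theta> (p - Suc k) (Suc k) (\<lambda>z. g (Suc k) z * mix w 1 (h i) z)" for \<theta> w i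
      unfolding pk by (simp, rule steps_cong) simp
    have e2: "(\<Prod>l\<in>{k..<p}. (\<theta>(k := w)) l ^ n l * ((\<theta>(k := w)) l - 1)) =
       w ^ n k * (w - 1) * (\<Prod>l\<in>{Suc k..<p}. \<theta> l ^ n l * (\<theta> l - 1))" for \<theta> w
    proof -
      have "(\<Prod>l\<in>{k..<p}. (\<theta>(k := w)) l ^ n l * ((\<theta>(k := w)) l - 1)) =
        w ^ n k * (w - 1) * (\<Prod>l\<in>{Suc k..<p}. (\<theta>(k := w)) l ^ n l * ((\<theta>(k := w)) l - 1))"
        using k by (simp add: prod.atLeast_Suc_lessThan)
      also have "(\<Prod>l\<in>{Suc k..<p}. (\<theta>(k := w)) l ^ n l * ((\<theta>(k := w)) l - 1)) =
        (\<Prod>l\<in>{Suc k..<p}. \<theta> l ^ n l * (\<theta> l - 1))"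
        by (rule prod.cong) auto
      finally show ?thesis .
    qed
    show ?thesis
      by (simp only: upt_conv_Cons[OF k(2)] oints.simps div e1 e2 divide_divide_eq_left')
  qed
  finally show ?case .
qed

definition origin :: "nat \<Rightarrow> int" where "origin = (\<lambda>j\<in>{..<N}. 0)"

lemma main_det:
  assumes B: "\<And>i. i < N \<Longrightarrow> low_vanish (u0 i)" and r: "1 < r"
    and init: "\<And>x. x \<in> states \<Longrightarrow> tseq_det u0 x = (if x = origin then e else 0)"
  shows "e * V (m p) origin =
    oints 0 (\<lambda>_. r) [1..<p] (\<lambda>\<theta>. rdet N (\<lambda>j i. tseq (\<lambda>z. norm_factor p z * steps \<theta> (p - 1) 1 (\<lambda>z. g 1 z * u0 i z) z) (int j) (a p)) /
      (\<Prod>l\<in>{1..<p}. \<theta> l ^ n l * (\<theta> l - 1)))"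
proof -
  have n0: "norm_factor 0 z = 1" for z by (simp add: norm_factor_def zero)
  have B0: "low_vanish (\<lambda>z. norm_factor 0 z * u0 i z)" if "i < N" for i using B[OF that] by (simp add: n0)
  have "supp_sum (\<lambda>x. tseq_det u0 x * V (m p) x) = e * V (m p) origin"
  proof (cases "origin \<in> states")
    case True
    have "supp_sum (\<lambda>x. tseq_det u0 x * V (m p) x) = sum (\<lambda>x. tseq_det u0 x * V (m p) x) {origin}"
      unfolding supp_sum_def by (rule sum.mono_neutral_left) (use init True in \<open>auto split: if_splits\<close>)
    then show ?thesis using init[OF True] by simp
  next
    case False
    \<comment> \<open>If the starting row is not a state, no state can follow it, and both sides are
      0.\<close>
    then have "a p \<le> 0" by (force simp: states_def origin_def)
    then have "y \<notin> succ origin" for y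
      using N_pos by (force simp: succ_def states_def origin_def)
    then have "succ origin = {}" by blast
    moreover obtain s where "m p = Suc s" using m_strict[of 0 p] p2 by (cases "m p") auto
    ultimately have "V (m p) origin = 0" by simp
    moreover have "supp_sum (\<lambda>x. tseq_det u0 x * V (m p) x) = 0"
    proof -
      have "{x \<in> states. tseq_det u0 x * V (m p) x \<noteq> 0} = {}" using init False by (auto split: if_splits)
      then show ?thesis by (simp only: supp_sum_def sum.empty)
    qed
    ultimately show ?thesis by simp
  qed
  moreover have "supp_sum (\<lambda>x. tseq_det (\<lambda>i z. norm_factor 0 z * u0 i z) x * V (m p - m 0) x) =
    supp_sum (\<lambda>x. tseq_det (\<lambda>i z. norm_factor (Suc 0) z * (g (Suc 0) z * u0 i z)) x * (meets_at (m (Suc 0)) x * V (m p - m (Suc 0)) x))"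
    by (rule supp_sum_move[OF B0]) (use p2 in auto)
  moreover have "supp_sum (\<lambda>x. tseq_det (\<lambda>i z. norm_factor 1 z * (g 1 z * u0 i z)) x * (meets_at (m 1) x * V (m p - m 1) x)) =
    oints 0 (\<lambda>_. r) [1..<p] (\<lambda>\<theta>. rdet N (\<lambda>j i. tseq (\<lambda>z. norm_factor p z * steps \<theta> (p - 1) 1 (\<lambda>z. g 1 z * u0 i z) z) (int j) (a p)) /
      (\<Prod>l\<in>{1..<p}. \<theta> l ^ n l * (\<theta> l - 1)))"
  proof (rule supp_sum_chain)
    show "low_vanish (\<lambda>z. norm_factor 1 z * (g 1 z * u0 i z))" if "i < N" for i
      using low_vanish_norm_factor_step[OF B0[OF that]] p2 by simp
    show "(\<lambda>z. g 1 z * u0 i z) holomorphic_on Om" if "i < N" for i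
      by (intro holomorphic_on_mult g_hol low_vanish_hol B that)
  qed (use p2 r in auto)
  ultimately show ?thesis by (simp add: n0 zero)
qed

fun full_chain :: "(nat \<Rightarrow> complex) \<Rightarrow> (nat \<Rightarrow> complex) \<Rightarrow> (complex \<Rightarrow> complex) \<Rightarrow> nat \<Rightarrow> complex \<Rightarrow> complex" where
  "full_chain t1 t2 u0 0 = u0"
| "full_chain t1 t2 u0 (Suc k) = mix (t1 (Suc k)) (t2 (Suc k)) (\<lambda>z. g (Suc k) z * full_chain t1 t2 u0 k z)"

lemma steps_full_chain: "1 \<le> k \<Longrightarrow> steps \<theta> d k (\<lambda>z. g k z * full_chain \<theta> (\<lambda>_. 1) u0 (k - 1) z) = (\<lambda>z. g (k + d) z * full_chain \<theta> (\<lambda>_. 1) u0 (k + d - 1) z)"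
proof (induction d arbitrary: k)
  case (Suc d)
  obtain k' where k': "k = Suc k'" using Suc.prems by (cases k) auto
  have "steps \<theta> (Suc d) k (\<lambda>z. g k z * full_chain \<theta> (\<lambda>_. 1) u0 (k - 1) z) =
    steps \<theta> d (Suc k) (\<lambda>z. g (Suc k) z * full_chain \<theta> (\<lambda>_. 1) u0 (Suc k - 1) z)"
    by (simp add: k')
  also have "\<dots> = (\<lambda>z. g (Suc k + d) z * full_chain \<theta> (\<lambda>_. 1) u0 (Suc k + d - 1) z)"
    by (rule Suc.IH) simp
  finally show ?case by simp
qed simp

section \<open>Separating the principal parts\<close>

definition mix1 :: "complex \<Rightarrow> complex \<Rightarrow> (complex \<Rightarrow> complex) \<Rightarrow> complex \<Rightarrow> complex" where
  "mix1 t1 t2 h z = t1 * h z - (t1 - t2) * P1 h z"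

lemma mix1_hol: "h holomorphic_on Om \<Longrightarrow> mix1 t1 t2 h holomorphic_on Om"
  unfolding mix1_def[abs_def] by (intro holomorphic_intros P1_hol)

lemma step_factor_denom_Ex: "z \<in> Ex \<Longrightarrow> 1 - z \<noteq> 0"
  using q0 by (auto simp: Ex_def)

lemma G_star_Ex: "0 \<le> i \<Longrightarrow> (\<lambda>z. G_star q z i j k) holomorphic_on Ex"
  unfolding G_star_def
  by (intro holomorphic_on_divide holomorphic_on_mult holomorphic_on_power_int holomorphic_intros disjI2 ballI disjI1)
     (use step_factor_denom step_factor_denom_Ex q1 in auto)

lemma g_Ex:
  assumes "1 \<le> k" "k \<le> p" shows "g k holomorphic_on Ex"
proof -
  have "n (k - 1) \<le> n k" by (rule n_mono) (use assms in auto)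
  then show ?thesis unfolding g_def[abs_def] by (intro G_star_Ex) simp
qed

lemma P1_cong: "z \<in> Ex \<Longrightarrow> (\<And>w. w \<in> Om \<Longrightarrow> f w = h w) \<Longrightarrow> P1 f z = P1 h z"
  by (rule prin_cong) (use q0 q1 annulus1_Om in \<open>auto simp: Ex_def\<close>)

lemma P0_cong: "z \<noteq> 0 \<Longrightarrow> (\<And>w. w \<in> Om \<Longrightarrow> f w = h w) \<Longrightarrow> P0 f z = P0 h z"
  by (rule prin_cong) (use q0 q1 annulus0_Om in auto)

lemma P1_add: "f holomorphic_on Om \<Longrightarrow> h holomorphic_on Om \<Longrightarrow> z \<in> Ex \<Longrightarrow> P1 (\<lambda>w. f w + h w) z = P1 f z + P1 h z"
  by (rule prin_add[OF hol_annulus1 hol_annulus1]; (assumption | simp add: Ex_def less_imp_le[OF q0] q1))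

lemma P1_sum:
  assumes "\<And>i. i \<in> A \<Longrightarrow> f i holomorphic_on Om" "z \<in> Ex"
  shows "P1 (\<lambda>w. \<Sum>i\<in>A. c i * f i w) z = (\<Sum>i\<in>A. c i * P1 (f i) z)"
proof (cases "finite A")
  case True
  then show ?thesis using assms(1)
  proof (induction A)
    case empty
    then show ?case using prin_cmul[of 1 q 1 0 "\<lambda>_. 0" z] by simp
  next
    case (insert i A)
    have "P1 (\<lambda>w. \<Sum>i\<in>insert i A. c i * f i w) z = P1 (\<lambda>w. c i * f i w + (\<Sum>i\<in>A. c i * f i w)) z"
      using insert by simp
    also have "\<dots> = P1 (\<lambda>w. c i * f i w) z + P1 (\<lambda>w. \<Sum>i\<in>A. c i * f i w) z"
      using insert.prems assms(2) by (intro P1_add holomorphic_on_mult holomorphic_on_sum holomorphic_on_const) auto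
    finally show ?case using insert by (simp add: prin_cmul)
  qed
next
  case False
  then show ?thesis using prin_cmul[of 1 q 1 0 "\<lambda>_. 0" z] by simp
qed

lemma full_chain_hol: "u0 holomorphic_on Om \<Longrightarrow> full_chain t1 t2 u0 k holomorphic_on Om"
proof (induction k)
  case (Suc k)
  have "(\<lambda>z. g (Suc k) z * full_chain t1 t2 u0 k z) holomorphic_on Om"
    by (rule holomorphic_on_mult[OF g_hol Suc.IH[OF Suc.prems]])
  then show ?case by (simp only: full_chain.simps mix_hol)
qed simp

definition g_prod :: "nat \<Rightarrow> nat \<Rightarrow> complex \<Rightarrow> complex" where
  "g_prod i j z = (\<Prod>l\<in>{i..j}. g l z)"

lemma g_prod_Ex: "1 \<le> i \<Longrightarrow> j \<le> p \<Longrightarrow> g_prod i j holomorphic_on Ex"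
  unfolding g_prod_def[abs_def] by (intro holomorphic_on_prod g_Ex) auto

text \<open>Modulo functions regular at 0 one has \<open>P0 h\<close> = \<open>h\<close> and
  \<open>P1 h\<close> = 0, so \<open>mix\<close> multiplies by its second parameter. All truncations
  up to \<open>k\<close> therefore leave only a constant factor.\<close>

lemma P0_full_chain:
  assumes u0: "u0 holomorphic_on Om" and "u holomorphic_on Ex" "k \<le> p" and z: "z \<noteq> 0"
  shows "P0 (\<lambda>w. u w * full_chain t1 t2 u0 k w) z = (\<Prod>l\<in>{1..k}. t2 l) * P0 (\<lambda>w. u w * g_prod 1 k w * u0 w) z"
  using assms(2,3)
proof (induction k arbitrary: u)
  case 0 then show ?case by (simp add: g_prod_def)
next
  case (Suc k)
  define h where "h = (\<lambda>z. g (Suc k) z * full_chain t1 t2 u0 k z)"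
  have h: "h holomorphic_on Om" unfolding h_def by (rule holomorphic_on_mult[OF g_hol full_chain_hol[OF u0]])
  have r: "0 \<le> (0::real)" "0 < 1 - q" "0 < cmod (z - 0)" using q1 z by auto
  note u = Suc.prems(1)
  have hh: "(\<lambda>w. u w * h w) holomorphic_on Om" "(\<lambda>w. u w * P1 h w) holomorphic_on Ex" "(\<lambda>w. u w * P0 h w) holomorphic_on Om"
    using h by (auto intro!: holomorphic_on_mult Ex_Om[OF u] u P1_Ex P0_hol)
  define c1 c2 where "c1 = t1 (Suc k)" and "c2 = t2 (Suc k)"
  have "P0 (\<lambda>w. u w * full_chain t1 t2 u0 (Suc k) w) z = P0 (\<lambda>w. c1 * (u w * h w) - (c1 - c2) * (u w * P1 h w + u w * P0 h w)) z"
    by (rule P0_cong[OF z]) (simp add: mix_def h_def[symmetric] c1_def[symmetric] c2_def[symmetric] algebra_simps)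
  also have "\<dots> = P0 (\<lambda>w. c1 * (u w * h w)) z - P0 (\<lambda>w. (c1 - c2) * (u w * P1 h w + u w * P0 h w)) z"
    by (intro prin_diff hol_annulus0 holomorphic_on_mult[OF holomorphic_on_const] holomorphic_on_add hh(1) Ex_Om[OF hh(2)] hh(3) r)
  also have "P0 (\<lambda>w. (c1 - c2) * (u w * P1 h w + u w * P0 h w)) z = (c1 - c2) * (P0 (\<lambda>w. u w * P1 h w) z + P0 (\<lambda>w. u w * P0 h w) z)"
    unfolding prin_cmul by (subst prin_add[OF hol_annulus0[OF Ex_Om[OF hh(2)]] hol_annulus0[OF hh(3)] r]) simp
  also have "P0 (\<lambda>w. u w * P1 h w) z = 0" by (rule prin_eq_0[OF Ex_ball0[OF hh(2)] r])
  also have "P0 (\<lambda>w. u w * P0 h w) z = P0 (\<lambda>w. u w * h w) z"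
    by (rule prin_mult_prin[OF Ex_ball0[OF u] hol_annulus0[OF h] r])
  also have "P0 (\<lambda>w. c1 * (u w * h w)) z = c1 * P0 (\<lambda>w. u w * h w) z" by (rule prin_cmul)
  also have "P0 (\<lambda>w. u w * h w) z = P0 (\<lambda>w. (u w * g (Suc k) w) * full_chain t1 t2 u0 k w) z"
    by (simp add: h_def mult.assoc)
  also have "\<dots> = (\<Prod>l\<in>{1..k}. t2 l) * P0 (\<lambda>w. u w * g (Suc k) w * g_prod 1 k w * u0 w) z"
    by (rule Suc.IH) (use Suc.prems in \<open>auto intro!: holomorphic_on_mult g_Ex\<close>)
  also have "(\<lambda>w. u w * g (Suc k) w * g_prod 1 k w * u0 w) = (\<lambda>w. u w * g_prod 1 (Suc k) w * u0 w)"
    by (simp add: g_prod_def mult_ac fun_eq_iff)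
  finally show ?case by (simp add: c2_def algebra_simps)
qed

definition left_fun :: "(complex \<Rightarrow> complex) \<Rightarrow> nat \<Rightarrow> complex \<Rightarrow> complex" where
  "left_fun u0 k = (if k = 0 then u0 else P0 (\<lambda>z. g_prod 1 k z * u0 z))"

text \<open>The term in which the last principal part at 0 is taken at \<open>k1\<close>: everything
  before has collapsed to \<open>left_fun\<close>, and afterwards only principal parts at 1 occur.
  For \<open>k1 = 0\<close> none at 0 is taken; the value 0 below \<open>k1\<close> makes the
  recursion total.\<close>

fun lchain :: "(nat \<Rightarrow> complex) \<Rightarrow> (nat \<Rightarrow> complex) \<Rightarrow> (complex \<Rightarrow> complex) \<Rightarrow> nat \<Rightarrow> nat \<Rightarrow> complex \<Rightarrow> complex" where
  "lchain t1 t2 u0 k1 0 = (if k1 = 0 then u0 else (\<lambda>_. 0))"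
| "lchain t1 t2 u0 k1 (Suc k) = (if k1 = Suc k then left_fun u0 k1
     else if k1 < Suc k then mix1 (t1 (Suc k)) (t2 (Suc k)) (\<lambda>z. g (Suc k) z * lchain t1 t2 u0 k1 k z) else (\<lambda>_. 0))"

lemma lchain_start: "lchain t1 t2 u0 k k = left_fun u0 k"
  by (cases k) (auto simp: left_fun_def)

lemma left_fun_hol:
  assumes "u0 holomorphic_on Om" shows "left_fun u0 k holomorphic_on Om"
proof (cases "k = 0")
  case False
  have "g_prod 1 k holomorphic_on Om" unfolding g_prod_def[abs_def] by (intro holomorphic_on_prod g_hol)
  then show ?thesis using False by (simp add: left_fun_def P0_hol holomorphic_on_mult assms)
qed (simp add: left_fun_def assms)

lemma lchain_hol:
  assumes "u0 holomorphic_on Om" shows "lchain t1 t2 u0 k1 k holomorphic_on Om"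
proof (induction k)
  case (Suc k)
  have "(\<lambda>z. g (Suc k) z * lchain t1 t2 u0 k1 k z) holomorphic_on Om"
    by (rule holomorphic_on_mult[OF g_hol Suc.IH])
  then show ?case using left_fun_hol[OF assms] by (simp add: mix1_hol)
qed (simp add: assms)

text \<open>The weight of the cut at \<open>k1\<close>: minus \<open>t1 - t2\<close> from the term
  with \<open>P0\<close> in \<open>mix\<close>, and one \<open>t2\<close> for each earlier
  truncation by \<open>P0_full_chain\<close>. On the right side the later truncations contribute
  \<open>t1\<close> instead.\<close>

definition coef_left :: "(nat \<Rightarrow> complex) \<Rightarrow> (nat \<Rightarrow> complex) \<Rightarrow> nat \<Rightarrow> complex" where
  "coef_left t1 t2 k = (if k = 0 then 1 else - ((t1 k - t2 k) * (\<Prod>l\<in>{1..<k}. t2 l)))"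

definition coef_right :: "(nat \<Rightarrow> complex) \<Rightarrow> (nat \<Rightarrow> complex) \<Rightarrow> nat \<Rightarrow> complex" where
  "coef_right t1 t2 k = (if k = p then 1 else (t1 k - t2 k) * (\<Prod>l\<in>{Suc k..<p}. t1 l))"

lemma full_chain_expand:
  assumes u0: "u0 holomorphic_on Om" and "k \<le> p" "z \<in> Om"
  shows "full_chain t1 t2 u0 k z = (\<Sum>k1\<le>k. coef_left t1 t2 k1 * lchain t1 t2 u0 k1 k z)"
  using assms(2,3)
proof (induction k arbitrary: z)
  case 0 then show ?case by (simp add: coef_left_def)
next
  case (Suc k)
  let ?h = "\<lambda>z. g (Suc k) z * full_chain t1 t2 u0 k z"
  let ?s = "\<lambda>k1 z. g (Suc k) z * lchain t1 t2 u0 k1 k z"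
  define c1 c2 where "c1 = t1 (Suc k)" and "c2 = t2 (Suc k)"
  have z: "z \<in> Ex" "z \<noteq> 0" using Suc.prems by (auto simp: Om_eq)
  have h: "?h w = (\<Sum>k1\<le>k. coef_left t1 t2 k1 * ?s k1 w)" if "w \<in> Om" for w
    using Suc.IH[OF _ that] Suc.prems by (simp add: sum_distrib_left mult_ac)
  have "P1 ?h z = P1 (\<lambda>w. \<Sum>k1\<le>k. coef_left t1 t2 k1 * ?s k1 w) z" by (rule P1_cong[OF z(1) h])
  also have "\<dots> = (\<Sum>k1\<le>k. coef_left t1 t2 k1 * P1 (?s k1) z)"
    by (intro P1_sum holomorphic_on_mult g_hol lchain_hol u0 z)
  finally have 1: "P1 ?h z = (\<Sum>k1\<le>k. coef_left t1 t2 k1 * P1 (?s k1) z)" .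
  have "P0 ?h z = (\<Prod>l\<in>{1..k}. t2 l) * P0 (\<lambda>w. g (Suc k) w * g_prod 1 k w * u0 w) z"
    by (rule P0_full_chain[OF u0]) (use Suc.prems z g_Ex in auto)
  also have "P0 (\<lambda>w. g (Suc k) w * g_prod 1 k w * u0 w) z = left_fun u0 (Suc k) z"
    by (simp add: left_fun_def g_prod_def mult_ac)
  finally have 0: "- ((c1 - c2) * P0 ?h z) = coef_left t1 t2 (Suc k) * lchain t1 t2 u0 (Suc k) (Suc k) z"
    by (simp add: coef_left_def c1_def c2_def atLeastLessThanSuc_atLeastAtMost)
  have "full_chain t1 t2 u0 (Suc k) z = (c1 * ?h z - (c1 - c2) * P1 ?h z) + - ((c1 - c2) * P0 ?h z)"
    by (simp add: mix_def c1_def c2_def algebra_simps)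
  also have "c1 * ?h z - (c1 - c2) * P1 ?h z = (\<Sum>k1\<le>k. coef_left t1 t2 k1 * (c1 * ?s k1 z - (c1 - c2) * P1 (?s k1) z))"
    unfolding 1 h[OF Suc.prems(2)] sum_distrib_left sum_subtractf[symmetric]
    by (rule sum.cong) (simp_all add: algebra_simps)
  also have "\<dots> = (\<Sum>k1\<le>k. coef_left t1 t2 k1 * lchain t1 t2 u0 k1 (Suc k) z)"
    by (rule sum.cong) (simp_all add: mix1_def c1_def c2_def)
  finally show ?case unfolding 0 by (simp only: sum.atMost_Suc)
qed

text \<open>Both sides are the double integral of s(z) h(w)/(z - w) over small circles around 0 and
  1: integrating \<open>w\<close> first gives \<open>P1 h\<close>, integrating \<open>z\<close>
  first gives minus \<open>P0 s\<close>. A principal part is thus moved from the left function to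
  the right one.\<close>

lemma oint_P1_swap:
  assumes s: "s holomorphic_on Om" and h: "h holomorphic_on Om"
    and R: "q < R" "R < 1" and \<tau>: "0 < \<tau>" "\<tau> < 1 - q"
  shows "oint 0 \<tau> (\<lambda>z. s z * P1 h z) = - oint 1 R (\<lambda>z. P0 s z * h z)"
proof -
  define \<tau>' where "\<tau>' = min \<tau> ((1 - R) / 2)"
  have \<tau>': "0 < \<tau>'" "\<tau>' < 1 - q" "\<tau>' < 1 - R" using R \<tau> by (auto simp: \<tau>'_def min_def)
  have far: "R < cmod (z - 1)" if "cmod z = \<tau>'" for z
    using norm_triangle_ineq4[of z "z - 1"] that \<tau>' by simp
  have far': "\<tau>' < cmod w" if "cmod (w - 1) = R" for w
    using norm_triangle_ineq4[of w "w - 1"] that \<tau>' by simp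
  have "oint 0 \<tau> (\<lambda>z. s z * P1 h z) = oint 0 \<tau>' (\<lambda>z. s z * P1 h z)"
    by (rule oint_radius[OF hol_annulus0[OF holomorphic_on_mult[OF s P1_hol[OF h]]]]) (use \<tau> \<tau>' in auto)
  also have "\<dots> = oint 0 \<tau>' (\<lambda>z. oint 1 R (\<lambda>w. s z * (h w / (z - w))))"
  proof (rule oint_cong)
    fix z assume z: "cmod (z - 0) = \<tau>'"
    have "P1 h z = oint 1 R (\<lambda>w. h w / (z - w))"
      by (rule prin_radius[OF hol_annulus1[OF h]]) (use q0 R far[of z] z in auto)
    then show "s z * P1 h z = oint 1 R (\<lambda>w. s z * (h w / (z - w)))" by (simp only: oint_cmul)
  qed (use \<tau>' in auto)
  also have "\<dots> = oint 1 R (\<lambda>w. oint 0 \<tau>' (\<lambda>z. s z * (h w / (z - w))))"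
  proof (rule oint_swap)
    have "continuous_on (sphere 0 \<tau>') s" by (rule hol_cont_sphere[OF hol_annulus0[OF s]]) (use \<tau>' in auto)
    then have 1: "continuous_on (sphere 0 \<tau>' \<times> sphere 1 R) (\<lambda>x. s (fst x))"
      by (rule continuous_on_compose2) (auto intro!: continuous_intros)
    have "continuous_on (sphere 1 R) h" by (rule hol_cont_sphere[OF hol_annulus1[OF h]]) (use R in auto)
    then have 2: "continuous_on (sphere 0 \<tau>' \<times> sphere 1 R) (\<lambda>x. h (snd x))"
      by (rule continuous_on_compose2) (auto intro!: continuous_intros)
    have ne: "z \<noteq> w" if "z \<in> sphere 0 \<tau>'" "w \<in> sphere 1 R" for z w :: complex
      using far[of z] that by (auto simp: dist_norm norm_minus_commute)
    show "continuous_on (sphere 0 \<tau>' \<times> sphere 1 R) (\<lambda>(z, w). s z * (h w / (z - w)))"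
      unfolding case_prod_beta
    proof (intro continuous_intros 1 2)
      show "\<forall>x\<in>sphere (0::complex) \<tau>' \<times> sphere 1 R. fst x - snd x \<noteq> 0"
      proof
        fix x :: "complex \<times> complex" assume "x \<in> sphere 0 \<tau>' \<times> sphere 1 R"
        then show "fst x - snd x \<noteq> 0" using ne[of "fst x" "snd x"] by (simp only: mem_Times_iff right_minus_eq) simp
      qed
    qed
  qed (use \<tau>' R q0 in auto)
  also have "\<dots> = oint 1 R (\<lambda>w. - (P0 s w * h w))"
  proof (rule oint_cong)
    fix w assume w: "cmod (w - 1) = R"
    have "P0 s w = oint 0 \<tau>' (\<lambda>z. s z / (w - z))"
      by (rule prin_radius[OF hol_annulus0[OF s]]) (use far'[OF w] \<tau>' in auto)
    moreover have "oint 0 \<tau>' (\<lambda>z. s z * (h w / (z - w))) = oint 0 \<tau>' (\<lambda>z. - (s z / (w - z) * h w))"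
    proof (rule oint_cong)
      fix z
      have "h w / (z - w) = - (h w / (w - z))" by (metis minus_diff_eq minus_divide_right)
      then show "s z * (h w / (z - w)) = - (s z / (w - z) * h w)" by simp
    qed (use \<tau>' in auto)
    ultimately show "oint 0 \<tau>' (\<lambda>z. s z * (h w / (z - w))) = - (P0 s w * h w)"
      by (simp only: oint_neg oint_mulc)
  qed (use R q0 in auto)
  finally show ?thesis by (simp only: oint_neg)
qed

section \<open>Expansion from the right and the pairing of both ends\<close>

definition right_prod :: "(complex \<Rightarrow> complex) \<Rightarrow> nat \<Rightarrow> complex \<Rightarrow> complex" where
  "right_prod \<rho> k z = \<rho> z * g_prod (Suc k) p z"

definition right_fun :: "(complex \<Rightarrow> complex) \<Rightarrow> nat \<Rightarrow> complex \<Rightarrow> complex" where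
  "right_fun \<rho> k = (if k = p then \<rho> else P0 (right_prod \<rho> k))"

lemma right_prod_hol: "\<rho> holomorphic_on Om \<Longrightarrow> right_prod \<rho> k holomorphic_on Om"
  unfolding right_prod_def[abs_def] g_prod_def by (intro holomorphic_on_mult holomorphic_on_prod g_hol)

lemma right_prod_step: "1 \<le> k \<Longrightarrow> k \<le> p \<Longrightarrow> right_prod \<rho> k z * g k z = right_prod \<rho> (k - 1) z"
proof -
  assume k: "1 \<le> k" "k \<le> p"
  then have "{k..p} = insert k {Suc k..p}" by auto
  then show ?thesis using k by (simp add: right_prod_def g_prod_def mult_ac)
qed

lemma right_fun_hol: "\<rho> holomorphic_on Om \<Longrightarrow> right_fun \<rho> k holomorphic_on Om"
  by (simp add: right_fun_def P0_hol right_prod_hol)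

text \<open>The contribution with the principal parts at 0 taken at \<open>k1\<close> on the left
  and at \<open>k2\<close> on the right. With the parameters \<open>sel1\<close> and
  \<open>sel2\<close> these are, up to normalisation, the integrals that enter
  \<open>A2_block\<close>.\<close>

definition pairing where
  "pairing t1 t2 u0 \<rho> k1 k2 = oint 1 ((1 + q) / 2) (\<lambda>z. right_fun \<rho> k2 z * (g k2 z * lchain t1 t2 u0 k1 (k2 - 1) z))"

definition pairing0 where
  "pairing0 u0 \<rho> k = oint 0 ((1 - q) / 2) (\<lambda>z. right_prod \<rho> k z * left_fun u0 k z)"

text \<open>Each \<open>mix1\<close> splits into \<open>t1\<close> times the shorter chain and a
  term with \<open>P1\<close>, which \<open>oint_P1_swap\<close> converts into a pairing cut at that
  index. The recursion ends at \<open>k1\<close>, where only \<open>left_fun\<close> is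
  left.\<close>

lemma right_expand:
  assumes u0: "u0 holomorphic_on Om" and \<rho>: "\<rho> holomorphic_on Om" and "k1 \<le> k" "k < p"
  shows "oint 0 ((1 - q) / 2) (\<lambda>z. right_prod \<rho> k z * lchain t1 t2 u0 k1 k z) =
    (\<Sum>k2\<in>{Suc k1..k}. (t1 k2 - t2 k2) * (\<Prod>l\<in>{Suc k2..k}. t1 l) * pairing t1 t2 u0 \<rho> k1 k2)
    + (\<Prod>l\<in>{Suc k1..k}. t1 l) * pairing0 u0 \<rho> k1"
  using assms(3,4)
proof (induction k rule: dec_induct)
  case base
  then show ?case by (simp add: pairing0_def lchain_start)
next
  case (step k)
  let ?\<tau> = "(1 - q) / 2"
  have \<tau>: "0 < ?\<tau>" "?\<tau> < 1 - q" using q1 by auto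
  let ?h = "\<lambda>z. g (Suc k) z * lchain t1 t2 u0 k1 k z"
  have h: "?h holomorphic_on Om" by (intro holomorphic_on_mult g_hol lchain_hol u0)
  have cont: "continuous_on (sphere 0 ?\<tau>) f" if "f holomorphic_on Om" for f
    by (rule hol_cont_sphere[OF hol_annulus0[OF that] \<tau>])
  define c1 c2 where "c1 = t1 (Suc k)" and "c2 = t2 (Suc k)"
  have "oint 0 ?\<tau> (\<lambda>z. right_prod \<rho> (Suc k) z * lchain t1 t2 u0 k1 (Suc k) z) =
    oint 0 ?\<tau> (\<lambda>z. c1 * (right_prod \<rho> k z * lchain t1 t2 u0 k1 k z) - (c1 - c2) * (right_prod \<rho> (Suc k) z * P1 ?h z))"
  proof (rule oint_cong)
    fix z
    have e: "right_prod \<rho> (Suc k) z * g (Suc k) z = right_prod \<rho> k z" using right_prod_step[of "Suc k" \<rho> z] step.prems by simp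
    show "right_prod \<rho> (Suc k) z * lchain t1 t2 u0 k1 (Suc k) z =
      c1 * (right_prod \<rho> k z * lchain t1 t2 u0 k1 k z) - (c1 - c2) * (right_prod \<rho> (Suc k) z * P1 ?h z)"
      using step.hyps unfolding e[symmetric] by (simp add: mix1_def c1_def c2_def algebra_simps)
  qed (use \<tau> in simp)
  also have "\<dots> = c1 * oint 0 ?\<tau> (\<lambda>z. right_prod \<rho> k z * lchain t1 t2 u0 k1 k z) - (c1 - c2) * oint 0 ?\<tau> (\<lambda>z. right_prod \<rho> (Suc k) z * P1 ?h z)"
    by (subst oint_diff) (use \<tau> in \<open>simp_all add: oint_cmul cont holomorphic_on_mult right_prod_hol \<rho> lchain_hol u0 P1_hol h\<close>)
  also have "oint 0 ?\<tau> (\<lambda>z. right_prod \<rho> (Suc k) z * P1 ?h z) = - oint 1 ((1 + q) / 2) (\<lambda>z. P0 (right_prod \<rho> (Suc k)) z * ?h z)"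
    by (rule oint_P1_swap[OF right_prod_hol[OF \<rho>] h]) (use q0 q1 in auto)
  also have "oint 1 ((1 + q) / 2) (\<lambda>z. P0 (right_prod \<rho> (Suc k)) z * ?h z) = pairing t1 t2 u0 \<rho> k1 (Suc k)"
    using step.prems by (simp add: pairing_def right_fun_def)
  finally have e: "oint 0 ?\<tau> (\<lambda>z. right_prod \<rho> (Suc k) z * lchain t1 t2 u0 k1 (Suc k) z) =
    c1 * oint 0 ?\<tau> (\<lambda>z. right_prod \<rho> k z * lchain t1 t2 u0 k1 k z) + (c1 - c2) * pairing t1 t2 u0 \<rho> k1 (Suc k)" by simp
  have i1: "{Suc k1..Suc k} = insert (Suc k) {Suc k1..k}" using step.hyps by auto
  have "(\<Sum>k2\<in>{Suc k1..k}. (t1 k2 - t2 k2) * (\<Prod>l\<in>{Suc k2..Suc k}. t1 l) * pairing t1 t2 u0 \<rho> k1 k2) =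
     c1 * (\<Sum>k2\<in>{Suc k1..k}. (t1 k2 - t2 k2) * (\<Prod>l\<in>{Suc k2..k}. t1 l) * pairing t1 t2 u0 \<rho> k1 k2)"
    unfolding sum_distrib_left by (rule sum.cong) (auto simp: c1_def)
  moreover have "oint 0 ?\<tau> (\<lambda>z. right_prod \<rho> k z * lchain t1 t2 u0 k1 k z) =
    (\<Sum>k2\<in>{Suc k1..k}. (t1 k2 - t2 k2) * (\<Prod>l\<in>{Suc k2..k}. t1 l) * pairing t1 t2 u0 \<rho> k1 k2)
    + (\<Prod>l\<in>{Suc k1..k}. t1 l) * pairing0 u0 \<rho> k1"
    using step.IH step.prems by simp
  ultimately show ?case unfolding e i1 by (simp add: c1_def c2_def algebra_simps)
qed

lemma big_expand:
  assumes u0: "u0 holomorphic_on Om" and \<rho>: "\<rho> holomorphic_on Om" and Rb: "1 < Rb"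
  shows "oint 1 Rb (\<lambda>z. \<rho> z * (g p z * full_chain t1 t2 u0 (p - 1) z)) =
    (\<Sum>k1<p. coef_left t1 t2 k1 * ((\<Sum>k2\<in>{Suc k1..p}. coef_right t1 t2 k2 * pairing t1 t2 u0 \<rho> k1 k2)
      + (\<Prod>l\<in>{Suc k1..<p}. t1 l) * pairing0 u0 \<rho> k1))"
proof -
  have pm: "{..p - 1} = {..<p}" using p2 by auto
  let ?f = "\<lambda>k1 z. \<rho> z * (g p z * lchain t1 t2 u0 k1 (p - 1) z)"
  have hf: "?f k1 holomorphic_on Om" for k1 by (intro holomorphic_on_mult g_hol lchain_hol u0 \<rho>)
  have "oint 1 Rb (\<lambda>z. \<rho> z * (g p z * full_chain t1 t2 u0 (p - 1) z)) = oint 1 Rb (\<lambda>z. \<Sum>k1<p. coef_left t1 t2 k1 * ?f k1 z)"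
  proof (rule oint_cong)
    fix z assume "cmod (z - 1) = Rb"
    then have "z \<in> Om" using in_Om[of z Rb] Rb q1 by auto
    then show "\<rho> z * (g p z * full_chain t1 t2 u0 (p - 1) z) = (\<Sum>k1<p. coef_left t1 t2 k1 * ?f k1 z)"
      using full_chain_expand[OF u0, of "p - 1" z t1 t2, unfolded pm] by (simp add: sum_distrib_left mult_ac)
  qed (use Rb in simp)
  also have "\<dots> = (\<Sum>k1<p. oint 1 Rb (\<lambda>z. coef_left t1 t2 k1 * ?f k1 z))"
  proof (rule oint_sum)
    show "continuous_on (sphere 1 Rb) (\<lambda>z. coef_left t1 t2 k1 * ?f k1 z)" for k1
      by (rule sphere_Om[OF holomorphic_on_mult[OF holomorphic_on_const hf]]) (use Rb q1 in simp_all)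
  qed (use Rb in simp)
  also have "\<dots> = (\<Sum>k1<p. coef_left t1 t2 k1 * ((\<Sum>k2\<in>{Suc k1..p}. coef_right t1 t2 k2 * pairing t1 t2 u0 \<rho> k1 k2)
      + (\<Prod>l\<in>{Suc k1..<p}. t1 l) * pairing0 u0 \<rho> k1))"
  proof (rule sum.cong)
    fix k1 assume k1: "k1 \<in> {..<p}"
    have "oint 1 Rb (?f k1) = oint 1 ((1 + q) / 2) (?f k1) + oint 0 ((1 - q) / 2) (?f k1)"
      by (rule big_split[OF hf Rb]) (use q1 in auto)
    \<comment> \<open>The circle around 1 is the term \<open>k2 = p\<close>, with no cut on the
      right; the circle around 0 supplies all smaller \<open>k2\<close> and a residue at
      \<open>k1\<close>.\<close>
    also have "oint 1 ((1 + q) / 2) (?f k1) = pairing t1 t2 u0 \<rho> k1 p" by (simp add: pairing_def right_fun_def)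
    also have "oint 0 ((1 - q) / 2) (?f k1) = oint 0 ((1 - q) / 2) (\<lambda>z. right_prod \<rho> (p - 1) z * lchain t1 t2 u0 k1 (p - 1) z)"
      using p2 by (intro arg_cong[of _ _ "oint 0 ((1 - q) / 2)"]) (simp add: right_prod_def g_prod_def fun_eq_iff mult_ac)
    also have "\<dots> =
      (\<Sum>k2\<in>{Suc k1..p - 1}. (t1 k2 - t2 k2) * (\<Prod>l\<in>{Suc k2..p - 1}. t1 l) * pairing t1 t2 u0 \<rho> k1 k2)
      + (\<Prod>l\<in>{Suc k1..p - 1}. t1 l) * pairing0 u0 \<rho> k1"
      by (rule right_expand[OF u0 \<rho>]) (use k1 p2 in auto)
    also have "(\<Sum>k2\<in>{Suc k1..p - 1}. (t1 k2 - t2 k2) * (\<Prod>l\<in>{Suc k2..p - 1}. t1 l) * pairing t1 t2 u0 \<rho> k1 k2) =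
      (\<Sum>k2\<in>{Suc k1..p - 1}. coef_right t1 t2 k2 * pairing t1 t2 u0 \<rho> k1 k2)"
    proof (rule sum.cong)
      fix k2 assume "k2 \<in> {Suc k1..p - 1}"
      moreover have "{Suc k2..p - 1} = {Suc k2..<p}" using p2 by auto
      ultimately show "(t1 k2 - t2 k2) * (\<Prod>l\<in>{Suc k2..p - 1}. t1 l) * pairing t1 t2 u0 \<rho> k1 k2 = coef_right t1 t2 k2 * pairing t1 t2 u0 \<rho> k1 k2"
        using p2 by (auto simp: coef_right_def)
    qed simp
    finally have "oint 1 Rb (?f k1) = (pairing t1 t2 u0 \<rho> k1 p + (\<Sum>k2\<in>{Suc k1..p - 1}. coef_right t1 t2 k2 * pairing t1 t2 u0 \<rho> k1 k2))
      + (\<Prod>l\<in>{Suc k1..p - 1}. t1 l) * pairing0 u0 \<rho> k1" by simp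
    also have "pairing t1 t2 u0 \<rho> k1 p + (\<Sum>k2\<in>{Suc k1..p - 1}. coef_right t1 t2 k2 * pairing t1 t2 u0 \<rho> k1 k2) =
      (\<Sum>k2\<in>{Suc k1..p}. coef_right t1 t2 k2 * pairing t1 t2 u0 \<rho> k1 k2)"
    proof -
      have i: "{Suc k1..p} = insert p {Suc k1..p - 1}" "p \<notin> {Suc k1..p - 1}" using k1 p2 by auto
      have "coef_right t1 t2 p = 1" by (simp add: coef_right_def)
      then show ?thesis unfolding i(1) sum.insert[OF finite_atLeastAtMost i(2)] by simp
    qed
    also have "{Suc k1..p - 1} = {Suc k1..<p}" using p2 by auto
    finally show "oint 1 Rb (\<lambda>z. coef_left t1 t2 k1 * ?f k1 z) = coef_left t1 t2 k1 * ((\<Sum>k2\<in>{Suc k1..p}. coef_right t1 t2 k2 * pairing t1 t2 u0 \<rho> k1 k2)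
      + (\<Prod>l\<in>{Suc k1..<p}. t1 l) * pairing0 u0 \<rho> k1)"
      by (simp only: oint_cmul)
  qed simp
  finally show ?thesis .
qed

end

section \<open>The entries as contour integrals\<close>

lemma G_star_minus: "1 / G_star q z i j k = G_star q z (- i) (- j) (- k)"
proof -
  have "(1 - z) powi (- k + - j) = inverse ((1 - z) powi (k + j))"
    by (metis minus_add_distrib power_int_minus)
  then show ?thesis by (simp add: G_star_def power_int_minus divide_inverse mult_ac)
qed

context pts begin

lemma G_star_add:
  assumes "z \<in> Om"
  shows "G_star q z i j k * G_star q z i' j' k' = G_star q z (i + i') (j + j') (k + k')"
  using OmD[OF assms] by (simp add: G_star_def power_int_add field_simps)

lemma g_prod_eq:
  assumes z: "z \<in> Om" and k: "k \<le> l" "l \<le> p"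
  shows "g_prod (Suc k) l z = G_star q z (int (n l) - int (n k)) (int (m l) - int (m k)) (a l - a k)"
  using k
proof (induction l rule: dec_induct)
  case base
  then show ?case using OmD[OF z] by (simp add: g_prod_def G_star_def)
next
  case (step l)
  have "g_prod (Suc k) (Suc l) z = g_prod (Suc k) l z * g (Suc l) z"
    using step.hyps by (simp add: g_prod_def)
  also have "\<dots> = G_star q z (int (n (Suc l)) - int (n k)) (int (m (Suc l)) - int (m k)) (a (Suc l) - a k)"
    using step by (simp add: g_def G_star_add[OF z])
  finally show ?case .
qed

text \<open>\<open>invG_l k i\<close> and \<open>invG_r k j\<close> are the reciprocals of the functions \<open>G\<^sup>*\<close> that carry the
  variables \<open>\<zeta>\<^sub>1\<close> and \<open>\<zeta>\<^sub>2\<close>.\<close>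

definition invG_l :: "nat \<Rightarrow> nat \<Rightarrow> complex \<Rightarrow> complex" where
  "invG_l k i z = G_star q z (int (n k) - int i) (int (m k) - m_row p n m i) (a k - a_row p n a i)"

definition invG_r :: "nat \<Rightarrow> nat \<Rightarrow> complex \<Rightarrow> complex" where
  "invG_r k j z = G_star q z (int j - 1 - int (n k)) (m_row p n m j - int (m k)) (a_row p n a j - a k)"

lemma invG_l_hol: "invG_l k i holomorphic_on Om" unfolding invG_l_def[abs_def] by (rule G_star_hol)
lemma invG_r_hol: "invG_r k i holomorphic_on Om" unfolding invG_r_def[abs_def] by (rule G_star_hol)

lemma invG_l_Ex: "i \<le> n k \<Longrightarrow> invG_l k i holomorphic_on Ex" unfolding invG_l_def[abs_def] by (rule G_star_Ex) simp
lemma invG_r_Ex: "n k < j \<Longrightarrow> invG_r k j holomorphic_on Ex" unfolding invG_r_def[abs_def] by (rule G_star_Ex) simp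

lemma g_prod_invG_l: "z \<in> Om \<Longrightarrow> k \<le> l \<Longrightarrow> l \<le> p \<Longrightarrow> g_prod (Suc k) l z * invG_l k i z = invG_l l i z"
  by (simp add: g_prod_eq invG_l_def G_star_add)

lemma g_prod_invG_r: "z \<in> Om \<Longrightarrow> k \<le> l \<Longrightarrow> l \<le> p \<Longrightarrow> g_prod (Suc k) l z * invG_r l j z = invG_r k j z"
  by (simp add: g_prod_eq invG_r_def G_star_add)

text \<open>Taking the principal part makes these functions triangular combinations of poles at 0;
  the factor 1/(1 - z) is, up to sign, the sequence concentrated at 0. The two occurrences of 1 - z
  are the source of the extra quotient in the terms with \<open>k1 = 0\<close>.\<close>

definition left_init :: "nat \<Rightarrow> complex \<Rightarrow> complex" where
  "left_init i z = P0 (\<lambda>z. (1 - z) * invG_l 0 i z) z / (1 - z)"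

definition right_init :: "nat \<Rightarrow> complex \<Rightarrow> complex" where "right_init j = P0 (invG_r p j)"

lemma inv_Ex: "(\<lambda>z. inverse (1 - z)) holomorphic_on Ex"
  by (intro holomorphic_intros) (use step_factor_denom_Ex in auto)

lemma F0_hol: "(\<lambda>z. (1 - z) * invG_l 0 i z) holomorphic_on Om"
  by (intro holomorphic_on_mult holomorphic_intros invG_l_hol)

lemma left_init_hol: "left_init i holomorphic_on Om"
  unfolding left_init_def[abs_def] divide_inverse
  by (intro holomorphic_on_mult P0_hol F0_hol Ex_Om[OF inv_Ex])

lemma right_init_hol: "right_init j holomorphic_on Om"
  unfolding right_init_def by (rule P0_hol[OF invG_r_hol])

text \<open>For positive \<open>k\<close> an outer principal part is taken, 1/(1 - z) is a factor
  regular at 0, and \<open>prin_mult_prin\<close> drops the inner principal part; then 1 - z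
  cancels.\<close>

lemma left_fun_left_init:
  assumes "1 \<le> k" "k \<le> p" "z \<noteq> 0"
  shows "left_fun (left_init i) k z = P0 (invG_l k i) z"
proof -
  have r: "0 \<le> (0::real)" "0 < 1 - q" "0 < cmod (z - 0)" using q1 assms by auto
  have u: "(\<lambda>w. g_prod 1 k w * inverse (1 - w)) holomorphic_on Ex"
    by (intro holomorphic_on_mult g_prod_Ex inv_Ex) (use assms in auto)
  have "left_fun (left_init i) k z = P0 (\<lambda>w. (g_prod 1 k w * inverse (1 - w)) * P0 (\<lambda>z. (1 - z) * invG_l 0 i z) w) z"
    using assms by (simp add: left_fun_def left_init_def divide_inverse mult_ac)
  also have "\<dots> = P0 (\<lambda>w. (g_prod 1 k w * inverse (1 - w)) * ((1 - w) * invG_l 0 i w)) z"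
    by (rule prin_mult_prin[OF Ex_ball0[OF u] hol_annulus0[OF F0_hol] r])
  also have "\<dots> = P0 (invG_l k i) z"
  proof (rule P0_cong[OF assms(3)])
    fix w assume w: "w \<in> Om"
    have "(g_prod 1 k w * inverse (1 - w)) * ((1 - w) * invG_l 0 i w) = g_prod (Suc 0) k w * invG_l 0 i w"
      using OmD(2)[OF w] by simp
    then show "(g_prod 1 k w * inverse (1 - w)) * ((1 - w) * invG_l 0 i w) = invG_l k i w"
      using g_prod_invG_l[OF w, of 0 k i] assms by simp
  qed
  finally show ?thesis .
qed

lemma right_fun_right_init:
  assumes "k \<le> p" "z \<noteq> 0"
  shows "right_fun (right_init j) k z = P0 (invG_r k j) z"
proof (cases "k = p")
  case False
  have r: "0 \<le> (0::real)" "0 < 1 - q" "0 < cmod (z - 0)" using q1 assms by auto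
  have u: "g_prod (Suc k) p holomorphic_on Ex" by (rule g_prod_Ex) simp_all
  have "right_fun (right_init j) k z = P0 (\<lambda>w. g_prod (Suc k) p w * P0 (invG_r p j) w) z"
    using False by (simp add: right_fun_def right_prod_def[abs_def] right_init_def mult.commute)
  also have "\<dots> = P0 (\<lambda>w. g_prod (Suc k) p w * invG_r p j w) z"
    by (rule prin_mult_prin[OF Ex_ball0[OF u] hol_annulus0[OF invG_r_hol] r])
  also have "\<dots> = P0 (invG_r k j) z"
    by (rule P0_cong[OF assms(2)]) (use g_prod_invG_r assms in simp)
  finally show ?thesis .
qed (simp add: right_fun_def right_init_def)

section \<open>Residues at 0: the diagonal terms\<close>

abbreviation \<tau>0 :: real where "\<tau>0 \<equiv> (1 - q) / 2"

lemma \<tau>0: "0 < \<tau>0" "\<tau>0 < 1 - q" using q1 by auto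

lemma \<tau>0_Om: "cmod (z - 0) = \<tau>0 \<Longrightarrow> z \<in> Om"
  using \<tau>0 annulus0_Om by (auto simp: annulus_def)

definition diag0 :: "nat \<Rightarrow> nat \<Rightarrow> complex" where
  "diag0 i j = oint 0 \<tau>0 (\<lambda>z. invG_l 0 i z * invG_r 0 j z)"

text \<open>Up to normalisation this is \<open>L_mat\<close> with the integral over \<zeta>2 carried
  out, just as \<open>diag0\<close> is the integral in \<open>B_block\<close>.\<close>

definition diagL :: "nat \<Rightarrow> nat \<Rightarrow> nat \<Rightarrow> complex" where
  "diagL k i j = oint 0 \<tau>0 (\<lambda>z. invG_l k i z * P0 (invG_r k j) z)"

lemma invG_l_invG_r: "z \<in> Om \<Longrightarrow> invG_l k i z * invG_r k j z = invG_l 0 i z * invG_r 0 j z"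
  by (simp add: invG_l_def invG_r_def G_star_add)

lemma invG_r_split:
  obtains e where "e holomorphic_on ball 0 (1 - q)" "\<And>z. z \<in> annulus 0 0 (1 - q) \<Longrightarrow> invG_r p j z = e z + right_init j z"
  using prin_extend[OF hol_annulus0[OF invG_r_hol], of p j] q1 unfolding right_init_def by auto

text \<open>The product of the \<open>g\<close> carries \<open>invG_l k i\<close> to
  \<open>invG_l p i\<close>, whose power of z is \<open>n p - i\<close>, hence nonnegative; nothing
  is singular at 0.\<close>

lemma oint_reg0:
  assumes e: "e holomorphic_on ball 0 (1 - q)" and i: "i \<le> n p" and k: "k < p"
  shows "oint 0 \<tau>0 (\<lambda>z. e z * g_prod (Suc k) p z * invG_l k i z) = 0"
proof -
  have "oint 0 \<tau>0 (\<lambda>z. e z * g_prod (Suc k) p z * invG_l k i z) = oint 0 \<tau>0 (\<lambda>z. e z * invG_l p i z)"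
    by (rule oint_cong) (use g_prod_invG_l \<tau>0_Om k \<tau>0 in \<open>auto simp: mult.assoc\<close>)
  also have "\<dots> = 0"
    by (rule oint_eq_0[OF holomorphic_on_mult[OF e Ex_ball0[OF invG_l_Ex[OF i]]] \<tau>0])
  finally show ?thesis .
qed

lemma cont_\<tau>0: "f holomorphic_on annulus 0 0 (1 - q) \<Longrightarrow> continuous_on (sphere 0 \<tau>0) f"
  by (rule hol_cont_sphere[OF _ \<tau>0])

lemma ball_annulus0: "f holomorphic_on ball 0 (1 - q) \<Longrightarrow> f holomorphic_on annulus 0 0 (1 - q)"
  by (rule holomorphic_on_subset[OF _ annulus_subset_ball])

text \<open>Once \<open>right_init j\<close> is written as \<open>invG_r p j - e\<close>, the factor
  in front of the left principal part is regular at 0, as \<open>1 \<le> j\<close> makes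
  \<open>invG_r 0 j\<close> regular there. So the principal part may be dropped, and the term with
  \<open>e\<close> integrates to 0.\<close>

lemma pairing0_0:
  assumes "1 \<le> j" "i \<le> n p"
  shows "pairing0 (left_init i) (right_init j) 0 = diag0 i j"
proof -
  obtain e where e: "e holomorphic_on ball 0 (1 - q)" "\<And>z. z \<in> annulus 0 0 (1 - q) \<Longrightarrow> invG_r p j z = e z + right_init j z"
    using invG_r_split by metis
  note r = order_refl[of "0::real"] \<tau>0
  have gpb: "g_prod 1 p holomorphic_on ball 0 (1 - q)" by (rule Ex_ball0[OF g_prod_Ex]) auto
  have H0: "invG_r 0 j holomorphic_on ball 0 (1 - q)" by (rule Ex_ball0[OF invG_r_Ex]) (use assms zero in auto)
  define s where "s z = (invG_r 0 j z - g_prod 1 p z * e z) * inverse (1 - z)" for z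
  have s: "s holomorphic_on ball 0 (1 - q)" unfolding s_def
    by (intro holomorphic_on_mult holomorphic_on_diff H0 gpb e(1) Ex_ball0[OF inv_Ex])
  have "pairing0 (left_init i) (right_init j) 0 = oint 0 \<tau>0 (\<lambda>z. s z * P0 (\<lambda>z. (1 - z) * invG_l 0 i z) z)"
    unfolding pairing0_def
  proof (rule oint_cong)
    fix z assume z: "cmod (z - 0) = \<tau>0"
    then have zO: "z \<in> Om" "z \<in> annulus 0 0 (1 - q)" using \<tau>0_Om \<tau>0 by (auto simp: annulus_def)
    have "right_init j z * g_prod 1 p z = invG_r 0 j z - g_prod 1 p z * e z"
      using e(2)[OF zO(2)] g_prod_invG_r[OF zO(1), of 0 p j] by (simp add: algebra_simps)
    then show "right_prod (right_init j) 0 z * left_fun (left_init i) 0 z = s z * P0 (\<lambda>z. (1 - z) * invG_l 0 i z) z"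
      by (simp add: right_prod_def left_fun_def left_init_def s_def divide_inverse)
  qed (use \<tau>0 in simp)
  also have "\<dots> = oint 0 \<tau>0 (\<lambda>z. s z * ((1 - z) * invG_l 0 i z))"
    by (rule oint_mult_prin[OF s hol_annulus0[OF F0_hol] r])
  also have "\<dots> = oint 0 \<tau>0 (\<lambda>z. invG_l 0 i z * invG_r 0 j z - e z * g_prod 1 p z * invG_l 0 i z)"
  proof (rule oint_cong)
    fix z assume z: "cmod (z - 0) = \<tau>0"
    then have "1 - z \<noteq> 0" using OmD(2)[OF \<tau>0_Om] by blast
    then have i1: "inverse (1 - z) * (1 - z) = 1" by (rule left_inverse)
    have "s z * ((1 - z) * invG_l 0 i z) = (invG_r 0 j z - g_prod 1 p z * e z) * (inverse (1 - z) * (1 - z)) * invG_l 0 i z"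
      by (simp only: s_def mult.assoc)
    also have "\<dots> = invG_l 0 i z * invG_r 0 j z - e z * g_prod 1 p z * invG_l 0 i z"
      unfolding i1 by (simp add: algebra_simps)
    finally show "s z * ((1 - z) * invG_l 0 i z) = invG_l 0 i z * invG_r 0 j z - e z * g_prod 1 p z * invG_l 0 i z" .
  qed (use \<tau>0 in simp)
  also have "\<dots> = oint 0 \<tau>0 (\<lambda>z. invG_l 0 i z * invG_r 0 j z) - oint 0 \<tau>0 (\<lambda>z. e z * g_prod 1 p z * invG_l 0 i z)"
    by (intro oint_diff cont_\<tau>0 holomorphic_on_mult hol_annulus0[OF invG_l_hol] hol_annulus0[OF invG_r_hol] ball_annulus0[OF e(1)] ball_annulus0[OF gpb])
       (use \<tau>0 in simp)
  also have "oint 0 \<tau>0 (\<lambda>z. e z * g_prod 1 p z * invG_l 0 i z) = 0"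
    using oint_reg0[OF e(1) assms(2), of 0] p2 by simp
  finally show ?thesis by (simp add: diag0_def)
qed

text \<open>With both functions split into regular and principal part, the residue of their product
  is the sum of the two mixed residues: regular times regular and principal times principal
  contribute nothing. One mixed residue is \<open>diagL\<close>, the other is the pairing.\<close>

lemma pairing0_pos:
  assumes "i \<le> n p" "1 \<le> k" "k < p"
  shows "pairing0 (left_init i) (right_init j) k = diag0 i j - diagL k i j"
proof -
  obtain e where e: "e holomorphic_on ball 0 (1 - q)" "\<And>z. z \<in> annulus 0 0 (1 - q) \<Longrightarrow> invG_r p j z = e z + right_init j z"
    using invG_r_split by metis
  note r = order_refl[of "0::real"] \<tau>0
  have q01: "0 < 1 - q" using q1 by simp
  have gpb: "g_prod (Suc k) p holomorphic_on ball 0 (1 - q)" by (rule Ex_ball0[OF g_prod_Ex]) auto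
  have hF: "invG_l k i holomorphic_on annulus 0 0 (1 - q)" and hH: "invG_r k j holomorphic_on annulus 0 0 (1 - q)"
    by (rule hol_annulus0[OF invG_l_hol] hol_annulus0[OF invG_r_hol])+
  note hP = prin_hol_annulus[OF hF r(1) q01] prin_hol_annulus[OF hH r(1) q01]
  have "pairing0 (left_init i) (right_init j) k = oint 0 \<tau>0 (\<lambda>z. invG_r k j z * P0 (invG_l k i) z - e z * g_prod (Suc k) p z * P0 (invG_l k i) z)"
    unfolding pairing0_def
  proof (rule oint_cong)
    fix z assume z: "cmod (z - 0) = \<tau>0"
    then have zO: "z \<in> Om" "z \<in> annulus 0 0 (1 - q)" "z \<noteq> 0" using \<tau>0_Om \<tau>0 by (auto simp: annulus_def)
    have "right_init j z * g_prod (Suc k) p z = invG_r k j z - g_prod (Suc k) p z * e z"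
      using e(2)[OF zO(2)] g_prod_invG_r[OF zO(1), of k p j] assms by (simp add: algebra_simps)
    moreover have "left_fun (left_init i) k z = P0 (invG_l k i) z" by (rule left_fun_left_init) (use assms zO in auto)
    ultimately have "right_prod (right_init j) k z * left_fun (left_init i) k z = (invG_r k j z - g_prod (Suc k) p z * e z) * P0 (invG_l k i) z"
      by (simp only: right_prod_def)
    then show "right_prod (right_init j) k z * left_fun (left_init i) k z = invG_r k j z * P0 (invG_l k i) z - e z * g_prod (Suc k) p z * P0 (invG_l k i) z"
      by (simp add: algebra_simps)
  qed (use \<tau>0 in simp)
  also have "\<dots> = oint 0 \<tau>0 (\<lambda>z. invG_r k j z * P0 (invG_l k i) z) - oint 0 \<tau>0 (\<lambda>z. e z * g_prod (Suc k) p z * P0 (invG_l k i) z)"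
    by (intro oint_diff cont_\<tau>0 holomorphic_on_mult hP hH ball_annulus0[OF e(1)] ball_annulus0[OF gpb])
       (use \<tau>0 in simp)
  also have "oint 0 \<tau>0 (\<lambda>z. e z * g_prod (Suc k) p z * P0 (invG_l k i) z) = oint 0 \<tau>0 (\<lambda>z. e z * g_prod (Suc k) p z * invG_l k i z)"
    by (rule oint_mult_prin[OF holomorphic_on_mult[OF e(1) gpb] hF r])
  also have "\<dots> = 0" by (rule oint_reg0[OF e(1) assms(1,3)])
  also have "oint 0 \<tau>0 (\<lambda>z. invG_r k j z * P0 (invG_l k i) z) = diag0 i j - diagL k i j"
  proof -
    obtain f where f: "f holomorphic_on ball 0 (1 - q)" "\<And>z. z \<in> annulus 0 0 (1 - q) \<Longrightarrow> invG_l k i z = f z + P0 (invG_l k i) z"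
      using prin_extend[OF hF r(1) q01] by metis
    obtain h where h: "h holomorphic_on ball 0 (1 - q)" "\<And>z. z \<in> annulus 0 0 (1 - q) \<Longrightarrow> invG_r k j z = h z + P0 (invG_r k j) z"
      using prin_extend[OF hH r(1) q01] by metis
    have "diag0 i j = oint 0 \<tau>0 (\<lambda>z. (invG_r k j z * P0 (invG_l k i) z + invG_l k i z * P0 (invG_r k j) z) + (f z * h z - P0 (invG_l k i) z * P0 (invG_r k j) z))"
      unfolding diag0_def
    proof (rule oint_cong)
      fix z assume z: "cmod (z - 0) = \<tau>0"
      then have zO: "z \<in> Om" "z \<in> annulus 0 0 (1 - q)" using \<tau>0_Om \<tau>0 by (auto simp: annulus_def)
      define x y where "x = P0 (invG_l k i) z" and "y = P0 (invG_r k j) z"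
      have "invG_l k i z = f z + x" "invG_r k j z = h z + y" using f(2)[OF zO(2)] h(2)[OF zO(2)] by (simp_all add: x_def y_def)
      moreover have "invG_l 0 i z * invG_r 0 j z = invG_l k i z * invG_r k j z" by (rule invG_l_invG_r[OF zO(1), symmetric])
      ultimately show "invG_l 0 i z * invG_r 0 j z = (invG_r k j z * P0 (invG_l k i) z + invG_l k i z * P0 (invG_r k j) z) + (f z * h z - P0 (invG_l k i) z * P0 (invG_r k j) z)"
        unfolding x_def[symmetric] y_def[symmetric] by (simp add: algebra_simps)
    qed (use \<tau>0 in simp)
    also have "\<dots> = (oint 0 \<tau>0 (\<lambda>z. invG_r k j z * P0 (invG_l k i) z) + oint 0 \<tau>0 (\<lambda>z. invG_l k i z * P0 (invG_r k j) z))
        + (oint 0 \<tau>0 (\<lambda>z. f z * h z) - oint 0 \<tau>0 (\<lambda>z. P0 (invG_l k i) z * P0 (invG_r k j) z))"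
    proof -
      note c = cont_\<tau>0[OF hP(1)] cont_\<tau>0[OF hP(2)] cont_\<tau>0[OF hF] cont_\<tau>0[OF hH] cont_\<tau>0[OF ball_annulus0[OF f(1)]] cont_\<tau>0[OF ball_annulus0[OF h(1)]]
      have t: "0 \<le> \<tau>0" using \<tau>0 by simp
      note m = continuous_on_mult[OF c(4) c(1)] continuous_on_mult[OF c(3) c(2)] continuous_on_mult[OF c(5) c(6)] continuous_on_mult[OF c(1) c(2)]
      show ?thesis
        by (subst oint_add[OF continuous_on_add[OF m(1,2)] continuous_on_diff[OF m(3,4)] t])
           (simp only: oint_add[OF m(1,2) t] oint_diff[OF m(3,4) t])
    qed
    also have "oint 0 \<tau>0 (\<lambda>z. f z * h z) = 0"
      by (rule oint_eq_0[OF holomorphic_on_mult[OF f(1) h(1)] \<tau>0])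
    also have "oint 0 \<tau>0 (\<lambda>z. P0 (invG_l k i) z * P0 (invG_r k j) z) = 0"
      by (rule oint_prin_prin[OF hF hH r(1) q01 \<tau>0(1)])
    finally show ?thesis by (simp add: diagL_def)
  qed
  finally show ?thesis by simp
qed

definition coef_diag :: "(nat \<Rightarrow> complex) \<Rightarrow> (nat \<Rightarrow> complex) \<Rightarrow> nat \<Rightarrow> complex" where
  "coef_diag t1 t2 k = (t1 k - t2 k) * (\<Prod>l\<in>{1..<k}. t2 l) * (\<Prod>l\<in>{Suc k..<p}. t1 l)"

text \<open>Each summand is the difference of two products that switch from \<open>t2\<close> to
  \<open>t1\<close> at \<open>l\<close> and at \<open>l + 1\<close>.\<close>

lemma coef_diag_telescope:
  "1 \<le> k \<Longrightarrow> k \<le> p \<Longrightarrow> (\<Sum>l\<in>{k..<p}. coef_diag t1 t2 l) =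
    (\<Prod>l\<in>{1..<k}. t2 l) * (\<Prod>l\<in>{k..<p}. t1 l) - (\<Prod>l\<in>{1..<p}. t2 l)"
proof (induction "p - k" arbitrary: k)
  case 0 then show ?case by simp
next
  case (Suc d)
  then have k: "k < p" by simp
  have "(\<Sum>l\<in>{k..<p}. coef_diag t1 t2 l) = coef_diag t1 t2 k + (\<Sum>l\<in>{Suc k..<p}. coef_diag t1 t2 l)"
    using k by (simp add: sum.atLeast_Suc_lessThan)
  also have "(\<Sum>l\<in>{Suc k..<p}. coef_diag t1 t2 l) = (\<Prod>l\<in>{1..<Suc k}. t2 l) * (\<Prod>l\<in>{Suc k..<p}. t1 l) - (\<Prod>l\<in>{1..<p}. t2 l)"
    using Suc by simp
  also have "(\<Prod>l\<in>{1..<Suc k}. t2 l) = (\<Prod>l\<in>{1..<k}. t2 l) * t2 k"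
    using Suc.prems by (simp add: prod.atLeastLessThan_Suc)
  also have "coef_diag t1 t2 k + ((\<Prod>l\<in>{1..<k}. t2 l) * t2 k * (\<Prod>l\<in>{Suc k..<p}. t1 l) - (\<Prod>l\<in>{1..<p}. t2 l)) =
    (\<Prod>l\<in>{1..<k}. t2 l) * (t1 k * (\<Prod>l\<in>{Suc k..<p}. t1 l)) - (\<Prod>l\<in>{1..<p}. t2 l)"
    by (simp add: coef_diag_def algebra_simps)
  also have "t1 k * (\<Prod>l\<in>{Suc k..<p}. t1 l) = (\<Prod>l\<in>{k..<p}. t1 l)"
    using k by (simp add: prod.atLeast_Suc_lessThan)
  finally show ?case .
qed

definition Tmat :: "(nat \<Rightarrow> complex) \<Rightarrow> (nat \<Rightarrow> complex) \<Rightarrow> nat \<Rightarrow> nat \<Rightarrow> complex" where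
  "Tmat t1 t2 i j = oint 1 2 (\<lambda>z. right_init j z * (g p z * full_chain t1 t2 (left_init i) (p - 1) z))"

text \<open>Every positive \<open>k1\<close> contributes \<open>diag0\<close> with coefficient minus
  \<open>coef_diag\<close>. These coefficients telescope and change the product of the
  \<open>t1\<close>, which stands at \<open>k1 = 0\<close>, into the product of the
  \<open>t2\<close>.\<close>

lemma Tmat_eq:
  assumes "1 \<le> j" "i \<le> n p"
  shows "Tmat t1 t2 i j = (\<Prod>l\<in>{1..<p}. t2 l) * diag0 i j + (\<Sum>k\<in>{1..<p}. coef_diag t1 t2 k * diagL k i j)
    + (\<Sum>k1<p. \<Sum>k2\<in>{Suc k1..p}. coef_left t1 t2 k1 * coef_right t1 t2 k2 * pairing t1 t2 (left_init i) (right_init j) k1 k2)"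
proof -
  have "Tmat t1 t2 i j = (\<Sum>k1<p. coef_left t1 t2 k1 * (\<Prod>l\<in>{Suc k1..<p}. t1 l) * pairing0 (left_init i) (right_init j) k1)
     + (\<Sum>k1<p. \<Sum>k2\<in>{Suc k1..p}. coef_left t1 t2 k1 * coef_right t1 t2 k2 * pairing t1 t2 (left_init i) (right_init j) k1 k2)"
    unfolding Tmat_def by (subst big_expand[OF left_init_hol right_init_hol])
      (simp_all add: distrib_left sum.distrib sum_distrib_left mult.assoc add.commute)
  also have "(\<Sum>k1<p. coef_left t1 t2 k1 * (\<Prod>l\<in>{Suc k1..<p}. t1 l) * pairing0 (left_init i) (right_init j) k1) =
    coef_left t1 t2 0 * (\<Prod>l\<in>{1..<p}. t1 l) * pairing0 (left_init i) (right_init j) 0 + (\<Sum>k\<in>{1..<p}. coef_left t1 t2 k * (\<Prod>l\<in>{Suc k..<p}. t1 l) * pairing0 (left_init i) (right_init j) k)"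
  proof -
    have e: "{..<p} = insert 0 {1..<p}" using p2 by auto
    show ?thesis unfolding e by (subst sum.insert) auto
  qed
  also have "coef_left t1 t2 0 * (\<Prod>l\<in>{1..<p}. t1 l) * pairing0 (left_init i) (right_init j) 0 = (\<Prod>l\<in>{1..<p}. t1 l) * diag0 i j"
    by (simp add: coef_left_def pairing0_0[OF assms])
  also have "(\<Sum>k\<in>{1..<p}. coef_left t1 t2 k * (\<Prod>l\<in>{Suc k..<p}. t1 l) * pairing0 (left_init i) (right_init j) k) =
    (\<Sum>k\<in>{1..<p}. coef_diag t1 t2 k * diagL k i j - coef_diag t1 t2 k * diag0 i j)"
    by (rule sum.cong) (use assms in \<open>auto simp: coef_left_def coef_diag_def pairing0_pos algebra_simps\<close>)
  also have "\<dots> = (\<Sum>k\<in>{1..<p}. coef_diag t1 t2 k * diagL k i j) - ((\<Prod>l\<in>{1..<p}. t1 l) - (\<Prod>l\<in>{1..<p}. t2 l)) * diag0 i j"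
    using coef_diag_telescope[of 1 t1 t2] p2 by (simp add: sum_subtractf sum_distrib_right[symmetric])
  finally show ?thesis by (simp add: algebra_simps)
qed

section \<open>Triangular changes of basis at the start and at the end\<close>

definition taylor_coef :: "(complex \<Rightarrow> complex) \<Rightarrow> nat \<Rightarrow> complex" where
  "taylor_coef u s = oint 0 \<tau>0 (\<lambda>z. u z * z powi (- int s - 1))"

lemma taylor_coef_0: "u holomorphic_on ball 0 (1 - q) \<Longrightarrow> taylor_coef u 0 = u 0"
proof -
  assume u: "u holomorphic_on ball 0 (1 - q)"
  have "oint 0 \<tau>0 (\<lambda>w. u w / (w - 0)) = u 0"
    by (rule oint_Cauchy[OF u]) (use \<tau>0 in auto)
  moreover have "(\<lambda>z. u z * z powi (- int 0 - 1)) = (\<lambda>w. u w / (w - 0))"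
    by (simp add: power_int_minus divide_inverse fun_eq_iff)
  ultimately show ?thesis by (simp only: taylor_coef_def)
qed

lemma geometric_kernel:
  fixes w z :: complex
  assumes "w \<noteq> z" "w \<noteq> 0"
  shows "1 / (w - z) = (\<Sum>l<d. z ^ l * w powi (- int l - 1)) + z ^ d * w powi (- int d) / (w - z)"
proof (induction d)
  case (Suc d)
  have "z ^ d * w powi (- int d) / (w - z) = z ^ d * w powi (- int d - 1) + z ^ Suc d * w powi (- int (Suc d)) / (w - z)"
  proof -
    have e: "w powi (- int d) = w * w powi (- int d - 1)"
      using assms(2) power_int_add_1'[of w "- int d - 1"] by simp
    have e': "- int (Suc d) = - int d - 1" by simp
    define x where "x = z ^ d * w powi (- int d - 1)"
    have "x * w / (w - z) = x + z * x / (w - z)"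
      using assms(1) by (simp add: field_simps)
    moreover have "z ^ d * w powi (- int d) = x * w" "z ^ Suc d * w powi (- int (Suc d)) = z * x"
      unfolding e e' x_def by (simp_all only: power_Suc mult_ac)
    ultimately show ?thesis by (simp only: x_def)
  qed
  then show ?case using Suc by simp
qed simp

text \<open>Expanding the Cauchy kernel to order \<open>d\<close> leaves a remainder divisible by
  z^d, which cancels the pole and integrates to 0.\<close>

lemma P0_pole:
  assumes u: "u holomorphic_on ball 0 (1 - q)" and w: "w \<noteq> 0"
  shows "P0 (\<lambda>z. u z * z powi (- int d)) w = (\<Sum>l<d. taylor_coef u (d - Suc l) * w powi (- int l - 1))"
proof -
  define \<tau> where "\<tau> = min (1 - q) (cmod w) / 2"
  have \<tau>: "0 < \<tau>" "\<tau> < 1 - q" "\<tau> < cmod w" using q1 w by (auto simp: \<tau>_def min_def)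
  let ?f = "\<lambda>z. u z * z powi (- int d)"
  have pw: "(\<lambda>z. z powi k) holomorphic_on annulus 0 0 (1 - q)" for k :: int
    by (rule hol_annulus0[OF powi_hol_Om(1)])
  have f: "?f holomorphic_on annulus 0 0 (1 - q)"
    by (intro holomorphic_on_mult ball_annulus0[OF u] pw)
  let ?t = "\<lambda>l z. (u z * z powi (int l - int d)) * w powi (- int l - 1)"
  let ?r = "\<lambda>z. u z * w powi (- int d) / (w - z)"
  have tc: "continuous_on (sphere 0 \<tau>) (?t l)" for l
    by (rule hol_cont_sphere[OF _ \<tau>(1,2)]) (intro holomorphic_on_mult ball_annulus0[OF u] pw holomorphic_on_const)
  have rh: "?r holomorphic_on ball 0 (min (1 - q) (cmod w))"
    by (intro holomorphic_on_divide holomorphic_on_mult holomorphic_on_const holomorphic_on_subset[OF u] holomorphic_on_diff holomorphic_on_ident) auto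
  have rc: "continuous_on (sphere 0 \<tau>) ?r"
    by (rule continuous_on_subset[OF holomorphic_on_imp_continuous_on[OF rh]]) (use \<tau> in auto)
  have "P0 ?f w = oint 0 \<tau> (\<lambda>z. ?f z / (w - z))"
    by (rule prin_radius[OF f]) (use \<tau> in auto)
  also have "\<dots> = oint 0 \<tau> (\<lambda>z. (\<Sum>l<d. ?t l z) + ?r z)"
  proof (rule oint_cong)
    fix z assume z: "cmod (z - 0) = \<tau>"
    then have nz: "z \<noteq> 0" "w \<noteq> z" using \<tau> by auto
    have e: "z powi (- int d) * z ^ l = z powi (int l - int d)" for l
      using nz by (simp add: power_int_diff power_int_minus field_simps)
    have "?f z / (w - z) = u z * z powi (- int d) * (1 / (w - z))" by simp
    also have "\<dots> = (\<Sum>l<d. u z * (z powi (- int d) * z ^ l) * w powi (- int l - 1))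
        + u z * (z powi (- int d) * z ^ d) * w powi (- int d) / (w - z)"
      unfolding geometric_kernel[OF nz(2) w, of d] by (simp add: distrib_left sum_distrib_left mult_ac)
    finally show "?f z / (w - z) = (\<Sum>l<d. ?t l z) + ?r z" by (simp only: e) simp
  qed (use \<tau> in simp)
  also have "\<dots> = (\<Sum>l<d. oint 0 \<tau> (?t l)) + oint 0 \<tau> ?r"
    using \<tau> by (subst oint_add[OF continuous_on_sum[OF tc] rc]) (simp_all add: oint_sum[OF tc])
  also have "oint 0 \<tau> ?r = 0"
    by (rule oint_eq_0[OF rh]) (use \<tau> in auto)
  also have "(\<Sum>l<d. oint 0 \<tau> (?t l)) = (\<Sum>l<d. taylor_coef u (d - Suc l) * w powi (- int l - 1))"
  proof (rule sum.cong)
    fix l assume l: "l \<in> {..<d}"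
    have "int l - int d = - int (d - Suc l) - 1" using l by auto
    moreover have "oint 0 \<tau> (\<lambda>z. u z * z powi (int l - int d)) = oint 0 \<tau>0 (\<lambda>z. u z * z powi (int l - int d))"
      by (rule oint_radius[of _ 0 0 "1 - q"]) (use \<tau> \<tau>0 in \<open>auto intro!: holomorphic_on_mult ball_annulus0[OF u] pw\<close>)
    ultimately show "oint 0 \<tau> (?t l) = taylor_coef u (d - Suc l) * w powi (- int l - 1)"
      by (simp only: oint_mulc taylor_coef_def)
  qed simp
  finally show ?thesis by simp
qed

text \<open>What remains after splitting off the power of z. The value 1 at 0 gives the triangular
  systems a diagonal of signs only.\<close>

definition reg_l :: "nat \<Rightarrow> complex \<Rightarrow> complex" where
  "reg_l i z = (1 - z) * G_star q z 0 (- m_row p n m i) (- a_row p n a i)"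

definition reg_r :: "nat \<Rightarrow> complex \<Rightarrow> complex" where
  "reg_r j z = G_star q z 0 (m_row p n m j - int (m p)) (a_row p n a j - a p)"

lemma reg_l_hol: "reg_l i holomorphic_on ball 0 (1 - q)"
  unfolding reg_l_def[abs_def] by (intro holomorphic_on_mult Ex_ball0[OF G_star_Ex] holomorphic_intros order_refl)

lemma reg_r_hol: "reg_r i holomorphic_on ball 0 (1 - q)"
  unfolding reg_r_def[abs_def] by (intro Ex_ball0[OF G_star_Ex] order_refl)

lemma reg_l_0: "reg_l i 0 = 1" and reg_r_0: "reg_r i 0 = 1"
  by (simp_all add: reg_l_def reg_r_def G_star_def)

lemma left_init_sum:
  assumes "z \<in> Om"
  shows "left_init i z = (\<Sum>l<i. taylor_coef (reg_l i) (i - Suc l) * (z powi (- int l - 1) * inverse (1 - z)))"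
proof -
  have z: "z \<noteq> 0" using assms by (simp add: Om_def)
  have "P0 (\<lambda>z. (1 - z) * invG_l 0 i z) z = P0 (\<lambda>z. reg_l i z * z powi (- int i)) z"
    by (rule P0_cong[OF z]) (simp add: invG_l_def reg_l_def G_star_def zero)
  then show ?thesis by (simp only: left_init_def P0_pole[OF reg_l_hol z] divide_inverse sum_distrib_right mult.assoc)
qed

lemma right_init_sum:
  assumes "z \<in> Om" "1 \<le> j" "j \<le> Suc (n p)"
  shows "right_init j z = (\<Sum>l<Suc (n p) - j. taylor_coef (reg_r j) (n p - j - l) * z powi (- int l - 1))"
proof -
  have z: "z \<noteq> 0" using assms by (simp add: Om_def)
  have e: "int j - 1 - int (n p) = - int (Suc (n p) - j)" using assms by auto
  have "right_init j z = P0 (\<lambda>z. reg_r j z * z powi (- int (Suc (n p) - j))) z"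
    unfolding right_init_def by (rule P0_cong[OF z]) (simp add: invG_r_def reg_r_def G_star_def e)
  also have "\<dots> = (\<Sum>l<Suc (n p) - j. taylor_coef (reg_r j) (Suc (n p) - j - Suc l) * z powi (- int l - 1))"
    by (rule P0_pole[OF reg_r_hol z])
  finally show ?thesis by simp
qed

abbreviation delta_fun :: "complex \<Rightarrow> complex" where "delta_fun \<equiv> (\<lambda>z. inverse (1 - z))"

lemma oint_powi: "oint 1 2 (\<lambda>z. (1 - z) powi k) = (if k = -1 then -1 else 0)"
proof -
  consider "0 \<le> k" | "k = -1" | "k \<le> -2" by linarith
  then show ?thesis
  proof cases
    case 1
    have "(\<lambda>z::complex. (1 - z) powi k) holomorphic_on ball 1 3"
      by (intro holomorphic_on_power_int holomorphic_intros disjI1 1)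
    then have "oint 1 2 (\<lambda>z. (1 - z) powi k) = 0" by (rule oint_eq_0) simp_all
    then show ?thesis using 1 by simp
  next
    case 2
    have "oint 1 2 (\<lambda>z. (1 - z) powi k) = oint 1 2 (\<lambda>z. - (1 / (z - 1)))"
    proof (rule oint_cong)
      fix z :: complex
      have "1 / (z - 1) = - (1 / (1 - z))" by (metis minus_diff_eq minus_divide_right)
      then show "(1 - z) powi k = - (1 / (z - 1))" using 2 by (simp add: power_int_minus divide_inverse)
    qed simp
    also have "\<dots> = - oint 1 2 (\<lambda>z. 1 / (z - 1))" by (rule oint_neg)
    also have "oint 1 2 (\<lambda>z. 1 / (z - 1)) = 1" by (rule oint_Cauchy[of "\<lambda>_. 1" 1 3]) auto
    finally show ?thesis using 2 by simp
  next
    case 3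
    have "oint 1 2 (\<lambda>z. (1 - z) powi k) = 0"
    proof (rule oint_decay[of _ 1 _ _ 1 1])
      show "(\<lambda>z. (1 - z) powi k) holomorphic_on {z. 1 < cmod (z - 1)}"
        by (intro holomorphic_on_power_int holomorphic_intros disjI2) auto
      fix z :: complex assume z: "1 \<le> cmod (z - 1)"
      have "cmod ((1 - z) powi k) = cmod (z - 1) powi k" by (simp add: norm_power_int norm_minus_commute)
      also have "\<dots> \<le> cmod (z - 1) powi (-2)" by (rule power_int_increasing) (use z 3 in auto)
      finally show "cmod ((1 - z) powi k) \<le> 1 / (cmod (z - 1))\<^sup>2" by (simp add: power_int_minus divide_inverse)
    qed auto
    then show ?thesis using 3 by simp
  qed
qed

lemma seq_delta_fun: "seq delta_fun x = (if x = 0 then -1 else 0)"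
proof -
  have "seq delta_fun x = oint 1 2 (\<lambda>z. (1 - z) powi (x - 1))"
    unfolding seq_def
  proof (rule oint_cong)
    fix z :: complex assume "cmod (z - 1) = 2"
    then have "1 - z \<noteq> 0" by auto
    then show "inverse (1 - z) * (1 - z) powi x = (1 - z) powi (x - 1)"
      by (simp add: power_int_diff divide_inverse mult.commute)
  qed simp
  then show ?thesis by (simp add: oint_powi)
qed

lemma low_vanish_delta_fun: "low_vanish delta_fun"
  unfolding low_vanish_def using Ex_Om[OF inv_Ex] by (auto simp: seq_delta_fun intro!: exI[of _ 0])

lemma low_vanish_sum: "(\<And>l. l \<in> A \<Longrightarrow> low_vanish (f l)) \<Longrightarrow> low_vanish (\<lambda>z. \<Sum>l\<in>A. c l * f l z)"
proof (induction A rule: infinite_finite_induct)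
  case (insert x A)
  have "low_vanish (\<lambda>z. c x * f x z + (\<Sum>l\<in>A. c l * f l z))" by (intro low_vanish_add low_vanish_cmul insert) auto
  then show ?case using insert by simp
qed (use low_vanish_cmul[OF low_vanish_delta_fun, of 0] in auto)

lemma tseq_sum:
  assumes "\<And>l. l \<in> A \<Longrightarrow> low_vanish (f l)"
  shows "tseq (\<lambda>z. \<Sum>l\<in>A. c l * f l z) k x = (\<Sum>l\<in>A. c l * tseq (f l) k x)"
  using assms
proof (induction A rule: infinite_finite_induct)
  case (insert y A)
  have "tseq (\<lambda>z. c y * f y z + (\<Sum>l\<in>A. c l * f l z)) k x = c y * tseq (f y) k x + tseq (\<lambda>z. \<Sum>l\<in>A. c l * f l z) k x"
    by (intro tseq_lin low_vanish_sum insert.prems) auto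
  then show ?case using insert by simp
qed (simp_all add: tseq_def seq_def)

lemma pole_neg: "z powi (- int l - 1) = (-1) ^ Suc l * (- z) powi (- int (Suc l))" for z :: complex
proof -
  have "- int (Suc l) = - int l - 1" by simp
  then show ?thesis using neg_powi(2)[of "Suc l" z] by (simp only:)
qed

lemma low_vanish_pole: "low_vanish (\<lambda>z. z powi (- int l - 1) * delta_fun z)"
proof -
  have "low_vanish (\<lambda>z. (-1) ^ Suc l * ((- z) powi (- int (Suc l)) * delta_fun z))" by (intro low_vanish_cmul low_vanish_zpow low_vanish_delta_fun)
  then show ?thesis
    by (rule low_vanish_cong[rotated]) (simp only: pole_neg mult.assoc)
qed

lemma tseq_pole: "tseq (\<lambda>z. z powi (- int l - 1) * delta_fun z) k x = (-1) ^ Suc l * tseq delta_fun (k - int l - 1) x"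
  unfolding tseq_def seq_cmul[symmetric]
proof (rule seq_cong)
  fix z assume "z \<in> Om"
  then have z: "- z \<noteq> 0" by (simp add: Om_def)
  note e = pole_neg[of z l]
  have "(- z) powi (k - int l - 1) = (- z) powi k * (- z) powi (- int (Suc l))"
    unfolding power_int_add[OF disjI1[OF z], symmetric] by (rule arg_cong) simp
  then show "(- z) powi k * (z powi (- int l - 1) * inverse (1 - z)) =
     (-1) ^ Suc l * ((- z) powi (k - int l - 1) * inverse (1 - z))"
    unfolding e by (simp only: mult_ac)
qed

lemma low_vanish_left_init: "low_vanish (left_init i)"
  by (rule low_vanish_cong[OF left_init_sum[symmetric]]) (auto intro!: low_vanish_sum low_vanish_pole)

text \<open>This sign arises once from the start, in \<open>det_left_init\<close>, and once from the
  end, in \<open>final_columns\<close>; its square is 1.\<close>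

definition sign_prod :: complex where "sign_prod = (\<Prod>i<N. (-1) ^ i)"

lemma sign_prod_sq: "sign_prod * sign_prod = 1"
  unfolding sign_prod_def prod.distrib[symmetric] by (simp add: power_mult_distrib[symmetric])

text \<open>The starting functions are triangular combinations of the poles z^(-l-1)/(1 - z), and
  each division by z lowers the difference order by one. So the determinant is that of
  \<open>initial_det\<close> times a triangular one.\<close>

lemma det_left_init:
  assumes x: "x \<in> states"
  shows "tseq_det (\<lambda>i. left_init (Suc i)) x = (if x = origin then sign_prod else 0)"
proof -
  define W where "W l i = (if l \<le> i then (-1) ^ Suc l * taylor_coef (reg_l (Suc i)) (i - l) else 0)" for l i
  have ent: "tseq (left_init (Suc i)) (int j + 1) (x j) = (\<Sum>l<N. tseq delta_fun (int j - int l) (x j) * W l i)" if "i < N" for i j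
  proof -
    have "tseq (left_init (Suc i)) (int j + 1) (x j) =
      tseq (\<lambda>z. \<Sum>l<Suc i. taylor_coef (reg_l (Suc i)) (Suc i - Suc l) * (z powi (- int l - 1) * delta_fun z)) (int j + 1) (x j)"
      unfolding tseq_def by (rule seq_cong) (simp only: left_init_sum)
    also have "\<dots> = (\<Sum>l<Suc i. taylor_coef (reg_l (Suc i)) (Suc i - Suc l) * tseq (\<lambda>z. z powi (- int l - 1) * delta_fun z) (int j + 1) (x j))"
      by (rule tseq_sum[OF low_vanish_pole])
    also have "\<dots> = (\<Sum>l<Suc i. tseq delta_fun (int j - int l) (x j) * W l i)"
      by (rule sum.cong) (simp_all only: tseq_pole, auto simp: W_def)
    also have "\<dots> = (\<Sum>l<N. tseq delta_fun (int j - int l) (x j) * W l i)"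
      by (rule sum.mono_neutral_left) (use that in \<open>auto simp: W_def\<close>)
    finally show ?thesis .
  qed
  have "tseq_det (\<lambda>i. left_init (Suc i)) x = rdet N (\<lambda>j i. \<Sum>l<N. tseq delta_fun (int j - int l) (x j) * W l i)"
    unfolding tower_det_def by (rule rdet_cong) (simp add: ent)
  also have "\<dots> = rdet N (\<lambda>j l. tseq delta_fun (int j - int l) (x j)) * rdet N W"
    by (rule rdet_mult)
  also have "rdet N W = (\<Prod>i<N. (-1) ^ Suc i)"
    by (subst rdet_upper) (auto simp: W_def taylor_coef_0[OF reg_l_hol] reg_l_0)
  also have "rdet N (\<lambda>j l. tseq delta_fun (int j - int l) (x j)) = (if \<forall>j<N. x j = 0 then (-1) ^ N else 0)"
  proof (rule initial_det)
    show "tower (tseq delta_fun)" by (rule tower_tseq[OF low_vanish_delta_fun])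
    show "tseq delta_fun 0 x = (if x = 0 then -1 else 0)" for x by (simp add: tseq_def seq_delta_fun)
    show "x j \<le> x (Suc j)" if "Suc j < N" for j using x that by (simp add: states_def)
  qed
  also have "(\<forall>j<N. x j = 0) \<longleftrightarrow> x = origin"
    using x by (auto simp: states_def origin_def fun_eq_iff PiE_def extensional_def)
  also have "(\<Prod>i<N. (-1) ^ Suc i) = (-1) ^ N * sign_prod"
    by (simp only: sign_prod_def power_Suc prod.distrib prod_constant card_lessThan)
  finally show ?thesis by (simp add: mult.assoc[symmetric] power_mult_distrib[symmetric])
qed

text \<open>Evaluation at \<open>a p\<close> cancels the power of 1 - z in
  \<open>norm_factor p\<close>, and order \<open>j\<close> leaves the power z^(j - N). The functions
  \<open>right_init (Suc j)\<close> are triangular combinations of these powers, with coefficient 1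
  at the lowest one.\<close>

lemma final_columns:
  fixes X :: "nat \<Rightarrow> complex \<Rightarrow> complex"
  assumes X: "\<And>i. i < N \<Longrightarrow> X i holomorphic_on Om"
  shows "sign_prod * rdet N (\<lambda>j i. tseq (\<lambda>z. norm_factor p z * X i z) (int j) (a p)) =
    rdet N (\<lambda>i j. oint 1 2 (\<lambda>z. right_init (Suc j) z * X i z))"
proof -
  let ?M = "\<lambda>j i. tseq (\<lambda>z. norm_factor p z * X i z) (int j) (a p)"
  define W where "W l j = (if j \<le> l then (-1) ^ l * taylor_coef (reg_r (Suc j)) (l - j) else 0)" for l j
  have Mo: "(-1) ^ j * ?M j i = oint 1 2 (\<lambda>z. z powi (int j - int N) * X i z)" for j i
    unfolding tseq_def seq_cmul[symmetric] unfolding seq_def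
  proof (rule oint_cong)
    fix z :: complex assume z: "cmod (z - 1) = 2"
    then have nz: "z \<noteq> 0" "1 - z \<noteq> 0" by auto
    have "(-1) ^ j * ((- z) powi int j * (norm_factor p z * X i z)) * (1 - z) powi a p =
      ((-1) ^ j * (- z) powi int j) * z powi (- int (n p)) * X i z * ((1 - z) powi (- a p) * (1 - z) powi a p)"
      by (simp only: norm_factor_def mult_ac)
    also have "(1 - z) powi (- a p) * (1 - z) powi a p = 1" using nz by (simp add: power_int_minus)
    also have "((-1) ^ j * (- z) powi int j) * z powi (- int (n p)) = z powi (int j - int N)"
      using nz by (simp only: neg_powi) (simp add: N_def power_int_diff power_int_minus divide_inverse)
    finally show "(-1) ^ j * ((- z) powi int j * (norm_factor p z * X i z)) * (1 - z) powi a p = z powi (int j - int N) * X i z"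
      by simp
  qed simp
  have ent: "oint 1 2 (\<lambda>z. right_init (Suc j) z * X i z) = (\<Sum>l<N. ?M l i * W l j)" if ij: "i < N" "j < N" for i j
  proof -
    have hz: "continuous_on (sphere 1 2) (\<lambda>z. c * (z powi k * X i z))" for c k
      by (rule sphere_Om) (use q1 in \<open>auto intro!: holomorphic_on_mult holomorphic_on_const powi_hol_Om(1) X ij\<close>)
    have "oint 1 2 (\<lambda>z. right_init (Suc j) z * X i z) =
      oint 1 2 (\<lambda>z. \<Sum>l\<in>{j..<N}. taylor_coef (reg_r (Suc j)) (l - j) * (z powi (int l - int N) * X i z))"
    proof (rule oint_cong)
      fix z :: complex assume "cmod (z - 1) = 2"
      then have zO: "z \<in> Om" using in_Om[of z 2] q1 by simp
      have "right_init (Suc j) z = (\<Sum>l<N - j. taylor_coef (reg_r (Suc j)) (N - Suc j - l) * z powi (- int l - 1))"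
        using right_init_sum[OF zO, of "Suc j"] ij by (simp add: N_def)
      also have "\<dots> = (\<Sum>l\<in>{j..<N}. taylor_coef (reg_r (Suc j)) (l - j) * z powi (int l - int N))"
        by (rule sum.reindex_bij_witness[where i = "\<lambda>l. N - Suc l" and j = "\<lambda>l. N - Suc l"])
           (use ij in \<open>auto intro!: arg_cong2[of _ _ _ _ "(*)"] arg_cong[of _ _ "\<lambda>k. z powi k"] arg_cong[of _ _ "taylor_coef (reg_r (Suc j))"]\<close>)
      finally show "right_init (Suc j) z * X i z = (\<Sum>l\<in>{j..<N}. taylor_coef (reg_r (Suc j)) (l - j) * (z powi (int l - int N) * X i z))"
        by (simp add: sum_distrib_right mult.assoc)
    qed simp
    also have "\<dots> = (\<Sum>l\<in>{j..<N}. taylor_coef (reg_r (Suc j)) (l - j) * oint 1 2 (\<lambda>z. z powi (int l - int N) * X i z))"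
      by (subst oint_sum[OF hz]) (simp_all add: oint_cmul)
    also have "\<dots> = (\<Sum>l\<in>{j..<N}. ?M l i * W l j)"
      by (rule sum.cong) (simp_all add: W_def flip: Mo)
    also have "\<dots> = (\<Sum>l<N. ?M l i * W l j)"
      by (rule sum.mono_neutral_left) (auto simp: W_def)
    finally show ?thesis .
  qed
  have "rdet N (\<lambda>i j. oint 1 2 (\<lambda>z. right_init (Suc j) z * X i z)) = rdet N (\<lambda>i j. \<Sum>l<N. ?M l i * W l j)"
    by (rule rdet_cong) (simp add: ent)
  also have "\<dots> = rdet N (\<lambda>i l. ?M l i) * rdet N W" by (rule rdet_mult)
  also have "rdet N (\<lambda>i l. ?M l i) = rdet N ?M" by (rule rdet_transpose)
  also have "rdet N W = rdet N (\<lambda>j l. W l j)" by (rule rdet_transpose[symmetric])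
  also have "\<dots> = sign_prod"
    unfolding sign_prod_def by (subst rdet_upper) (auto simp: W_def taylor_coef_0[OF reg_r_hol] reg_r_0)
  finally show ?thesis by simp
qed

lemma oints_cmul: "oints c \<rho> ks (\<lambda>\<theta>. K * F \<theta>) = K * oints c \<rho> ks F"
  by (induction ks arbitrary: F) (simp_all add: oint_cmul)

lemma V_eq_Tmat:
  assumes "1 < r"
  shows "V (m p) origin = oints 0 (\<lambda>_. r) [1..<p] (\<lambda>\<theta>.
    rdet N (\<lambda>i j. Tmat \<theta> (\<lambda>_. 1) (Suc i) (Suc j)) / (\<Prod>l\<in>{1..<p}. \<theta> l ^ n l * (\<theta> l - 1)))"
proof -
  let ?X = "\<lambda>\<theta> i z. g p z * full_chain \<theta> (\<lambda>_. 1) (left_init (Suc i)) (p - 1) z"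
  have HX: "steps \<theta> (p - 1) 1 (\<lambda>z. g 1 z * left_init (Suc i) z) = ?X \<theta> i" for \<theta> i
    using steps_full_chain[of 1 \<theta> "p - 1" "left_init (Suc i)"] p2 by simp
  have "sign_prod * V (m p) origin = oints 0 (\<lambda>_. r) [1..<p] (\<lambda>\<theta>.
     rdet N (\<lambda>j i. tseq (\<lambda>z. norm_factor p z * steps \<theta> (p - 1) 1 (\<lambda>z. g 1 z * left_init (Suc i) z) z) (int j) (a p)) /
      (\<Prod>l\<in>{1..<p}. \<theta> l ^ n l * (\<theta> l - 1)))"
    by (rule main_det[OF low_vanish_left_init assms det_left_init])
  then have "sign_prod * (sign_prod * V (m p) origin) = oints 0 (\<lambda>_. r) [1..<p] (\<lambda>\<theta>.
     sign_prod * (rdet N (\<lambda>j i. tseq (\<lambda>z. norm_factor p z * ?X \<theta> i z) (int j) (a p)) / (\<Prod>l\<in>{1..<p}. \<theta> l ^ n l * (\<theta> l - 1))))"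
    unfolding HX oints_cmul by simp
  also have "\<dots> = oints 0 (\<lambda>_. r) [1..<p] (\<lambda>\<theta>.
    rdet N (\<lambda>i j. Tmat \<theta> (\<lambda>_. 1) (Suc i) (Suc j)) / (\<Prod>l\<in>{1..<p}. \<theta> l ^ n l * (\<theta> l - 1)))"
  proof -
    have "sign_prod * rdet N (\<lambda>j i. tseq (\<lambda>z. norm_factor p z * ?X \<theta> i z) (int j) (a p)) = rdet N (\<lambda>i j. Tmat \<theta> (\<lambda>_. 1) (Suc i) (Suc j))" for \<theta>
      unfolding Tmat_def by (rule final_columns) (intro holomorphic_on_mult g_hol full_chain_hol left_init_hol)
    then show ?thesis by (simp only: times_divide_eq_right)
  qed
  finally show ?thesis by (simp add: mult.assoc[symmetric] sign_prod_sq)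
qed

lemma P0_cmul_fun: "P0 (\<lambda>w. k * f w) = (\<lambda>z. k * P0 f z)" "P1 (\<lambda>w. k * f w) = (\<lambda>z. k * P1 f z)"
  by (simp_all add: prin_cmul fun_eq_iff)

lemma full_chain_scale: "full_chain (\<lambda>k. c k * t1 k) (\<lambda>k. c k * t2 k) u0 k z = (\<Prod>l\<in>{1..k}. c l) * full_chain t1 t2 u0 k z"
proof (induction k arbitrary: z)
  case (Suc k)
  let ?h = "\<lambda>z. g (Suc k) z * full_chain t1 t2 u0 k z"
  define C where "C = (\<Prod>l\<in>{1..k}. c l)"
  have "(\<lambda>z. g (Suc k) z * full_chain (\<lambda>k. c k * t1 k) (\<lambda>k. c k * t2 k) u0 k z) = (\<lambda>z. C * ?h z)"
    by (simp add: Suc C_def fun_eq_iff mult_ac)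
  then have "full_chain (\<lambda>k. c k * t1 k) (\<lambda>k. c k * t2 k) u0 (Suc k) z =
      C * c (Suc k) * mix (t1 (Suc k)) (t2 (Suc k)) ?h z"
    by (simp add: mix_def P0_cmul_fun algebra_simps)
  then show ?case by (simp add: C_def)
qed simp

text \<open>Each truncation is homogeneous of degree one in its pair of parameters. This lets every
  row of the matrix choose its own normalisation of \<theta>.\<close>

lemma Tmat_scale: "Tmat (\<lambda>k. c k * t1 k) (\<lambda>k. c k * t2 k) i j = (\<Prod>l\<in>{1..<p}. c l) * Tmat t1 t2 i j"
proof -
  have "{1..p - 1} = {1..<p}" using p2 by auto
  then show ?thesis by (simp add: Tmat_def full_chain_scale mult.left_commute oint_cmul)
qed

end

section \<open>Nested integrals and the order of the radii\<close>

text \<open>\<open>oints\<close> treats the head of the list as the outermost variable; an induction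
  along a chain adds the innermost one.\<close>

lemma oints_snoc:
  "distinct (ks @ [k]) \<Longrightarrow> oints c \<rho> (ks @ [k]) f = oints c \<rho> ks (\<lambda>z. oint c (\<rho> k) (\<lambda>w. f (z(k := w))))"
proof (induction ks arbitrary: f)
  case (Cons x ks)
  then have "x \<noteq> k" "distinct (ks @ [k])" by auto
  have "(\<lambda>v. oints c \<rho> (ks @ [k]) (\<lambda>z. f (z(x := v)))) =
      (\<lambda>v. oints c \<rho> ks (\<lambda>z. oint c (\<rho> k) (\<lambda>w. f (z(x := v, k := w)))))"
    using \<open>x \<noteq> k\<close> by (simp only: Cons.IH[OF \<open>distinct (ks @ [k])\<close>] fun_upd_twist[of k x])
  then show ?case by (simp only: oints.simps append_Cons)
qed simp

lemma oints_cong: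
  assumes "distinct ks" "\<And>k. k \<in> set ks \<Longrightarrow> 0 \<le> \<rho> k"
    and "\<And>z. (\<And>k. k \<in> set ks \<Longrightarrow> cmod (z k - c) = \<rho> k) \<Longrightarrow> f z = f' z"
  shows "oints c \<rho> ks f = oints c \<rho> ks f'"
  using assms
proof (induction ks arbitrary: f f')
  case (Cons x ks)
  have "oint c (\<rho> x) (\<lambda>w. oints c \<rho> ks (\<lambda>z. f (z(x := w)))) = oint c (\<rho> x) (\<lambda>w. oints c \<rho> ks (\<lambda>z. f' (z(x := w))))"
  proof (rule oint_cong)
    fix w assume w: "cmod (w - c) = \<rho> x"
    show "oints c \<rho> ks (\<lambda>z. f (z(x := w))) = oints c \<rho> ks (\<lambda>z. f' (z(x := w)))"
    proof (rule Cons.IH)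
      fix z assume z: "\<And>k. k \<in> set ks \<Longrightarrow> cmod (z k - c) = \<rho> k"
      show "f (z(x := w)) = f' (z(x := w))"
        by (rule Cons.prems(3)) (use z w in \<open>auto simp: fun_upd_apply\<close>)
    qed (use Cons.prems in auto)
  qed (use Cons.prems in auto)
  then show ?case by simp
qed simp

lemma cont_kernel_prod:
  fixes f h :: "complex \<Rightarrow> complex"
  assumes "continuous_on (sphere c \<rho>) f" "continuous_on (sphere c' \<rho>') h"
    and ne: "\<And>z w. cmod (z - c) = \<rho> \<Longrightarrow> cmod (w - c') = \<rho>' \<Longrightarrow> z \<noteq> w"
  shows "continuous_on (sphere c \<rho> \<times> sphere c' \<rho>') (\<lambda>(z, w). f z * (h w * inverse (z - w)))"
proof -
  have 1: "continuous_on (sphere c \<rho> \<times> sphere c' \<rho>') (\<lambda>x. f (fst x))"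
    using assms(1) by (rule continuous_on_compose2) (auto intro!: continuous_intros)
  have 2: "continuous_on (sphere c \<rho> \<times> sphere c' \<rho>') (\<lambda>x. h (snd x))"
    using assms(2) by (rule continuous_on_compose2) (auto intro!: continuous_intros)
  have 3: "\<forall>x\<in>sphere c \<rho> \<times> sphere c' \<rho>'. fst x - snd x \<noteq> 0"
  proof
    fix x assume "x \<in> sphere c \<rho> \<times> sphere c' \<rho>'"
    then show "fst x - snd x \<noteq> 0"
      using ne[of "fst x" "snd x"] by (simp only: mem_Times_iff right_minus_eq) (simp add: dist_norm norm_minus_commute)
  qed
  show ?thesis unfolding case_prod_beta by (intro continuous_intros 1 2 3)
qed

lemma oint_swap_kernel:
  fixes f h :: "complex \<Rightarrow> complex"
  assumes "continuous_on (sphere c \<rho>) f" "continuous_on (sphere c' \<rho>') h" "0 \<le> \<rho>" "0 \<le> \<rho>'"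
    and "\<And>z w. cmod (z - c) = \<rho> \<Longrightarrow> cmod (w - c') = \<rho>' \<Longrightarrow> z \<noteq> w"
  shows "oint c \<rho> (\<lambda>z. f z * oint c' \<rho>' (\<lambda>w. h w * inverse (z - w))) =
    oint c' \<rho>' (\<lambda>w. oint c \<rho> (\<lambda>z. f z * inverse (z - w)) * h w)"
proof -
  have "oint c \<rho> (\<lambda>z. f z * oint c' \<rho>' (\<lambda>w. h w * inverse (z - w))) =
      oint c' \<rho>' (\<lambda>w. oint c \<rho> (\<lambda>z. f z * (h w * inverse (z - w))))"
    unfolding oint_cmul[symmetric] by (rule oint_swap[OF cont_kernel_prod]) (use assms in auto)
  also have "(\<lambda>w. oint c \<rho> (\<lambda>z. f z * (h w * inverse (z - w)))) = (\<lambda>w. oint c \<rho> (\<lambda>z. f z * inverse (z - w)) * h w)"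
    unfolding oint_mulc[symmetric] by (simp add: mult_ac)
  finally show ?thesis .
qed

text \<open>The functional \<open>E\<close> is either evaluation at a point or a further contour integral,
  which then is outermost.\<close>

lemma chain_integral:
  fixes E :: "(complex \<Rightarrow> complex) \<Rightarrow> complex" and K :: "complex \<Rightarrow> complex \<Rightarrow> complex"
    and G S :: "nat \<Rightarrow> complex \<Rightarrow> complex"
  assumes R: "\<And>k. k1 < k \<Longrightarrow> k \<le> k2 \<Longrightarrow> 0 < R k"
    and ne: "\<And>k. k1 < k \<Longrightarrow> k < k2 \<Longrightarrow> R k \<noteq> R (Suc k)"
    and G: "\<And>k. k1 < k \<Longrightarrow> k \<le> k2 \<Longrightarrow> continuous_on (sphere 1 (R k)) (G k)"
    and S: "\<And>k. k1 < k \<Longrightarrow> k \<le> k2 \<Longrightarrow> continuous_on (sphere 1 (R k)) (S (k - 1))"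
    and step: "\<And>k w. k1 < k \<Longrightarrow> k < k2 \<Longrightarrow> cmod (w - 1) = R (Suc k) \<Longrightarrow>
       oint 1 (R k) (\<lambda>z. S (k - 1) z * G k z * inverse (z - w)) = S k w"
    and base: "\<And>\<rho>. continuous_on (sphere 1 (R (Suc k1))) \<rho> \<Longrightarrow>
       E (\<lambda>\<zeta>. oint 1 (R (Suc k1)) (\<lambda>z. K \<zeta> z * (G (Suc k1) z * \<rho> z))) =
       oint 1 (R (Suc k1)) (\<lambda>z. S k1 z * (G (Suc k1) z * \<rho> z))"
    and k: "k1 < k2" and \<rho>: "continuous_on (sphere 1 (R k2)) \<rho>"
  shows "E (\<lambda>\<zeta>. oints 1 R [Suc k1..<Suc k2] (\<lambda>z. K \<zeta> (z (Suc k1)) * (\<Prod>k\<in>{k1<..k2}. G k (z k))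
      * (\<Prod>k\<in>{k1<..<k2}. inverse (z k - z (Suc k))) * \<rho> (z k2))) =
    oint 1 (R k2) (\<lambda>z. S (k2 - 1) z * (G k2 z * \<rho> z))"
proof -
  have "E (\<lambda>\<zeta>. oints 1 R [Suc k1..<Suc k] (\<lambda>z. K \<zeta> (z (Suc k1)) * (\<Prod>k\<in>{k1<..k}. G k (z k))
      * (\<Prod>k\<in>{k1<..<k}. inverse (z k - z (Suc k))) * \<rho> (z k))) =
    oint 1 (R k) (\<lambda>z. S (k - 1) z * (G k z * \<rho> z))"
    if "Suc k1 \<le> k" "k \<le> k2" "continuous_on (sphere 1 (R k)) \<rho>" for k \<rho>
    using that
  proof (induction k arbitrary: \<rho> rule: dec_induct)
    case base
    have i: "{k1<..Suc k1} = {Suc k1}" "{k1<..<Suc k1} = {}" by auto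
    show ?case using assms(6)[OF base(2)] by (simp add: i mult.assoc)
  next
    case (step k)
    then have k: "k1 < k" "k < k2" "0 < R k" "0 < R (Suc k)" using R by auto
    define \<rho>' where "\<rho>' z = oint 1 (R (Suc k)) (\<lambda>w. (G (Suc k) w * \<rho> w) * inverse (z - w))" for z
    have c1: "continuous_on (sphere 1 (R k)) (\<lambda>z. S (k - 1) z * G k z)"
      using k by (intro continuous_on_mult G S) auto
    have c2: "continuous_on (sphere 1 (R (Suc k))) (\<lambda>w. G (Suc k) w * \<rho> w)"
      using k step.prems by (intro continuous_on_mult G) auto
    have "\<rho>' holomorphic_on {z. cmod (z - 1) \<noteq> R (Suc k)}"
      using Cauchy_type_holomorphic[OF c2 k(4)] by (simp add: \<rho>'_def[abs_def] divide_inverse)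
    then have c3: "continuous_on (sphere 1 (R k)) \<rho>'"
      by (rule continuous_on_subset[OF holomorphic_on_imp_continuous_on])
         (use ne[OF k(1,2)] in \<open>auto simp: dist_norm norm_minus_commute\<close>)
    have i: "{k1<..Suc k} = insert (Suc k) {k1<..k}" "{k1<..<Suc k} = insert k {k1<..<k}" using k by auto
    have "oints 1 R [Suc k1..<Suc (Suc k)] (\<lambda>z. K \<zeta> (z (Suc k1)) * (\<Prod>k\<in>{k1<..Suc k}. G k (z k))
      * (\<Prod>k\<in>{k1<..<Suc k}. inverse (z k - z (Suc k))) * \<rho> (z (Suc k))) =
      oints 1 R [Suc k1..<Suc k] (\<lambda>z. K \<zeta> (z (Suc k1)) * (\<Prod>k\<in>{k1<..k}. G k (z k))
      * (\<Prod>k\<in>{k1<..<k}. inverse (z k - z (Suc k))) * \<rho>' (z k))" for \<zeta>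
    proof -
      have u: "[Suc k1..<Suc (Suc k)] = [Suc k1..<Suc k] @ [Suc k]" using k by simp
      have "K \<zeta> ((z(Suc k := w)) (Suc k1)) * (\<Prod>l\<in>{k1<..Suc k}. G l ((z(Suc k := w)) l))
        * (\<Prod>l\<in>{k1<..<Suc k}. inverse ((z(Suc k := w)) l - (z(Suc k := w)) (Suc l))) * \<rho> ((z(Suc k := w)) (Suc k)) =
        (K \<zeta> (z (Suc k1)) * (\<Prod>l\<in>{k1<..k}. G l (z l)) * (\<Prod>l\<in>{k1<..<k}. inverse (z l - z (Suc l)))) *
        ((G (Suc k) w * \<rho> w) * inverse (z k - w))" for z w
      proof -
        have "(\<Prod>l\<in>{k1<..k}. G l ((z(Suc k := w)) l)) = (\<Prod>l\<in>{k1<..k}. G l (z l))"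
          by (rule prod.cong) auto
        moreover have "(\<Prod>l\<in>{k1<..<k}. inverse ((z(Suc k := w)) l - (z(Suc k := w)) (Suc l))) = (\<Prod>l\<in>{k1<..<k}. inverse (z l - z (Suc l)))"
          by (rule prod.cong) auto
        ultimately show ?thesis using k unfolding i by (simp add: mult_ac)
      qed
      moreover have "distinct ([Suc k1..<Suc k] @ [Suc k])" by simp
      ultimately show ?thesis unfolding u by (simp only: oints_snoc oint_cmul \<rho>'_def)
    qed
    then have "E (\<lambda>\<zeta>. oints 1 R [Suc k1..<Suc (Suc k)] (\<lambda>z. K \<zeta> (z (Suc k1)) * (\<Prod>k\<in>{k1<..Suc k}. G k (z k))
      * (\<Prod>k\<in>{k1<..<Suc k}. inverse (z k - z (Suc k))) * \<rho> (z (Suc k)))) =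
      oint 1 (R k) (\<lambda>z. S (k - 1) z * (G k z * \<rho>' z))"
      using step.IH[OF _ c3] k by simp
    also have "\<dots> = oint 1 (R k) (\<lambda>z. (S (k - 1) z * G k z) * oint 1 (R (Suc k)) (\<lambda>w. (G (Suc k) w * \<rho> w) * inverse (z - w)))"
      by (simp only: \<rho>'_def mult.assoc)
    also have "\<dots> = oint 1 (R (Suc k)) (\<lambda>w. oint 1 (R k) (\<lambda>z. (S (k - 1) z * G k z) * inverse (z - w)) * (G (Suc k) w * \<rho> w))"
      by (rule oint_swap_kernel[OF c1 c2]) (use k ne[OF k(1,2)] in auto)
    also have "\<dots> = oint 1 (R (Suc k)) (\<lambda>w. S k w * (G (Suc k) w * \<rho> w))"
      by (rule oint_cong) (use assms(5)[OF k(1,2)] k in auto)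
    finally show ?case by simp
  qed
  then show ?thesis using k \<rho> by simp
qed

text \<open>The result of integrating the first \<open>d\<close> variables of a chain, as a function
  of the next variable. It serves for chains in which \<zeta>1 is still fixed.\<close>

primrec chain_fun where
  "chain_fun R G k1 u 0 = u"
| "chain_fun R G k1 u (Suc d) = (\<lambda>w. oint 1 (R (Suc (k1 + d)))
     (\<lambda>z. chain_fun R G k1 u d z * G (Suc (k1 + d)) z * inverse (z - w)))"

text \<open>The new variable meets only the last variable of the chain, and everything before is a
  continuous function of that one; exchanging two integrals suffices.\<close>

lemma oint_oints_swap:
  fixes u :: "complex \<Rightarrow> complex" and G :: "nat \<Rightarrow> complex \<Rightarrow> complex"
  assumes R: "\<And>k. k1 < k \<Longrightarrow> k \<le> k2 \<Longrightarrow> 0 < R k"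
    and ne: "\<And>k. k1 < k \<Longrightarrow> k < k2 \<Longrightarrow> R k \<noteq> R (Suc k)"
    and G: "\<And>k. k1 < k \<Longrightarrow> k \<le> k2 \<Longrightarrow> continuous_on (sphere 1 (R k)) (G k)"
    and u: "continuous_on (sphere 1 (R (Suc k1))) u"
    and k: "k1 < k2" and h: "continuous_on (sphere c \<tau>) h" and \<tau>: "0 < \<tau>"
    and far: "\<And>z \<zeta>. cmod (z - 1) = R k2 \<Longrightarrow> cmod (\<zeta> - c) = \<tau> \<Longrightarrow> z \<noteq> \<zeta>"
  shows "oint c \<tau> (\<lambda>\<zeta>. oints 1 R [Suc k1..<Suc k2] (\<lambda>z. u (z (Suc k1)) * (\<Prod>k\<in>{k1<..k2}. G k (z k))
      * (\<Prod>k\<in>{k1<..<k2}. inverse (z k - z (Suc k))) * (h \<zeta> * inverse (z k2 - \<zeta>)))) =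
    oints 1 R [Suc k1..<Suc k2] (\<lambda>z. u (z (Suc k1)) * (\<Prod>k\<in>{k1<..k2}. G k (z k))
      * (\<Prod>k\<in>{k1<..<k2}. inverse (z k - z (Suc k))) * oint c \<tau> (\<lambda>\<zeta>. h \<zeta> * inverse (z k2 - \<zeta>)))"
proof -
  define S where "S k = chain_fun R G k1 u (k - k1)" for k
  have Sc: "continuous_on (sphere 1 (R (Suc (k1 + d)))) (chain_fun R G k1 u d)" if "k1 + d < k2" for d
    using that
  proof (induction d)
    case (Suc d)
    let ?f = "\<lambda>z. chain_fun R G k1 u d z * G (Suc (k1 + d)) z"
    have c: "continuous_on (sphere 1 (R (Suc (k1 + d)))) ?f"
      using Suc by (intro continuous_on_mult G) auto
    have e: "chain_fun R G k1 u (Suc d) = (\<lambda>w. - oint 1 (R (Suc (k1 + d))) (\<lambda>z. ?f z / (w - z)))"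
    proof
      fix w
      have "?f z * inverse (z - w) = - (?f z / (w - z))" for z
        by (metis divide_inverse minus_diff_eq minus_divide_right)
      then show "chain_fun R G k1 u (Suc d) w = - oint 1 (R (Suc (k1 + d))) (\<lambda>z. ?f z / (w - z))"
        by (simp only: chain_fun.simps oint_neg)
    qed
    have "chain_fun R G k1 u (Suc d) holomorphic_on {z. cmod (z - 1) \<noteq> R (Suc (k1 + d))}"
      unfolding e using R[of "Suc (k1 + d)"] Suc.prems
      by (intro holomorphic_on_minus Cauchy_type_holomorphic[OF c]) auto
    then show ?case
      by (rule continuous_on_subset[OF holomorphic_on_imp_continuous_on])
         (use ne[of "Suc (k1 + d)"] Suc.prems in \<open>auto simp: dist_norm norm_minus_commute\<close>)
  qed (use u in simp)
  have S: "continuous_on (sphere 1 (R k)) (S (k - 1))" if "k1 < k" "k \<le> k2" for k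
    using Sc[of "k - 1 - k1"] that by (simp add: S_def)
  have chain: "oints 1 R [Suc k1..<Suc k2] (\<lambda>z. u (z (Suc k1)) * (\<Prod>k\<in>{k1<..k2}. G k (z k))
      * (\<Prod>k\<in>{k1<..<k2}. inverse (z k - z (Suc k))) * \<rho> (z k2)) =
    oint 1 (R k2) (\<lambda>z. S (k2 - 1) z * (G k2 z * \<rho> z))" if "continuous_on (sphere 1 (R k2)) \<rho>" for \<rho>
  proof (rule chain_integral[of k1 k2 R G S "\<lambda>f. f 0" "\<lambda>_. u" \<rho>])
    fix k w assume k: "k1 < k" "k < k2"
    then obtain d where "k = Suc (k1 + d)" using less_imp_Suc_add by blast
    then show "oint 1 (R k) (\<lambda>z. S (k - 1) z * G k z * inverse (z - w)) = S k w"
      by (simp add: S_def Suc_diff_le)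
  qed (use R ne G S k that in \<open>auto simp: S_def\<close>)
  have c1: "continuous_on (sphere 1 (R k2)) (\<lambda>z. S (k2 - 1) z * G k2 z)"
    using k by (intro continuous_on_mult G S) auto
  have kern: "continuous_on (sphere 1 (R k2)) (\<lambda>z. h \<zeta> * inverse (z - \<zeta>))" if "cmod (\<zeta> - c) = \<tau>" for \<zeta>
    by (intro continuous_intros) (use far that in \<open>auto simp: dist_norm norm_minus_commute\<close>)
  have ch: "continuous_on (sphere 1 (R k2)) (\<lambda>z. oint c \<tau> (\<lambda>\<zeta>. h \<zeta> * inverse (z - \<zeta>)))"
  proof (rule continuous_on_subset[OF holomorphic_on_imp_continuous_on])
    show "(\<lambda>z. oint c \<tau> (\<lambda>\<zeta>. h \<zeta> * inverse (z - \<zeta>))) holomorphic_on {z. cmod (z - c) \<noteq> \<tau>}"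
      using Cauchy_type_holomorphic[OF h \<tau>] by (simp only: divide_inverse)
    show "sphere 1 (R k2) \<subseteq> {z. cmod (z - c) \<noteq> \<tau>}"
    proof
      fix z :: complex assume "z \<in> sphere 1 (R k2)"
      then show "z \<in> {z. cmod (z - c) \<noteq> \<tau>}" using far[of z z] by (auto simp: dist_norm norm_minus_commute)
    qed
  qed
  have "oint c \<tau> (\<lambda>\<zeta>. oints 1 R [Suc k1..<Suc k2] (\<lambda>z. u (z (Suc k1)) * (\<Prod>k\<in>{k1<..k2}. G k (z k))
      * (\<Prod>k\<in>{k1<..<k2}. inverse (z k - z (Suc k))) * (h \<zeta> * inverse (z k2 - \<zeta>)))) =
    oint c \<tau> (\<lambda>\<zeta>. oint 1 (R k2) (\<lambda>z. (S (k2 - 1) z * G k2 z) * inverse (z - \<zeta>)) * h \<zeta>)"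
  proof (rule oint_cong)
    fix \<zeta> assume "cmod (\<zeta> - c) = \<tau>"
    from chain[OF kern[OF this]] show "oints 1 R [Suc k1..<Suc k2] (\<lambda>z. u (z (Suc k1)) * (\<Prod>k\<in>{k1<..k2}. G k (z k))
      * (\<Prod>k\<in>{k1<..<k2}. inverse (z k - z (Suc k))) * (h \<zeta> * inverse (z k2 - \<zeta>))) =
      oint 1 (R k2) (\<lambda>z. (S (k2 - 1) z * G k2 z) * inverse (z - \<zeta>)) * h \<zeta>"
      unfolding oint_mulc[symmetric] by (simp only: mult_ac)
  qed (use \<tau> in simp)
  also have "\<dots> = oint 1 (R k2) (\<lambda>z. (S (k2 - 1) z * G k2 z) * oint c \<tau> (\<lambda>\<zeta>. h \<zeta> * inverse (z - \<zeta>)))"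
    by (rule oint_swap_kernel[OF c1 h, symmetric]) (use far \<tau> R[of k2] k in auto)
  finally show ?thesis unfolding chain[OF ch] by (simp only: mult.assoc)
qed

context pts begin

text \<open>If \<open>R < R'\<close>, the point \<open>w\<close> is outside the contour and minus
  the principal part appears; if \<open>R' < R\<close>, it is inside and the residue
  \<open>h w\<close> is added. Both are \<open>mix1\<close>, with parameters 0, -1 and 1, 0
  respectively.\<close>

lemma kernel_step:
  assumes h: "h holomorphic_on Om" and R: "q < R" "R < 1" "q < R'" "R' < 1" "R \<noteq> R'" and w: "cmod (w - 1) = R'"
  shows "oint 1 R (\<lambda>z. h z * inverse (z - w)) = mix1 (of_bool (R' < R)) (- of_bool (R < R')) h w"
proof (cases "R < R'")
  case True
  have "oint 1 R (\<lambda>z. h z * inverse (z - w)) = oint 1 R (\<lambda>z. - (h z / (w - z)))"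
    by (intro arg_cong[of _ _ "oint 1 R"] ext) (metis divide_inverse minus_diff_eq minus_divide_right)
  also have "\<dots> = - P1 h w"
    unfolding oint_neg by (subst prin_radius[OF hol_annulus1[OF h]]) (use R w q0 True in auto)
  finally show ?thesis using True by (simp add: mix1_def)
next
  case False
  then have "oint 1 R (\<lambda>z. h z * inverse (z - w)) = h w - P1 h w"
    unfolding divide_inverse[symmetric]
    by (intro prin_regular[OF hol_annulus1[OF h], symmetric]) (use R w q0 in auto)
  then show ?thesis using False R by (simp add: mix1_def)
qed

lemma lchain_step: "k1 < k \<Longrightarrow> lchain t1 t2 u0 k1 k = mix1 (t1 k) (t2 k) (\<lambda>z. g k z * lchain t1 t2 u0 k1 (k - 1) z)"
  by (cases k) auto

text \<open>For \<open>\<epsilon> k = 1\<close> the radii are decreasing at \<open>k\<close> and the inner integral picks up the residue at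
  \<open>z (Suc k)\<close>, for \<open>\<epsilon> k = 2\<close> it does not; \<open>mix1 (sel1 \<epsilon> k) (sel2 \<epsilon> k)\<close> covers both cases.\<close>

definition sel1 :: "(nat \<Rightarrow> nat) \<Rightarrow> nat \<Rightarrow> complex" where "sel1 \<epsilon> k = of_bool (\<epsilon> k = 1)"
definition sel2 :: "(nat \<Rightarrow> nat) \<Rightarrow> nat \<Rightarrow> complex" where "sel2 \<epsilon> k = - of_bool (\<epsilon> k = 2)"

definition radii_ok :: "nat \<Rightarrow> nat \<Rightarrow> (nat \<Rightarrow> nat) \<Rightarrow> (nat \<Rightarrow> real) \<Rightarrow> bool" where
  "radii_ok k1 k2 \<epsilon> R \<longleftrightarrow> (\<forall>k. k1 < k \<and> k \<le> k2 \<longrightarrow> q < R k \<and> R k < sqrt q) \<and>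
     (\<forall>k. k1 < k \<and> k < k2 \<longrightarrow> (\<epsilon> k = 2 \<and> R k < R (Suc k)) \<or> (\<epsilon> k = 1 \<and> R k > R (Suc k)))"

lemma sqrt_q: "q < sqrt q" "sqrt q < 1"
  using q0 q1 real_less_rsqrt[of q q] by (auto simp: power2_eq_square)

lemma radii_okD:
  assumes "radii_ok k1 k2 \<epsilon> R"
  shows "k1 < k \<Longrightarrow> k \<le> k2 \<Longrightarrow> q < R k" "k1 < k \<Longrightarrow> k \<le> k2 \<Longrightarrow> R k < 1" "k1 < k \<Longrightarrow> k \<le> k2 \<Longrightarrow> 0 < R k"
    "k1 < k \<Longrightarrow> k < k2 \<Longrightarrow> R k \<noteq> R (Suc k)"
    "k1 < k \<Longrightarrow> k < k2 \<Longrightarrow> sel1 \<epsilon> k = of_bool (R (Suc k) < R k)"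
    "k1 < k \<Longrightarrow> k < k2 \<Longrightarrow> sel2 \<epsilon> k = - of_bool (R k < R (Suc k))"
proof -
  show 1: "q < R k" "R k < 1" "0 < R k" if "k1 < k" "k \<le> k2"
    using assms sqrt_q(2) q0 that unfolding radii_ok_def by (meson less_trans)+
  have "(\<epsilon> k = 2 \<and> R k < R (Suc k)) \<or> (\<epsilon> k = 1 \<and> R k > R (Suc k))" if "k1 < k" "k < k2"
    using assms that unfolding radii_ok_def by blast
  then show "R k \<noteq> R (Suc k)" "sel1 \<epsilon> k = of_bool (R (Suc k) < R k)" "sel2 \<epsilon> k = - of_bool (R k < R (Suc k))"
    if "k1 < k" "k < k2"
    using that unfolding sel1_def sel2_def by fastforce+
qed

text \<open>The discs of radius sqrt q around 1 and of radius 1 - sqrt q around 0 touch only at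
  \<open>w_c q\<close>, so the strictly smaller circles never meet.\<close>

lemma radii_far:
  assumes "radii_ok k1 k2 \<epsilon> R" "k1 < k" "k \<le> k2" "cmod (z - 1) = R k" "\<tau> < 1 - sqrt q"
  shows "\<tau> < cmod z"
proof -
  have "R k < sqrt q" using assms unfolding radii_ok_def by blast
  then show ?thesis using norm_triangle_ineq4[of z "z - 1"] assms by simp
qed

lemma chain_lchain:
  fixes E :: "(complex \<Rightarrow> complex) \<Rightarrow> complex" and K :: "complex \<Rightarrow> complex \<Rightarrow> complex"
  assumes u0: "u0 holomorphic_on Om" and R: "radii_ok k1 k2 \<epsilon> R" and k: "k1 < k2"
    and base: "\<And>\<rho>. continuous_on (sphere 1 (R (Suc k1))) \<rho> \<Longrightarrow>
       E (\<lambda>\<zeta>. oint 1 (R (Suc k1)) (\<lambda>z. K \<zeta> z * (g (Suc k1) z * \<rho> z))) =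
       oint 1 (R (Suc k1)) (\<lambda>z. left_fun u0 k1 z * (g (Suc k1) z * \<rho> z))"
    and \<rho>: "continuous_on (sphere 1 (R k2)) \<rho>"
  shows "E (\<lambda>\<zeta>. oints 1 R [Suc k1..<Suc k2] (\<lambda>z. K \<zeta> (z (Suc k1)) * (\<Prod>k\<in>{k1<..k2}. g k (z k))
      * (\<Prod>k\<in>{k1<..<k2}. inverse (z k - z (Suc k))) * \<rho> (z k2))) =
    oint 1 (R k2) (\<lambda>z. lchain (sel1 \<epsilon>) (sel2 \<epsilon>) u0 k1 (k2 - 1) z * (g k2 z * \<rho> z))"
proof (rule chain_integral[of k1 k2 R g "lchain (sel1 \<epsilon>) (sel2 \<epsilon>) u0 k1" E K \<rho>])
  note Rd = radii_okD[OF R]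
  have c: "continuous_on (sphere 1 (R k)) f" if "f holomorphic_on Om" "k1 < k" "k \<le> k2" for f k
    by (rule hol_cont_sphere[OF hol_annulus1[OF that(1)]]) (use Rd that in auto)
  show "continuous_on (sphere 1 (R k)) (g k)" if "k1 < k" "k \<le> k2" for k
    by (rule c[OF g_hol that])
  show "continuous_on (sphere 1 (R k)) (lchain (sel1 \<epsilon>) (sel2 \<epsilon>) u0 k1 (k - 1))" if "k1 < k" "k \<le> k2" for k
    by (rule c[OF lchain_hol[OF u0] that])
  show "oint 1 (R k) (\<lambda>z. lchain (sel1 \<epsilon>) (sel2 \<epsilon>) u0 k1 (k - 1) z * g k z * inverse (z - w)) = lchain (sel1 \<epsilon>) (sel2 \<epsilon>) u0 k1 k w"
    if k: "k1 < k" "k < k2" and w: "cmod (w - 1) = R (Suc k)" for k w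
  proof -
    have h: "(\<lambda>z. g k z * lchain (sel1 \<epsilon>) (sel2 \<epsilon>) u0 k1 (k - 1) z) holomorphic_on Om"
      by (intro holomorphic_on_mult g_hol lchain_hol u0)
    have "oint 1 (R k) (\<lambda>z. (g k z * lchain (sel1 \<epsilon>) (sel2 \<epsilon>) u0 k1 (k - 1) z) * inverse (z - w)) =
      mix1 (of_bool (R (Suc k) < R k)) (- of_bool (R k < R (Suc k))) (\<lambda>z. g k z * lchain (sel1 \<epsilon>) (sel2 \<epsilon>) u0 k1 (k - 1) z) w"
      by (rule kernel_step[OF h _ _ _ _ _ w]) (use Rd k in auto)
    then show ?thesis by (simp only: lchain_step[OF k(1)] Rd(5,6)[OF k] mult.commute)
  qed
  show "0 < R k" if "k1 < k" "k \<le> k2" for k by (rule Rd(3)[OF that])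
  show "R k \<noteq> R (Suc k)" if "k1 < k" "k < k2" for k by (rule Rd(4)[OF that])
  fix \<rho> :: "complex \<Rightarrow> complex" assume "continuous_on (sphere 1 (R (Suc k1))) \<rho>"
  from base[OF this] show "E (\<lambda>\<zeta>. oint 1 (R (Suc k1)) (\<lambda>z. K \<zeta> z * (g (Suc k1) z * \<rho> z))) =
       oint 1 (R (Suc k1)) (\<lambda>z. lchain (sel1 \<epsilon>) (sel2 \<epsilon>) u0 k1 k1 z * (g (Suc k1) z * \<rho> z))"
    by (simp only: lchain_start)
qed (use k \<rho> in auto)

text \<open>In the Cauchy formula between a small and a large circle the large one contributes
  nothing, because a negative power divided by w - z decays quadratically.\<close>

lemma P0_power:
  assumes "z \<noteq> 0" "0 < d"
  shows "P0 (\<lambda>w. w powi (- int d)) z = z powi (- int d)"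
proof -
  let ?f = "\<lambda>w::complex. w powi (- int d)"
  define \<rho> where "\<rho> = min (1 - q) (cmod z) / 2"
  have \<rho>: "0 < \<rho>" "\<rho> < 1 - q" "\<rho> < cmod z" using q1 assms by (auto simp: \<rho>_def min_def)
  have h: "?f holomorphic_on - {0}" by (intro holomorphic_on_power_int holomorphic_intros disjI2) auto
  have ha: "?f holomorphic_on annulus 0 0 r" for r by (rule holomorphic_on_subset[OF h]) (auto simp: annulus_def)
  have "P0 ?f z = oint 0 \<rho> (\<lambda>w. ?f w / (z - w))"
    by (rule prin_radius[OF ha]) (use \<rho> in auto)
  also have "\<dots> = oint 0 \<rho> (\<lambda>w. - (?f w / (w - z)))"
    by (intro arg_cong[of _ _ "oint 0 \<rho>"] ext) (metis minus_diff_eq minus_divide_right)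
  also have "\<dots> = - oint 0 \<rho> (\<lambda>w. ?f w / (w - z))" by (rule oint_neg)
  also have "\<dots> = ?f z - oint 0 (2 * cmod z) (\<lambda>w. ?f w / (w - z))"
    using oint_annulus[OF ha[of "3 * cmod z"], of \<rho> z "2 * cmod z"] \<rho> assms by simp
  also have "oint 0 (2 * cmod z) (\<lambda>w. ?f w / (w - z)) = 0"
  proof (rule oint_decay[of _ "cmod z" _ _ "max 1 (2 * cmod z)" 2])
    show "(\<lambda>w. ?f w / (w - z)) holomorphic_on {w. cmod z < cmod (w - 0)}"
      by (intro holomorphic_on_divide holomorphic_on_subset[OF h] holomorphic_intros) auto
    fix w :: complex assume w: "max 1 (2 * cmod z) \<le> cmod (w - 0)"
    have w0: "0 < cmod w" "0 < cmod (w - z)" using w assms by auto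
    have "cmod (?f w) = cmod w powi (- int d)" by (simp add: norm_power_int)
    also have "\<dots> \<le> cmod w powi (-1)" by (rule power_int_increasing) (use w assms in auto)
    finally have 1: "cmod (?f w) \<le> 1 / cmod w" by (simp add: power_int_minus divide_inverse)
    have 2: "cmod w / 2 \<le> cmod (w - z)" using w norm_triangle_ineq2[of w z] by simp
    have "cmod (?f w / (w - z)) = cmod (?f w) / cmod (w - z)" by (rule norm_divide)
    also have "\<dots> \<le> (1 / cmod w) / (cmod w / 2)"
      by (rule frac_le) (use 1 2 w0 in auto)
    also have "\<dots> = 2 / (cmod (w - 0))\<^sup>2" by (simp add: power2_eq_square)
    finally show "cmod (?f w / (w - z)) \<le> 2 / (cmod (w - 0))\<^sup>2" .
  qed (use assms in auto)
  finally show ?thesis by simp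
qed

definition start_kernel :: "nat \<Rightarrow> nat \<Rightarrow> complex \<Rightarrow> complex \<Rightarrow> complex" where
  "start_kernel k1 i \<zeta> z = invG_l k1 i \<zeta> * ((1 - \<zeta>) / (1 - z)) ^ of_bool (k1 = 0) * inverse (z - \<zeta>)"

text \<open>Integrating \<zeta>1 first turns the kernel into a principal part at 0, identified by
  \<open>left_fun_left_init\<close>; for \<open>k1 = 0\<close> the quotient of 1 - \<zeta> and 1 - z
  reproduces \<open>left_init\<close> itself.\<close>

lemma left_kernel:
  assumes k: "k1 \<le> p" and R: "q < R" "R < sqrt q" and \<tau>: "0 < \<tau>" "\<tau> < 1 - sqrt q"
    and f: "continuous_on (sphere 1 R) f"
  shows "oint 0 \<tau> (\<lambda>\<zeta>. oint 1 R (\<lambda>z. start_kernel k1 i \<zeta> z * f z)) = oint 1 R (\<lambda>z. left_fun (left_init i) k1 z * f z)"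
proof -
  let ?b = "of_bool (k1 = 0) :: nat"
  let ?h = "\<lambda>\<zeta>. (1 - \<zeta>) ^ ?b * invG_l k1 i \<zeta>"
  let ?f = "\<lambda>z. f z * inverse (1 - z) ^ ?b"
  have R1: "R < 1" "0 < R" and \<tau>1: "\<tau> < 1 - q" using R \<tau> sqrt_q q0 by auto
  have far: "cmod z > \<tau>" if "cmod (z - 1) = R" for z
    using norm_triangle_ineq4[of z "z - 1"] that R \<tau> by simp
  have hh: "?h holomorphic_on annulus 0 0 (1 - q)"
    by (intro hol_annulus0 holomorphic_on_mult invG_l_hol holomorphic_intros)
  have ch: "continuous_on (sphere 0 \<tau>) ?h" by (rule hol_cont_sphere[OF hh \<tau>(1) \<tau>1])
  have cf: "continuous_on (sphere 1 R) ?f"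
    by (intro continuous_intros f) (use R1 in auto)
  have l: "left_fun (left_init i) k1 z = inverse (1 - z) ^ ?b * P0 ?h z" if z: "cmod (z - 1) = R" for z
  proof (cases "k1 = 0")
    case True
    then show ?thesis by (simp add: left_fun_def left_init_def divide_inverse mult.commute)
  next
    case False
    moreover have "z \<noteq> 0" using far[OF z] \<tau> by auto
    ultimately show ?thesis using left_fun_left_init[of k1 z i] k by simp
  qed
  have "oint 0 \<tau> (\<lambda>\<zeta>. oint 1 R (\<lambda>z. start_kernel k1 i \<zeta> z * f z)) =
      oint 0 \<tau> (\<lambda>\<zeta>. oint 1 R (\<lambda>z. ?f z * inverse (z - \<zeta>)) * ?h \<zeta>)"
    unfolding oint_mulc[symmetric] start_kernel_def divide_inverse power_mult_distrib by (simp only: mult_ac)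
  also have "\<dots> = oint 1 R (\<lambda>z. ?f z * oint 0 \<tau> (\<lambda>\<zeta>. ?h \<zeta> * inverse (z - \<zeta>)))"
    by (rule oint_swap_kernel[OF cf ch, symmetric]) (use far \<tau> R1 in auto)
  also have "\<dots> = oint 1 R (\<lambda>z. left_fun (left_init i) k1 z * f z)"
  proof (rule oint_cong)
    fix z assume z: "cmod (z - 1) = R"
    have "P0 ?h z = oint 0 \<tau> (\<lambda>\<zeta>. ?h \<zeta> / (z - \<zeta>))"
      by (rule prin_radius[OF hh]) (use far[OF z] \<tau> \<tau>1 in auto)
    then show "?f z * oint 0 \<tau> (\<lambda>\<zeta>. ?h \<zeta> * inverse (z - \<zeta>)) = left_fun (left_init i) k1 z * f z"
      by (simp only: l[OF z] divide_inverse mult_ac)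
  qed (use R1 in simp)
  finally show ?thesis .
qed

lemma pairing_radius:
  assumes "q < R" "R < 1"
  shows "pairing t1 t2 (left_init i) (right_init j) k1 k2 =
    oint 1 R (\<lambda>z. lchain t1 t2 (left_init i) k1 (k2 - 1) z * (g k2 z * right_fun (right_init j) k2 z))"
proof -
  have "pairing t1 t2 (left_init i) (right_init j) k1 k2 = oint 1 R (\<lambda>z. right_fun (right_init j) k2 z * (g k2 z * lchain t1 t2 (left_init i) k1 (k2 - 1) z))"
    unfolding pairing_def
    by (rule oint_radius[OF hol_annulus1[OF holomorphic_on_mult[OF right_fun_hol[OF right_init_hol] holomorphic_on_mult[OF g_hol lchain_hol[OF left_init_hol]]]]])
       (use assms q0 q1 in auto)
  then show ?thesis by (simp only: mult_ac)
qed

lemma chain_left_init: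
  assumes R: "radii_ok k1 k2 \<epsilon> R" and k: "k1 < k2" "k2 \<le> p" and \<tau>: "0 < \<tau>" "\<tau> < 1 - sqrt q"
    and \<rho>: "\<And>z. z \<in> Om \<Longrightarrow> right_fun (right_init j) k2 z = \<rho> z"
  shows "oint 0 \<tau> (\<lambda>\<zeta>. oints 1 R [Suc k1..<Suc k2] (\<lambda>z. start_kernel k1 i \<zeta> (z (Suc k1)) * (\<Prod>k\<in>{k1<..k2}. g k (z k))
      * (\<Prod>k\<in>{k1<..<k2}. inverse (z k - z (Suc k))) * \<rho> (z k2))) =
    pairing (sel1 \<epsilon>) (sel2 \<epsilon>) (left_init i) (right_init j) k1 k2"
proof -
  note Rd = radii_okD[OF R]
  have Rk: "q < R k2" "R k2 < 1" using Rd(1,2)[of k2] k by auto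
  have c: "continuous_on (sphere 1 (R k)) f" if "f holomorphic_on Om" "k1 < k" "k \<le> k2" for f k
    by (rule hol_cont_sphere[OF hol_annulus1[OF that(1)]]) (use Rd(1,2)[OF that(2,3)] in auto)
  have zO: "z \<in> Om" if "z \<in> sphere 1 (R k2)" for z
    by (rule in_Om[of z "R k2"]) (use that Rk in \<open>auto simp: dist_norm norm_minus_commute\<close>)
  have "continuous_on (sphere 1 (R k2)) (right_fun (right_init j) k2)"
    by (rule c[OF right_fun_hol[OF right_init_hol]]) (use k in auto)
  then have c\<rho>: "continuous_on (sphere 1 (R k2)) \<rho>"
    using \<rho>[OF zO] by (subst (asm) continuous_on_cong[OF refl]) auto
  have "oint 0 \<tau> (\<lambda>\<zeta>. oints 1 R [Suc k1..<Suc k2] (\<lambda>z. start_kernel k1 i \<zeta> (z (Suc k1)) * (\<Prod>k\<in>{k1<..k2}. g k (z k))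
      * (\<Prod>k\<in>{k1<..<k2}. inverse (z k - z (Suc k))) * \<rho> (z k2))) =
    oint 1 (R k2) (\<lambda>z. lchain (sel1 \<epsilon>) (sel2 \<epsilon>) (left_init i) k1 (k2 - 1) z * (g k2 z * \<rho> z))"
  proof (rule chain_lchain[OF left_init_hol R k(1) _ c\<rho>, of "oint 0 \<tau>"])
    fix \<rho> :: "complex \<Rightarrow> complex" assume "continuous_on (sphere 1 (R (Suc k1))) \<rho>"
    then show "oint 0 \<tau> (\<lambda>\<zeta>. oint 1 (R (Suc k1)) (\<lambda>z. start_kernel k1 i \<zeta> z * (g (Suc k1) z * \<rho> z))) =
       oint 1 (R (Suc k1)) (\<lambda>z. left_fun (left_init i) k1 z * (g (Suc k1) z * \<rho> z))"
      using R k by (intro left_kernel \<tau> continuous_on_mult c[OF g_hol]) (auto simp: radii_ok_def)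
  qed
  also have "\<dots> = oint 1 (R k2) (\<lambda>z. lchain (sel1 \<epsilon>) (sel2 \<epsilon>) (left_init i) k1 (k2 - 1) z * (g k2 z * right_fun (right_init j) k2 z))"
  proof (rule oint_cong)
    fix z assume "cmod (z - 1) = R k2"
    then have "z \<in> Om" by (intro zO) (simp add: dist_norm norm_minus_commute)
    then show "lchain (sel1 \<epsilon>) (sel2 \<epsilon>) (left_init i) k1 (k2 - 1) z * (g k2 z * \<rho> z) =
      lchain (sel1 \<epsilon>) (sel2 \<epsilon>) (left_init i) k1 (k2 - 1) z * (g k2 z * right_fun (right_init j) k2 z)" by (simp only: \<rho>)
  qed (use Rk q0 in simp)
  also have "\<dots> = pairing (sel1 \<epsilon>) (sel2 \<epsilon>) (left_init i) (right_init j) k1 k2"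
    by (rule pairing_radius[OF Rk, symmetric])
  finally show ?thesis .
qed

lemma chain_left_init_right_init:
  assumes R: "radii_ok k1 k2 \<epsilon> R" and k: "k1 < k2" "k2 \<le> p" and \<tau>: "0 < \<tau>1" "\<tau>1 < 1 - sqrt q" "0 < \<tau>2" "\<tau>2 < 1 - sqrt q"
  shows "oint 0 \<tau>1 (\<lambda>\<zeta>1. oint 0 \<tau>2 (\<lambda>\<zeta>2. oints 1 R [Suc k1..<Suc k2] (\<lambda>z. start_kernel k1 i \<zeta>1 (z (Suc k1)) * (\<Prod>k\<in>{k1<..k2}. g k (z k))
      * (\<Prod>k\<in>{k1<..<k2}. inverse (z k - z (Suc k))) * (invG_r k2 j \<zeta>2 * inverse (z k2 - \<zeta>2))))) =
    pairing (sel1 \<epsilon>) (sel2 \<epsilon>) (left_init i) (right_init j) k1 k2"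
proof -
  note Rd = radii_okD[OF R]
  have t: "\<tau>1 < 1 - q" "\<tau>2 < 1 - q" using \<tau> sqrt_q by auto
  have hH: "invG_r k2 j holomorphic_on annulus 0 0 (1 - q)" by (rule hol_annulus0[OF invG_r_hol])
  \<comment> \<open>The integral over \<zeta>2 equals \<open>right_fun\<close> only outside radius
    \<open>\<tau>2\<close>. This patched function agrees with \<open>right_fun\<close> on all of
    \<open>Om\<close> and is the integral wherever the contours of the chain run.\<close>
  define \<rho> where "\<rho> z = (if z \<in> Om \<and> \<not> \<tau>2 < cmod z then right_fun (right_init j) k2 z else oint 0 \<tau>2 (\<lambda>\<zeta>. invG_r k2 j \<zeta> * inverse (z - \<zeta>)))" for z
  have \<rho>: "right_fun (right_init j) k2 z = \<rho> z" if z: "z \<in> Om" for z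
  proof (cases "\<tau>2 < cmod z")
    case True
    have "right_fun (right_init j) k2 z = P0 (invG_r k2 j) z" by (rule right_fun_right_init) (use k OmD(1)[OF z] in auto)
    also have "\<dots> = oint 0 \<tau>2 (\<lambda>\<zeta>. invG_r k2 j \<zeta> / (z - \<zeta>))"
      by (rule prin_radius[OF hH]) (use True \<tau> t in auto)
    finally show ?thesis using True by (simp add: \<rho>_def divide_inverse)
  qed (simp add: \<rho>_def z)
  show ?thesis
  proof (rule trans[OF oint_cong chain_left_init[OF R k \<tau>(1,2) \<rho>]])
    fix \<zeta>1 assume z1: "cmod (\<zeta>1 - 0) = \<tau>1"
    have c: "continuous_on (sphere 1 (R k)) (g k)" if "k1 < k" "k \<le> k2" for k
      by (rule hol_cont_sphere[OF hol_annulus1[OF g_hol]]) (use Rd(1,2)[OF that] in auto)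
    have u: "continuous_on (sphere 1 (R (Suc k1))) (start_kernel k1 i \<zeta>1)"
      unfolding start_kernel_def
    proof (intro continuous_intros ballI)
      fix z :: complex assume z: "z \<in> sphere 1 (R (Suc k1))"
      then have "cmod (z - 1) = R (Suc k1)" by (simp add: dist_norm norm_minus_commute)
      from radii_far[OF R _ _ this \<tau>(2)] this show "z - \<zeta>1 \<noteq> 0" "1 - z \<noteq> 0"
        using z1 k Rd(3)[of "Suc k1"] by auto
    qed
    have "oint 0 \<tau>2 (\<lambda>\<zeta>2. oints 1 R [Suc k1..<Suc k2] (\<lambda>z. start_kernel k1 i \<zeta>1 (z (Suc k1)) * (\<Prod>k\<in>{k1<..k2}. g k (z k))
      * (\<Prod>k\<in>{k1<..<k2}. inverse (z k - z (Suc k))) * (invG_r k2 j \<zeta>2 * inverse (z k2 - \<zeta>2)))) =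
      oints 1 R [Suc k1..<Suc k2] (\<lambda>z. start_kernel k1 i \<zeta>1 (z (Suc k1)) * (\<Prod>k\<in>{k1<..k2}. g k (z k))
      * (\<Prod>k\<in>{k1<..<k2}. inverse (z k - z (Suc k))) * oint 0 \<tau>2 (\<lambda>\<zeta>2. invG_r k2 j \<zeta>2 * inverse (z k2 - \<zeta>2)))"
    proof (rule oint_oints_swap)
      show "z \<noteq> \<zeta>" if "cmod (z - 1) = R k2" "cmod (\<zeta> - 0) = \<tau>2" for z \<zeta>
        using radii_far[OF R k(1) order_refl that(1) \<tau>(4)] that(2) by auto
    qed (use Rd(3,4) c u k \<tau> hol_cont_sphere[OF hH \<tau>(3) t(2)] in auto)
    also have "\<dots> = oints 1 R [Suc k1..<Suc k2] (\<lambda>z. start_kernel k1 i \<zeta>1 (z (Suc k1)) * (\<Prod>k\<in>{k1<..k2}. g k (z k))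
      * (\<Prod>k\<in>{k1<..<k2}. inverse (z k - z (Suc k))) * \<rho> (z k2))"
    proof (rule oints_cong)
      fix z :: "nat \<Rightarrow> complex" assume "\<And>k. k \<in> set [Suc k1..<Suc k2] \<Longrightarrow> cmod (z k - 1) = R k"
      then have "cmod (z k2 - 1) = R k2" using k by simp
      from radii_far[OF R k(1) order_refl this \<tau>(4)]
      show "start_kernel k1 i \<zeta>1 (z (Suc k1)) * (\<Prod>k\<in>{k1<..k2}. g k (z k))
        * (\<Prod>k\<in>{k1<..<k2}. inverse (z k - z (Suc k))) * oint 0 \<tau>2 (\<lambda>\<zeta>2. invG_r k2 j \<zeta>2 * inverse (z k2 - \<zeta>2)) =
        start_kernel k1 i \<zeta>1 (z (Suc k1)) * (\<Prod>k\<in>{k1<..k2}. g k (z k))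
        * (\<Prod>k\<in>{k1<..<k2}. inverse (z k - z (Suc k))) * \<rho> (z k2)" by (simp add: \<rho>_def)
    next
      fix k assume "k \<in> set [Suc k1..<Suc k2]" then have "0 < R k" by (intro Rd(3)) auto
      then show "0 \<le> R k" by simp
    qed simp
    finally show "oint 0 \<tau>2 (\<lambda>\<zeta>2. oints 1 R [Suc k1..<Suc k2] (\<lambda>z. start_kernel k1 i \<zeta>1 (z (Suc k1)) * (\<Prod>k\<in>{k1<..k2}. g k (z k))
      * (\<Prod>k\<in>{k1<..<k2}. inverse (z k - z (Suc k))) * (invG_r k2 j \<zeta>2 * inverse (z k2 - \<zeta>2)))) =
      oints 1 R [Suc k1..<Suc k2] (\<lambda>z. start_kernel k1 i \<zeta>1 (z (Suc k1)) * (\<Prod>k\<in>{k1<..k2}. g k (z k))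
      * (\<Prod>k\<in>{k1<..<k2}. inverse (z k - z (Suc k))) * \<rho> (z k2))" .
  qed (use \<tau> in simp)
qed

end

section \<open>Summation over the signs\<close>

lemma sum_PiE_insert:
  assumes "x \<notin> A"
  shows "(\<Sum>\<epsilon>\<in>PiE (insert x A) D. f \<epsilon>) = (\<Sum>e\<in>D x. \<Sum>\<epsilon>\<in>PiE A D. f (\<epsilon>(x := e)))"
proof -
  have "(\<Sum>\<epsilon>\<in>PiE (insert x A) D. f \<epsilon>) = (\<Sum>(e, \<epsilon>)\<in>D x \<times> PiE A D. f (\<epsilon>(x := e)))"
    unfolding PiE_insert_eq by (subst sum.reindex[OF inj_combinator[OF assms]]) (simp add: case_prod_beta' comp_def)
  then show ?thesis by (simp add: sum.cartesian_product)
qed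

text \<open>The weights factor over the indices and \<open>X\<close> does not see those in
  \<open>B\<close>, so their sums separate.\<close>

lemma sum_PiE_outer:
  fixes c :: "'i \<Rightarrow> 'b \<Rightarrow> 'c :: comm_semiring_1"
  assumes B: "finite B" and A: "finite A" "A \<inter> B = {}"
    and X: "\<And>\<epsilon> \<epsilon>'. (\<And>k. k \<in> A \<Longrightarrow> \<epsilon> k = \<epsilon>' k) \<Longrightarrow> X \<epsilon> = X \<epsilon>'"
  shows "(\<Sum>\<epsilon>\<in>PiE (A \<union> B) D. (\<Prod>k\<in>A \<union> B. c k (\<epsilon> k)) * X \<epsilon>) =
    (\<Prod>k\<in>B. \<Sum>e\<in>D k. c k e) * (\<Sum>\<epsilon>\<in>PiE A D. (\<Prod>k\<in>A. c k (\<epsilon> k)) * X \<epsilon>)"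
  using B A(2)
proof (induction B rule: finite_induct)
  case (insert x B)
  let ?P = "\<lambda>\<epsilon>. (\<Prod>k\<in>A \<union> B. c k (\<epsilon> k)) * X \<epsilon>"
  have x: "x \<notin> A \<union> B" "finite (A \<union> B)" using insert A by auto
  have "(\<Sum>\<epsilon>\<in>PiE (A \<union> insert x B) D. (\<Prod>k\<in>A \<union> insert x B. c k (\<epsilon> k)) * X \<epsilon>) =
      (\<Sum>e\<in>D x. \<Sum>\<epsilon>\<in>PiE (A \<union> B) D. (\<Prod>k\<in>insert x (A \<union> B). c k ((\<epsilon>(x := e)) k)) * X (\<epsilon>(x := e)))"
    unfolding Un_insert_right sum_PiE_insert[OF x(1)] ..
  also have "\<dots> = (\<Sum>e\<in>D x. \<Sum>\<epsilon>\<in>PiE (A \<union> B) D. c x e * ?P \<epsilon>)"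
  proof (intro sum.cong refl)
    fix e \<epsilon>
    have "(\<Prod>k\<in>A \<union> B. c k ((\<epsilon>(x := e)) k)) = (\<Prod>k\<in>A \<union> B. c k (\<epsilon> k))"
      by (rule prod.cong) (use x in auto)
    moreover have "X (\<epsilon>(x := e)) = X \<epsilon>" by (rule X) (use x in auto)
    ultimately show "(\<Prod>k\<in>insert x (A \<union> B). c k ((\<epsilon>(x := e)) k)) * X (\<epsilon>(x := e)) = c x e * ?P \<epsilon>"
      unfolding prod.insert[OF x(2,1)] by (simp add: mult_ac)
  qed
  also have "\<dots> = (\<Sum>e\<in>D x. c x e) * (\<Sum>\<epsilon>\<in>PiE (A \<union> B) D. ?P \<epsilon>)"
    by (simp add: sum_product)
  finally show ?case using insert by (simp add: mult.assoc)
qed simp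

context pts begin

lemma lchain_cong:
  "(\<And>l. k1 < l \<Longrightarrow> l \<le> k \<Longrightarrow> t1 l = t1' l \<and> t2 l = t2' l) \<Longrightarrow> lchain t1 t2 u0 k1 k = lchain t1' t2' u0 k1 k"
proof (induction k)
  case (Suc k)
  then have "lchain t1 t2 u0 k1 k = lchain t1' t2' u0 k1 k" by simp
  moreover have "k1 < Suc k \<Longrightarrow> t1 (Suc k) = t1' (Suc k)" "k1 < Suc k \<Longrightarrow> t2 (Suc k) = t2' (Suc k)"
    using Suc.prems by auto
  ultimately show ?case by simp
qed simp

text \<open>\<open>lchain\<close> is linear in each pair of parameters separately. Choice 1 stands
  for the pair 1, 0 and choice 2 for the pair 0, -1; weighting them by \<open>c l 1\<close> and
  \<open>c l 2\<close> adds up to the pair on the right.\<close>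

lemma lchain_eps_sum:
  assumes u0: "u0 holomorphic_on Om" and "k1 \<le> k" "z \<in> Om"
  shows "(\<Sum>\<epsilon>\<in>PiE {Suc k1..k} (\<lambda>_. {1, 2}). (\<Prod>l\<in>{Suc k1..k}. c l (\<epsilon> l)) * lchain (sel1 \<epsilon>) (sel2 \<epsilon>) u0 k1 k z) =
    lchain (\<lambda>l. c l 1) (\<lambda>l. - c l 2) u0 k1 k z"
  using assms(2,3)
proof (induction k arbitrary: z rule: dec_induct)
  case base
  then show ?case by (simp add: lchain_start)
next
  case (step k)
  let ?E = "PiE {Suc k1..k} (\<lambda>_. {1, 2 :: nat})"
  let ?c = "\<lambda>\<epsilon>. \<Prod>l\<in>{Suc k1..k}. c l (\<epsilon> l)"
  let ?h = "\<lambda>\<epsilon> z. g (Suc k) z * lchain (sel1 \<epsilon>) (sel2 \<epsilon>) u0 k1 k z"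
  let ?H = "\<lambda>z. g (Suc k) z * lchain (\<lambda>l. c l 1) (\<lambda>l. - c l 2) u0 k1 k z"
  have i: "{Suc k1..Suc k} = insert (Suc k) {Suc k1..k}" "Suc k \<notin> {Suc k1..k}" using step.hyps by auto
  have hh: "?h \<epsilon> holomorphic_on Om" for \<epsilon> by (intro holomorphic_on_mult g_hol lchain_hol u0)
  have H: "(\<Sum>\<epsilon>\<in>?E. ?c \<epsilon> * ?h \<epsilon> w) = ?H w" if "w \<in> Om" for w
    using step.IH[OF that] by (simp add: sum_distrib_left[symmetric] mult.left_commute)
  have zE: "z \<in> Ex" using step.prems Om_Ex by auto
  have PH: "(\<Sum>\<epsilon>\<in>?E. ?c \<epsilon> * P1 (?h \<epsilon>) z) = P1 ?H z"
  proof -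
    have "(\<Sum>\<epsilon>\<in>?E. ?c \<epsilon> * P1 (?h \<epsilon>) z) = P1 (\<lambda>w. \<Sum>\<epsilon>\<in>?E. ?c \<epsilon> * ?h \<epsilon> w) z"
      by (rule P1_sum[symmetric]) (use hh zE in auto)
    also have "\<dots> = P1 ?H z" by (rule P1_cong[OF zE H])
    finally show ?thesis .
  qed
  have t: "(\<Prod>l\<in>{Suc k1..Suc k}. c l ((\<epsilon>(Suc k := e)) l)) * lchain (sel1 (\<epsilon>(Suc k := e))) (sel2 (\<epsilon>(Suc k := e))) u0 k1 (Suc k) z =
      c (Suc k) e * (of_bool (e = 1) * (?c \<epsilon> * ?h \<epsilon> z) - (of_bool (e = 1) + of_bool (e = 2)) * (?c \<epsilon> * P1 (?h \<epsilon>) z))" for \<epsilon> e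
  proof -
    have "(\<Prod>l\<in>{Suc k1..k}. c l ((\<epsilon>(Suc k := e)) l)) = ?c \<epsilon>" by (rule prod.cong) auto
    then have 1: "(\<Prod>l\<in>{Suc k1..Suc k}. c l ((\<epsilon>(Suc k := e)) l)) = c (Suc k) e * ?c \<epsilon>"
      unfolding i(1) by (subst prod.insert) auto
    have 2: "lchain (sel1 (\<epsilon>(Suc k := e))) (sel2 (\<epsilon>(Suc k := e))) u0 k1 k = lchain (sel1 \<epsilon>) (sel2 \<epsilon>) u0 k1 k"
      by (rule lchain_cong) (simp add: sel1_def sel2_def)
    have 3: "sel1 (\<epsilon>(Suc k := e)) (Suc k) = of_bool (e = 1)" "sel2 (\<epsilon>(Suc k := e)) (Suc k) = - of_bool (e = 2)"
      by (simp_all add: sel1_def sel2_def)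
    have "k1 \<noteq> Suc k" "k1 < Suc k" using step.hyps by auto
    then show ?thesis unfolding 1 by (simp only: lchain.simps if_False if_True 2 3 mix1_def) (simp add: algebra_simps)
  qed
  have "(\<Sum>\<epsilon>\<in>PiE {Suc k1..Suc k} (\<lambda>_. {1, 2}). (\<Prod>l\<in>{Suc k1..Suc k}. c l (\<epsilon> l)) * lchain (sel1 \<epsilon>) (sel2 \<epsilon>) u0 k1 (Suc k) z) =
     (\<Sum>e\<in>{1, 2}. \<Sum>\<epsilon>\<in>?E. c (Suc k) e * (of_bool (e = 1) * (?c \<epsilon> * ?h \<epsilon> z) - (of_bool (e = 1) + of_bool (e = 2)) * (?c \<epsilon> * P1 (?h \<epsilon>) z)))"
    unfolding t[symmetric] unfolding i(1) by (rule sum_PiE_insert[OF i(2)])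
  also have "\<dots> = (\<Sum>e\<in>{1, 2}. c (Suc k) e * (of_bool (e = 1) * ?H z - (of_bool (e = 1) + of_bool (e = 2)) * P1 ?H z))"
    by (simp only: sum_distrib_left[symmetric] sum_subtractf H[OF step.prems] PH)
  also have "\<dots> = c (Suc k) 1 * ?H z - (c (Suc k) 1 - - c (Suc k) 2) * P1 ?H z"
    by (simp add: algebra_simps)
  also have "\<dots> = lchain (\<lambda>l. c l 1) (\<lambda>l. - c l 2) u0 k1 (Suc k) z"
    using step.hyps by (simp add: mix1_def)
  finally show ?case .
qed

lemma lchain_uminus: "k1 \<le> k \<Longrightarrow> lchain (\<lambda>l. - t1 l) (\<lambda>l. - t2 l) u0 k1 k = (\<lambda>z. (-1) ^ (k - k1) * lchain t1 t2 u0 k1 k z)"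
proof (induction k rule: dec_induct)
  case (step k)
  let ?h = "\<lambda>z. g (Suc k) z * lchain t1 t2 u0 k1 k z"
  have "(\<lambda>z. g (Suc k) z * lchain (\<lambda>l. - t1 l) (\<lambda>l. - t2 l) u0 k1 k z) = (\<lambda>z. (-1) ^ (k - k1) * ?h z)"
    unfolding step.IH by (simp add: mult.left_commute)
  moreover have "Suc k - k1 = Suc (k - k1)" "k1 \<noteq> Suc k" "k1 < Suc k" using step.hyps by auto
  ultimately show ?case
    by (simp only: lchain.simps if_False if_True mix1_def P0_cmul_fun power_Suc) (simp add: algebra_simps fun_eq_iff)
qed (simp add: lchain_start)

text \<open>These weights lead to the negatives of both \<open>t1 l\<close> and \<open>t2 l\<close>,
  hence one factor -1 for every index strictly between the cuts.\<close>

lemma pairing_eps_sum: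
  assumes k: "k1 < k2" and c: "\<And>l. k1 < l \<Longrightarrow> l < k2 \<Longrightarrow> c l 1 = - t1 l \<and> c l 2 = t2 l"
  shows "(\<Sum>\<epsilon>\<in>PiE {Suc k1..k2 - 1} (\<lambda>_. {1, 2}). (\<Prod>l\<in>{Suc k1..k2 - 1}. c l (\<epsilon> l)) * pairing (sel1 \<epsilon>) (sel2 \<epsilon>) (left_init i) (right_init j) k1 k2) =
    (-1) ^ (k2 - 1 - k1) * pairing t1 t2 (left_init i) (right_init j) k1 k2"
proof -
  let ?R = "(1 + q) / 2"
  let ?E = "PiE {Suc k1..k2 - 1} (\<lambda>_. {1, 2 :: nat})"
  let ?c = "\<lambda>\<epsilon>. \<Prod>l\<in>{Suc k1..k2 - 1}. c l (\<epsilon> l)"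
  let ?f = "\<lambda>\<epsilon> z. right_fun (right_init j) k2 z * (g k2 z * lchain (sel1 \<epsilon>) (sel2 \<epsilon>) (left_init i) k1 (k2 - 1) z)"
  have R: "q < ?R" "?R < 1" "0 \<le> ?R" using q0 q1 by auto
  have hf: "(\<lambda>z. ?c \<epsilon> * ?f \<epsilon> z) holomorphic_on Om" for \<epsilon>
    by (intro holomorphic_on_mult holomorphic_on_const right_fun_hol right_init_hol g_hol lchain_hol left_init_hol)
  have "(\<Sum>\<epsilon>\<in>?E. ?c \<epsilon> * pairing (sel1 \<epsilon>) (sel2 \<epsilon>) (left_init i) (right_init j) k1 k2) = oint 1 ?R (\<lambda>z. \<Sum>\<epsilon>\<in>?E. ?c \<epsilon> * ?f \<epsilon> z)"
    unfolding pairing_def oint_cmul[symmetric]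
    by (rule oint_sum[symmetric]) (use hol_cont_sphere[OF hol_annulus1[OF hf] R(1,2)] R in auto)
  also have "\<dots> = oint 1 ?R (\<lambda>z. (-1) ^ (k2 - 1 - k1) * (right_fun (right_init j) k2 z * (g k2 z * lchain t1 t2 (left_init i) k1 (k2 - 1) z)))"
  proof (rule oint_cong)
    fix z assume "cmod (z - 1) = ?R"
    then have z: "z \<in> Om" by (rule in_Om) (use R in auto)
    have "(\<Sum>\<epsilon>\<in>?E. ?c \<epsilon> * ?f \<epsilon> z) = right_fun (right_init j) k2 z * (g k2 z * (\<Sum>\<epsilon>\<in>?E. ?c \<epsilon> * lchain (sel1 \<epsilon>) (sel2 \<epsilon>) (left_init i) k1 (k2 - 1) z))"
      unfolding sum_distrib_left by (simp only: mult_ac)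
    also have "(\<Sum>\<epsilon>\<in>?E. ?c \<epsilon> * lchain (sel1 \<epsilon>) (sel2 \<epsilon>) (left_init i) k1 (k2 - 1) z) = lchain (\<lambda>l. c l 1) (\<lambda>l. - c l 2) (left_init i) k1 (k2 - 1) z"
      by (rule lchain_eps_sum[OF left_init_hol _ z]) (use k in simp)
    also have "lchain (\<lambda>l. c l 1) (\<lambda>l. - c l 2) (left_init i) k1 (k2 - 1) = lchain (\<lambda>l. - t1 l) (\<lambda>l. - t2 l) (left_init i) k1 (k2 - 1)"
      by (rule lchain_cong) (use c in auto)
    also have "\<dots> = (\<lambda>z. (-1) ^ (k2 - 1 - k1) * lchain t1 t2 (left_init i) k1 (k2 - 1) z)"
      by (rule lchain_uminus) (use k in simp)
    finally show "(\<Sum>\<epsilon>\<in>?E. ?c \<epsilon> * ?f \<epsilon> z) = (-1) ^ (k2 - 1 - k1) * (right_fun (right_init j) k2 z * (g k2 z * lchain t1 t2 (left_init i) k1 (k2 - 1) z))"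
      by (simp only: mult_ac)
  qed (use R in simp)
  finally show ?thesis by (simp only: oint_cmul pairing_def)
qed

text \<open>Dividing a row of block \<open>r\<close> by the \<open>\<theta> k\<close> with \<open>r \<le> k\<close> turns the parameters \<open>(\<theta> k, 1)\<close> into
  \<open>(theta1 \<theta> r k, theta2 \<theta> r k)\<close>.\<close>

definition theta1 :: "(nat \<Rightarrow> complex) \<Rightarrow> nat \<Rightarrow> nat \<Rightarrow> complex" where
  "theta1 \<theta> r k = (if k < r then \<theta> k else 1)"
definition theta2 :: "(nat \<Rightarrow> complex) \<Rightarrow> nat \<Rightarrow> nat \<Rightarrow> complex" where
  "theta2 \<theta> r k = (if k < r then 1 else inverse (\<theta> k))"

lemma theta_prod:
  assumes r: "1 \<le> r" "r \<le> p" and \<epsilon>: "\<And>k. k \<in> {1..<p} \<Longrightarrow> \<epsilon> k \<in> {1, 2}"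
  shows "theta p \<theta> r \<epsilon> = (\<Prod>k\<in>{1..p - 1}. if \<epsilon> k = 1 then theta1 \<theta> r k else theta2 \<theta> r k)"
proof -
  have "{1..p - 1} = {1..<r} \<union> {r..<p}" "{1..<r} \<inter> {r..<p} = {}" using r p2 by auto
  then have "(\<Prod>k\<in>{1..p - 1}. if \<epsilon> k = 1 then theta1 \<theta> r k else theta2 \<theta> r k) =
    (\<Prod>k\<in>{1..<r}. if \<epsilon> k = 1 then theta1 \<theta> r k else theta2 \<theta> r k) * (\<Prod>k\<in>{r..<p}. if \<epsilon> k = 1 then theta1 \<theta> r k else theta2 \<theta> r k)"
    by (simp only: prod.union_disjoint[OF finite_atLeastLessThan finite_atLeastLessThan])
  also have "(\<Prod>k\<in>{1..<r}. if \<epsilon> k = 1 then theta1 \<theta> r k else theta2 \<theta> r k) = (\<Prod>k\<in>{1..<r}. \<theta> k powi (2 - int (\<epsilon> k)))"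
  proof (rule prod.cong)
    fix k assume "k \<in> {1..<r}"
    then show "(if \<epsilon> k = 1 then theta1 \<theta> r k else theta2 \<theta> r k) = \<theta> k powi (2 - int (\<epsilon> k))"
      using \<epsilon>[of k] r by (auto simp: theta1_def theta2_def)
  qed simp
  also have "(\<Prod>k\<in>{r..<p}. if \<epsilon> k = 1 then theta1 \<theta> r k else theta2 \<theta> r k) = (\<Prod>k\<in>{r..<p}. \<theta> k powi (1 - int (\<epsilon> k)))"
  proof (rule prod.cong)
    fix k assume "k \<in> {r..<p}"
    then show "(if \<epsilon> k = 1 then theta1 \<theta> r k else theta2 \<theta> r k) = \<theta> k powi (1 - int (\<epsilon> k))"
      using \<epsilon>[of k] r by (auto simp: theta1_def theta2_def)
  qed simp
  finally show ?thesis by (simp add: theta_def)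
qed

definition eps_choice :: "nat \<Rightarrow> nat \<Rightarrow> nat \<Rightarrow> nat set" where
  "eps_choice k1 k2 k = (if k < max k1 1 then {2} else if min k2 (p - 1) < k then {1} else {1, 2})"

lemma eps_range_PiE:
  assumes "k1 < k2"
  shows "eps_range p k1 k2 = PiE {1..p - 1} (eps_choice k1 k2)"
proof -
  have e: "(\<epsilon> k = 1 \<or> \<epsilon> k = 2) \<and> (k < max k1 1 \<longrightarrow> \<epsilon> k = 2) \<and> (min k2 (p - 1) < k \<longrightarrow> \<epsilon> k = 1) \<longleftrightarrow> \<epsilon> k \<in> eps_choice k1 k2 k"
    if "k \<in> {1..p - 1}" for k and \<epsilon> :: "nat \<Rightarrow> nat"
  proof -
    have "\<not> (k < max k1 1 \<and> min k2 (p - 1) < k)" using that assms by auto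
    then show ?thesis by (auto simp: eps_choice_def)
  qed
  show ?thesis
  proof (rule Set.set_eqI)
    fix \<epsilon> :: "nat \<Rightarrow> nat"
    have "\<epsilon> \<in> eps_range p k1 k2 \<longleftrightarrow> \<epsilon> \<in> extensional {1..p - 1} \<and>
      (\<forall>k\<in>{1..p - 1}. (\<epsilon> k = 1 \<or> \<epsilon> k = 2) \<and> (k < max k1 1 \<longrightarrow> \<epsilon> k = 2) \<and> (min k2 (p - 1) < k \<longrightarrow> \<epsilon> k = 1))"
      unfolding eps_range_def eps_all_def PiE_iff mem_Collect_eq insert_iff empty_iff by blast
    also have "\<dots> \<longleftrightarrow> \<epsilon> \<in> extensional {1..p - 1} \<and> (\<forall>k\<in>{1..p - 1}. \<epsilon> k \<in> eps_choice k1 k2 k)"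
      by (simp only: e cong: ball_cong)
    finally show "\<epsilon> \<in> eps_range p k1 k2 \<longleftrightarrow> \<epsilon> \<in> PiE {1..p - 1} (eps_choice k1 k2)" by (simp only: PiE_iff) blast
  qed
qed

definition eps_sign :: "nat \<Rightarrow> nat \<Rightarrow> nat \<Rightarrow> nat \<Rightarrow> complex" where
  "eps_sign k1 k2 k e = (if max 1 k1 \<le> k \<and> k \<le> min k2 (p - 1) then (-1) ^ e else 1)"

definition eps_coef :: "(nat \<Rightarrow> complex) \<Rightarrow> nat \<Rightarrow> nat \<Rightarrow> nat \<Rightarrow> nat \<Rightarrow> nat \<Rightarrow> complex" where
  "eps_coef \<theta> r k1 k2 k e = eps_sign k1 k2 k e * (if e = 1 then theta1 \<theta> r k else theta2 \<theta> r k)"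

lemma eps_weight:
  assumes r: "1 \<le> r" "r \<le> p" and k: "k1 < k2" and \<epsilon>: "\<epsilon> \<in> eps_range p k1 k2"
  shows "(-1) ^ (\<Sum>k\<in>{max 1 k1..min k2 (p - 1)}. \<epsilon> k) * theta p \<theta> r \<epsilon> = (\<Prod>k\<in>{1..p - 1}. eps_coef \<theta> r k1 k2 k (\<epsilon> k))"
proof -
  have "\<epsilon> k \<in> {1, 2}" if "k \<in> {1..<p}" for k
  proof -
    have "k \<in> {1..p - 1}" using that p2 by auto
    then show ?thesis using \<epsilon> unfolding eps_range_def eps_all_def by (auto simp: PiE_iff)
  qed
  then have "theta p \<theta> r \<epsilon> = (\<Prod>k\<in>{1..p - 1}. if \<epsilon> k = 1 then theta1 \<theta> r k else theta2 \<theta> r k)"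
    by (rule theta_prod[OF r])
  moreover have "(-1) ^ (\<Sum>k\<in>{max 1 k1..min k2 (p - 1)}. \<epsilon> k) = (\<Prod>k\<in>{1..p - 1}. eps_sign k1 k2 k (\<epsilon> k))"
  proof -
    have "(\<Prod>k\<in>{1..p - 1}. eps_sign k1 k2 k (\<epsilon> k)) = (\<Prod>k\<in>{max 1 k1..min k2 (p - 1)}. eps_sign k1 k2 k (\<epsilon> k))"
      by (rule prod.mono_neutral_right) (auto simp: eps_sign_def)
    also have "\<dots> = (\<Prod>k\<in>{max 1 k1..min k2 (p - 1)}. (-1) ^ \<epsilon> k)"
      by (rule prod.cong) (auto simp: eps_sign_def)
    finally show ?thesis by (simp add: power_sum)
  qed
  ultimately show ?thesis unfolding eps_coef_def prod.distrib by simp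
qed

text \<open>The pairing depends only on the choices strictly between the cuts. Below
  \<open>k1\<close> the choice is forced to be 2, above \<open>k2\<close> to be 1, and at a cut both
  occur and give \<open>t2 - t1\<close>. The outer sums are therefore \<open>coef_left\<close> and,
  up to sign, \<open>coef_right\<close>, and the prescribed sign cancels all others.\<close>

lemma eps_total:
  assumes r: "1 \<le> r" "r \<le> p" and k: "k1 < k2" "k2 \<le> p"
  shows "(\<Sum>\<epsilon>\<in>eps_range p k1 k2. (-1) ^ ((\<Sum>k\<in>{max 1 k1..min k2 (p - 1)}. \<epsilon> k) + k1 + star p k2)
      * theta p \<theta> r \<epsilon> * pairing (sel1 \<epsilon>) (sel2 \<epsilon>) (left_init i) (right_init j) k1 k2) =
    coef_left (theta1 \<theta> r) (theta2 \<theta> r) k1 * coef_right (theta1 \<theta> r) (theta2 \<theta> r) k2 * pairing (theta1 \<theta> r) (theta2 \<theta> r) (left_init i) (right_init j) k1 k2"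
proof -
  let ?t1 = "theta1 \<theta> r" and ?t2 = "theta2 \<theta> r"
  let ?I = "{Suc k1..k2 - 1}"
  let ?B1 = "{1..k1}" and ?B2 = "{k2..p - 1}"
  let ?Q = "\<lambda>\<epsilon>. pairing (sel1 \<epsilon>) (sel2 \<epsilon>) (left_init i) (right_init j) k1 k2"
  let ?c = "eps_coef \<theta> r k1 k2"
  let ?s = "\<lambda>k. \<Sum>e\<in>eps_choice k1 k2 k. ?c k e"
  have U: "{1..p - 1} = ?I \<union> (?B1 \<union> ?B2)" using k by auto
  have Qc: "?Q \<epsilon> = ?Q \<epsilon>'" if "\<And>k. k \<in> ?I \<Longrightarrow> \<epsilon> k = \<epsilon>' k" for \<epsilon> \<epsilon>'
  proof -
    have "lchain (sel1 \<epsilon>) (sel2 \<epsilon>) (left_init i) k1 (k2 - 1) = lchain (sel1 \<epsilon>') (sel2 \<epsilon>') (left_init i) k1 (k2 - 1)"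
      by (rule lchain_cong) (use that in \<open>auto simp: sel1_def sel2_def\<close>)
    then show ?thesis by (simp only: pairing_def)
  qed
  have "(\<Sum>\<epsilon>\<in>eps_range p k1 k2. (-1) ^ ((\<Sum>k\<in>{max 1 k1..min k2 (p - 1)}. \<epsilon> k) + k1 + star p k2)
      * theta p \<theta> r \<epsilon> * ?Q \<epsilon>) =
    (-1) ^ (k1 + star p k2) * (\<Sum>\<epsilon>\<in>eps_range p k1 k2. ((-1) ^ (\<Sum>k\<in>{max 1 k1..min k2 (p - 1)}. \<epsilon> k)
      * theta p \<theta> r \<epsilon>) * ?Q \<epsilon>)"
    unfolding sum_distrib_left power_add by (simp only: mult_ac)
  also have "(\<Sum>\<epsilon>\<in>eps_range p k1 k2. ((-1) ^ (\<Sum>k\<in>{max 1 k1..min k2 (p - 1)}. \<epsilon> k) * theta p \<theta> r \<epsilon>) * ?Q \<epsilon>) =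
      (\<Sum>\<epsilon>\<in>eps_range p k1 k2. (\<Prod>k\<in>{1..p - 1}. ?c k (\<epsilon> k)) * ?Q \<epsilon>)"
    by (rule sum.cong) (simp_all only: eps_weight[OF r k(1)])
  also have "\<dots> = (\<Sum>\<epsilon>\<in>PiE (?I \<union> (?B1 \<union> ?B2)) (eps_choice k1 k2). (\<Prod>k\<in>?I \<union> (?B1 \<union> ?B2). ?c k (\<epsilon> k)) * ?Q \<epsilon>)"
    by (simp only: eps_range_PiE[OF k(1)] U)
  also have "\<dots> = (\<Prod>k\<in>?B1 \<union> ?B2. ?s k) * (\<Sum>\<epsilon>\<in>PiE ?I (eps_choice k1 k2). (\<Prod>k\<in>?I. ?c k (\<epsilon> k)) * ?Q \<epsilon>)"
    by (rule sum_PiE_outer[OF _ _ _ Qc]) (use k in auto)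
  also have "PiE ?I (eps_choice k1 k2) = PiE ?I (\<lambda>_. {1, 2})"
    by (rule PiE_cong) (use k in \<open>auto simp: eps_choice_def\<close>)
  also have "(\<Sum>\<epsilon>\<in>PiE ?I (\<lambda>_. {1, 2}). (\<Prod>k\<in>?I. ?c k (\<epsilon> k)) * ?Q \<epsilon>) = (-1) ^ (k2 - 1 - k1) * pairing ?t1 ?t2 (left_init i) (right_init j) k1 k2"
    by (rule pairing_eps_sum[OF k(1)]) (use k in \<open>auto simp: eps_coef_def eps_sign_def\<close>)
  also have "(\<Prod>k\<in>?B1 \<union> ?B2. ?s k) = (\<Prod>k\<in>?B1. ?s k) * (\<Prod>k\<in>?B2. ?s k)"
    by (rule prod.union_disjoint) (use k in auto)
  also have "(\<Prod>k\<in>?B1. ?s k) = coef_left ?t1 ?t2 k1"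
  proof (cases "k1 = 0")
    case False
    have "?B1 = insert k1 {1..<k1}" using False by auto
    moreover have "(\<Prod>l\<in>{1..<k1}. ?s l) = (\<Prod>l\<in>{1..<k1}. ?t2 l)"
      by (rule prod.cong) (use k in \<open>auto simp: eps_choice_def eps_coef_def eps_sign_def\<close>)
    moreover have "?s k1 = ?t2 k1 - ?t1 k1"
      using False k by (auto simp: eps_choice_def eps_coef_def eps_sign_def)
    ultimately have "(\<Prod>k\<in>?B1. ?s k) = (?t2 k1 - ?t1 k1) * (\<Prod>l\<in>{1..<k1}. ?t2 l)" by simp
    then show ?thesis using False by (simp add: coef_left_def algebra_simps)
  qed (simp add: coef_left_def)
  also have "(\<Prod>k\<in>?B2. ?s k) = (if k2 = p then 1 else - 1) * coef_right ?t1 ?t2 k2"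
  proof (cases "k2 = p")
    case True
    then have "?B2 = {}" using p2 by auto
    then show ?thesis using True by (simp add: coef_right_def)
  next
    case False
    then have "?B2 = insert k2 {Suc k2..<p}" "k2 < p" using k by auto
    moreover have "(\<Prod>l\<in>{Suc k2..<p}. ?s l) = (\<Prod>l\<in>{Suc k2..<p}. ?t1 l)"
      by (rule prod.cong) (use k in \<open>auto simp: eps_choice_def eps_coef_def eps_sign_def\<close>)
    moreover have "?s k2 = ?t2 k2 - ?t1 k2"
      using False k by (auto simp: eps_choice_def eps_coef_def eps_sign_def)
    ultimately have "(\<Prod>k\<in>?B2. ?s k) = (?t2 k2 - ?t1 k2) * (\<Prod>l\<in>{Suc k2..<p}. ?t1 l)" by simp
    then show ?thesis using False by (simp add: coef_right_def algebra_simps)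
  qed
  finally have eq: "(\<Sum>\<epsilon>\<in>eps_range p k1 k2. (-1) ^ ((\<Sum>k\<in>{max 1 k1..min k2 (p - 1)}. \<epsilon> k) + k1 + star p k2)
      * theta p \<theta> r \<epsilon> * ?Q \<epsilon>) = ((-1) ^ (k1 + star p k2) * (if k2 = p then 1 else - 1) * (-1) ^ (k2 - 1 - k1)) *
       (coef_left ?t1 ?t2 k1 * coef_right ?t1 ?t2 k2 * pairing ?t1 ?t2 (left_init i) (right_init j) k1 k2)"
    by (simp only: mult_ac)
  have "(-1) ^ (k1 + star p k2) * (if k2 = p then 1 else - 1) * (-1) ^ (k2 - 1 - k1) = (1 :: complex)"
  proof -
    \<comment> \<open>At \<open>k2 = p\<close> there is no parameter and hence one sign fewer;
      replacing \<open>k2\<close> by \<open>star p k2 = p - 1\<close> makes up for it.\<close>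
    have "even (k1 + star p k2 + (if k2 = p then 0 else 1) + (k2 - 1 - k1))"
    proof (cases "k2 = p")
      case True
      then have "k1 + star p k2 + (k2 - 1 - k1) = 2 * (p - 1)" using k by (auto simp: star_def)
      then show ?thesis using True by simp
    next
      case False
      then have "k1 + star p k2 + 1 + (k2 - 1 - k1) = 2 * k2" using k by (auto simp: star_def)
      then show ?thesis using False by (metis dvd_triv_left)
    qed
    then have "(-1) ^ (k1 + star p k2 + (if k2 = p then 0 else 1) + (k2 - 1 - k1)) = (1 :: complex)" by simp
    then show ?thesis by (cases "k2 = p") (simp_all add: power_add)
  qed
  then show ?thesis unfolding eq by simp
qed

section \<open>The blocks\<close>

lemma oint_powi_0:
  assumes "0 < \<rho>"
  shows "oint 0 \<rho> (\<lambda>z. z powi k) = of_bool (k = -1)"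
proof -
  consider "0 \<le> k" | "k = -1" | "k \<le> -2" by linarith
  then show ?thesis
  proof cases
    case 1
    have "(\<lambda>z::complex. z powi k) holomorphic_on ball 0 (\<rho> + 1)"
      by (intro holomorphic_on_power_int holomorphic_intros disjI1 1)
    then show ?thesis using 1 assms by (subst oint_eq_0) auto
  next
    case 2
    have "oint 0 \<rho> (\<lambda>z. 1 / (z - 0)) = 1" by (rule oint_Cauchy[of "\<lambda>_. 1" 0 "\<rho> + 1"]) (use assms in auto)
    then show ?thesis using 2 by (simp add: power_int_minus divide_inverse)
  next
    case 3
    have "oint 0 \<rho> (\<lambda>z. z powi k) = 0"
    proof (rule oint_decay[of _ 0 _ _ 1 1])
      show "(\<lambda>z. z powi k) holomorphic_on {z. 0 < cmod (z - 0)}"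
        by (intro holomorphic_on_power_int holomorphic_intros disjI2) auto
      fix z :: complex assume z: "1 \<le> cmod (z - 0)"
      have "cmod (z powi k) = cmod z powi k" by (simp add: norm_power_int)
      also have "\<dots> \<le> cmod z powi (-2)" by (rule power_int_increasing) (use z 3 in auto)
      finally show "cmod (z powi k) \<le> 1 / (cmod (z - 0))\<^sup>2" by (simp add: power_int_minus divide_inverse)
    qed (use assms in auto)
    then show ?thesis using 3 by simp
  qed
qed

abbreviation "row_in r i \<equiv> 1 \<le> r \<and> r \<le> p \<and> n (r - 1) < i \<and> i \<le> n r"

lemma block_of_eq:
  assumes "row_in r i" shows "block_of p n i = r"
  unfolding block_of_def
proof (rule the_equality)
  fix s assume s: "row_in s i"
  show "s = r"
  proof (rule ccontr)
    assume "s \<noteq> r"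
    then consider "s \<le> r - 1" | "r \<le> s - 1" by linarith
    moreover have "r - 1 \<le> p" "s - 1 \<le> p" using assms s by linarith+
    ultimately show False
      using assms s n_mono[of s "r - 1"] n_mono[of r "s - 1"] by cases simp_all
  qed
qed (use assms in auto)

lemma block_ex:
  assumes "1 \<le> i" "i \<le> n p" obtains r where "row_in r i" "block_of p n i = r"
proof -
  define r where "r = (LEAST r. i \<le> n r)"
  have r: "i \<le> n r" "r \<le> p" unfolding r_def using assms LeastI[of "\<lambda>r. i \<le> n r" p] by (auto intro: Least_le)
  have "r \<noteq> 0"
  proof
    assume "r = 0"
    then have "i \<le> n 0" using r(1) by simp
    then show False using zero assms by simp
  qed
  then have "\<not> i \<le> n (r - 1)" using not_less_Least[of "r - 1" "\<lambda>r. i \<le> n r"] by (simp add: r_def)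
  then have "row_in r i" using r \<open>r \<noteq> 0\<close> by auto
  then show thesis using that block_of_eq by blast
qed

lemma row_above: "row_in r i \<Longrightarrow> k < r \<Longrightarrow> n k < i"
  using n_mono[of k "r - 1"] by linarith

lemma row_below: "row_in r i \<Longrightarrow> r \<le> k \<Longrightarrow> k \<le> p \<Longrightarrow> i \<le> n k"
  using n_mono[of r k] by linarith

lemma row_data:
  assumes "row_in r i"
  shows "n_row p n i = int (n (star p r))" "m_row p n m i = int (m (star p r))" "a_row p n a i = a (star p r)"
  using block_of_eq[OF assms] by (simp_all add: n_row_def m_row_def a_row_def)

section \<open>The diagonal terms block by block\<close>

lemma invG_l_invG_r_prod:
  "z \<in> Om \<Longrightarrow> invG_l 0 i z * invG_r 0 j z =
    G_star q z (int j - 1 - int i) (m_row p n m j - m_row p n m i) (a_row p n a j - a_row p n a i)"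
  using zero by (simp add: invG_l_def invG_r_def G_star_add algebra_simps)

lemma diag0_eq:
  "diag0 i j = oint 0 \<tau>0 (\<lambda>z. G_star q z (int j - 1 - int i) (m_row p n m j - m_row p n m i) (a_row p n a j - a_row p n a i))"
  unfolding diag0_def by (rule oint_cong[OF invG_l_invG_r_prod[OF \<tau>0_Om]]) (use \<tau>0 in auto)

lemma diag0_less: "i < j \<Longrightarrow> diag0 i j = 0"
  unfolding diag0_eq by (rule oint_eq_0[OF Ex_ball0[OF G_star_Ex] \<tau>0]) simp

lemma G_star_00: "G_star q z k 0 0 = z powi k" by (simp add: G_star_def)

lemma diag0_same:
  assumes "m_row p n m j = m_row p n m i" "a_row p n a j = a_row p n a i"
  shows "diag0 i j = of_bool (i = j)"
proof -
  have "diag0 i j = of_bool (int j - 1 - int i = - 1)"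
    unfolding diag0_eq assms by (simp only: diff_self G_star_00 oint_powi_0[OF \<tau>0(1)])
  also have "(int j - 1 - int i = - 1) \<longleftrightarrow> i = j" by auto
  finally show ?thesis .
qed

text \<open>When the block of \<open>j\<close> has the data of index \<open>k\<close>, only a power
  of z is left of \<open>invG_r\<close>, and a negative power is its own principal part.\<close>

lemma P0_invG_r_pure:
  assumes "m_row p n m j = int (m k)" "a_row p n a j = a k" "j \<le> n k" "z \<noteq> 0"
  shows "P0 (invG_r k j) z = invG_r k j z"
proof -
  have d: "int j - 1 - int (n k) = - int (Suc (n k) - j)" using assms(3) by auto
  have e: "invG_r k j = (\<lambda>z. z powi (- int (Suc (n k) - j)))"
    unfolding d[symmetric] invG_r_def[abs_def] assms(1,2) by (simp only: diff_self G_star_00)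
  show ?thesis unfolding e by (rule P0_power) (use assms in auto)
qed

lemma P0_invG_l_pure:
  assumes "m_row p n m i = int (m k)" "a_row p n a i = a k" "n k < i" "z \<noteq> 0"
  shows "P0 (invG_l k i) z = invG_l k i z"
proof -
  have d: "int (n k) - int i = - int (i - n k)" using assms(3) by auto
  have e: "invG_l k i = (\<lambda>z. z powi (- int (i - n k)))"
    unfolding d[symmetric] invG_l_def[abs_def] assms(1,2) by (simp only: diff_self G_star_00)
  show ?thesis unfolding e by (rule P0_power) (use assms in auto)
qed

lemma P0_invG_r_zero: "n k < j \<Longrightarrow> z \<noteq> 0 \<Longrightarrow> P0 (invG_r k j) z = 0"
  by (rule prin_eq_0[OF Ex_ball0[OF invG_r_Ex]]) (use q1 in auto)

lemma P0_invG_l_zero: "i \<le> n k \<Longrightarrow> z \<noteq> 0 \<Longrightarrow> P0 (invG_l k i) z = 0"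
  by (rule prin_eq_0[OF Ex_ball0[OF invG_l_Ex]]) (use q1 in auto)

lemma diagL_diag0: "i \<le> n k \<Longrightarrow> diagL k i j = diag0 i j"
proof -
  assume i: "i \<le> n k"
  have "diagL k i j = oint 0 \<tau>0 (\<lambda>z. invG_l k i z * invG_r k j z)"
    unfolding diagL_def by (rule oint_mult_prin[OF Ex_ball0[OF invG_l_Ex[OF i]] hol_annulus0[OF invG_r_hol]]) (use \<tau>0 in auto)
  also have "\<dots> = diag0 i j"
    unfolding diag0_def by (rule oint_cong[OF invG_l_invG_r[OF \<tau>0_Om]]) (use \<tau>0 in auto)
  finally show ?thesis .
qed

lemma \<tau>0_nz: "cmod (z - 0) = \<tau>0 \<Longrightarrow> z \<noteq> 0" using \<tau>0 by auto

lemma diagL_zero: "n k < j \<Longrightarrow> diagL k i j = 0"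
proof -
  assume "n k < j"
  then have "diagL k i j = oint 0 \<tau>0 (\<lambda>z. 0)"
    unfolding diagL_def by (intro oint_cong) (use P0_invG_r_zero[OF _ \<tau>0_nz] \<tau>0 in simp_all)
  then show ?thesis by simp
qed

lemma diagL_pure_right:
  assumes "m_row p n m j = int (m k)" "a_row p n a j = a k" "j \<le> n k"
  shows "diagL k i j = diag0 i j"
  unfolding diagL_def diag0_def
proof (rule oint_cong)
  fix z assume z: "cmod (z - 0) = \<tau>0"
  show "invG_l k i z * P0 (invG_r k j) z = invG_l 0 i z * invG_r 0 j z"
    unfolding P0_invG_r_pure[OF assms \<tau>0_nz[OF z]] by (rule invG_l_invG_r[OF \<tau>0_Om[OF z]])
qed (use \<tau>0 in simp)

lemma diagL_pure_left:
  assumes "m_row p n m i = int (m k)" "a_row p n a i = a k" "n k < i"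
  shows "diagL k i j = 0"
proof -
  have "diagL k i j = oint 0 \<tau>0 (\<lambda>z. P0 (invG_l k i) z * P0 (invG_r k j) z)"
    unfolding diagL_def by (rule oint_cong) (use \<tau>0 P0_invG_l_pure[OF assms \<tau>0_nz] in simp_all)
  also have "\<dots> = 0"
    by (rule oint_prin_prin[OF hol_annulus0[OF invG_l_hol] hol_annulus0[OF invG_r_hol]]) (use \<tau>0 q1 in auto)
  finally show ?thesis .
qed

lemma theta_eps_step:
  assumes "1 \<le> r" "r \<le> p" "1 \<le> k" "k \<le> p"
  shows "theta p \<theta> r (eps_step k) = (\<Prod>l\<in>{1..<k}. theta2 \<theta> r l) * (\<Prod>l\<in>{k..<p}. theta1 \<theta> r l)"
proof -
  have "{1..p - 1} = {1..<k} \<union> {k..<p}" "{1..<k} \<inter> {k..<p} = {}" using assms p2 by auto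
  then have "theta p \<theta> r (eps_step k) =
      (\<Prod>l\<in>{1..<k}. if eps_step k l = 1 then theta1 \<theta> r l else theta2 \<theta> r l) * (\<Prod>l\<in>{k..<p}. if eps_step k l = 1 then theta1 \<theta> r l else theta2 \<theta> r l)"
    by (subst theta_prod[OF assms(1,2)]) (simp_all only: prod.union_disjoint[OF finite_atLeastLessThan finite_atLeastLessThan], auto simp: eps_step_def)
  then show ?thesis by (simp add: eps_step_def)
qed

text \<open>The two terms of \<open>Theta\<close> are products that switch from
  \<open>theta2\<close> to \<open>theta1\<close> at \<open>k\<close> and at \<open>k + 1\<close>;
  their common factors come out and leave \<open>coef_diag\<close>.\<close>

lemma Theta_coef_diag:
  assumes "1 \<le> r" "r \<le> p" "1 \<le> k" "k < star p r"
  shows "Theta p \<theta> r k = coef_diag (theta1 \<theta> r) (theta2 \<theta> r) k"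
proof -
  have k: "k < p" using assms by (auto simp: star_def)
  have "{k..<p} = insert k {Suc k..<p}" using k by auto
  then have "(\<Prod>l\<in>{k..<p}. theta1 \<theta> r l) = theta1 \<theta> r k * (\<Prod>l\<in>{Suc k..<p}. theta1 \<theta> r l)" by simp
  moreover have "(\<Prod>l\<in>{1..<Suc k}. theta2 \<theta> r l) = (\<Prod>l\<in>{1..<k}. theta2 \<theta> r l) * theta2 \<theta> r k"
    using assms by (simp add: prod.atLeastLessThan_Suc)
  ultimately show ?thesis using assms k
    by (simp add: Theta_def theta_eps_step coef_diag_def algebra_simps del: One_nat_def)
qed

text \<open>The indices from \<open>star p r\<close> on combine with the product of the
  \<open>theta2\<close> to plain \<open>diag0\<close>. Below, \<open>diagL k i j\<close> vanishes
  for \<open>k < s\<close>, equals \<open>diag0\<close> for \<open>k = s\<close>, and gives the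
  terms of \<open>A1_block\<close> for \<open>k > s\<close>. Finally \<open>diag0\<close> is the
  identity matrix unless \<open>s < star p r\<close>, where it becomes the integral of
  \<open>B_block\<close>.\<close>

lemma diagonal_part:
  assumes i: "row_in r i" and j: "row_in s j"
  shows "(\<Prod>l\<in>{1..<p}. theta2 \<theta> r l) * diag0 i j + (\<Sum>k\<in>{1..<p}. coef_diag (theta1 \<theta> r) (theta2 \<theta> r) k * diagL k i j) =
    of_bool (i = j) + (\<Sum>k\<in>{0..p}. Theta p \<theta> r k * of_bool (s < k \<and> k < star p r) * diagL k i j)
    + (1 + Theta p \<theta> r s) * of_bool (s < star p r) * diag0 i j"
proof -
  let ?coef_diag = "coef_diag (theta1 \<theta> r) (theta2 \<theta> r)"
  let ?S = "star p r"
  have S: "1 \<le> ?S" "?S \<le> r" "?S < p" using i p2 by (auto simp: star_def)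
  have bbv: "diag0 i j = of_bool (i = j)" if "?S \<le> s"
  proof (cases "star p s = ?S")
    case True
    then show ?thesis using row_data[OF i] row_data[OF j] by (intro diag0_same) auto
  next
    case False
    then have "r < s" using that j i by (auto simp: star_def min_def split: if_splits)
    then have "i < j" using row_above[OF j, of r] i by linarith
    then show ?thesis using diag0_less by simp
  qed
  \<comment> \<open>For \<open>r = p\<close> the rows have the data of \<open>p - 1\<close>, so the
    one remaining \<open>diagL\<close> is 0 and all \<open>theta2\<close> are 1. For
    \<open>r < p\<close> every \<open>diagL\<close> here equals \<open>diag0\<close>, and the
    coefficients sum to 1 minus the product of the \<open>theta2\<close>.\<close>
  have hi: "(\<Prod>l\<in>{1..<p}. theta2 \<theta> r l) * diag0 i j + (\<Sum>k\<in>{?S..<p}. ?coef_diag k * diagL k i j) = diag0 i j"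
  proof (cases "r = p")
    case True
    then have "?S = p - 1" "{p - 1..<p} = {p - 1}" using p2 by (auto simp: star_def)
    moreover have "diagL (p - 1) i j = 0"
      by (rule diagL_pure_left) (use row_data[OF i] True i \<open>?S = p - 1\<close> in auto)
    moreover have "(\<Prod>l\<in>{1..<p}. theta2 \<theta> r l) = 1" using True by (intro prod.neutral) (auto simp: theta2_def)
    ultimately show ?thesis by simp
  next
    case False
    then have Sr: "?S = r" using i by (auto simp: star_def)
    have "(\<Sum>k\<in>{?S..<p}. ?coef_diag k * diagL k i j) = (\<Sum>k\<in>{r..<p}. ?coef_diag k * diag0 i j)"
      unfolding Sr by (rule sum.cong) (use row_below[OF i] diagL_diag0 in simp_all)
    also have "\<dots> = (\<Sum>k\<in>{r..<p}. ?coef_diag k) * diag0 i j" by (rule sum_distrib_right[symmetric])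
    also have "(\<Sum>k\<in>{r..<p}. ?coef_diag k) = (\<Prod>l\<in>{1..<r}. theta2 \<theta> r l) * (\<Prod>l\<in>{r..<p}. theta1 \<theta> r l) - (\<Prod>l\<in>{1..<p}. theta2 \<theta> r l)"
      by (rule coef_diag_telescope) (use i in auto)
    also have "(\<Prod>l\<in>{1..<r}. theta2 \<theta> r l) = 1" by (intro prod.neutral) (auto simp: theta2_def)
    also have "(\<Prod>l\<in>{r..<p}. theta1 \<theta> r l) = 1" by (intro prod.neutral) (auto simp: theta1_def)
    finally show ?thesis by (simp add: algebra_simps)
  qed
  have "{1..<p} = {1..<?S} \<union> {?S..<p}" "{1..<?S} \<inter> {?S..<p} = {}" using S by auto
  then have "(\<Sum>k\<in>{1..<p}. ?coef_diag k * diagL k i j) = (\<Sum>k\<in>{1..<?S}. ?coef_diag k * diagL k i j) + (\<Sum>k\<in>{?S..<p}. ?coef_diag k * diagL k i j)"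
    by (simp only: sum.union_disjoint[OF finite_atLeastLessThan finite_atLeastLessThan])
  moreover have "(\<Sum>k\<in>{1..<?S}. ?coef_diag k * diagL k i j) =
    (\<Sum>k\<in>{1..<?S}. Theta p \<theta> r k * of_bool (s < k \<and> k < ?S) * diagL k i j + (if k = s then Theta p \<theta> r s * diag0 i j else 0))"
  proof (rule sum.cong)
    fix k assume k: "k \<in> {1..<?S}"
    then have T: "?coef_diag k = Theta p \<theta> r k" using i by (intro Theta_coef_diag[symmetric]) auto
    consider "k < s" | "k = s" | "s < k" by linarith
    then show "?coef_diag k * diagL k i j = Theta p \<theta> r k * of_bool (s < k \<and> k < ?S) * diagL k i j + (if k = s then Theta p \<theta> r s * diag0 i j else 0)"
    proof cases
      case 1
      then have "n k < j" by (rule row_above[OF j])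
      then show ?thesis using 1 by (simp add: diagL_zero)
    next
      case 2
      then have "star p s = s" using k S by (auto simp: star_def)
      then have "diagL s i j = diag0 i j" using row_data[OF j] j by (intro diagL_pure_right) auto
      then show ?thesis using 2 T by simp
    next
      case 3
      then show ?thesis using k T by simp
    qed
  qed simp
  also have "\<dots> = (\<Sum>k\<in>{1..<?S}. Theta p \<theta> r k * of_bool (s < k \<and> k < ?S) * diagL k i j) + of_bool (s < ?S) * (Theta p \<theta> r s * diag0 i j)"
    using j by (simp add: sum.distrib sum.delta' of_bool_def del: One_nat_def)
  also have "(\<Sum>k\<in>{1..<?S}. Theta p \<theta> r k * of_bool (s < k \<and> k < ?S) * diagL k i j) =
     (\<Sum>k\<in>{0..p}. Theta p \<theta> r k * of_bool (s < k \<and> k < ?S) * diagL k i j)"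
    by (rule sum.mono_neutral_left) (use S in auto)
  moreover have "diag0 i j = of_bool (i = j) + of_bool (s < ?S) * diag0 i j"
  proof (cases "s < ?S")
    case True
    then have "n s < i" using S by (intro row_above[OF i]) simp
    then have "i \<noteq> j" using j by auto
    then show ?thesis using True by simp
  qed (use bbv in simp)
  ultimately show ?thesis using hi by (simp add: algebra_simps)
qed

section \<open>Normalisation at the critical point and evaluation of the basic blocks\<close>

abbreviation W where "W \<equiv> w_c q"

lemma W_Om: "W \<in> Om"
proof -
  have "W - 1 = of_real (- sqrt q)" by (simp add: w_c_def)
  then have "cmod (W - 1) = \<bar>- sqrt q\<bar>" by (simp only: norm_of_real)
  then show ?thesis using sqrt_q q0 by (intro in_Om[of W "sqrt q"]) auto
qed

lemma W_nz: "W \<noteq> 0" using W_Om by (simp add: Om_def)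

lemma G_star_nz: "z \<in> Om \<Longrightarrow> G_star q z i j k \<noteq> 0"
  using OmD[of z] q1 by (auto simp: G_star_def)

lemma invG_l_nz: "z \<in> Om \<Longrightarrow> invG_l k i z \<noteq> 0" and invG_r_nz: "z \<in> Om \<Longrightarrow> invG_r k i z \<noteq> 0"
  by (simp_all add: invG_l_def invG_r_def G_star_nz)

lemma G_fun_invG_l: "1 / G_fun q z (int i - int (n k)) (m_row p n m i - int (m k)) (a_row p n a i - a k) = invG_l k i z / invG_l k i W"
proof -
  have "invG_l k i z = 1 / G_star q z (int i - int (n k)) (m_row p n m i - int (m k)) (a_row p n a i - a k)" for z
    unfolding G_star_minus minus_diff_eq invG_l_def ..
  then show ?thesis by (simp add: G_fun_def)
qed

lemma G_fun_invG_r: "1 / G_fun q z (int (n k) - int j + 1) (int (m k) - m_row p n m j) (a k - a_row p n a j) = invG_r k j z / invG_r k j W"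
proof -
  have e: "- (int (n k) - int j + 1) = int j - 1 - int (n k)" by simp
  have "invG_r k j z = 1 / G_star q z (int (n k) - int j + 1) (int (m k) - m_row p n m j) (a k - a_row p n a j)" for z
    unfolding G_star_minus minus_diff_eq invG_r_def e ..
  then show ?thesis by (simp add: G_fun_def)
qed

lemma G_fun_g: "G_fun q z (int (n k) - int (n (k - 1))) (int (m k) - int (m (k - 1))) (a k - a (k - 1)) = g k z / g k W"
  by (simp add: G_fun_def g_def)

text \<open>The normalising constants of consecutive factors telescope, so all blocks share one
  constant, whatever their cuts.\<close>

lemma g_W: "k1 \<le> k2 \<Longrightarrow> k2 \<le> p \<Longrightarrow> (\<Prod>k\<in>{k1<..k2}. g k W) * invG_l k1 i W * invG_r k2 j W = invG_l 0 i W * invG_r 0 j W"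
proof -
  assume k: "k1 \<le> k2" "k2 \<le> p"
  have "(\<Prod>k\<in>{k1<..k2}. g k W) * invG_r k2 j W = invG_r k1 j W"
    using g_prod_invG_r[OF W_Om k, of j] by (simp add: g_prod_def atLeastSucAtMost_greaterThanAtMost)
  then show ?thesis using invG_l_invG_r[OF W_Om, of k1 i j] by (simp add: mult_ac)
qed

definition norm_const :: "nat \<Rightarrow> nat \<Rightarrow> complex" where "norm_const i j = 1 / (W * (invG_l 0 i W * invG_r 0 j W))"

lemma left_factor:
  "((1 - \<zeta>) / (1 - z 1)) ^ of_bool (k1 = 0) = ((1 - \<zeta>) / (1 - z (Suc k1))) ^ of_bool (k1 = (0::nat))" for \<zeta> :: complex
  by (cases "k1 = 0") auto

lemma L_eps_pairing:
  assumes R: "radii_ok k1 k2 \<epsilon> (R k1 k2 \<epsilon>)" and k: "k1 < k2" "k2 \<le> p" and \<tau>: "0 < \<tau>1" "\<tau>1 < 1 - sqrt q" "0 < \<tau>2" "\<tau>2 < 1 - sqrt q"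
    and ij: "n k1 < i" "j \<le> n k2"
  shows "L_eps q p n m a \<tau>1 \<tau>2 R k1 k2 \<epsilon> i j = norm_const i j * pairing (sel1 \<epsilon>) (sel2 \<epsilon>) (left_init i) (right_init j) k1 k2"
proof -
  let ?C = "1 / ((\<Prod>k\<in>{k1<..k2}. g k W) * invG_l k1 i W * invG_r k2 j W)"
  let ?X = "\<lambda>\<zeta>1 \<zeta>2 z. start_kernel k1 i \<zeta>1 (z (Suc k1)) * (\<Prod>k\<in>{k1<..k2}. g k (z k))
      * (\<Prod>k\<in>{k1<..<k2}. inverse (z k - z (Suc k))) * (invG_r k2 j \<zeta>2 * inverse (z k2 - \<zeta>2))"
  have int: "(\<Prod>k\<in>{k1<..k2}. G_fun q (z k) (int (n k) - int (n (k - 1)))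
          (int (m k) - int (m (k - 1))) (a k - a (k - 1)))
       * (\<Prod>k\<in>{k1<..<k2}. inverse (z k - z (Suc k)))
       * ((1 - \<zeta>1) / (1 - z 1)) ^ of_bool (k1 = 0)
       * inverse (z (Suc k1) - \<zeta>1) * inverse (z k2 - \<zeta>2)
       / (G_fun q \<zeta>1 (int i - int (n k1)) (m_row p n m i - int (m k1)) (a_row p n a i - a k1)
          * G_fun q \<zeta>2 (int (n k2) - int j + 1) (int (m k2) - m_row p n m j) (a k2 - a_row p n a j)) = ?C * ?X \<zeta>1 \<zeta>2 z"
    (is "?P * ?I * ?L * ?u * ?v / (?G1 * ?G2) = _") for \<zeta>1 \<zeta>2 z
  proof -
    have "?P * ?I * ?L * ?u * ?v / (?G1 * ?G2) = ?P * ?I * ?L * ?u * ?v * (1 / ?G1) * (1 / ?G2)" by simp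
    also have "\<dots> = ((\<Prod>k\<in>{k1<..k2}. g k (z k)) / (\<Prod>k\<in>{k1<..k2}. g k W)) * ?I * ?L * ?u * ?v *
      (invG_l k1 i \<zeta>1 / invG_l k1 i W) * (invG_r k2 j \<zeta>2 / invG_r k2 j W)"
      by (simp only: G_fun_invG_l G_fun_invG_r G_fun_g prod_dividef)
    also have "\<dots> = ?C * ?X \<zeta>1 \<zeta>2 z"
      unfolding start_kernel_def left_factor[of \<zeta>1 z k1] by (simp add: divide_inverse mult_ac)
    finally show ?thesis .
  qed
  have "L_eps q p n m a \<tau>1 \<tau>2 R k1 k2 \<epsilon> i j = of_bool (n k1 < i \<and> j \<le> n k2) / W *
    (?C * oint 0 \<tau>1 (\<lambda>\<zeta>1. oint 0 \<tau>2 (\<lambda>\<zeta>2. oints 1 (R k1 k2 \<epsilon>) [Suc k1..<Suc k2] (?X \<zeta>1 \<zeta>2))))"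
    unfolding L_eps_def int oints_cmul oint_cmul ..
  also have "oint 0 \<tau>1 (\<lambda>\<zeta>1. oint 0 \<tau>2 (\<lambda>\<zeta>2. oints 1 (R k1 k2 \<epsilon>) [Suc k1..<Suc k2] (?X \<zeta>1 \<zeta>2))) =
    pairing (sel1 \<epsilon>) (sel2 \<epsilon>) (left_init i) (right_init j) k1 k2"
    by (rule chain_left_init_right_init[OF R k \<tau>])
  also have "(\<Prod>k\<in>{k1<..k2}. g k W) * invG_l k1 i W * invG_r k2 j W = invG_l 0 i W * invG_r 0 j W"
    by (rule g_W) (use k in auto)
  finally show ?thesis using ij by (simp add: norm_const_def)
qed

text \<open>For a column with the data of \<open>k2\<close> the right function is a pure power and
  equals its own principal part; this is why the integral over \<zeta>2 is absent here.\<close>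

lemma J_eps_pairing:
  assumes R: "radii_ok k1 k2 \<epsilon> (R k1 k2 \<epsilon>)" and k: "k1 < k2" "k2 \<le> p" and \<tau>: "0 < \<tau>1" "\<tau>1 < 1 - sqrt q"
    and j: "m_row p n m j = int (m k2)" "a_row p n a j = a k2" "j \<le> n k2"
  shows "J_eps q p n m a \<tau>1 R k1 k2 \<epsilon> i j = norm_const i j * pairing (sel1 \<epsilon>) (sel2 \<epsilon>) (left_init i) (right_init j) k1 k2"
proof -
  note Rd = radii_okD[OF R]
  let ?C = "1 / ((\<Prod>k\<in>{k1<..k2}. g k W) * invG_l k1 i W * invG_r k2 j W)"
  let ?X = "\<lambda>\<zeta>1 z. start_kernel k1 i \<zeta>1 (z (Suc k1)) * (\<Prod>k\<in>{k1<..k2}. g k (z k))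
      * (\<Prod>k\<in>{k1<..<k2}. inverse (z k - z (Suc k))) * invG_r k2 j (z k2)"
  let ?J = "\<lambda>\<zeta>1 z. (\<Prod>k\<in>{k1<..<k2}. G_fun q (z k) (int (n k) - int (n (k - 1)))
          (int (m k) - int (m (k - 1))) (a k - a (k - 1)))
       * G_fun q (z k2) (int j - 1 - int (n (k2 - 1)))
           (int (m k2) - int (m (k2 - 1))) (a k2 - a (k2 - 1))
       * ((1 - \<zeta>1) / (1 - z 1)) ^ of_bool (k1 = 0)
       / (G_fun q \<zeta>1 (int i - int (n k1)) (m_row p n m i - int (m k1)) (a_row p n a i - a k1)
          * (\<Prod>k\<in>{k1<..<k2}. z k - z (Suc k)) * (z (Suc k1) - \<zeta>1))"
  have last: "G_star q z (int j - 1 - int (n (k2 - 1))) (int (m k2) - int (m (k2 - 1))) (a k2 - a (k2 - 1)) = g k2 z * invG_r k2 j z"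
    if "z \<in> Om" for z
    unfolding g_def invG_r_def G_star_add[OF that] j by (simp add: algebra_simps)
  have int: "?J \<zeta>1 z = ?C * ?X \<zeta>1 z" if z: "z k2 \<in> Om" for \<zeta>1 z
  proof -
    let ?L = "((1 - \<zeta>1) / (1 - z 1)) ^ of_bool (k1 = 0)" and ?I = "\<Prod>k\<in>{k1<..<k2}. inverse (z k - z (Suc k))"
    let ?P = "\<Prod>k\<in>{k1<..<k2}. G_fun q (z k) (int (n k) - int (n (k - 1))) (int (m k) - int (m (k - 1))) (a k - a (k - 1))"
    let ?G1 = "G_fun q \<zeta>1 (int i - int (n k1)) (m_row p n m i - int (m k1)) (a_row p n a i - a k1)"
    let ?H = "G_fun q (z k2) (int j - 1 - int (n (k2 - 1))) (int (m k2) - int (m (k2 - 1))) (a k2 - a (k2 - 1))"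
    have i: "{k1<..k2} = insert k2 {k1<..<k2}" "k2 \<notin> {k1<..<k2}" "finite {k1<..<k2}" using k by auto
    have H: "?H = (g k2 (z k2) / g k2 W) * (invG_r k2 j (z k2) / invG_r k2 j W)"
      unfolding G_fun_def last[OF z] last[OF W_Om] by simp
    have "?J \<zeta>1 z = ?P * ?H * ?L * (1 / ?G1) * ?I * inverse (z (Suc k1) - \<zeta>1)"
      by (simp add: divide_inverse prod_inversef[symmetric] comp_def mult_ac)
    also have "\<dots> = ((\<Prod>k\<in>{k1<..<k2}. g k (z k)) / (\<Prod>k\<in>{k1<..<k2}. g k W)) *
       ((g k2 (z k2) / g k2 W) * (invG_r k2 j (z k2) / invG_r k2 j W)) * ?L * (invG_l k1 i \<zeta>1 / invG_l k1 i W) * ?I * inverse (z (Suc k1) - \<zeta>1)"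
      unfolding H by (simp only: G_fun_invG_l G_fun_g prod_dividef)
    also have "\<dots> = ?C * ?X \<zeta>1 z"
      unfolding start_kernel_def left_factor[of \<zeta>1 z k1] unfolding i(1) prod.insert[OF i(3,2)]
      by (simp add: divide_inverse mult_ac)
    finally show ?thesis .
  qed
  have "J_eps q p n m a \<tau>1 R k1 k2 \<epsilon> i j = 1 / W * oint 0 \<tau>1 (\<lambda>\<zeta>1. oints 1 (R k1 k2 \<epsilon>) [Suc k1..<Suc k2] (?J \<zeta>1))"
    unfolding J_eps_def ..
  also have "(\<lambda>\<zeta>1. oints 1 (R k1 k2 \<epsilon>) [Suc k1..<Suc k2] (?J \<zeta>1)) = (\<lambda>\<zeta>1. oints 1 (R k1 k2 \<epsilon>) [Suc k1..<Suc k2] (\<lambda>z. ?C * ?X \<zeta>1 z))"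
  proof (intro ext oints_cong)
    fix z :: "nat \<Rightarrow> complex" and \<zeta>1
    assume "\<And>k. k \<in> set [Suc k1..<Suc k2] \<Longrightarrow> cmod (z k - 1) = R k1 k2 \<epsilon> k"
    then have "cmod (z k2 - 1) = R k1 k2 \<epsilon> k2" using k by simp
    then have "z k2 \<in> Om" by (rule in_Om) (use Rd(1,2)[of k2] k in auto)
    then show "?J \<zeta>1 z = ?C * ?X \<zeta>1 z" by (rule int)
  next
    fix k assume "k \<in> set [Suc k1..<Suc k2]"
    then have "0 < R k1 k2 \<epsilon> k" by (intro Rd(3)) auto
    then show "0 \<le> R k1 k2 \<epsilon> k" by simp
  qed simp
  also have "oint 0 \<tau>1 \<dots> = ?C * pairing (sel1 \<epsilon>) (sel2 \<epsilon>) (left_init i) (right_init j) k1 k2"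
    unfolding oints_cmul oint_cmul
  proof (subst chain_left_init[OF R k \<tau>])
    fix z assume "z \<in> Om"
    then have "z \<noteq> 0" by (simp add: Om_def)
    then show "right_fun (right_init j) k2 z = invG_r k2 j z" using right_fun_right_init[of k2 z j] P0_invG_r_pure[OF j] k by simp
  qed simp
  also have "(\<Prod>k\<in>{k1<..k2}. g k W) * invG_l k1 i W * invG_r k2 j W = invG_l 0 i W * invG_r 0 j W"
    by (rule g_W) (use k in auto)
  finally show ?thesis by (simp add: norm_const_def)
qed

text \<open>The mirror image of the preceding case: for rows with the data of \<open>p - 1\<close>
  the left function is a pure power, and the integral over \<zeta>1 is absent. The chain between the
  cuts is empty, so the identity holds for arbitrary \<open>t1\<close> and
  \<open>t2\<close>.\<close>

lemma Lambda_pairing: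
  assumes R\<Lambda>: "q < R\<Lambda>" "R\<Lambda> < sqrt q" and \<tau>: "0 < \<tau>2" "\<tau>2 < 1 - sqrt q"
    and i: "m_row p n m i = int (m (p - 1))" "a_row p n a i = a (p - 1)" "n (p - 1) < i"
  shows "Lambda_mat q p n m a \<tau>2 R\<Lambda> i j = norm_const i j * pairing t1 t2 (left_init i) (right_init j) (p - 1) p"
proof -
  have R1: "R\<Lambda> < 1" "0 < R\<Lambda>" and t: "\<tau>2 < 1 - q" using R\<Lambda> \<tau> sqrt_q q0 by auto
  have far: "cmod z > \<tau>2" if "cmod (z - 1) = R\<Lambda>" for z
    using norm_triangle_ineq4[of z "z - 1"] that R\<Lambda> \<tau> by simp
  have hH: "invG_r p j holomorphic_on annulus 0 0 (1 - q)" by (rule hol_annulus0[OF invG_r_hol])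
  have int: "G_fun q z (int (n p) - int i) (int (m p) - int (m (p - 1))) (a p - a (p - 1)) /
       (G_fun q \<zeta> (int (n p) - int j + 1) (int (m p) - m_row p n m j) (a p - a_row p n a j) * (z - \<zeta>)) =
     1 / (invG_l p i W * invG_r p j W) * (invG_l p i z * inverse (z - \<zeta>) * invG_r p j \<zeta>)" (is "?A / (?G * ?d) = _") for z \<zeta>
  proof -
    have A: "?A = invG_l p i z / invG_l p i W" by (simp add: G_fun_def invG_l_def i)
    have "?A / (?G * ?d) = ?A * (1 / ?G) * inverse ?d" by (simp add: divide_inverse)
    then show ?thesis unfolding G_fun_invG_r unfolding A by (simp add: divide_inverse mult_ac)
  qed
  have "Lambda_mat q p n m a \<tau>2 R\<Lambda> i j =
    1 / W * (1 / (invG_l p i W * invG_r p j W) * oint 0 \<tau>2 (\<lambda>\<zeta>. oint 1 R\<Lambda> (\<lambda>z. invG_l p i z * inverse (z - \<zeta>)) * invG_r p j \<zeta>))"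
    unfolding Lambda_mat_def int oint_cmul oint_mulc using i(3) by simp
  also have "oint 0 \<tau>2 (\<lambda>\<zeta>. oint 1 R\<Lambda> (\<lambda>z. invG_l p i z * inverse (z - \<zeta>)) * invG_r p j \<zeta>) =
      oint 1 R\<Lambda> (\<lambda>z. invG_l p i z * oint 0 \<tau>2 (\<lambda>\<zeta>. invG_r p j \<zeta> * inverse (z - \<zeta>)))"
    by (rule oint_swap_kernel[symmetric])
       (use hol_cont_sphere[OF hol_annulus1[OF invG_l_hol] R\<Lambda>(1) R1(1)] hol_cont_sphere[OF hH \<tau>(1) t] far \<tau> R1 in auto)
  also have "\<dots> = oint 1 R\<Lambda> (\<lambda>z. lchain t1 t2 (left_init i) (p - 1) (p - 1) z * (g p z * right_fun (right_init j) p z))"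
  proof (rule oint_cong)
    fix z assume z: "cmod (z - 1) = R\<Lambda>"
    have zO: "z \<in> Om" by (rule in_Om[OF z]) (use R\<Lambda> R1 in auto)
    have z0: "z \<noteq> 0" using zO by (simp add: Om_def)
    have p1: "1 \<le> p - 1" "p - 1 \<le> p" "Suc (p - 1) = p" using p2 by auto
    have a: "P0 (invG_r p j) z = oint 0 \<tau>2 (\<lambda>\<zeta>. invG_r p j \<zeta> / (z - \<zeta>))"
      by (rule prin_radius[OF hH]) (use far[OF z] \<tau> t in auto)
    have b: "right_fun (right_init j) p z = P0 (invG_r p j) z" by (rule right_fun_right_init) (use z0 in auto)
    have c: "lchain t1 t2 (left_init i) (p - 1) (p - 1) z = invG_l (p - 1) i z"
      unfolding lchain_start using left_fun_left_init[OF p1(1,2) z0, of i] P0_invG_l_pure[OF i z0] by simp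
    have d: "g p z * invG_l (p - 1) i z = invG_l p i z"
      using g_prod_invG_l[OF zO p1(2) order_refl, of i] p1(3) by (simp add: g_prod_def)
    show "invG_l p i z * oint 0 \<tau>2 (\<lambda>\<zeta>. invG_r p j \<zeta> * inverse (z - \<zeta>)) =
      lchain t1 t2 (left_init i) (p - 1) (p - 1) z * (g p z * right_fun (right_init j) p z)"
      unfolding divide_inverse[symmetric] a[symmetric] b c d[symmetric] by (simp only: mult_ac)
  qed (use R1 in simp)
  also have "\<dots> = pairing t1 t2 (left_init i) (right_init j) (p - 1) p" by (rule pairing_radius[symmetric]) (use R\<Lambda> R1 in auto)
  also have "invG_l p i W * invG_r p j W = invG_l 0 i W * invG_r 0 j W" by (rule invG_l_invG_r[OF W_Om])
  finally show ?thesis by (simp add: norm_const_def)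
qed

lemma L_mat_diagL:
  assumes "0 < \<tau>2" "\<tau>2 < \<tau>1" "\<tau>1 < 1 - sqrt q" "1 \<le> k"
  shows "L_mat q p n m a \<tau>1 \<tau>2 k i j = norm_const i j * diagL k i j"
proof -
  have t: "\<tau>1 < 1 - q" "\<tau>2 < 1 - q" using assms sqrt_q by auto
  have hH: "invG_r k j holomorphic_on annulus 0 0 (1 - q)" by (rule hol_annulus0[OF invG_r_hol])
  have int: "G_fun q \<zeta>1 (int (n k) - int i) (int (m k) - m_row p n m i) (a k - a_row p n a i) /
       (G_fun q \<zeta>2 (int (n k) - int j + 1) (int (m k) - m_row p n m j) (a k - a_row p n a j) * (\<zeta>1 - \<zeta>2)) =
     1 / (invG_l k i W * invG_r k j W) * (invG_l k i \<zeta>1 * (invG_r k j \<zeta>2 / (\<zeta>1 - \<zeta>2)))" (is "?A / (?G * ?d) = _") for \<zeta>1 \<zeta>2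
  proof -
    have A: "?A = invG_l k i \<zeta>1 / invG_l k i W" by (simp add: G_fun_def invG_l_def)
    have "?A / (?G * ?d) = ?A * (1 / ?G) * inverse ?d" by (simp add: divide_inverse)
    then show ?thesis unfolding G_fun_invG_r unfolding A by (simp add: divide_inverse mult_ac)
  qed
  have "L_mat q p n m a \<tau>1 \<tau>2 k i j = 1 / W * (1 / (invG_l k i W * invG_r k j W) *
     oint 0 \<tau>1 (\<lambda>\<zeta>1. invG_l k i \<zeta>1 * oint 0 \<tau>2 (\<lambda>\<zeta>2. invG_r k j \<zeta>2 / (\<zeta>1 - \<zeta>2))))"
    unfolding L_mat_def int oint_cmul using assms(4) by simp
  also have "oint 0 \<tau>1 (\<lambda>\<zeta>1. invG_l k i \<zeta>1 * oint 0 \<tau>2 (\<lambda>\<zeta>2. invG_r k j \<zeta>2 / (\<zeta>1 - \<zeta>2))) =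
      oint 0 \<tau>1 (\<lambda>\<zeta>1. invG_l k i \<zeta>1 * P0 (invG_r k j) \<zeta>1)"
  proof (rule oint_cong)
    fix \<zeta> assume "cmod (\<zeta> - 0) = \<tau>1"
    then have "P0 (invG_r k j) \<zeta> = oint 0 \<tau>2 (\<lambda>\<zeta>2. invG_r k j \<zeta>2 / (\<zeta> - \<zeta>2))"
      by (intro prin_radius[OF hH]) (use assms t in auto)
    then show "invG_l k i \<zeta> * oint 0 \<tau>2 (\<lambda>\<zeta>2. invG_r k j \<zeta>2 / (\<zeta> - \<zeta>2)) = invG_l k i \<zeta> * P0 (invG_r k j) \<zeta>" by simp
  qed (use assms in simp)
  also have "\<dots> = diagL k i j" unfolding diagL_def
    by (rule oint_radius[OF hol_annulus0[OF holomorphic_on_mult[OF invG_l_hol P0_hol[OF invG_r_hol]]]]) (use assms t \<tau>0 in auto)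
  also have "invG_l k i W * invG_r k j W = invG_l 0 i W * invG_r 0 j W" by (rule invG_l_invG_r[OF W_Om])
  finally show ?thesis by (simp add: norm_const_def)
qed

lemma B_diag0:
  assumes \<tau>: "0 < \<tau>" "\<tau> < 1 - sqrt q" and i: "row_in r i" and j: "row_in s j" and s: "s < star p r"
  shows "1 / W * oint 0 \<tau> (\<lambda>w. 1 / G_fun q w (int i - int j + 1)
         (int (m (star p r)) - int (m s)) (a (star p r) - a s)) = norm_const i j * diag0 i j"
proof -
  have t: "\<tau> < 1 - q" using assms sqrt_q by auto
  have ss: "star p s = s" using s by (auto simp: star_def)
  have e: "- (int i - int j + 1) = int j - 1 - int i" by simp
  have "1 / G_star q z (int i - int j + 1) (int (m (star p r)) - int (m s)) (a (star p r) - a s) = invG_l 0 i z * invG_r 0 j z"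
    if "z \<in> Om" for z
    unfolding invG_l_invG_r_prod[OF that] row_data[OF i] row_data[OF j] ss G_star_minus e minus_diff_eq ..
  note G = this
  have "oint 0 \<tau> (\<lambda>w. 1 / G_fun q w (int i - int j + 1) (int (m (star p r)) - int (m s)) (a (star p r) - a s)) =
    oint 0 \<tau> (\<lambda>w. 1 / (invG_l 0 i W * invG_r 0 j W) * (invG_l 0 i w * invG_r 0 j w))"
  proof (rule oint_cong)
    fix z assume "cmod (z - 0) = \<tau>"
    then have z: "z \<in> Om" using annulus0_Om \<tau> t by (auto simp: annulus_def)
    show "1 / G_fun q z (int i - int j + 1) (int (m (star p r)) - int (m s)) (a (star p r) - a s) =
      1 / (invG_l 0 i W * invG_r 0 j W) * (invG_l 0 i z * invG_r 0 j z)"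
      unfolding G[OF z, symmetric] G[OF W_Om, symmetric] by (simp add: G_fun_def)
  qed (use \<tau> in simp)
  also have "\<dots> = 1 / (invG_l 0 i W * invG_r 0 j W) * oint 0 \<tau> (\<lambda>w. invG_l 0 i w * invG_r 0 j w)" by (rule oint_cmul)
  also have "oint 0 \<tau> (\<lambda>w. invG_l 0 i w * invG_r 0 j w) = diag0 i j" unfolding diag0_def
    by (rule oint_radius[OF hol_annulus0[OF holomorphic_on_mult[OF invG_l_hol invG_r_hol]]]) (use \<tau> t \<tau>0 in auto)
  finally show ?thesis by (simp add: norm_const_def)
qed

text \<open>For such a column the right function is regular at 0. Together with
  \<open>pairing_left_fun_zero\<close> this accounts for the indicators in the definition of the
  blocks.\<close>

lemma pairing_right_fun_zero:
  assumes "n k2 < j" "k2 \<le> p"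
  shows "pairing t1 t2 u0 (right_init j) k1 k2 = 0"
proof -
  have "pairing t1 t2 u0 (right_init j) k1 k2 = oint 1 ((1 + q) / 2) (\<lambda>z. 0)"
    unfolding pairing_def
  proof (rule oint_cong)
    fix z assume "cmod (z - 1) = (1 + q) / 2"
    then have "z \<in> Om" by (rule in_Om) (use q0 q1 in auto)
    then have "z \<noteq> 0" by (simp add: Om_def)
    then have "right_fun (right_init j) k2 z = 0" using right_fun_right_init[OF assms(2)] P0_invG_r_zero[OF assms(1)] by simp
    then show "right_fun (right_init j) k2 z * (g k2 z * lchain t1 t2 u0 k1 (k2 - 1) z) = 0" by simp
  qed (use q0 in simp)
  then show ?thesis by simp
qed

lemma pairing_left_fun_zero:
  assumes "i \<le> n k1" "1 \<le> k1" "k1 < k2" "k2 \<le> p"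
  shows "pairing t1 t2 (left_init i) \<rho> k1 k2 = 0"
proof -
  have S: "lchain t1 t2 (left_init i) k1 k z = 0" if "k1 \<le> k" "z \<in> Om" for k z
    using that
  proof (induction k arbitrary: z rule: dec_induct)
    case base
    then have "z \<noteq> 0" by (simp add: Om_def)
    then show ?case using left_fun_left_init[of k1 z i] P0_invG_l_zero[OF assms(1)] assms by (simp add: lchain_start)
  next
    case (step k)
    have "P1 (\<lambda>z. g (Suc k) z * lchain t1 t2 (left_init i) k1 k z) z = P1 (\<lambda>w. 0 * 0) z"
      by (rule P1_cong) (use step Om_Ex in auto)
    also have "\<dots> = 0" by (subst prin_cmul) simp
    finally show ?case using step by (simp add: mix1_def)
  qed
  have "pairing t1 t2 (left_init i) \<rho> k1 k2 = oint 1 ((1 + q) / 2) (\<lambda>z. 0)"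
    unfolding pairing_def
  proof (rule oint_cong)
    fix z assume "cmod (z - 1) = (1 + q) / 2"
    then have "z \<in> Om" by (rule in_Om) (use q0 q1 in auto)
    then have "lchain t1 t2 (left_init i) k1 (k2 - 1) z = 0" using assms by (intro S) auto
    then show "right_fun \<rho> k2 z * (g k2 z * lchain t1 t2 (left_init i) k1 (k2 - 1) z) = 0" by simp
  qed (use q0 in simp)
  then show ?thesis by simp
qed

end

section \<open>Rows of the last-passage process\<close>

lemma lpp_cong:
  assumes "\<And>i j. i \<in> {1..m} \<Longrightarrow> j \<in> {1..n} \<Longrightarrow> w (i, j) = w' (i, j)"
  shows "lpp w m n = lpp w' m n"
  using assms
proof (induction w m n rule: lpp.induct)
  case (3 w m n)
  have "lpp w m (Suc n) = lpp w' m (Suc n)" "lpp w (Suc m) n = lpp w' (Suc m) n"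
    by (rule 3; use 3(3) in simp)+
  then show ?case using 3(3)[of "Suc m" "Suc n"] by simp
qed simp_all

lemma lpp_mono1: "lpp w m n \<le> lpp w (Suc m) n"
  by (cases n) (cases m; simp)+

lemma lpp_mono2: "lpp w m n \<le> lpp w m (Suc n)"
  by (cases m) simp_all

lemma lpp_mono: "m \<le> m' \<Longrightarrow> n \<le> n' \<Longrightarrow> lpp w m n \<le> lpp w m' n'"
proof -
  assume "m \<le> m'" "n \<le> n'"
  then have "lpp w m n \<le> lpp w m' n" by (induction m' rule: dec_induct) (auto intro: le_trans lpp_mono1)
  also have "lpp w m' n \<le> lpp w m' n'" using \<open>n \<le> n'\<close>
    by (induction n' rule: dec_induct) (auto intro: le_trans lpp_mono2)
  finally show ?thesis .
qed

context pts begin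

definition lpp_row :: "(nat \<times> nat \<Rightarrow> nat) \<Rightarrow> nat \<Rightarrow> nat \<Rightarrow> int" where
  "lpp_row w t = (\<lambda>j\<in>{..<N}. int (lpp w t (Suc j)))"

definition meets :: "(nat \<times> nat \<Rightarrow> nat) \<Rightarrow> nat \<Rightarrow> bool" where
  "meets w t \<longleftrightarrow> (\<forall>s\<in>{1..t}. lpp_row w s \<in> states \<and> meets_at s (lpp_row w s) = 1)"

definition increment :: "nat \<Rightarrow> (nat \<Rightarrow> int) \<Rightarrow> (nat \<Rightarrow> int) \<Rightarrow> int" where
  "increment j x y = y j - (if j = 0 then x 0 else max (x j) (y (j - 1)))"

lemma lpp_row_mono: "Suc j < N \<Longrightarrow> lpp_row w t j \<le> lpp_row w t (Suc j)"
  by (simp add: lpp_row_def lpp_mono2)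

lemma lpp_row_nonneg: "j < N \<Longrightarrow> 0 \<le> lpp_row w t j"
  by (simp add: lpp_row_def)

lemma lpp_row_0: "lpp_row w 0 = origin"
  by (simp add: lpp_row_def origin_def fun_eq_iff)

text \<open>Read from left to right, the recursion determines the weights from two consecutive rows
  and the new row from the weights.\<close>

lemma lpp_row_Suc_eq:
  assumes y: "y \<in> {..<N} \<rightarrow>\<^sub>E UNIV"
  shows "lpp_row w (Suc t) = y \<longleftrightarrow> (\<forall>j<N. int (w (Suc t, Suc j)) = increment j (lpp_row w t) y)"
proof -
  have rec: "lpp_row w (Suc t) j = (if j = 0 then lpp_row w t 0 else max (lpp_row w t j) (lpp_row w (Suc t) (j - 1))) + int (w (Suc t, Suc j))" if "j < N" for j
    using that by (cases j) (auto simp: lpp_row_def)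
  show ?thesis
  proof
    assume y: "lpp_row w (Suc t) = y"
    show "\<forall>j<N. int (w (Suc t, Suc j)) = increment j (lpp_row w t) y"
    proof (intro allI impI)
      fix j assume "j < N"
      from rec[OF this] show "int (w (Suc t, Suc j)) = increment j (lpp_row w t) y" by (simp add: increment_def y)
    qed
  next
    assume *: "\<forall>j<N. int (w (Suc t, Suc j)) = increment j (lpp_row w t) y"
    have "lpp_row w (Suc t) j = y j" if "j < N" for j
      using that
    proof (induction j)
      case 0 then show ?case using rec[of 0] * by (simp add: increment_def)
    next
      case (Suc j)
      then show ?case using rec[of "Suc j"] * by (simp add: increment_def)
    qed
    then show "lpp_row w (Suc t) = y" using y by (auto simp: fun_eq_iff lpp_row_def PiE_def extensional_def restrict_def)
  qed
qed

lemma meets_Suc: "meets w (Suc t) \<longleftrightarrow> meets w t \<and> lpp_row w (Suc t) \<in> states \<and> meets_at (Suc t) (lpp_row w (Suc t)) = 1"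
proof -
  have "{1..Suc t} = insert (Suc t) {1..t}" by auto
  then show ?thesis by (auto simp: meets_def)
qed

lemma lpp_row_cong: "(\<And>i. i \<in> {1..t} \<times> {1..N} \<Longrightarrow> w i = w' i) \<Longrightarrow> s \<le> t \<Longrightarrow> lpp_row w s = lpp_row w' s"
  unfolding lpp_row_def by (intro restrict_ext arg_cong[of _ _ int] lpp_cong) auto

lemma meets_cong: "(\<And>i. i \<in> {1..t} \<times> {1..N} \<Longrightarrow> w i = w' i) \<Longrightarrow> meets w t = meets w' t"
  unfolding meets_def by (intro ball_cong refl) (use lpp_row_cong[of t w w'] in auto)

lemma transition_increment: "transition q N x y = (\<Prod>j<N. weight q (increment j x y))"
  by (simp add: transition_def increment_def)

lemma transition_zero: "j < N \<Longrightarrow> increment j x y < 0 \<Longrightarrow> transition q N x y = 0"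
proof -
  assume "j < N" "increment j x y < 0"
  then have "\<exists>j\<in>{..<N}. weight q (increment j x y) = 0" by (intro bexI[of _ j]) (simp_all add: weight_def)
  then show ?thesis unfolding transition_increment by (intro prod_zero) simp_all
qed

text \<open>By monotonicity the last constraint bounds all earlier rows and is the same as their
  being states. Each other constraint concerns one entry, at position \<open>n k - 1\<close> because
  the entries of a row are counted from 0.\<close>

lemma meets_iff:
  "(\<forall>k\<in>{1..p}. int (lpp w (m k) (n k)) < a k) \<longleftrightarrow> meets w (m p)"
proof
  have N1: "lpp_row w t (n k - 1) = int (lpp w t (n k))" if "k \<in> {1..p}" for t k
    using n_pos[of k] n_mono[of k p] that by (auto simp: lpp_row_def N_def)
  assume *: "\<forall>k\<in>{1..p}. int (lpp w (m k) (n k)) < a k"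
  show "meets w (m p)" unfolding meets_def
  proof (intro ballI conjI)
    fix s assume s: "s \<in> {1..m p}"
    have "lpp_row w s j < a p" if "j < N" for j
    proof -
      have "lpp w s (Suc j) \<le> lpp w (m p) (n p)" by (rule lpp_mono) (use s that in \<open>auto simp: N_def\<close>)
      moreover have "int (lpp w (m p) (n p)) < a p" using * p2 by simp
      ultimately show ?thesis using that by (simp add: lpp_row_def)
    qed
    then show "lpp_row w s \<in> states" using lpp_row_mono by (auto simp: states_def lpp_row_def)
    show "meets_at s (lpp_row w s) = 1" using * N1 by (auto simp: meets_at_def)
  qed
next
  have N1: "lpp_row w t (n k - 1) = int (lpp w t (n k))" if "k \<in> {1..p}" for t k
    using n_pos[of k] n_mono[of k p] that by (auto simp: lpp_row_def N_def)
  assume *: "meets w (m p)"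
  show "\<forall>k\<in>{1..p}. int (lpp w (m k) (n k)) < a k"
  proof
    fix k assume k: "k \<in> {1..p}"
    have mk: "m k \<in> {1..m p}" using m_strict[of 0 k] m_mono[of k p] k by auto
    show "int (lpp w (m k) (n k)) < a k"
    proof (cases "k = p")
      case True
      have "lpp_row w (m p) \<in> states" using * mk True by (auto simp: meets_def)
      then have "lpp_row w (m p) (N - 1) < a p" using N_pos by (auto simp: states_def)
      then show ?thesis using N1[OF k] True by (simp add: N_def)
    next
      case False
      have "meets_at (m k) (lpp_row w (m k)) = 1" using * mk by (auto simp: meets_def)
      then have "lpp_row w (m k) (n k - 1) < a k" using meets_at_at[of k] k False by (auto split: if_splits)
      then show ?thesis using N1[OF k] by simp
    qed
  qed
qed

end

section \<open>Independence of the weights and the Markov property of the rows\<close>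

locale lpp_prob = pts q p n m a + prob_space M
  for q :: real and p :: nat and n m :: "nat \<Rightarrow> nat" and a :: "nat \<Rightarrow> int" and M :: "'a measure" +
  fixes \<omega> :: "nat \<times> nat \<Rightarrow> 'a \<Rightarrow> nat"
  assumes indep: "indep_vars (\<lambda>_. count_space UNIV) \<omega> ({1..} \<times> {1..})"
    and geom: "\<And>i j k. 1 \<le> i \<Longrightarrow> 1 \<le> j \<Longrightarrow> measure M {x \<in> space M. \<omega> (i, j) x = k} = (1 - q) * q ^ k"
begin

abbreviation w where "w x \<equiv> (\<lambda>ij. \<omega> ij x)"

definition row_event :: "nat \<Rightarrow> (nat \<Rightarrow> int) \<Rightarrow> 'a set" where
  "row_event t y = {x \<in> space M. lpp_row (w x) t = y \<and> meets (w x) t}"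

definition row :: "nat \<Rightarrow> (nat \<Rightarrow> int) \<Rightarrow> (nat \<Rightarrow> int) \<Rightarrow> 'a set" where
  "row t x y = {z \<in> space M. \<forall>j<N. int (\<omega> (Suc t, Suc j) z) = increment j x y}"

lemma sets_PiM_grid: "finite A \<Longrightarrow> B \<subseteq> A \<rightarrow>\<^sub>E UNIV \<Longrightarrow> B \<in> sets (PiM A (\<lambda>_. count_space (UNIV :: nat set)))"
  by (subst count_space_PiM_finite) auto

text \<open>The past depends on the weights with first index at most \<open>t\<close>, the next
  increments on those with first index \<open>t + 1\<close>; both families restricted to these
  disjoint finite index sets are independent.\<close>

lemma row_event_row:
  shows "row_event t x \<in> events" "row t x y \<in> events" "prob (row_event t x \<inter> row t x y) = prob (row_event t x) * prob (row t x y)"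
proof -
  let ?A = "{1..t} \<times> {1..N}" and ?B = "{Suc t} \<times> {1..N}"
  have iv: "indep_var (PiM ?A (\<lambda>_. count_space UNIV)) (\<lambda>x. restrict (\<lambda>i. \<omega> i x) ?A)
      (PiM ?B (\<lambda>_. count_space UNIV)) (\<lambda>x. restrict (\<lambda>i. \<omega> i x) ?B)"
    by (rule indep_var_restrict[OF indep]) auto
  define SA where "SA = {f \<in> ?A \<rightarrow>\<^sub>E UNIV. lpp_row f t = x \<and> meets f t}"
  define SB where "SB = {f \<in> ?B \<rightarrow>\<^sub>E UNIV. \<forall>j<N. int (f (Suc t, Suc j)) = increment j x y}"
  have SA: "SA \<in> sets (PiM ?A (\<lambda>_. count_space UNIV))" by (rule sets_PiM_grid) (auto simp: SA_def)
  have SB: "SB \<in> sets (PiM ?B (\<lambda>_. count_space UNIV))" by (rule sets_PiM_grid) (auto simp: SB_def)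
  have e: "lpp_row (restrict (\<lambda>i. \<omega> i z) ?A) t = lpp_row (w z) t" "meets (restrict (\<lambda>i. \<omega> i z) ?A) t = meets (w z) t" for z
    by (rule lpp_row_cong[of t]; simp) (rule meets_cong; simp)
  have evA: "row_event t x = (\<lambda>x. restrict (\<lambda>i. \<omega> i x) ?A) -` SA \<inter> space M"
    by (auto simp: row_event_def SA_def e simp del: One_nat_def)
  have rowB: "row t x y = (\<lambda>x. restrict (\<lambda>i. \<omega> i x) ?B) -` SB \<inter> space M"
    by (auto simp: row_def SB_def)
  show "row_event t x \<in> events" unfolding evA by (rule measurable_sets[OF indep_var_rv1[OF iv] SA])
  show "row t x y \<in> events" unfolding rowB by (rule measurable_sets[OF indep_var_rv2[OF iv] SB])
  have "row_event t x \<inter> row t x y = (\<lambda>x. (restrict (\<lambda>i. \<omega> i x) ?A, restrict (\<lambda>i. \<omega> i x) ?B)) -` (SA \<times> SB) \<inter> space M"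
    unfolding evA rowB by auto
  then show "prob (row_event t x \<inter> row t x y) = prob (row_event t x) * prob (row t x y)"
    using indep_varD[OF iv SA SB] by (simp only: evA rowB)
qed

lemma prob_row: "complex_of_real (prob (row t x y)) = transition q N x y"
proof (cases "\<forall>j<N. 0 \<le> increment j x y")
  case True
  let ?B = "(\<lambda>j. (Suc t, Suc j)) ` {..<N}"
  define c where "c i = nat (increment (snd i - 1) x y)" for i :: "nat \<times> nat"
  have "row t x y = (\<Inter>i\<in>?B. \<omega> i -` {c i} \<inter> space M)"
    using True N_pos by (auto simp: row_def c_def)
  also have "prob \<dots> = (\<Prod>i\<in>?B. prob (\<omega> i -` {c i} \<inter> space M))"
    by (rule indep_varsD[OF indep]) (use N_pos in auto)
  also have "\<dots> = (\<Prod>j<N. prob (\<omega> (Suc t, Suc j) -` {nat (increment j x y)} \<inter> space M))"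
    by (subst prod.reindex) (auto simp: inj_on_def c_def)
  also have "\<dots> = (\<Prod>j<N. (1 - q) * q ^ nat (increment j x y))"
  proof (rule prod.cong)
    fix j
    have "\<omega> (Suc t, Suc j) -` {k} \<inter> space M = {x \<in> space M. \<omega> (Suc t, Suc j) x = k}" for k by auto
    then show "prob (\<omega> (Suc t, Suc j) -` {nat (increment j x y)} \<inter> space M) = (1 - q) * q ^ nat (increment j x y)"
      by (simp add: geom)
  qed simp
  finally show ?thesis using True by (simp add: transition_increment weight_def)
next
  case False
  then obtain j where j: "j < N" "increment j x y < 0" by force
  have "row t x y = {}" using j by (force simp: row_def)
  moreover have "transition q N x y = 0" by (rule transition_zero[OF j])
  ultimately show ?thesis by simp
qed

text \<open>The row of zeros at time 0 need not be a state, namely when \<open>a p\<close> is not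
  positive. From time 1 on, the rows that occur are states with nonnegative entries, of which there
  are finitely many.\<close>

definition start_set :: "nat \<Rightarrow> (nat \<Rightarrow> int) set" where
  "start_set t = (if t = 0 then {origin} else box 0)"

lemma finite_start_set: "finite (start_set t)" by (simp add: start_set_def)

lemma lpp_row_start_set: "meets (w x) t \<Longrightarrow> lpp_row (w x) t \<in> start_set t"
proof (cases "t = 0")
  case False
  assume "meets (w x) t"
  then have "lpp_row (w x) t \<in> states" using False by (auto simp: meets_def)
  moreover have "0 \<le> lpp_row (w x) t 0" using lpp_row_nonneg N_pos by blast
  ultimately show ?thesis using False by (simp add: start_set_def box_eq)
qed (simp add: start_set_def lpp_row_0)

lemma row_event_Suc:
  assumes y: "y \<in> box 0"
  shows "complex_of_real (prob (row_event (Suc t) y)) = meets_at (Suc t) y * (\<Sum>x\<in>start_set t. complex_of_real (prob (row_event t x)) * transition q N x y)"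
proof (cases "meets_at (Suc t) y = 1")
  case True
  have ys: "y \<in> states" "y \<in> {..<N} \<rightarrow>\<^sub>E UNIV" using y by (auto simp: box_eq states_def)
  have un: "row_event (Suc t) y = (\<Union>x\<in>start_set t. row_event t x \<inter> row t x y)"
  proof (intro equalityI subsetI)
    fix z assume z: "z \<in> row_event (Suc t) y"
    then have g: "meets (w z) t" "lpp_row (w z) (Suc t) = y" "z \<in> space M" by (auto simp: row_event_def meets_Suc)
    then have "z \<in> row_event t (lpp_row (w z) t) \<inter> row t (lpp_row (w z) t) y"
      using lpp_row_Suc_eq[OF ys(2)] by (auto simp: row_event_def row_def)
    then show "z \<in> (\<Union>x\<in>start_set t. row_event t x \<inter> row t x y)" using lpp_row_start_set[OF g(1)] by blast
  next
    fix z assume "z \<in> (\<Union>x\<in>start_set t. row_event t x \<inter> row t x y)"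
    then obtain x where z: "z \<in> row_event t x" "z \<in> row t x y" by auto
    then have "lpp_row (w z) (Suc t) = y" using lpp_row_Suc_eq[OF ys(2)] by (auto simp: row_event_def row_def)
    with z True ys show "z \<in> row_event (Suc t) y" by (auto simp: row_event_def meets_Suc)
  qed
  have "disjoint_family_on (\<lambda>x. row_event t x \<inter> row t x y) (start_set t)"
    by (auto simp: disjoint_family_on_def row_event_def)
  moreover have "(\<lambda>x. row_event t x \<inter> row t x y) ` start_set t \<subseteq> events" using row_event_row(1,2) by blast
  ultimately have "prob (\<Union>x\<in>start_set t. row_event t x \<inter> row t x y) = (\<Sum>x\<in>start_set t. prob (row_event t x \<inter> row t x y))"
    by (intro finite_measure_finite_Union finite_start_set)
  then have "prob (row_event (Suc t) y) = (\<Sum>x\<in>start_set t. prob (row_event t x) * prob (row t x y))"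
    unfolding un row_event_row(3) .
  then have "complex_of_real (prob (row_event (Suc t) y)) = (\<Sum>x\<in>start_set t. complex_of_real (prob (row_event t x)) * transition q N x y)"
    by (simp only: of_real_sum of_real_mult prob_row)
  with True show ?thesis by (simp only: mult_1_left)
next
  case False
  then have "row_event (Suc t) y = {}" by (auto simp: row_event_def meets_Suc)
  moreover have "meets_at (Suc t) y = 0" using False by (simp add: meets_at_def split: if_splits)
  ultimately show ?thesis by simp
qed

text \<open>The induction runs from \<open>m p\<close> downwards: there the events
  \<open>row_event\<close> partition the target event, and each step back expands the law of the
  next row and absorbs it into the recursion of \<open>V\<close>.\<close>

lemma prob_V_step:
  assumes "t \<le> m p"
  shows "complex_of_real (prob {x \<in> space M. meets (w x) (m p)}) =
    (\<Sum>y\<in>start_set t. complex_of_real (prob (row_event t y)) * V (m p - t) y)"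
  using assms
proof (induction t rule: inc_induct)
  case base
  have un: "{x \<in> space M. meets (w x) (m p)} = (\<Union>y\<in>start_set (m p). row_event (m p) y)"
    using lpp_row_start_set by (auto simp: row_event_def)
  have "disjoint_family_on (row_event (m p)) (start_set (m p))"
    by (auto simp: disjoint_family_on_def row_event_def)
  moreover have "row_event (m p) ` start_set (m p) \<subseteq> events" using row_event_row(1) by blast
  ultimately have "prob (\<Union>y\<in>start_set (m p). row_event (m p) y) = (\<Sum>y\<in>start_set (m p). prob (row_event (m p) y))"
    by (intro finite_measure_finite_Union finite_start_set)
  then show ?case unfolding un by simp
next
  case (step t)
  have s: "m p - t = Suc (m p - Suc t)" "m p - (m p - Suc t) = Suc t" using step.hyps by auto
  have "complex_of_real (prob {x \<in> space M. meets (w x) (m p)}) =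
    (\<Sum>y\<in>box 0. complex_of_real (prob (row_event (Suc t) y)) * V (m p - Suc t) y)"
    using step.IH by (simp add: start_set_def)
  also have "\<dots> = (\<Sum>y\<in>box 0. \<Sum>x\<in>start_set t. complex_of_real (prob (row_event t x)) * (transition q N x y * meets_at (Suc t) y * V (m p - Suc t) y))"
    by (rule sum.cong) (auto simp: row_event_Suc sum_distrib_left sum_distrib_right mult_ac)
  also have "\<dots> = (\<Sum>x\<in>start_set t. complex_of_real (prob (row_event t x)) * (\<Sum>y\<in>box 0. transition q N x y * meets_at (Suc t) y * V (m p - Suc t) y))"
    unfolding sum_distrib_left by (rule sum.swap)
  also have "\<dots> = (\<Sum>x\<in>start_set t. complex_of_real (prob (row_event t x)) * V (m p - t) x)"
  proof (rule sum.cong)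
    fix x assume x: "x \<in> start_set t"
    have x0: "0 \<le> x 0" using x N_pos by (auto simp: start_set_def box_eq origin_def split: if_splits)
    have sub: "succ x \<subseteq> box 0" using x0 N_pos by (force simp: succ_def box_eq)
    \<comment> \<open>\<open>V\<close> sums over the successors only. A row of the box that is not a
      successor decreases somewhere, and the increment at that place is negative.\<close>
    have "transition q N x y = 0" if "y \<in> box 0 - succ x" for y
    proof -
      have "y \<in> states" "\<not> (\<forall>j<N. x j \<le> y j)" using that by (auto simp: succ_def box_eq)
      then obtain j where j: "j < N" "y j < x j" by (auto simp: not_le)
      then have "increment j x y < 0" by (auto simp: increment_def)
      then show ?thesis by (rule transition_zero[OF j(1)])
    qed
    then have "(\<Sum>y\<in>succ x. transition q N x y * meets_at (Suc t) y * V (m p - Suc t) y) =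
      (\<Sum>y\<in>box 0. transition q N x y * meets_at (Suc t) y * V (m p - Suc t) y)"
      by (intro sum.mono_neutral_left sub) auto
    then show "complex_of_real (prob (row_event t x)) * (\<Sum>y\<in>box 0. transition q N x y * meets_at (Suc t) y * V (m p - Suc t) y) =
      complex_of_real (prob (row_event t x)) * V (m p - t) x"
      unfolding s(1) V.simps s(2) by simp
  qed simp
  finally show ?case .
qed

lemma prob_eq_V:
  "complex_of_real (prob {x \<in> space M. \<forall>k\<in>{1..p}. int (lpp (\<lambda>ij. \<omega> ij x) (m k) (n k)) < a k}) = V (m p) origin"
proof -
  have "row_event 0 origin = space M" by (auto simp: row_event_def lpp_row_0 meets_def)
  then show ?thesis unfolding meets_iff using prob_V_step[of 0] by (simp add: start_set_def prob_space)
qed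

end

section \<open>The determinant\<close>

context pts begin

lemma admissible_ok:
  assumes "admissible_radii q p R" "k1 < k2" "k2 \<le> p" "\<epsilon> \<in> eps_range p k1 k2"
  shows "radii_ok k1 k2 \<epsilon> (R k1 k2 \<epsilon>)"
proof -
  have \<epsilon>: "\<epsilon> \<in> eps_all p" using assms(4) by (simp add: eps_range_def)
  have v: "\<epsilon> k = 1 \<or> \<epsilon> k = 2" if "k1 < k" "k < k2" for k
  proof -
    have "k \<in> {1..p - 1}" using that assms(2,3) by auto
    then show ?thesis using \<epsilon> by (auto simp: eps_all_def PiE_iff)
  qed
  have "(\<forall>k. k1 < k \<and> k \<le> k2 \<longrightarrow> q < R k1 k2 \<epsilon> k \<and> R k1 k2 \<epsilon> k < sqrt q) \<and>
        (\<forall>k. k1 < k \<and> k < k2 \<longrightarrow>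
           (\<epsilon> k = 2 \<longrightarrow> R k1 k2 \<epsilon> k < R k1 k2 \<epsilon> (Suc k)) \<and>
           (\<epsilon> k = 1 \<longrightarrow> R k1 k2 \<epsilon> k > R k1 k2 \<epsilon> (Suc k)))"
    using assms(1-3) \<epsilon> unfolding admissible_radii_def by blast
  then show ?thesis using v unfolding radii_ok_def by blast
qed

lemma block_form_row: "row_in r i \<Longrightarrow> row_in s j \<Longrightarrow> block_form n M r i s j = M i j"
  by (simp add: block_form_def)

text \<open>The indicators of the three kinds of block exclude each other and cover all cuts at
  which the pairing can be nonzero. In the remaining cases the position of the row or of the column
  makes a principal part at 0 vanish.\<close>

lemma blocks_pairing:
  assumes R: "admissible_radii q p R" and k: "k1 < k2" "k2 \<le> p" and \<epsilon>: "\<epsilon> \<in> eps_range p k1 k2"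
    and \<tau>: "0 < \<tau>2" "\<tau>2 < \<tau>1" "\<tau>1 < 1 - sqrt q" and R\<Lambda>: "q < R\<Lambda>" "R\<Lambda> < sqrt q"
    and i: "row_in r i" and j: "row_in s j"
  shows "L_eps_block q p n m a \<mu> \<nu> \<tau>1 \<tau>2 R k1 k2 \<epsilon> r i s j + J_eps_block q p n m a \<mu> \<nu> \<tau>1 R k1 k2 \<epsilon> r i s j
      + of_bool (k1 = p - 1 \<and> k2 = p) * Lambda_block q p n m a \<mu> \<nu> \<tau>2 R\<Lambda> r i s j =
    c_conj p n \<mu> \<nu> i j * norm_const i j * pairing (sel1 \<epsilon>) (sel2 \<epsilon>) (left_init i) (right_init j) k1 k2"
    (is "?L + ?J + ?\<Lambda> = ?c * _ * ?Q")
proof -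
  note ok = admissible_ok[OF R k \<epsilon>]
  have t: "0 < \<tau>1" "\<tau>2 < 1 - sqrt q" using \<tau> by auto
  note bf = L_eps_block_def J_eps_block_def Lambda_block_def block_form_row[OF i j]
  have S: "star p r \<le> r" "star p r \<le> p - 1" "star p s \<le> s" "star p s \<le> p - 1" by (auto simp: star_def)
  consider (L) "k1 < star p r" "star p s < k2" | (J) "k1 < star p r" "s = k2" "k2 < p"
    | (right) "k1 < star p r" "k2 \<le> star p s" "s \<noteq> k2" | (left) "r \<le> k1" | (last) "r = p" "k1 = p - 1" "k2 = p"
  proof -
    have "r \<le> k1 \<or> (r = p \<and> k1 = p - 1 \<and> k2 = p)" if "\<not> k1 < star p r"
      using that k i unfolding star_def by linarith
    moreover have "k2 < p" if "s = k2" "\<not> star p s < k2" using that S p2 by linarith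
    ultimately show thesis using L J right left last by (meson not_le)
  qed
  then show ?thesis
  proof cases
    case L
    have "n k1 < i" by (rule row_above[OF i]) (use L S in auto)
    moreover have "s \<le> k2" using L k j by (auto simp: star_def min_def split: if_splits)
    then have "j \<le> n k2" by (rule row_below[OF j _ k(2)])
    moreover have "\<not> (s = k2 \<and> k2 < p)" using L by (auto simp: star_def)
    moreover have "k1 \<noteq> p - 1" using L S by auto
    ultimately show ?thesis using L k L_eps_pairing[of k1 k2 \<epsilon> R, OF ok k t(1) \<tau>(3,1) t(2)] by (simp add: bf mult.assoc)
  next
    case J
    then have ss: "star p s = k2" by (auto simp: star_def)
    have "m_row p n m j = int (m k2)" "a_row p n a j = a k2" "j \<le> n k2" using row_data[OF j] ss J j by auto
    from J_eps_pairing[of k1 k2 \<epsilon> R, OF ok k t(1) \<tau>(3) this] show ?thesis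
      unfolding bf using J k ss by (simp add: mult.assoc)
  next
    case right
    then have "k2 < s" using S by auto
    then have "n k2 < j" by (rule row_above[OF j])
    then have "?Q = 0" using k by (intro pairing_right_fun_zero)
    moreover have "k1 \<noteq> p - 1" using right S by auto
    ultimately show ?thesis using right by (simp add: bf)
  next
    case left
    then have "i \<le> n k1" using k by (intro row_below[OF i]) auto
    then have "?Q = 0" using left i k by (intro pairing_left_fun_zero) auto
    moreover have "\<not> k1 < star p r" using left S by auto
    moreover have "\<not> (r = p \<and> k1 = p - 1)" using left p2 by auto
    ultimately show ?thesis by (auto simp: bf)
  next
    case last
    then have ss: "star p r = p - 1" by (auto simp: star_def)
    have "m_row p n m i = int (m (p - 1))" "a_row p n a i = a (p - 1)" "n (p - 1) < i" using row_data[OF i] ss last i by auto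
    from Lambda_pairing[OF R\<Lambda> \<tau>(1) t(2) this, of j "sel1 \<epsilon>" "sel2 \<epsilon>"] show ?thesis
      unfolding bf using last ss by (simp add: mult.assoc)
  qed
qed

lemma sum_pairs:
  fixes F :: "nat \<Rightarrow> nat \<Rightarrow> complex"
  shows "(\<Sum>k2\<in>{0..p}. \<Sum>k1\<in>{0..<k2}. F k1 k2) = (\<Sum>k1<p. \<Sum>k2\<in>{Suc k1..p}. F k1 k2)"
  unfolding sum.Sigma[OF finite_atLeastAtMost ballI[OF finite_atLeastLessThan]] sum.Sigma[OF finite_lessThan ballI[OF finite_atLeastAtMost]]
  by (rule sum.reindex_bij_witness[where i = "\<lambda>(x, y). (y, x)" and j = "\<lambda>(x, y). (y, x)"]) auto

lemma A2_pairing: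
  assumes R: "admissible_radii q p R"
    and \<tau>: "0 < \<tau>2" "\<tau>2 < \<tau>1" "\<tau>1 < 1 - sqrt q" and R\<Lambda>: "q < R\<Lambda>" "R\<Lambda> < sqrt q"
    and i: "row_in r i" and j: "row_in s j"
  shows "A2_block q p n m a \<mu> \<nu> \<tau>1 \<tau>2 R R\<Lambda> \<theta> r i s j = c_conj p n \<mu> \<nu> i j * norm_const i j *
    (\<Sum>k1<p. \<Sum>k2\<in>{Suc k1..p}. coef_left (theta1 \<theta> r) (theta2 \<theta> r) k1 * coef_right (theta1 \<theta> r) (theta2 \<theta> r) k2 * pairing (theta1 \<theta> r) (theta2 \<theta> r) (left_init i) (right_init j) k1 k2)"
proof -
  let ?c = "c_conj p n \<mu> \<nu> i j * norm_const i j"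
  have "A2_block q p n m a \<mu> \<nu> \<tau>1 \<tau>2 R R\<Lambda> \<theta> r i s j =
    (\<Sum>k2\<in>{0..p}. \<Sum>k1\<in>{0..<k2}. ?c * (\<Sum>\<epsilon>\<in>eps_range p k1 k2. (-1) ^ ((\<Sum>k\<in>{max 1 k1..min k2 (p - 1)}. \<epsilon> k) + k1 + star p k2)
      * theta p \<theta> r \<epsilon> * pairing (sel1 \<epsilon>) (sel2 \<epsilon>) (left_init i) (right_init j) k1 k2))"
    unfolding A2_block_def
  proof (intro sum.cong refl)
    fix k1 k2 assume "k2 \<in> {0..p}" "k1 \<in> {0..<k2}"
    then have k: "k1 < k2" "k2 \<le> p" by auto
    show "(\<Sum>\<epsilon>\<in>eps_range p k1 k2. (- 1) ^ ((\<Sum>k\<in>{max 1 k1..min k2 (p - 1)}. \<epsilon> k) + k1 + star p k2) * theta p \<theta> r \<epsilon>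
        * (L_eps_block q p n m a \<mu> \<nu> \<tau>1 \<tau>2 R k1 k2 \<epsilon> r i s j + J_eps_block q p n m a \<mu> \<nu> \<tau>1 R k1 k2 \<epsilon> r i s j
           + of_bool (k1 = p - 1 \<and> k2 = p) * Lambda_block q p n m a \<mu> \<nu> \<tau>2 R\<Lambda> r i s j)) =
      ?c * (\<Sum>\<epsilon>\<in>eps_range p k1 k2. (-1) ^ ((\<Sum>k\<in>{max 1 k1..min k2 (p - 1)}. \<epsilon> k) + k1 + star p k2)
      * theta p \<theta> r \<epsilon> * pairing (sel1 \<epsilon>) (sel2 \<epsilon>) (left_init i) (right_init j) k1 k2)"
      unfolding sum_distrib_left
    proof (rule sum.cong)
      fix \<epsilon> assume "\<epsilon> \<in> eps_range p k1 k2"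
      from blocks_pairing[OF R k this \<tau> R\<Lambda> i j]
      show "(- 1) ^ ((\<Sum>k\<in>{max 1 k1..min k2 (p - 1)}. \<epsilon> k) + k1 + star p k2) * theta p \<theta> r \<epsilon>
        * (L_eps_block q p n m a \<mu> \<nu> \<tau>1 \<tau>2 R k1 k2 \<epsilon> r i s j + J_eps_block q p n m a \<mu> \<nu> \<tau>1 R k1 k2 \<epsilon> r i s j
           + of_bool (k1 = p - 1 \<and> k2 = p) * Lambda_block q p n m a \<mu> \<nu> \<tau>2 R\<Lambda> r i s j) =
        ?c * ((-1) ^ ((\<Sum>k\<in>{max 1 k1..min k2 (p - 1)}. \<epsilon> k) + k1 + star p k2)
        * theta p \<theta> r \<epsilon> * pairing (sel1 \<epsilon>) (sel2 \<epsilon>) (left_init i) (right_init j) k1 k2)"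
        by (simp only: mult_ac)
    qed simp
  qed
  also have "\<dots> = (\<Sum>k2\<in>{0..p}. \<Sum>k1\<in>{0..<k2}. ?c * (coef_left (theta1 \<theta> r) (theta2 \<theta> r) k1 * coef_right (theta1 \<theta> r) (theta2 \<theta> r) k2 * pairing (theta1 \<theta> r) (theta2 \<theta> r) (left_init i) (right_init j) k1 k2))"
  proof (intro sum.cong refl)
    fix k1 k2 assume "k2 \<in> {0..p}" "k1 \<in> {0..<k2}"
    then show "?c * (\<Sum>\<epsilon>\<in>eps_range p k1 k2. (-1) ^ ((\<Sum>k\<in>{max 1 k1..min k2 (p - 1)}. \<epsilon> k) + k1 + star p k2)
      * theta p \<theta> r \<epsilon> * pairing (sel1 \<epsilon>) (sel2 \<epsilon>) (left_init i) (right_init j) k1 k2) =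
      ?c * (coef_left (theta1 \<theta> r) (theta2 \<theta> r) k1 * coef_right (theta1 \<theta> r) (theta2 \<theta> r) k2 * pairing (theta1 \<theta> r) (theta2 \<theta> r) (left_init i) (right_init j) k1 k2)"
      using i by (subst eps_total) auto
  qed
  also have "\<dots> = ?c * (\<Sum>k1<p. \<Sum>k2\<in>{Suc k1..p}. coef_left (theta1 \<theta> r) (theta2 \<theta> r) k1 * coef_right (theta1 \<theta> r) (theta2 \<theta> r) k2 * pairing (theta1 \<theta> r) (theta2 \<theta> r) (left_init i) (right_init j) k1 k2)"
    unfolding sum_pairs by (simp only: sum_distrib_left)
  finally show ?thesis .
qed

text \<open>The conjugation factor and the normalising constants together form a quotient of a
  quantity depending on \<open>i\<close> and the same quantity at \<open>j\<close>, so the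
  determinant does not see them.\<close>

definition conj_scale :: "real \<Rightarrow> real \<Rightarrow> nat \<Rightarrow> complex" where
  "conj_scale \<mu> \<nu> i = of_real (exp (\<mu> * (of_int (n_row p n i - int i) / \<nu>))) / invG_l 0 i W"

lemma conj_scale_nz: "conj_scale \<mu> \<nu> i \<noteq> 0" by (simp add: conj_scale_def invG_l_nz[OF W_Om])

text \<open>In the product of \<open>invG_l 0 j\<close> and \<open>invG_r 0 j\<close> all exponents
  cancel except one negative power of the variable; at \<open>W\<close> it is compensated by the
  factor 1/\<open>W\<close> in front of the blocks.\<close>

lemma norm_const_invG_l: "norm_const i j = invG_l 0 j W / invG_l 0 i W"
proof -
  have "invG_l 0 j W * invG_r 0 j W = inverse W"
    unfolding invG_l_invG_r_prod[OF W_Om] by (simp add: G_star_def power_int_minus)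
  then have "1 / (W * invG_r 0 j W) = invG_l 0 j W"
    using W_nz invG_r_nz[OF W_Om, of 0 j] by (simp add: field_simps)
  then show ?thesis by (simp add: norm_const_def divide_inverse mult_ac)
qed

lemma conj_conj_scale: "c_conj p n \<mu> \<nu> i j * norm_const i j = conj_scale \<mu> \<nu> i * inverse (conj_scale \<mu> \<nu> j)"
proof -
  have "c_conj p n \<mu> \<nu> i j = of_real (exp (\<mu> * (of_int (n_row p n i - int i) / \<nu>))) * inverse (of_real (exp (\<mu> * (of_int (n_row p n j - int j) / \<nu>))))"
    unfolding of_real_inverse[symmetric] exp_minus[symmetric] of_real_mult[symmetric] exp_add[symmetric] c_conj_def
    by (simp add: diff_divide_distrib right_diff_distrib)
  then show ?thesis by (simp add: norm_const_invG_l conj_scale_def divide_inverse mult_ac)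
qed

lemma entry_Tmat:
  assumes R: "admissible_radii q p R"
    and \<tau>: "0 < \<tau>" "\<tau> < 1 - sqrt q" and \<tau>12: "0 < \<tau>2" "\<tau>2 < \<tau>1" "\<tau>1 < 1 - sqrt q" and R\<Lambda>: "q < R\<Lambda>" "R\<Lambda> < sqrt q"
    and i: "row_in r i" and j: "row_in s j"
  shows "of_bool (i = j) + (A1_block q p n m a \<mu> \<nu> \<tau>1 \<tau>2 \<theta> r i s j + A2_block q p n m a \<mu> \<nu> \<tau>1 \<tau>2 R R\<Lambda> \<theta> r i s j)
      + B_block q p n m a \<mu> \<nu> \<tau> \<theta> r i s j =
    conj_scale \<mu> \<nu> i * Tmat (theta1 \<theta> r) (theta2 \<theta> r) i j * inverse (conj_scale \<mu> \<nu> j)"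
proof -
  let ?c = "c_conj p n \<mu> \<nu> i j * norm_const i j"
  let ?Q = "\<Sum>k1<p. \<Sum>k2\<in>{Suc k1..p}. coef_left (theta1 \<theta> r) (theta2 \<theta> r) k1 * coef_right (theta1 \<theta> r) (theta2 \<theta> r) k2 * pairing (theta1 \<theta> r) (theta2 \<theta> r) (left_init i) (right_init j) k1 k2"
  have A1: "A1_block q p n m a \<mu> \<nu> \<tau>1 \<tau>2 \<theta> r i s j = ?c * (\<Sum>k\<in>{0..p}. Theta p \<theta> r k * of_bool (s < k \<and> k < star p r) * diagL k i j)"
    unfolding A1_block_def sum_distrib_left
  proof (rule sum.cong)
    fix k
    show "Theta p \<theta> r k * L_diag_block q p n m a \<mu> \<nu> \<tau>1 \<tau>2 k r i s j = ?c * (Theta p \<theta> r k * of_bool (s < k \<and> k < star p r) * diagL k i j)"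
    proof (cases "s < k")
      case True
      then have "L_mat q p n m a \<tau>1 \<tau>2 k i j = norm_const i j * diagL k i j" by (intro L_mat_diagL \<tau>12) auto
      then show ?thesis by (simp add: L_diag_block_def block_form_row[OF i j])
    qed (simp add: L_diag_block_def)
  qed simp
  have B: "B_block q p n m a \<mu> \<nu> \<tau> \<theta> r i s j = ?c * ((1 + Theta p \<theta> r s) * of_bool (s < star p r) * diag0 i j)"
  proof (cases "s < star p r")
    case True
    have "B_block q p n m a \<mu> \<nu> \<tau> \<theta> r i s j = (1 + Theta p \<theta> r s) * c_conj p n \<mu> \<nu> i j *
        (1 / W * oint 0 \<tau> (\<lambda>w. 1 / G_fun q w (int i - int j + 1) (int (m (star p r)) - int (m s)) (a (star p r) - a s)))"
      using True unfolding B_block_def block_form_row[OF i j] by (simp only: of_bool_eq mult_1_right mult.assoc)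
    then show ?thesis unfolding B_diag0[OF \<tau> i j True] using True by simp
  qed (simp add: B_block_def)
  have D: "of_bool (i = j) = ?c * of_bool (i = j)"
    unfolding conj_conj_scale using conj_scale_nz by simp
  have "of_bool (i = j) + (A1_block q p n m a \<mu> \<nu> \<tau>1 \<tau>2 \<theta> r i s j + A2_block q p n m a \<mu> \<nu> \<tau>1 \<tau>2 R R\<Lambda> \<theta> r i s j)
      + B_block q p n m a \<mu> \<nu> \<tau> \<theta> r i s j =
    ?c * ((of_bool (i = j) + (\<Sum>k\<in>{0..p}. Theta p \<theta> r k * of_bool (s < k \<and> k < star p r) * diagL k i j)
    + (1 + Theta p \<theta> r s) * of_bool (s < star p r) * diag0 i j) + ?Q)"
    unfolding A1 B A2_pairing[OF R \<tau>12 R\<Lambda> i j] by (subst D) (simp only: distrib_left add_ac)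
  also have "\<dots> = ?c * Tmat (theta1 \<theta> r) (theta2 \<theta> r) i j"
    using i j n_mono[of r p] by (subst Tmat_eq) (simp_all only: diagonal_part[OF i j], auto)
  finally show ?thesis unfolding conj_conj_scale by (simp only: mult_ac)
qed

lemma rdet_conj:
  assumes "\<And>i. i < N \<Longrightarrow> e i \<noteq> 0"
  shows "rdet N (\<lambda>i j. e i * r i j * inverse (e j)) = rdet N r"
proof -
  have "rdet N (\<lambda>i j. e i * r i j * inverse (e j)) = rdet N (\<lambda>i j. e i * (r i j * inverse (e j)))"
    by (simp only: mult.assoc)
  also have "\<dots> = (\<Prod>i<N. e i) * rdet N (\<lambda>i j. r i j * inverse (e j))" by (rule rdet_scale_rows)
  also have "rdet N (\<lambda>i j. r i j * inverse (e j)) = rdet N (\<lambda>j i. inverse (e j) * r i j)"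
    unfolding mult.commute[of _ "inverse _"] by (rule rdet_transpose[symmetric])
  also have "\<dots> = (\<Prod>j<N. inverse (e j)) * rdet N (\<lambda>j i. r i j)" by (rule rdet_scale_rows)
  also have "rdet N (\<lambda>j i. r i j) = rdet N r" by (rule rdet_transpose)
  also have "(\<Prod>i<N. e i) * ((\<Prod>j<N. inverse (e j)) * rdet N r) = rdet N r"
    unfolding mult.assoc[symmetric] prod.distrib[symmetric] using assms by simp
  finally show ?thesis .
qed

lemma full_chain_cong:
  "(\<And>l. l \<in> {1..k} \<Longrightarrow> t1 l = t1' l \<and> t2 l = t2' l) \<Longrightarrow> full_chain t1 t2 u0 k = full_chain t1' t2' u0 k"
proof (induction k)
  case (Suc k)
  then have "full_chain t1 t2 u0 k = full_chain t1' t2' u0 k" "t1 (Suc k) = t1' (Suc k)" "t2 (Suc k) = t2' (Suc k)" by auto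
  then show ?case by simp
qed simp

lemma Tmat_cong:
  assumes "\<And>l. l \<in> {1..<p} \<Longrightarrow> t1 l = t1' l \<and> t2 l = t2' l"
  shows "Tmat t1 t2 i j = Tmat t1' t2' i j"
proof -
  have "full_chain t1 t2 (left_init i) (p - 1) = full_chain t1' t2' (left_init i) (p - 1)"
    by (rule full_chain_cong) (use assms p2 in auto)
  then show ?thesis by (simp only: Tmat_def)
qed

text \<open>A row of block \<open>r\<close> belongs to the parameters \<theta> and 1 divided by
  \<open>\<theta> l\<close> for all \<open>l\<close> from \<open>r\<close> on, and by homogeneity
  these divisors come out of the row. The index \<open>l\<close> is affected in exactly the first
  \<open>n l\<close> rows, which yields the power of \<open>\<theta> l\<close> left over from
  \<open>theta_integral\<close>.\<close>

lemma det_Tmat: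
  assumes R: "admissible_radii q p R"
    and \<tau>: "0 < \<tau>" "\<tau> < 1 - sqrt q" and \<tau>12: "0 < \<tau>2" "\<tau>2 < \<tau>1" "\<tau>1 < 1 - sqrt q" and R\<Lambda>: "q < R\<Lambda>" "R\<Lambda> < sqrt q"
    and \<theta>: "\<And>l. l \<in> {1..<p} \<Longrightarrow> \<theta> l \<noteq> 0"
  shows "Determinant.det (1\<^sub>m (n p) + A_matrix q p n m a \<mu> \<nu> \<tau>1 \<tau>2 R R\<Lambda> \<theta> + B_matrix q p n m a \<mu> \<nu> \<tau> \<theta>) =
    rdet N (\<lambda>i j. Tmat \<theta> (\<lambda>_. 1) (Suc i) (Suc j)) / (\<Prod>l\<in>{1..<p}. \<theta> l ^ n l)"
proof -
  define b where "b i = block_of p n (Suc i)" for i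
  have b: "row_in (b i) (Suc i)" if "i < N" for i
    using block_ex[of "Suc i"] that unfolding b_def N_def by fastforce
  define c where "c i l = (if l < b i then 1 else inverse (\<theta> l))" for i l
  have "Determinant.det (1\<^sub>m (n p) + A_matrix q p n m a \<mu> \<nu> \<tau>1 \<tau>2 R R\<Lambda> \<theta> + B_matrix q p n m a \<mu> \<nu> \<tau> \<theta>) =
    rdet N (\<lambda>i j. of_bool (Suc i = Suc j) + (A1_block q p n m a \<mu> \<nu> \<tau>1 \<tau>2 \<theta> (b i) (Suc i) (b j) (Suc j)
      + A2_block q p n m a \<mu> \<nu> \<tau>1 \<tau>2 R R\<Lambda> \<theta> (b i) (Suc i) (b j) (Suc j))
      + B_block q p n m a \<mu> \<nu> \<tau> \<theta> (b i) (Suc i) (b j) (Suc j))"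
    unfolding rdet_def A_matrix_def B_matrix_def assemble_def b_def N_def
    by (rule arg_cong[of _ _ Determinant.det], rule eq_matI) auto
  also have "\<dots> = rdet N (\<lambda>i j. conj_scale \<mu> \<nu> (Suc i) * Tmat (theta1 \<theta> (b i)) (theta2 \<theta> (b i)) (Suc i) (Suc j) * inverse (conj_scale \<mu> \<nu> (Suc j)))"
    by (rule rdet_cong) (rule entry_Tmat[OF R \<tau> \<tau>12 R\<Lambda> b b])
  also have "\<dots> = rdet N (\<lambda>i j. Tmat (theta1 \<theta> (b i)) (theta2 \<theta> (b i)) (Suc i) (Suc j))"
    by (rule rdet_conj) (rule conj_scale_nz)
  also have "\<dots> = rdet N (\<lambda>i j. (\<Prod>l\<in>{1..<p}. c i l) * Tmat \<theta> (\<lambda>_. 1) (Suc i) (Suc j))"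
  proof (rule rdet_cong)
    fix i j
    have "Tmat (theta1 \<theta> (b i)) (theta2 \<theta> (b i)) (Suc i) (Suc j) = Tmat (\<lambda>l. c i l * \<theta> l) (\<lambda>l. c i l * 1) (Suc i) (Suc j)"
    proof (rule Tmat_cong)
      fix l assume "l \<in> {1..<p}"
      then show "theta1 \<theta> (b i) l = c i l * \<theta> l \<and> theta2 \<theta> (b i) l = c i l * 1" using \<theta>[of l] by (auto simp: theta1_def theta2_def c_def)
    qed
    also have "\<dots> = (\<Prod>l\<in>{1..<p}. c i l) * Tmat \<theta> (\<lambda>_. 1) (Suc i) (Suc j)" by (rule Tmat_scale)
    finally show "Tmat (theta1 \<theta> (b i)) (theta2 \<theta> (b i)) (Suc i) (Suc j) = (\<Prod>l\<in>{1..<p}. c i l) * Tmat \<theta> (\<lambda>_. 1) (Suc i) (Suc j)" .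
  qed
  also have "\<dots> = (\<Prod>i<N. \<Prod>l\<in>{1..<p}. c i l) * rdet N (\<lambda>i j. Tmat \<theta> (\<lambda>_. 1) (Suc i) (Suc j))"
    by (rule rdet_scale_rows)
  also have "(\<Prod>i<N. \<Prod>l\<in>{1..<p}. c i l) = (\<Prod>l\<in>{1..<p}. \<Prod>i<N. c i l)" by (rule prod.swap)
  also have "\<dots> = (\<Prod>l\<in>{1..<p}. inverse (\<theta> l ^ n l))"
  proof (rule prod.cong)
    fix l assume l: "l \<in> {1..<p}"
    have nl: "n l \<le> N" using n_mono[of l p] l by (auto simp: N_def)
    have "(\<Prod>i<N. c i l) = (\<Prod>i<n l. inverse (\<theta> l))"
    proof (rule prod.mono_neutral_cong_right)
      show "\<forall>i\<in>{..<N} - {..<n l}. c i l = 1"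
      proof
        fix i assume "i \<in> {..<N} - {..<n l}"
        then have i: "i < N" "\<not> Suc i \<le> n l" by auto
        have "l < b i" using row_below[OF b[OF i(1)], of l] i(2) l by fastforce
        then show "c i l = 1" by (simp add: c_def)
      qed
      fix i assume "i \<in> {..<n l}"
      then have i: "i < N" "\<not> n l < Suc i" using nl by auto
      have "\<not> l < b i" using row_above[OF b[OF i(1)], of l] i(2) by blast
      then show "c i l = inverse (\<theta> l)" by (simp add: c_def)
    qed (use nl in auto)
    then show "(\<Prod>i<N. c i l) = inverse (\<theta> l ^ n l)" by (simp add: power_inverse)
  qed simp
  finally show ?thesis by (simp add: divide_inverse prod_inversef[symmetric] comp_def mult.commute)
qed

end

theorem theorem2:
  fixes M :: "'a measure" and \<omega> :: "nat \<times> nat \<Rightarrow> 'a \<Rightarrow> nat"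
    and q :: real and p :: nat
    and n m :: "nat \<Rightarrow> nat" and a :: "nat \<Rightarrow> int"
    and \<mu> \<nu> \<tau> \<tau>1 \<tau>2 R\<Lambda> r :: real
    and R :: "nat \<Rightarrow> nat \<Rightarrow> (nat \<Rightarrow> nat) \<Rightarrow> nat \<Rightarrow> real"
  assumes q: "0 < q" "q < 1"
    and prob: "prob_space M"
    and indep: "prob_space.indep_vars M (\<lambda>_. count_space UNIV) \<omega> ({1..} \<times> {1..})"
    and geom: "\<And>i j k. 1 \<le> i \<Longrightarrow> 1 \<le> j \<Longrightarrow>
      measure M {x \<in> space M. \<omega> (i, j) x = k} = (1 - q) * q ^ k"
    and p: "2 \<le> p"
    and zero: "n 0 = 0" "m 0 = 0" "a 0 = 0"
    and n: "\<And>k. k < p \<Longrightarrow> n k < n (Suc k)"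
    and m: "\<And>k. k < p \<Longrightarrow> m k < m (Suc k)"
    and conj_consts: "0 < \<mu>" "0 < \<nu>"
    and tau: "0 < \<tau>" "\<tau> < 1 - sqrt q"
    and tau12: "0 < \<tau>2" "\<tau>2 < \<tau>1" "\<tau>1 < 1 - sqrt q"
    and radii: "admissible_radii q p R"
    and radius_Lambda: "q < R\<Lambda>" "R\<Lambda> < sqrt q"
    and r: "1 < r"
  shows "complex_of_real (measure M
      {x \<in> space M. \<forall>k\<in>{1..p}. int (lpp (\<lambda>ij. \<omega> ij x) (m k) (n k)) < a k}) =
    oints 0 (\<lambda>_. r) [1..<p] (\<lambda>\<theta>.
      Determinant.det (1\<^sub>m (n p)
        + A_matrix q p n m a \<mu> \<nu> \<tau>1 \<tau>2 R R\<Lambda> \<theta>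
        + B_matrix q p n m a \<mu> \<nu> \<tau> \<theta>)
      / (\<Prod>k\<in>{1..p - 1}. \<theta> k - 1))"
proof -
  interpret prob_space M by (rule prob)
  interpret lpp_prob q p n m a M \<omega>
    by unfold_locales (use assms in auto)
  have "oints 0 (\<lambda>_. r) [1..<p] (\<lambda>\<theta>. rdet N (\<lambda>i j. Tmat \<theta> (\<lambda>_. 1) (Suc i) (Suc j)) /
      (\<Prod>l\<in>{1..<p}. \<theta> l ^ n l * (\<theta> l - 1))) =
    oints 0 (\<lambda>_. r) [1..<p] (\<lambda>\<theta>. Determinant.det (1\<^sub>m (n p)
        + A_matrix q p n m a \<mu> \<nu> \<tau>1 \<tau>2 R R\<Lambda> \<theta> + B_matrix q p n m a \<mu> \<nu> \<tau> \<theta>)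
      / (\<Prod>k\<in>{1..p - 1}. \<theta> k - 1))"
  proof (rule oints_cong)
    fix \<theta> :: "nat \<Rightarrow> complex" assume \<theta>: "\<And>k. k \<in> set [1..<p] \<Longrightarrow> cmod (\<theta> k - 0) = r"
    have nz: "\<theta> l \<noteq> 0" if "l \<in> {1..<p}" for l
    proof
      assume "\<theta> l = 0"
      then show False using \<theta>[of l] that r by simp
    qed
    have D: "Determinant.det (1\<^sub>m (n p) + A_matrix q p n m a \<mu> \<nu> \<tau>1 \<tau>2 R R\<Lambda> \<theta> + B_matrix q p n m a \<mu> \<nu> \<tau> \<theta>) =
      rdet N (\<lambda>i j. Tmat \<theta> (\<lambda>_. 1) (Suc i) (Suc j)) / (\<Prod>l\<in>{1..<p}. \<theta> l ^ n l)"
      by (rule det_Tmat[OF radii tau tau12 radius_Lambda]) (rule nz)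
    have "{1..p - 1} = {1..<p}" using p by auto
    then show "rdet N (\<lambda>i j. Tmat \<theta> (\<lambda>_. 1) (Suc i) (Suc j)) / (\<Prod>l\<in>{1..<p}. \<theta> l ^ n l * (\<theta> l - 1)) =
      Determinant.det (1\<^sub>m (n p) + A_matrix q p n m a \<mu> \<nu> \<tau>1 \<tau>2 R R\<Lambda> \<theta> + B_matrix q p n m a \<mu> \<nu> \<tau> \<theta>)
      / (\<Prod>k\<in>{1..p - 1}. \<theta> k - 1)"
      unfolding D by (simp only: prod.distrib divide_divide_eq_left)
  qed (use r in auto)
  then show ?thesis using prob_eq_V V_eq_Tmat[OF r] by simp
qed

end
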